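(* For every partition $\lambda$ of $n$, the crystal skeleton $\mathsf{CS}(\lambda)$, with each vertex $T$ labeled by its descent composition $\mathsf{Des}(T)$ and each edge labeled by its Dyck pattern interval, is a $\mathsf{CS}$-graph.
   Context: French notation. $\mathsf{SYT}(\lambda)$ standard tableaux; $\mathsf{row}(T)$ reads rows left to right from top row to bottom row; $\mathsf{std}$ replaces the $a_j$ entries $j$, in reading order, by $a_1+\dots+a_{j-1}+1,\dots,a_1+\dots+a_j$. Crystal $B(\lambda)_s$: semistandard tableaux of shape $\lambda$ with entries in $[s]$, with edges $b\xrightarrow{j}f_j(b)$ where, in the subword of $\mathsf{row}(b)$ of letters $j,j+1$, each $j+1$ is bracketed with an unbracketed $j$ to its right (parenthesis matching) and $f_j$ changes the rightmost unbracketed $j$ to $j+1$; weight = vector of multiplicities of entries. For a permutation $\pi$ of $[n]$ and $I=[i,i+2m]$, $m\ge1$, $I$ is a Dyck pattern interval of $\pi$ if the RSK insertion tableau of the subword $\pi|_I$ has bottom row $i,\dots,i+m$ and top row $i+m+1,\dots,i+2m$. $\mathsf{CS}(\lambda)$: vertices $\mathsf{SYT}(\lambda)$; for each Dyck pattern interval $I=[i,i+2m]$ of $\mathsf{row}(T)$ an edge $T\xrightarrow{I}\mathsf{std}(f_i(b))$, $b$ obtained from $T$ by replacing entries $i,\dots,i+m$ by $i$ and $i+m+1,\dots,i+2m$ by $i+1$. $\mathsf{Des}(T)=(d_1,d_2-d_1,\dots,n-d_k)$ where $d_1<\dots<d_k$ are the $d$ with $d+1$ in a strictly higher row than $d$.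 A composition $\alpha=(\alpha_1,\dots,\alpha_\ell)$ of $n$ is identified with its blocks $\alpha^{(j)}=\{\alpha_1+\dots+\alpha_{j-1}+1,\dots,\alpha_1+\dots+\alpha_j\}$; $\mathsf{len}(\alpha)=\ell$; $\gamma$ dominates $\alpha$ if $\gamma_1+\dots+\gamma_k\ge\alpha_1+\dots+\alpha_k$ for all $k$. Let $G$ be a finite connected directed graph whose vertices $(v,\alpha)$ are labeled by compositions of $n$ and whose edges are labeled by intervals $I\subseteq[n]$. $G$ is a $\mathsf{CS}$-graph if: (A0) for every edge $(v,\alpha)\xrightarrow{I}(w,\beta)$, $I=I^-\cup\{k\}\cup I^+$ with $I^-,\{k\},I^+$ consecutive intervals in this order, $|I^-|=|I^+|>0$, and $I^-\cup\{k\}\subseteq\alpha^{(j)}$, $I^+\subseteq\alpha^{(j+1)}$ for some $1\le j<\mathsf{len}(\alpha)$; (A1) for each vertex $(v,\alpha)$ and each interval $I$ satisfying the conditions of (A0) relative to $\alpha$, exactly one holds: (i) there is exactly one outgoing edge from $(v,\alpha)$ labeled $I$; (ii) there is an incoming edge $(u,\gamma)\xrightarrow{J}(v,\alpha)$ with $J\subseteq I$ and $\gamma$ dominating $\alpha$; (A2) for an edge as in (A0), the block sequence of $\beta$ is $(\alpha^{(1)},\dots,\alpha^{(j-2)},\ast,\alpha^{(j+2)},\dots)$ with $\ast$ one of: (I, length-preserving) $(\alpha^{(j-1)},\alpha^{(j)}\setminus\{k\},\alpha^{(j+1)}\cup\{k\})$; (II, length-increasing) $(\alpha^{(j-1)},\alpha^{(j)}\setminus\{k\},I^+\cup\{k\},\alpha^{(j+1)}\setminus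 I^+)$; (III, length-decreasing) $(\alpha^{(j-1)}\cup I^-,\alpha^{(j+1)}\cup\{k\})$, where $\alpha^{(j)}=I^-\cup\{k\}$ (empty blocks omitted); (A3) every edge $(v,\alpha)\xrightarrow{I}(w,\beta)$ of type II belongs to a fan: for some $i,m$ there are vertices $w_1,\dots,w_m$, one of which is $(w,\beta)$, and edges $(v,\alpha)\xrightarrow{I_r}w_r$ with $I_r=[i+r-1,i+2m-r+1]$ ($1\le r\le m$), all of type II, edges $w_r\xrightarrow{J_r}w_{r+1}$ with $J_r=[i+2m-r,i+2m-r+2]$ ($1\le r\le m-1$), of type I, and an edge $w_m\xrightarrow{J_m}(v,\alpha)$ with $J_m=[i+m,i+m+2]$, of type III; (A4) $\mathcal{L}_n(G)\cong G$ and $\mathcal{L}_{n-1}(G_{[1,n-1]})\cong G_{[1,n-1]}$, where $\mathcal{L}_n$ replaces each vertex label $\alpha$ by its reversal $\mathsf{rev}(\alpha)$, reverses every edge and replaces each edge label $[a,b]$ by $[n+1-b,n+1-a]$, and $G_{[1,n-1]}$ is obtained from $G$ by deleting the element $n$ from each vertex label (decreasing the last part by one, dropping it if it becomes $0$) and deleting every edge whose label contains $n$; (A5) with $s$ the minimum of $\mathsf{len}(\alpha)$ over vertex labels, the induced subgraph on vertices with $\mathsf{len}(\alpha)=s$ is isomorphic to $B(\mu)_s$ for some partition $\mu$ with $s$ parts, vertex labels corresponding to weights and an edge labeled $I$ (with $j$ as in (A0)) corresponding to an $f_j$-edge. Isomorphisms preserve edge directions and all labels. *)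

theory Defs
  imports Main "HOL-Library.Multiset"
begin

section \<open>Partitions, compositions, tableaux (French notation)\<close>

text \<open>A partition is a weakly decreasing list of positive integers.\<close>
definition is_partition :: "nat list \<Rightarrow> bool" where
  "is_partition lam \<longleftrightarrow> sorted (rev lam) \<and> (\<forall>x\<in>set lam. 0 < x)"

text \<open>A composition of n: a list of positive integers summing to n.\<close>
definition is_composition :: "nat \<Rightarrow> nat list \<Rightarrow> bool" where
  "is_composition n al \<longleftrightarrow> (\<forall>x\<in>set al. 0 < x) \<and> sum_list al = n"

text \<open>The j-th block (1-indexed) of a composition; block 0 is empty.\<close>
definition block :: "nat list \<Rightarrow> nat \<Rightarrow> nat set" where
  "block al j = {sum_list (take (j - 1) al) + 1 .. sum_list (take j al)}"

definition blocks :: "nat list \<Rightarrow> nat set list" where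
  "blocks al = map (block al) [1..<length al + 1]"

definition dominates :: "nat list \<Rightarrow> nat list \<Rightarrow> bool" where
  "dominates ga al \<longleftrightarrow> (\<forall>k. sum_list (take k al) \<le> sum_list (take k ga))"

text \<open>Tableaux are lists of rows; the first row is the bottom row (French notation).
  Row entries are read left to right.\<close>
type_synonym tableau = "nat list list"

definition semistandard :: "tableau \<Rightarrow> bool" where
  "semistandard T \<longleftrightarrow> (\<forall>r\<in>set T. sorted r) \<and>
     (\<forall>i j. Suc i < length T \<longrightarrow> j < length (T ! Suc i) \<longrightarrow>
            j < length (T ! i) \<and> T ! i ! j < T ! Suc i ! j)"

text \<open>Semistandard tableaux of shape mu with entries in [s] (vertex set of B(mu)_s).\<close>
definition SSYT :: "nat list \<Rightarrow> nat \<Rightarrow> tableau set" where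
  "SSYT mu s = {T. map length T = mu \<and> semistandard T \<and> (\<forall>x\<in>set (concat T). 1 \<le> x \<and> x \<le> s)}"

definition SYT :: "nat list \<Rightarrow> tableau set" where
  "SYT lam = {T. map length T = lam \<and> semistandard T \<and>
                 mset (concat T) = mset [1..<sum_list lam + 1]}"

text \<open>Reading word: rows left to right, from the top row to the bottom row.\<close>
definition row :: "tableau \<Rightarrow> nat list" where
  "row T = concat (rev T)"

fun split_lens :: "nat list \<Rightarrow> 'a list \<Rightarrow> 'a list list" where
  "split_lens [] w = []"
| "split_lens (l # ls) w = take l w # split_lens ls (drop l w)"

text \<open>Refill the shape of T with the word w in reading order.\<close>
definition refill :: "tableau \<Rightarrow> nat list \<Rightarrow> tableau" where
  "refill T w = rev (split_lens (rev (map length T)) w)"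

text \<open>Weight: vector of multiplicities of the entries 1..s.\<close>
definition weight :: "nat \<Rightarrow> tableau \<Rightarrow> nat list" where
  "weight s T = map (\<lambda>i. count (mset (concat T)) i) [1..<s + 1]"

section \<open>Crystal operators\<close>

text \<open>Positions (0-indexed) of the unbracketed letters j in a word, where each
  letter j+1 is bracketed with an unbracketed j to its right (parenthesis
  matching). The last argument counts the currently unmatched letters j+1.\<close>
fun unbracketed :: "nat \<Rightarrow> nat list \<Rightarrow> nat \<Rightarrow> nat \<Rightarrow> nat list" where
  "unbracketed j [] p c = []"
| "unbracketed j (x # xs) p c =
     (if x = Suc j then unbracketed j xs (Suc p) (Suc c)
      else if x = j then
        (if 0 < c then unbracketed j xs (Suc p) (c - 1) else p # unbracketed j xs (Suc p) c)
      else unbracketed j xs (Suc p) c)"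

definition f_word :: "nat \<Rightarrow> nat list \<Rightarrow> nat list option" where
  "f_word j w = (case unbracketed j w 0 0 of [] \<Rightarrow> None
                  | ps \<Rightarrow> Some (w[last ps := Suc j]))"

definition f_tab :: "nat \<Rightarrow> tableau \<Rightarrow> tableau option" where
  "f_tab j T = map_option (refill T) (f_word j (row T))"

text \<open>Edges of the crystal B(mu)_s, labelled by j.\<close>
definition crystal_edges :: "nat list \<Rightarrow> nat \<Rightarrow> (tableau \<times> nat \<times> tableau) set" where
  "crystal_edges mu s = {(b, j, b'). b \<in> SSYT mu s \<and> b' \<in> SSYT mu s \<and>
                          1 \<le> j \<and> j < s \<and> f_tab j b = Some b'}"

section \<open>Standardization, RSK, descents\<close>

definition std_word :: "nat list \<Rightarrow> nat list" where
  "std_word w = map (\<lambda>p. length (filter (\<lambda>x. x < w ! p) w)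
                          + length (filter (\<lambda>x. x = w ! p) (take (Suc p) w)))
                     [0..<length w]"

definition std :: "tableau \<Rightarrow> tableau" where
  "std T = refill T (std_word (row T))"

text \<open>Schensted row insertion (rows listed bottom to top): x bumps the leftmost
  entry strictly larger than x.\<close>
fun row_insert :: "nat \<Rightarrow> tableau \<Rightarrow> tableau" where
  "row_insert x [] = [[x]]"
| "row_insert x (r # rs) =
     (case find (\<lambda>y. x < y) r of
        None \<Rightarrow> (r @ [x]) # rs
      | Some y \<Rightarrow> (r[(LEAST k. k < length r \<and> x < r ! k) := x]) # row_insert y rs)"

definition rsk_P :: "nat list \<Rightarrow> tableau" where
  "rsk_P w = foldl (\<lambda>T x. row_insert x T) [] w"

text \<open>[i, i+2m] (m >= 1) is a Dyck pattern interval of the permutation pi.\<close>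
definition dyck_pattern_interval :: "nat list \<Rightarrow> nat \<Rightarrow> nat \<Rightarrow> bool" where
  "dyck_pattern_interval pi i m \<longleftrightarrow> 1 \<le> i \<and> 1 \<le> m \<and> i + 2 * m \<le> length pi \<and>
     rsk_P (filter (\<lambda>x. i \<le> x \<and> x \<le> i + 2 * m) pi) = [[i..<i + m + 1], [i + m + 1..<i + 2 * m + 1]]"

definition row_index :: "tableau \<Rightarrow> nat \<Rightarrow> nat" where
  "row_index T x = (LEAST r. r < length T \<and> x \<in> set (T ! r))"

fun diffs :: "nat \<Rightarrow> nat list \<Rightarrow> nat list" where
  "diffs p [] = []"
| "diffs p (x # xs) = (x - p) # diffs x xs"

text \<open>Composition of n with descent set D: (d1, d2-d1, ..., n-dk).\<close>
definition comp_of_set :: "nat \<Rightarrow> nat set \<Rightarrow> nat list" where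
  "comp_of_set n D = (if n = 0 then [] else diffs 0 (sorted_list_of_set D @ [n]))"

definition Des :: "tableau \<Rightarrow> nat list" where
  "Des T = (let n = length (concat T) in
     comp_of_set n {d. 1 \<le> d \<and> d < n \<and> row_index T d < row_index T (Suc d)})"

section \<open>Labelled graphs\<close>

text \<open>Vertices carry composition labels, edges carry interval labels (a,b) = [a,b].\<close>
record 'v lgraph =
  verts :: "'v set"
  vlab :: "'v \<Rightarrow> nat list"
  edges :: "('v \<times> (nat \<times> nat) \<times> 'v) set"

definition ivl :: "nat \<times> nat \<Rightarrow> nat set" where
  "ivl I = {fst I .. snd I}"

definition lgraph_iso :: "'v lgraph \<Rightarrow> 'w lgraph \<Rightarrow> bool" where
  "lgraph_iso G H \<longleftrightarrow> (\<exists>f. bij_betw f (verts G) (verts H) \<and>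
     (\<forall>v\<in>verts G. vlab H (f v) = vlab G v) \<and>
     (\<forall>v\<in>verts G. \<forall>w\<in>verts G. \<forall>I. (v, I, w) \<in> edges G \<longleftrightarrow> (f v, I, f w) \<in> edges H))"

text \<open>The crystal skeleton CS(lambda).\<close>
definition CS :: "nat list \<Rightarrow> tableau lgraph" where
  "CS lam = \<lparr> verts = SYT lam, vlab = Des,
     edges = {(T, (i, i + 2 * m), T') | T T' i m.
        T \<in> SYT lam \<and> dyck_pattern_interval (row T) i m \<and>
        (\<exists>c. f_tab i (map (map (\<lambda>x. if i \<le> x \<and> x \<le> i + m then i
                                    else if i + m < x \<and> x \<le> i + 2 * m then Suc i else x)) T)
              = Some c \<and> T' = std c)} \<rparr>"

section \<open>CS-graphs\<close>

definition well_formed :: "nat \<Rightarrow> 'v lgraph \<Rightarrow> bool" where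
  "well_formed n G \<longleftrightarrow> finite (verts G) \<and>
     (\<forall>v\<in>verts G. is_composition n (vlab G v)) \<and>
     (\<forall>(v, I, w)\<in>edges G. v \<in> verts G \<and> w \<in> verts G \<and> 1 \<le> fst I \<and> fst I \<le> snd I \<and> snd I \<le> n)"

definition connected_lg :: "'v lgraph \<Rightarrow> bool" where
  "connected_lg G \<longleftrightarrow> verts G \<noteq> {} \<and>
     (let R = {(v, w). \<exists>I. (v, I, w) \<in> edges G} in
      \<forall>v\<in>verts G. \<forall>w\<in>verts G. (v, w) \<in> (R \<union> R\<inverse>)\<^sup>*)"

text \<open>Condition (A0) for an interval I = [a,b] relative to alpha, with the
  splitting I = I^- u {k} u I^+ and block index j.\<close>
definition A0_split :: "nat list \<Rightarrow> nat \<times> nat \<Rightarrow> nat \<Rightarrow> nat \<Rightarrow> bool" where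
  "A0_split al I k j \<longleftrightarrow> fst I < k \<and> k - fst I = snd I - k \<and>
     1 \<le> j \<and> j < length al \<and> {fst I .. k} \<subseteq> block al j \<and> {Suc k .. snd I} \<subseteq> block al (Suc j)"

definition A0_ok :: "nat list \<Rightarrow> nat \<times> nat \<Rightarrow> bool" where
  "A0_ok al I \<longleftrightarrow> (\<exists>k j. A0_split al I k j)"

definition edge_type :: "nat \<Rightarrow> nat list \<Rightarrow> nat \<times> nat \<Rightarrow> nat list \<Rightarrow> bool" where
  "edge_type t al I be \<longleftrightarrow> (\<exists>k j. A0_split al I k j \<and>
     (let Im = {fst I ..< k}; Ip = {Suc k .. snd I};
          B = block al; pre = take (j - 2) (blocks al); post = drop (Suc j) (blocks al) in
      (t = 1 \<and> blocks be = pre @ filter (\<lambda>X. X \<noteq> {}) [B (j - 1), B j - {k}, B (Suc j) \<union> {k}] @ post)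
    \<or> (t = 2 \<and> length be = Suc (length al) \<and>
        blocks be = pre @ filter (\<lambda>X. X \<noteq> {}) [B (j - 1), B j - {k}, Ip \<union> {k}, B (Suc j) - Ip] @ post)
    \<or> (t = 3 \<and> Suc (length be) = length al \<and> B j = Im \<union> {k} \<and>
        blocks be = pre @ filter (\<lambda>X. X \<noteq> {}) [B (j - 1) \<union> Im, B (Suc j) \<union> {k}] @ post)))"

definition etype :: "'v lgraph \<Rightarrow> nat \<Rightarrow> 'v \<Rightarrow> nat \<times> nat \<Rightarrow> 'v \<Rightarrow> bool" where
  "etype G t v I w \<longleftrightarrow> (v, I, w) \<in> edges G \<and> edge_type t (vlab G v) I (vlab G w)"

definition A1 :: "'v lgraph \<Rightarrow> bool" where
  "A1 G \<longleftrightarrow> (\<forall>v\<in>verts G. \<forall>I. A0_ok (vlab G v) I \<longrightarrow>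
     ((\<exists>!w. (v, I, w) \<in> edges G) \<longleftrightarrow>
      \<not> (\<exists>u J. (u, J, v) \<in> edges G \<and> ivl J \<subseteq> ivl I \<and> dominates (vlab G u) (vlab G v))))"

definition A3 :: "'v lgraph \<Rightarrow> bool" where
  "A3 G \<longleftrightarrow> (\<forall>(v, I, w)\<in>edges G. etype G 2 v I w \<longrightarrow>
     (\<exists>i m ws. 1 \<le> m \<and> length ws = m \<and> w \<in> set ws \<and> set ws \<subseteq> verts G \<and>
        (\<forall>r\<in>{1..m}. etype G 2 v (i + r - 1, i + 2 * m - r + 1) (ws ! (r - 1))) \<and>
        (\<forall>r\<in>{1..<m}. etype G 1 (ws ! (r - 1)) (i + 2 * m - r, i + 2 * m - r + 2) (ws ! r)) \<and>
        etype G 3 (ws ! (m - 1)) (i + m, i + m + 2) v))"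

definition L_op :: "nat \<Rightarrow> 'v lgraph \<Rightarrow> 'v lgraph" where
  "L_op n G = \<lparr> verts = verts G, vlab = (\<lambda>v. rev (vlab G v)),
     edges = {(w, (n + 1 - b, n + 1 - a), v) | v w a b. (v, (a, b), w) \<in> edges G} \<rparr>"

definition drop_last_elem :: "nat list \<Rightarrow> nat list" where
  "drop_last_elem al = (if al = [] then [] else if last al \<le> 1 then butlast al
                        else butlast al @ [last al - 1])"

definition restrict_last :: "nat \<Rightarrow> 'v lgraph \<Rightarrow> 'v lgraph" where
  "restrict_last n G = \<lparr> verts = verts G, vlab = (\<lambda>v. drop_last_elem (vlab G v)),
     edges = {(v, I, w). (v, I, w) \<in> edges G \<and> n \<notin> ivl I} \<rparr>"

definition A4 :: "nat \<Rightarrow> 'v lgraph \<Rightarrow> bool" where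
  "A4 n G \<longleftrightarrow> lgraph_iso (L_op n G) G \<and>
     lgraph_iso (L_op (n - 1) (restrict_last n G)) (restrict_last n G)"

text \<open>Block index j of (A0) for an edge label I relative to alpha.\<close>
definition jidx :: "nat list \<Rightarrow> nat \<times> nat \<Rightarrow> nat" where
  "jidx al I = (LEAST j. fst I \<in> block al j)"

definition A5 :: "'v lgraph \<Rightarrow> bool" where
  "A5 G \<longleftrightarrow> (let s = Min ((\<lambda>v. length (vlab G v)) ` verts G);
                 Vs = {v\<in>verts G. length (vlab G v) = s};
                 Es = {(v, I, w). (v, I, w) \<in> edges G \<and> v \<in> Vs \<and> w \<in> Vs} in
     \<exists>mu. is_partition mu \<and> length mu = s \<and>
       (\<exists>phi. bij_betw phi Vs (SSYT mu s) \<and> (\<forall>v\<in>Vs. vlab G v = weight s (phi v)) \<and>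
          bij_betw (\<lambda>(v, I, w). (phi v, jidx (vlab G v) I, phi w)) Es (crystal_edges mu s)))"

definition is_CS_graph :: "nat \<Rightarrow> 'v lgraph \<Rightarrow> bool" where
  "is_CS_graph n G \<longleftrightarrow> well_formed n G \<and> connected_lg G \<and>
     (\<forall>(v, I, w)\<in>edges G. A0_ok (vlab G v) I) \<and>
     A1 G \<and>
     (\<forall>(v, I, w)\<in>edges G. edge_type 1 (vlab G v) I (vlab G w) \<or>
        edge_type 2 (vlab G v) I (vlab G w) \<or> edge_type 3 (vlab G v) I (vlab G w)) \<and>
     A3 G \<and> A4 n G \<and> A5 G"

end

theory Submission
  imports Defs
begin

text \<open>
  A standard tableau is encoded by its row function, which sends \<open>x\<close> to the row containing \<open>x\<close>.
  In this encoding the edge labelled \<open>[i, i+2m]\<close> precomposes the row function with the cycle that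
  moves the letter \<open>i+p\<close> to \<open>i+m+p\<close>, where \<open>i+p\<close> is the letter left unbracketed, so that (A0)--(A3)
  become inequalities between the rows of the letters around the descent \<open>i+m\<close>.

  Both Dyck patterns and their edges lift along Knuth moves, and they are symmetric under reversing
  and complementing a word. Evacuation (the insertion tableau of the reversed and complemented
  reading word) preserves the shape by Greene's theorem and is an involution because a Knuth class
  contains only one tableau; it therefore yields (A4). It also turns the question about incoming
  edges in (A1) into one about outgoing edges.

  The edges with \<open>m = 1\<close> are dual Knuth moves, and these connect all tableaux of one shape, by
  induction on the size. A tableau whose descent composition has the least possible length is the
  standardization of exactly one semistandard tableau, obtained by collapsing the blocks of the
  composition; this identifies the corresponding induced subgraph with the crystal in (A5).\<close>

subsection \<open>Knuth equivalence and Greene's theorem\<close>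

text \<open>Edges are defined from their sources, while (A1) asks which edges enter a given vertex;
  this is the obstacle that brings in Knuth equivalence, since evacuation reverses all edges at
  once. It is carried out on the letters up to some \<open>N\<close> and leaves the larger ones in
  place, because the second half of (A4) concerns the letters below \<open>n\<close>. Greene's
  theorem is used in a refined form: unions of \<open>k\<close> increasing subsequences are counted
  separately among the letters up to each \<open>j\<close>. The counts for \<open>j = n\<close> give
  the shape, and their growth with \<open>j\<close> gives the row of every letter, which is why a
  Knuth class contains only one tableau. (A1) rests on one chain of inequalities: \<open>C M\<close>
  compares the \<open>M\<close> letters up to a descent with the \<open>M\<close> letters after it.
  \<open>C m\<close> decides whether the edge leaves, and \<open>C (M + 1)\<close> whether the
  source of the entering edge of parameter \<open>M\<close> fails to dominate. In (A5) the partition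
  is \<open>lam\<close> itself: each row above the bottom one costs a descent, so no descent
  composition is shorter than the number of rows.\<close>

fun bef :: "'a list \<Rightarrow> 'a \<Rightarrow> 'a \<Rightarrow> bool" where
  "bef [] x y = False"
| "bef (z # w) x y \<longleftrightarrow> (z = x \<and> y \<in> set w) \<or> bef w x y"

lemma bef_append: "bef (u @ v) x y \<longleftrightarrow> bef u x y \<or> bef v x y \<or> (x \<in> set u \<and> y \<in> set v)"
  by (induction u) auto

lemma bef_in: "bef w x y \<Longrightarrow> x \<in> set w \<and> y \<in> set w"
  by (induction w) auto

lemma bef_filter: "bef (filter P w) x y \<longleftrightarrow> P x \<and> P y \<and> bef w x y"
  by (induction w) (auto dest: bef_in)

lemma bef_rev: "bef (rev w) x y \<longleftrightarrow> bef w y x"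
  by (induction w) (auto simp: bef_append)

lemma bef_map:
  assumes "inj_on f A" "set w \<subseteq> A" "x \<in> A" "y \<in> A"
  shows "bef (map f w) (f x) (f y) \<longleftrightarrow> bef w x y"
  using assms(2) by (induction w) (use assms in \<open>auto simp: inj_on_def\<close>)

text \<open>A letter that does not occur gets the place \<open>length w\<close>.\<close>

definition pos :: "'a list \<Rightarrow> 'a \<Rightarrow> nat" where
  "pos w x = length (takeWhile (\<lambda>y. y \<noteq> x) w)"

lemma pos_Cons: "pos (z # w) x = (if z = x then 0 else Suc (pos w x))"
  by (simp add: pos_def)

lemma pos_append: "pos (u @ v) x = (if x \<in> set u then pos u x else length u + pos v x)"
  by (induction u) (auto simp: pos_Cons)

lemma pos_less: "x \<in> set w \<Longrightarrow> pos w x < length w"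
  by (induction w) (auto simp: pos_Cons)

lemma pos_inj: "inj_on (pos w) (set w)"
proof (rule inj_onI)
  fix x y assume "x \<in> set w" "y \<in> set w" "pos w x = pos w y"
  then show "x = y" by (induction w) (auto simp: pos_Cons split: if_splits)
qed

lemma bef_pos:
  "distinct w \<Longrightarrow> x \<in> set w \<Longrightarrow> y \<in> set w \<Longrightarrow> bef w x y \<longleftrightarrow> pos w x < pos w y"
  by (induction w) (auto simp: pos_Cons dest: bef_in)

lemma bef_asym: "distinct w \<Longrightarrow> bef w x y \<Longrightarrow> \<not> bef w y x"
  by (metis bef_in bef_pos less_asym)

text \<open>The two first letters agree, since otherwise each would have to stand before the other.
  Words are compared through this relation because it passes easily through restriction to some
  letters, reversal and relabelling.\<close>

lemma bef_unique:
  assumes "distinct u" "distinct v" "set u = set v"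
    and "\<And>x y. x \<in> set u \<Longrightarrow> y \<in> set u \<Longrightarrow> bef u x y = bef v x y"
  shows "u = v"
  using assms
proof (induction u arbitrary: v)
  case (Cons x u)
  then obtain y v' where v: "v = y # v'" by (cases v) auto
  have "x = y"
  proof (rule ccontr)
    assume "x \<noteq> y"
    then have "y \<in> set u" "x \<in> set v'" using Cons.prems(3) v by auto
    then have "bef v y x" "bef (x # u) x y" using v by auto
    then show False using Cons.prems bef_asym[of v]
      by (metis bef_in)
  qed
  moreover have "u = v'"
  proof (rule Cons.IH)
    show "set u = set v'" using Cons.prems(1-3) v \<open>x = y\<close> by (metis distinct.simps(2) insert_ident list.simps(15))
    show "bef u a b = bef v' a b" if "a \<in> set u" "b \<in> set u" for a b
      using Cons.prems(4)[of a b] that v \<open>x = y\<close> Cons.prems(1,2) by auto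
  qed (use Cons.prems v in auto)
  ultimately show ?case using v by simp
qed auto

section \<open>Knuth relations, and their symmetry under reversal and complement\<close>

definition kmove :: "nat list \<Rightarrow> nat list \<Rightarrow> bool" where
  "kmove w w' \<longleftrightarrow> (\<exists>u v a b c. a < b \<and> b < c \<and>
     (w = u @ [b, a, c] @ v \<and> w' = u @ [b, c, a] @ v \<or>
      w = u @ [a, c, b] @ v \<and> w' = u @ [c, a, b] @ v))"

abbreviation keq :: "nat list \<Rightarrow> nat list \<Rightarrow> bool" where
  "keq \<equiv> equivclp kmove"

lemma keq_sym: "keq u v \<Longrightarrow> keq v u" by (rule equivclp_sym)

lemma keq_trans: "keq u v \<Longrightarrow> keq v w \<Longrightarrow> keq u w" by (rule equivclp_trans)

lemma kmove_mset: "kmove w w' \<Longrightarrow> mset w' = mset w"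
  by (auto simp: kmove_def)

lemma keq_mset: "keq w w' \<Longrightarrow> mset w' = mset w"
  by (induction rule: equivclp_induct) (auto dest: kmove_mset)

lemma keq_set: "keq w w' \<Longrightarrow> set w' = set w"
  using keq_mset mset_eq_setD by blast

lemma keq_distinct: "keq w w' \<Longrightarrow> distinct w' = distinct w"
  using keq_mset mset_eq_imp_distinct_iff by blast

lemma kmove_ctx: "kmove w w' \<Longrightarrow> kmove (x @ w @ y) (x @ w' @ y)"
  unfolding kmove_def
proof (elim exE conjE)
  fix u v a b c assume "a < b" "b < c"
     "w = u @ [b, a, c] @ v \<and> w' = u @ [b, c, a] @ v \<or>
      w = u @ [a, c, b] @ v \<and> w' = u @ [c, a, b] @ v"
  then show "\<exists>u v a b c. a < b \<and> b < c \<and>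
     (x @ w @ y = u @ [b, a, c] @ v \<and> x @ w' @ y = u @ [b, c, a] @ v \<or>
      x @ w @ y = u @ [a, c, b] @ v \<and> x @ w' @ y = u @ [c, a, b] @ v)"
    by (intro exI[of _ "x @ u"] exI[of _ "v @ y"] exI[of _ a] exI[of _ b] exI[of _ c]) auto
qed

lemma keq_ctx: "keq w w' \<Longrightarrow> keq (x @ w @ y) (x @ w' @ y)"
proof (induction rule: equivclp_induct)
  case (step v w')
  then have "kmove (x @ v @ y) (x @ w' @ y) \<or> kmove (x @ w' @ y) (x @ v @ y)"
    using kmove_ctx by blast
  then have "keq (x @ v @ y) (x @ w' @ y)" by (auto intro: r_into_equivclp converse_r_into_equivclp)
  then show ?case using step.IH keq_trans by blast
qed auto

definition rc :: "nat \<Rightarrow> nat list \<Rightarrow> nat list" where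
  "rc N w = rev (map (\<lambda>x. N + 1 - x) w)"

text \<open>Complementing reverses the order of \<open>a, b, c\<close>. After reversing the word as
  well, the relation between \<open>bac\<close> and \<open>bca\<close> becomes the one between
  \<open>acb\<close> and \<open>cab\<close>, and vice versa, with the two sides of the context
  exchanged.\<close>

lemma kmove_rc: "kmove w w' \<Longrightarrow> set w \<subseteq> {1..N} \<Longrightarrow> kmove (rc N w) (rc N w')"
  unfolding kmove_def
proof (elim exE conjE)
  fix u v a b c assume *: "a < b" "b < c" "set w \<subseteq> {1..N}"
     "w = u @ [b, a, c] @ v \<and> w' = u @ [b, c, a] @ v \<or>
      w = u @ [a, c, b] @ v \<and> w' = u @ [c, a, b] @ v"
  let ?f = "\<lambda>x. N + 1 - x"
  have "?f c < ?f b" "?f b < ?f a" using * by auto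
  then show "\<exists>u v a b c. a < b \<and> b < c \<and>
     (rc N w = u @ [b, a, c] @ v \<and> rc N w' = u @ [b, c, a] @ v \<or>
      rc N w = u @ [a, c, b] @ v \<and> rc N w' = u @ [c, a, b] @ v)"
    using *(4)
    by (intro exI[of _ "rc N v"] exI[of _ "rc N u"] exI[of _ "?f c"] exI[of _ "?f b"] exI[of _ "?f a"])
       (auto simp: rc_def)
qed

lemma keq_rc: "keq w w' \<Longrightarrow> set w \<subseteq> {1..N} \<Longrightarrow> keq (rc N w) (rc N w')"
proof (induction rule: equivclp_induct)
  case (step v w')
  have "set v \<subseteq> {1..N}" "set w' \<subseteq> {1..N}"
    using step keq_set kmove_mset mset_eq_setD by blast+
  then have "kmove (rc N v) (rc N w') \<or> kmove (rc N w') (rc N v)"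
    using kmove_rc step by blast
  then have "keq (rc N v) (rc N w')" by (auto intro: r_into_equivclp converse_r_into_equivclp)
  then show ?case using step keq_trans by blast
qed auto

lemma rc_rc: "set w \<subseteq> {1..N} \<Longrightarrow> rc N (rc N w) = w"
  unfolding rc_def by (auto simp: rev_map[symmetric] intro!: map_idI)

lemma set_rc: "set w = {1..N} \<Longrightarrow> set (rc N w) = {1..N}"
proof -
  assume "set w = {1..N}"
  moreover have "(\<lambda>x. N + 1 - x) ` {1..N} = {1..N}"
  proof safe
    fix x assume "x \<in> {1..N}"
    then show "x \<in> (\<lambda>x. N + 1 - x) ` {1..N}" by (intro image_eqI[of _ _ "N + 1 - x"]) auto
  qed auto
  ultimately show ?thesis by (simp add: rc_def)
qed

lemma inj_rc: "inj_on (\<lambda>x. N + 1 - x) {1..N::nat}"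
  by (auto simp: inj_on_def)

lemma distinct_rc: "distinct w \<Longrightarrow> set w \<subseteq> {1..N} \<Longrightarrow> distinct (rc N w)"
  unfolding rc_def using inj_on_subset[OF inj_rc] by (auto simp: distinct_map)

lemma bef_rc:
  "set w \<subseteq> {1..N} \<Longrightarrow> x \<in> {1..N} \<Longrightarrow> y \<in> {1..N} \<Longrightarrow>
   bef (rc N w) (N + 1 - x) (N + 1 - y) \<longleftrightarrow> bef w y x"
  unfolding rc_def bef_rev using bef_map[OF inj_rc, of w N y x] by simp

text \<open>In coordinates: \<open>P\<close> and \<open>Q\<close> give the places of the letters before and after the
  exchange of the adjacent letters \<open>a\<close> and \<open>c\<close>.\<close>
definition kpos :: "nat set \<Rightarrow> (nat \<Rightarrow> nat) \<Rightarrow> (nat \<Rightarrow> nat) \<Rightarrow> nat \<Rightarrow> nat \<Rightarrow> nat \<Rightarrow> bool" where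
  "kpos A P Q a b c \<longleftrightarrow> a < b \<and> b < c \<and> a \<in> A \<and> b \<in> A \<and> c \<in> A \<and> inj_on P A \<and>
     P c = Suc (P a) \<and> (Suc (P b) = P a \<or> P b = Suc (P c)) \<and> Q a = P c \<and> Q c = P a \<and>
     (\<forall>z. z \<noteq> a \<longrightarrow> z \<noteq> c \<longrightarrow> Q z = P z)"

lemma kmove_kpos:
  assumes "kmove w w'" "distinct w"
  obtains P Q a b c where "kpos (set w) P Q a b c"
    "\<And>x y. x \<in> set w \<Longrightarrow> y \<in> set w \<Longrightarrow> bef w x y \<longleftrightarrow> P x < P y"
    "\<And>x y. x \<in> set w \<Longrightarrow> y \<in> set w \<Longrightarrow> bef w' x y \<longleftrightarrow> Q x < Q y"
proof -
  have d: "distinct w'" "set w' = set w"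
    using assms kmove_mset mset_eq_imp_distinct_iff mset_eq_setD by blast+
  have *: "bef w x y \<longleftrightarrow> pos w x < pos w y" "bef w' x y \<longleftrightarrow> pos w' x < pos w' y"
    if "x \<in> set w" "y \<in> set w" for x y
    using that d assms(2) bef_pos[of w] bef_pos[of w'] by auto
  obtain u v a b c where k: "a < b" "b < c"
     "w = u @ [b, a, c] @ v \<and> w' = u @ [b, c, a] @ v \<or>
      w = u @ [a, c, b] @ v \<and> w' = u @ [c, a, b] @ v"
    using assms(1) unfolding kmove_def by blast
  have "kpos (set w) (pos w) (pos w') a b c"
    unfolding kpos_def using k assms(2) pos_inj[of w]
    by (auto simp: pos_append pos_Cons)
  then show ?thesis using that * by blast
qed

section \<open>Greene invariants: unions of \<open>k\<close> increasing subsequences, given as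
  colour classes\<close>

definition colorable :: "nat list \<Rightarrow> nat \<Rightarrow> nat set \<Rightarrow> bool" where
  "colorable w k U \<longleftrightarrow> (\<exists>f :: nat \<Rightarrow> nat. (\<forall>x\<in>U. f x < k) \<and>
     (\<forall>x\<in>U. \<forall>y\<in>U. f x = f y \<longrightarrow> x < y \<longrightarrow> bef w x y))"

lemma kpos_fwd:
  assumes "kpos A P Q a b c" "x \<in> A" "y \<in> A" "P x < P y" "\<not> (x = a \<and> y = c)"
  shows "Q x < Q y"
proof -
  note K = assms(1)[unfolded kpos_def]
  have e: "P x = P a \<Longrightarrow> x = a" "P x = P c \<Longrightarrow> x = c" "P y = P a \<Longrightarrow> y = a" "P y = P c \<Longrightarrow> y = c"
    using K assms by (auto simp: inj_on_def)
  have q: "Q x = (if x = a then P c else if x = c then P a else P x)"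
     "Q y = (if y = a then P c else if y = c then P a else P y)" "P c = Suc (P a)"
    using K by auto
  have ac: "a \<noteq> c" using K by auto
  have xy: "x \<noteq> y" using assms(4) by auto
  consider "x = a" | "x = c" | "y = a" "x \<noteq> a" "x \<noteq> c" | "y = c" "x \<noteq> a" "x \<noteq> c"
    | "x \<noteq> a" "x \<noteq> c" "y \<noteq> a" "y \<noteq> c" by blast
  then show ?thesis
  proof cases
    case 1
    then have "y \<noteq> a" "y \<noteq> c" "P y \<noteq> P c" using assms(5) xy e by blast+
    then show ?thesis using 1 q assms(4) by simp
  next
    case 2
    then have "y \<noteq> c" "y \<noteq> a" using xy assms(4) q(3) by auto
    then show ?thesis using 2 q assms(4) ac by simp
  next
    case 3
    then show ?thesis using q assms(4) by simp
  next
    case 4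
    then have "P x \<noteq> P a" using e by blast
    then show ?thesis using 4 q assms(4) ac by simp
  next
    case 5
    then show ?thesis using q assms(4) by simp
  qed
qed

text \<open>Before the move \<open>a\<close> precedes \<open>c\<close>, so undoing the exchange
  creates an increasing pair and destroys none. Hence a colouring carries over unchanged in this
  direction, and only the other one needs a repair.\<close>

lemma kpos_back:
  assumes "kpos A P Q a b c" "x \<in> A" "y \<in> A" "x < y" "Q x < Q y"
  shows "P x < P y"
proof (rule ccontr)
  note K = assms(1)[unfolded kpos_def]
  assume "\<not> P x < P y"
  moreover have "P x \<noteq> P y" using K assms by (auto simp: inj_on_def)
  ultimately have "P y < P x" by simp
  moreover have "\<not> (y = a \<and> x = c)" using K assms(4) by auto
  ultimately have "Q y < Q x" using kpos_fwd[OF assms(1)] assms(2,3) by blast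
  then show False using assms(5) by simp
qed

text \<open>If \<open>a\<close> and \<open>c\<close> have the same colour, the exchange is repaired by inserting \<open>b\<close> for one of
  them when \<open>b\<close> is uncoloured, and otherwise by swapping the tails of the two colour classes.\<close>
lemma greene_fwd_insert:
  assumes k: "kpos A P Q a b c" and U: "U \<subseteq> A" "finite U"
    and f: "\<forall>x\<in>U. \<forall>y\<in>U. f x = f y \<longrightarrow> x < y \<longrightarrow> P x < P y"
    and ac: "a \<in> U" "c \<in> U" "f a = f c" "b \<notin> U"
    and z: "z = (if P b < P a then a else c)"
    and xy: "x \<in> insert b (U - {z})" "y \<in> insert b (U - {z})" "(f(b := f a)) x = (f(b := f a)) y" "x < y"
  shows "Q x < Q y"
proof -
  note K = k[unfolded kpos_def]
  have abc: "a < b" "b < c" "P c = Suc (P a)" "b \<in> A" using K by auto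
  \<comment> \<open>In \<open>bac\<close> the letter \<open>b\<close> takes the part of
    \<open>a\<close>, in \<open>acb\<close> that of \<open>c\<close>; the letter it joins then stays
    on the correct side of it.\<close>
  have zz: "z = a \<and> Suc (P b) = P a \<or> z = c \<and> P b = Suc (P c)" using K z by auto
  have ne: "P x \<noteq> P b" if "x \<in> A" "x \<noteq> b" for x using K that by (auto simp: inj_on_def)
  consider "x = b" "y \<noteq> b" | "y = b" "x \<noteq> b" | "x \<noteq> b" "y \<noteq> b" using xy by auto
  then show ?thesis
  proof cases
    case 1
    then have y: "y \<in> U" "f y = f a" "y \<noteq> z" "b < y" using xy by auto
    have Pay: "P a < P y" using f ac y abc by (metis less_trans)
    have "P b < P y"
      using zz
    proof
      assume "z = c \<and> P b = Suc (P c)"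
      \<comment> \<open>A letter of the class between \<open>a\<close> and \<open>c\<close> in value
        would have to lie strictly between two adjacent places.\<close>
      moreover have "\<not> y < c" using f ac y(1,2) Pay abc(3) by (metis not_less_eq less_antisym less_irrefl_nat)
      ultimately have "P c < P y" using f ac y by auto
      then show ?thesis using ne[of y] y U \<open>z = c \<and> P b = Suc (P c)\<close> by fastforce
    qed (use Pay in auto)
    then show ?thesis using kpos_fwd[OF k, of b y] 1 y U abc by auto
  next
    case 2
    then have y: "x \<in> U" "f x = f a" "x \<noteq> z" "x < b" using xy by auto
    have Pxc: "P x < P c" using f ac y abc by (metis less_trans)
    have "P x < P b"
      using zz
    proof
      assume za: "z = a \<and> Suc (P b) = P a"
      have "\<not> a < x" using f ac y(1,2) Pxc abc(3) by (metis not_less_eq)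
      then have "P x < P a" using f ac y za by auto
      then show ?thesis using ne[of x] y U za by fastforce
    qed (use Pxc in auto)
    then show ?thesis using kpos_fwd[OF k, of x b] 2 y U abc by auto
  next
    case 3
    then have "x \<in> U" "y \<in> U" "f x = f y" "\<not> (x = a \<and> y = c)" using xy z by (auto split: if_splits)
    then show ?thesis using f kpos_fwd[OF k] U xy by blast
  qed
qed

lemma greene_fwd_swap:
  assumes k: "kpos A P Q a b c" and U: "U \<subseteq> A"
    and f: "\<forall>x\<in>U. \<forall>y\<in>U. f x = f y \<longrightarrow> x < y \<longrightarrow> P x < P y"
    and ac: "a \<in> U" "c \<in> U" "f a = f c" "b \<in> U"
    and sw: "sw = (\<lambda>t. if t = f a then f b else if t = f b then f a else t)"
    and f': "f' = (\<lambda>x. if P c \<le> P x then sw (f x) else f x)"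
    and xy: "x \<in> U" "y \<in> U" "f' x = f' y" "x < y"
  shows "Q x < Q y"
proof -
  note K = k[unfolded kpos_def]
  have abc: "a < b" "b < c" "P c = Suc (P a)" "b \<in> A" using K by auto
  have adj: "Suc (P b) = P a \<or> P b = Suc (P c)" using K by auto
  have inj: "P x = P y \<Longrightarrow> x = y" if "x \<in> U" "y \<in> U" for x y
    using K that U by (auto simp: inj_on_def)
  \<comment> \<open>In one class \<open>a < b < c\<close> would force \<open>b\<close> between the
    adjacent letters \<open>a\<close> and \<open>c\<close>.\<close>
  have fab: "f a \<noteq> f b"
  proof
    assume "f a = f b"
    then have "P a < P b" "P b < P c" using f ac abc by metis+
    then show False using abc by auto
  qed
  have nac: "\<not> (x = a \<and> y = c)"
    using xy(3) fab abc ac unfolding f' sw by auto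
  consider "P c \<le> P x" "P c \<le> P y" | "P x < P c" "P y < P c" | "P x < P c" "P c \<le> P y" | "P c \<le> P x" "P y < P c"
    by linarith
  then have "P x < P y"
  proof cases
    case 1
    then have "f x = f y" using xy fab unfolding f' sw by (auto split: if_splits)
    then show ?thesis using xy f by auto
  next
    case 2
    then have "f x = f y" using xy unfolding f' by (auto split: if_splits)
    then show ?thesis using xy f by auto
  next
    \<comment> \<open>The critical case: the smaller letter lies in a swapped tail, the larger one
      before the cut. Comparing them with \<open>a\<close>, \<open>b\<close>, \<open>c\<close> in
      their classes would squeeze a letter in between the adjacent places of these three.\<close>
    case 4
    then have e: "f y = sw (f x)" using xy unfolding f' by (auto split: if_splits)
    then consider "f x = f a" "f y = f b" | "f x = f b" "f y = f a" | "f x = f y"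
      unfolding sw by (auto split: if_splits)
    then show ?thesis
    proof cases
      case 1
      have "\<not> x < c" using f xy ac 1 4 by fastforce
      then have "b < y" using xy abc by simp
      then have "P b < P y" using f ac xy 1 by auto
      then show ?thesis using adj 4 abc inj[of y a] xy ac fab 1 by fastforce
    next
      case 2
      have "\<not> a < y"
      proof
        assume "a < y"
        then have "P a < P y" using f ac xy 2 by auto
        then show False using 4 abc by auto
      qed
      then have "x < b" using xy abc by simp
      then have "P x < P b" using f ac xy 2 by auto
      then show ?thesis using 4 adj abc inj[of x c] xy 2 fab ac by fastforce
    qed (use xy f in auto)
  qed auto
  then show ?thesis using kpos_fwd[OF k] nac xy U by blast
qed

lemma greene_fwd:
  assumes k: "kpos A P Q a b c" and U: "U \<subseteq> A" "U \<subseteq> {1..j}"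
    and f: "\<forall>x\<in>U. f x < k" "\<forall>x\<in>U. \<forall>y\<in>U. f x = f y \<longrightarrow> x < y \<longrightarrow> P x < P y"
  shows "\<exists>U' f'. U' \<subseteq> A \<and> U' \<subseteq> {1..j} \<and> card U' = card U \<and> (\<forall>x\<in>U'. f' x < (k::nat)) \<and>
     (\<forall>x\<in>U'. \<forall>y\<in>U'. f' x = f' y \<longrightarrow> x < y \<longrightarrow> Q x < Q y)"
proof -
  have abc: "a < b" "b < c" "b \<in> A" using k[unfolded kpos_def] by auto
  have fin: "finite U" using U(2) finite_subset by blast
  consider "\<not> (a \<in> U \<and> c \<in> U \<and> f a = f c)" | "a \<in> U" "c \<in> U" "f a = f c" "b \<notin> U" |
     "a \<in> U" "c \<in> U" "f a = f c" "b \<in> U" by blast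
  then show ?thesis
  proof cases
    case 1
    have "Q x < Q y" if "x \<in> U" "y \<in> U" "f x = f y" "x < y" for x y
      using kpos_fwd[OF k, of x y] that f(2) U(1) 1 by blast
    then show ?thesis using U f(1) by blast
  next
    case 2
    define z where "z = (if P b < P a then a else c)"
    define f' where "f' = f(b := f a)"
    have zU: "z \<in> U" using 2 z_def by auto
    have "card (insert b (U - {z})) = card U" using fin zU 2 by (simp add: card_Suc_Diff1 del: card_Diff_insert card_Diff_singleton)
    moreover have "insert b (U - {z}) \<subseteq> A" "insert b (U - {z}) \<subseteq> {1..j}" using U abc 2 by auto
    moreover have "\<forall>x\<in>insert b (U - {z}). f' x < k" using f 2 unfolding f'_def by auto
    moreover have "\<forall>x\<in>insert b (U - {z}). \<forall>y\<in>insert b (U - {z}). f' x = f' y \<longrightarrow> x < y \<longrightarrow> Q x < Q y"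
      using greene_fwd_insert[OF k U(1) fin f(2) 2 z_def] unfolding f'_def by blast
    ultimately show ?thesis by blast
  next
    case 3
    define sw where "sw = (\<lambda>t. if t = f a then f b else if t = f b then f a else t)"
    define f' where "f' = (\<lambda>x. if P c \<le> P x then sw (f x) else f x)"
    have "\<forall>x\<in>U. f' x < k" using f 3 unfolding f'_def sw_def by auto
    moreover have "\<forall>x\<in>U. \<forall>y\<in>U. f' x = f' y \<longrightarrow> x < y \<longrightarrow> Q x < Q y"
      using greene_fwd_swap[OF k U(1) f(2) 3 sw_def f'_def] by blast
    ultimately show ?thesis using U by blast
  qed
qed

text \<open>The bound \<open>j\<close> on the letters makes the invariant finer than the shape:
  letting \<open>j\<close> vary shows how the shape grows, that is, the tableau itself.\<close>

definition greene :: "nat list \<Rightarrow> nat \<Rightarrow> nat \<Rightarrow> nat \<Rightarrow> bool" where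
  "greene w k j s \<longleftrightarrow> (\<exists>U. U \<subseteq> set w \<and> U \<subseteq> {1..j} \<and> card U = s \<and> colorable w k U)"

lemma kmove_greene:
  assumes "kmove w w'" "distinct w"
  shows "greene w k j s \<longleftrightarrow> greene w' k j s"
proof -
  obtain P Q a b c where K: "kpos (set w) P Q a b c"
    and b: "\<And>x y. x \<in> set w \<Longrightarrow> y \<in> set w \<Longrightarrow> bef w x y \<longleftrightarrow> P x < P y"
    "\<And>x y. x \<in> set w \<Longrightarrow> y \<in> set w \<Longrightarrow> bef w' x y \<longleftrightarrow> Q x < Q y"
    using kmove_kpos[OF assms] by blast
  have s: "set w' = set w" using assms kmove_mset mset_eq_setD by blast
  show ?thesis
  proof
    assume "greene w k j s"
    then obtain U f where U: "U \<subseteq> set w" "U \<subseteq> {1..j}" "card U = s"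
      and f: "\<forall>x\<in>U. f x < k" "\<forall>x\<in>U. \<forall>y\<in>U. f x = f y \<longrightarrow> x < y \<longrightarrow> bef w x y"
      unfolding greene_def colorable_def by blast
    have f2: "\<forall>x\<in>U. \<forall>y\<in>U. f x = f y \<longrightarrow> x < y \<longrightarrow> P x < P y" using f(2) b(1) U(1) by blast
    obtain U' f' where U': "U' \<subseteq> set w" "U' \<subseteq> {1..j}" "card U' = card U" 
      "\<forall>x\<in>U'. f' x < k" "\<forall>x\<in>U'. \<forall>y\<in>U'. f' x = f' y \<longrightarrow> x < y \<longrightarrow> Q x < Q y"
      using greene_fwd[OF K U(1,2) f(1) f2] by blast
    have "\<forall>x\<in>U'. \<forall>y\<in>U'. f' x = f' y \<longrightarrow> x < y \<longrightarrow> bef w' x y" using U' b(2) by blast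
    then have "colorable w' k U'" unfolding colorable_def using U'(4) by (intro exI[of _ f'] conjI)
    then show "greene w' k j s" unfolding greene_def s using U' U(3) by (intro exI[of _ U']) simp
  next
    assume "greene w' k j s"
    then obtain U f where U: "U \<subseteq> set w" "U \<subseteq> {1..j}" "card U = s"
      and f: "\<forall>x\<in>U. f x < k" "\<forall>x\<in>U. \<forall>y\<in>U. f x = f y \<longrightarrow> x < y \<longrightarrow> bef w' x y"
      unfolding greene_def colorable_def s by blast
    have "\<forall>x\<in>U. \<forall>y\<in>U. f x = f y \<longrightarrow> x < y \<longrightarrow> bef w x y"
      using f(2) b U(1) kpos_back[OF K] by (meson subsetD)
    then have "colorable w k U" unfolding colorable_def using f(1) by (intro exI[of _ f] conjI)
    then show "greene w k j s" unfolding greene_def using U by (intro exI[of _ U]) simp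
  qed
qed

lemma keq_greene: "keq w w' \<Longrightarrow> distinct w \<Longrightarrow> greene w k j s \<longleftrightarrow> greene w' k j s"
proof (induction rule: equivclp_induct)
  case (step v w')
  have "distinct v" "distinct w'" using step keq_distinct kmove_mset mset_eq_imp_distinct_iff by blast+
  then show ?case using step kmove_greene by blast
qed auto

text \<open>Reversal and complement together keep increasing subsequences increasing. The bound is
  \<open>j = N\<close> because complementing does not preserve a smaller segment
  \<open>{1..j}\<close>.\<close>

lemma greene_rc:
  assumes "set w = {1..N}" "greene w k N s"
  shows "greene (rc N w) k N s"
proof -
  obtain U f where U: "U \<subseteq> {1..N}" "card U = s"
      and f: "\<forall>x\<in>U. f x < k" "\<forall>x\<in>U. \<forall>y\<in>U. f x = f y \<longrightarrow> x < y \<longrightarrow> bef w x y"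
    using assms unfolding greene_def colorable_def by blast
  define h where "h = (\<lambda>x. N + 1 - x)"
  define U' where "U' = h ` U"
  have hh: "h (h x) = x" if "x \<in> {1..N}" for x using that unfolding h_def by auto
  have "card U' = s" unfolding U'_def
    using card_image[OF inj_on_subset[OF inj_rc U(1)]] U(2) unfolding h_def by simp
  moreover have "U' \<subseteq> {1..N}" using U(1) unfolding U'_def h_def by fastforce
  moreover have "\<forall>x\<in>U'. (f \<circ> h) x < k"
    using f(1) U hh unfolding U'_def by (auto simp: subset_iff)
  moreover have "bef (rc N w) x y" if xy: "x \<in> U'" "y \<in> U'" "(f \<circ> h) x = (f \<circ> h) y" "x < y" for x y
  proof -
    obtain x' y' where x': "x = h x'" "y = h y'" "x' \<in> U" "y' \<in> U" using xy U'_def by auto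
    then have i: "x' \<in> {1..N}" "y' \<in> {1..N}" using U by auto
    then have "f x' = f y'" "y' < x'" using xy x' hh by (auto simp: h_def)
    then have "bef w y' x'" using f(2) x' by auto
    then show ?thesis using bef_rc[of w N x' y'] i assms(1) x' by (simp add: h_def)
  qed
  ultimately have "colorable (rc N w) k U'" unfolding colorable_def by (intro exI[of _ "f \<circ> h"]) blast
  then show ?thesis unfolding greene_def set_rc[OF assms(1)]
    using \<open>card U' = s\<close> \<open>U' \<subseteq> {1..N}\<close> by (intro exI[of _ U']) simp
qed

subsection \<open>Row functions of standard tableaux\<close>

declare upt_Suc [simp del]

lemma row_index_props:
  assumes "x \<in> set (concat T)"
  shows "row_index T x < length T" "x \<in> set (T ! row_index T x)"
proof -
  obtain k where "k < length T \<and> x \<in> set (T ! k)"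
    using assms by (auto simp: in_set_conv_nth) (metis nth_mem)
  then have "row_index T x < length T \<and> x \<in> set (T ! row_index T x)"
    unfolding row_index_def by (rule LeastI)
  then show "row_index T x < length T" "x \<in> set (T ! row_index T x)" by auto
qed

lemma row_index_Cons:
  assumes "x \<in> set (concat (r # rs))"
  shows "row_index (r # rs) x = (if x \<in> set r then 0 else Suc (row_index rs x))"
proof (cases "x \<in> set r")
  case False
  then have "x \<in> set (concat rs)" using assms by simp
  from row_index_props[OF this] have "Suc (row_index rs x) < length (r # rs) \<and> x \<in> set ((r # rs) ! Suc (row_index rs x))"
    by simp
  then have "(LEAST k. k < length (r # rs) \<and> x \<in> set ((r # rs) ! k)) =
      Suc (LEAST k. Suc k < length (r # rs) \<and> x \<in> set ((r # rs) ! Suc k))"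
    by (rule Least_Suc) (use False in simp)
  then show ?thesis using False by (simp add: row_index_def)
qed (auto simp: row_index_def intro: Least_equality)

lemma row_index_eq:
  "distinct (concat T) \<Longrightarrow> k < length T \<Longrightarrow> x \<in> set (T ! k) \<Longrightarrow> row_index T x = k"
proof (induction T arbitrary: k)
  case (Cons r rs)
  have ne: "x \<in> set (concat (r # rs))" using Cons.prems(2,3) nth_mem[of k "r # rs"] by auto
  show ?case
  proof (cases k)
    case 0
    then show ?thesis using row_index_Cons[OF ne] Cons.prems(3) by simp
  next
    case (Suc l)
    then have l: "x \<in> set (rs ! l)" "l < length rs" using Cons.prems by auto
    then have "x \<in> set (concat rs)" using nth_mem[of l rs] by auto
    then have "x \<notin> set r" using Cons.prems(1) by auto
    moreover have "row_index rs x = l" using Cons.IH[OF _ l(2,1)] Cons.prems(1) by simp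
    ultimately show ?thesis using Suc row_index_Cons[OF ne] by simp
  qed
qed simp

text \<open>The order of letters in a reading word: higher rows are read first, and each row is read
  upwards.\<close>

definition rel_of :: "(nat \<Rightarrow> nat) \<Rightarrow> nat \<Rightarrow> nat \<Rightarrow> bool" where
  "rel_of r x y \<longleftrightarrow> r y < r x \<or> r x = r y \<and> x < y"

lemma bef_sorted:
  fixes r :: "nat list"
  shows "sorted r \<Longrightarrow> distinct r \<Longrightarrow> bef r x y \<longleftrightarrow> x \<in> set r \<and> y \<in> set r \<and> x < y"
  by (induction r) (auto simp: less_le)

lemma set_row: "set (row T) = set (concat T)" by (simp add: row_def)

lemma mset_row: "mset (row T) = mset (concat T)"
  by (induction T) (auto simp: row_def)

lemma distinct_row: "distinct (row T) = distinct (concat T)"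
  using mset_row mset_eq_imp_distinct_iff by blast

lemma bef_row:
  assumes "distinct (concat T)" "\<forall>r\<in>set T. sorted r" "x \<in> set (concat T)" "y \<in> set (concat T)"
  shows "bef (row T) x y \<longleftrightarrow> rel_of (row_index T) x y"
  using assms
proof (induction T)
  case (Cons r rs)
  have row: "row (r # rs) = row rs @ r" by (simp add: row_def)
  have d: "distinct r" "distinct (concat rs)" "set r \<inter> set (concat rs) = {}" "sorted r"
    using Cons.prems by auto
  have ix: "row_index (r # rs) x = (if x \<in> set r then 0 else Suc (row_index rs x))"
     "row_index (r # rs) y = (if y \<in> set r then 0 else Suc (row_index rs y))"
    using row_index_Cons Cons.prems(3,4) by blast+
  define A where "A = set (concat rs)"
  define B where "B = set r"
  have b: "bef r x y \<longleftrightarrow> x \<in> B \<and> y \<in> B \<and> x < y"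
    using bef_sorted[OF d(4,1)] B_def by simp
  have nb: "bef (row rs) x y \<Longrightarrow> x \<in> A \<and> y \<in> A"
    using bef_in[of "row rs" x y] unfolding A_def set_row .
  have IH: "x \<in> A \<Longrightarrow> y \<in> A \<Longrightarrow> bef (row rs) x y \<longleftrightarrow> rel_of (row_index rs) x y"
    unfolding A_def using Cons.IH[OF d(2)] Cons.prems(2) by simp
  have m: "x \<in> A \<longleftrightarrow> x \<notin> B" "y \<in> A \<longleftrightarrow> y \<notin> B"
    using Cons.prems(3,4) d(3) unfolding A_def B_def by auto
  have bf: "bef (row rs) x y \<longleftrightarrow> x \<in> A \<and> y \<in> A \<and> rel_of (row_index rs) x y"
    using nb IH by blast
  show ?case unfolding row bef_append b set_row ix A_def[symmetric] B_def[symmetric] bf rel_of_def m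
    by auto
qed simp

section \<open>Ballot functions and standard tableaux\<close>

definition cnt :: "(nat \<Rightarrow> nat) \<Rightarrow> nat \<Rightarrow> nat \<Rightarrow> nat" where
  "cnt r k \<rho> = card {x \<in> {1..k}. r x = \<rho>}"

lemma cnt_0 [simp]: "cnt r 0 \<rho> = 0" by (simp add: cnt_def)

lemma cnt_Suc: "cnt r (Suc k) \<rho> = cnt r k \<rho> + (if r (Suc k) = \<rho> then 1 else 0)"
proof -
  have "{x \<in> {1..Suc k}. r x = \<rho>} = {x \<in> {1..k}. r x = \<rho>} \<union> (if r (Suc k) = \<rho> then {Suc k} else {})"
    by (auto simp: le_Suc_eq)
  then show ?thesis unfolding cnt_def by (auto simp: card_insert_if)
qed

lemma cnt_cong: "(\<And>x. x \<in> {1..k} \<Longrightarrow> r x = s x) \<Longrightarrow> cnt r k \<rho> = cnt s k \<rho>"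
  unfolding cnt_def by (rule arg_cong[of _ _ card]) auto

lemma cnt_mono: "k \<le> l \<Longrightarrow> cnt r k \<rho> \<le> cnt r l \<rho>"
  unfolding cnt_def by (rule card_mono) auto

text \<open>The Yamanouchi condition: for every \<open>k\<close> the letters up to \<open>k\<close>
  fill a Young diagram.\<close>

definition bal :: "nat \<Rightarrow> (nat \<Rightarrow> nat) \<Rightarrow> bool" where
  "bal n r \<longleftrightarrow> (\<forall>k\<le>n. \<forall>\<rho>. cnt r k (Suc \<rho>) \<le> cnt r k \<rho>)"

definition yam :: "nat list \<Rightarrow> (nat \<Rightarrow> nat) \<Rightarrow> bool" where
  "yam lam r \<longleftrightarrow> bal (sum_list lam) r \<and>
     (\<forall>\<rho>. cnt r (sum_list lam) \<rho> = (if \<rho> < length lam then lam ! \<rho> else 0))"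

definition tab :: "nat \<Rightarrow> nat \<Rightarrow> (nat \<Rightarrow> nat) \<Rightarrow> tableau" where
  "tab n L r = map (\<lambda>\<rho>. filter (\<lambda>x. r x = \<rho>) [1..<n + 1]) [0..<L]"

lemma tab_cong: "(\<And>x. x \<in> {1..n} \<Longrightarrow> r x = s x) \<Longrightarrow> tab n L r = tab n L s"
  unfolding tab_def by (auto intro!: filter_cong)

lemma yam_cong:
  assumes "\<And>x. x \<in> {1..sum_list lam} \<Longrightarrow> r x = s x"
  shows "yam lam r = yam lam s"
proof -
  have "cnt r k \<rho> = cnt s k \<rho>" if "k \<le> sum_list lam" for k \<rho>
    using that assms by (intro cnt_cong) auto
  then show ?thesis unfolding yam_def bal_def by auto
qed

lemma length_filter_cnt: "length (filter (\<lambda>x. r x = \<rho>) [1..<k + 1]) = cnt r k \<rho>"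
  unfolding cnt_def by (subst distinct_length_filter) (auto intro!: arg_cong[of _ _ card])

lemma filter_nth_le:
  assumes "k \<le> n" "j < length (filter (\<lambda>x. r x = \<rho>) [1..<n + 1])"
  shows "filter (\<lambda>x. r x = \<rho>) [1..<n + 1] ! j \<le> k \<longleftrightarrow> j < cnt r k \<rho>"
proof -
  have e: "[1..<n + 1] = [1..<k + 1] @ [k + 1..<n + 1]"
    using upt_add_eq_append[of 1 "k + 1" "n - k"] assms by simp
  let ?P = "\<lambda>x. r x = \<rho>"
  have l: "length (filter ?P [1..<k + 1]) = cnt r k \<rho>" by (rule length_filter_cnt)
  show ?thesis
  proof (cases "j < cnt r k \<rho>")
    case True
    then have "filter ?P [1..<n + 1] ! j = filter ?P [1..<k + 1] ! j"
      using l unfolding e by (simp add: nth_append)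
    moreover have "filter ?P [1..<k + 1] ! j \<in> set (filter ?P [1..<k + 1])"
      using True l by (intro nth_mem) simp
    ultimately show ?thesis using True by auto
  next
    case False
    then have "filter ?P [1..<n + 1] ! j = filter ?P [k + 1..<n + 1] ! (j - cnt r k \<rho>)"
      using l unfolding e by (simp add: nth_append)
    moreover have "filter ?P [k + 1..<n + 1] ! (j - cnt r k \<rho>) \<in> set (filter ?P [k + 1..<n + 1])"
      using False l assms unfolding e by (intro nth_mem) simp
    ultimately show ?thesis using False by auto
  qed
qed

text \<open>Entries and counts determine each other (\<open>filter_nth_le\<close>): place
  \<open>j\<close>, counted from 0, holds a letter at most \<open>k\<close> just if the row has more
  than \<open>j\<close> letters up to \<open>k\<close>. So comparing vertically adjacent cells in
  all columns is the same as comparing the two counts for all \<open>k\<close>.\<close>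

lemma semistandard_tab:
  assumes "\<And>x. x \<in> {1..n} \<Longrightarrow> r x < L"
  shows "semistandard (tab n L r) \<longleftrightarrow> bal n r"
proof
  let ?F = "\<lambda>\<rho>. filter (\<lambda>x. r x = \<rho>) [1..<n + 1]"
  have nth: "tab n L r ! i = ?F i" if "i < L" for i using that by (simp add: tab_def)
  have len: "length (tab n L r) = L" by (simp add: tab_def)
  {
    assume s: "semistandard (tab n L r)"
    show "bal n r" unfolding bal_def
    proof (intro allI impI)
      fix k \<rho> assume k: "k \<le> n"
      show "cnt r k (Suc \<rho>) \<le> cnt r k \<rho>"
      proof (cases "cnt r k (Suc \<rho>)")
        case (Suc j)
        then have "{x \<in> {1..k}. r x = Suc \<rho>} \<noteq> {}" unfolding cnt_def by (metis card.empty nat.distinct(1))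
        then have L: "Suc \<rho> < L" using assms k by fastforce
        have j: "j < length (?F (Suc \<rho>))"
          unfolding length_filter_cnt using Suc cnt_mono[OF k, of r "Suc \<rho>"] by simp
        then have "?F (Suc \<rho>) ! j \<le> k" using filter_nth_le[OF k j] Suc by simp
        moreover have "j < length (?F \<rho>) \<and> ?F \<rho> ! j < ?F (Suc \<rho>) ! j"
          using s[unfolded semistandard_def] nth[of \<rho>] nth[of "Suc \<rho>"] L j len by (metis Suc_lessD)
        ultimately have "j < cnt r k \<rho>" using filter_nth_le[OF k, of j r \<rho>] by auto
        then show ?thesis using Suc by simp
      qed simp
    qed
  }
  {
    assume b: "bal n r"
    show "semistandard (tab n L r)" unfolding semistandard_def
    proof (intro conjI allI impI ballI)
      fix row assume "row \<in> set (tab n L r)"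
      then show "sorted row" by (auto simp: tab_def intro!: sorted_filter[of "\<lambda>x. x", simplified])
    next
      fix i j assume i: "Suc i < length (tab n L r)" and "j < length (tab n L r ! Suc i)"
      then have j: "j < length (?F (Suc i))" using nth len by simp
      define y where "y = ?F (Suc i) ! j"
      have "y \<in> set (?F (Suc i))" unfolding y_def using j nth_mem by blast
      then have y: "y \<le> n" "r y = Suc i" by auto
      have "j < cnt r y (Suc i)" using filter_nth_le[OF y(1) j] y_def by simp
      then have c: "j < cnt r y i" using b y unfolding bal_def by (meson less_le_trans)
      then have j': "j < length (?F i)" unfolding length_filter_cnt using cnt_mono[OF y(1), of r i] by simp
      then have "?F i ! j \<le> y" using filter_nth_le[OF y(1) j'] c by simp
      moreover have "?F i ! j \<noteq> y" using nth_mem[OF j'] y by auto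
      ultimately have "?F i ! j < y" by simp
      then show "j < length (tab n L r ! i)" "tab n L r ! i ! j < tab n L r ! Suc i ! j"
        using j' nth i len y_def by auto
    qed
  }
qed

lemma mset_concat_tab: "mset (concat (tab n L r)) = mset (filter (\<lambda>x. r x < L) [1..<n + 1])"
proof (induction L)
  case (Suc L)
  have "mset (filter (\<lambda>x. r x < Suc L) xs) = mset (filter (\<lambda>x. r x < L) xs) + mset (filter (\<lambda>x. r x = L) xs)" for xs
    by (induction xs) auto
  moreover have "concat (tab n (Suc L) r) = concat (tab n L r) @ filter (\<lambda>x. r x = L) [1..<n + 1]"
    by (simp add: tab_def upt_Suc)
  ultimately show ?case using Suc by (simp only: mset_append)
qed (simp add: tab_def)

lemma SYT_basic:
  assumes "T \<in> SYT lam"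
  shows "length T = length lam" "distinct (concat T)" "set (concat T) = {1..sum_list lam}"
    "\<forall>r\<in>set T. sorted r" "length (concat T) = sum_list lam"
proof -
  have m: "mset (concat T) = mset [1..<sum_list lam + 1]" using assms by (simp add: SYT_def)
  show "length T = length lam" using assms by (auto simp: SYT_def)
  show "distinct (concat T)" using mset_eq_imp_distinct_iff[OF m] by simp
  show "set (concat T) = {1..sum_list lam}" using mset_eq_setD[OF m] by auto
  show "\<forall>r\<in>set T. sorted r" using assms by (auto simp: SYT_def semistandard_def)
  show "length (concat T) = sum_list lam" using mset_eq_length[OF m] by (simp del: length_concat)
qed

lemma tab_row_index:
  assumes "distinct (concat T)" "set (concat T) = {1..n}" "\<forall>r\<in>set T. sorted r"
  shows "tab n (length T) (row_index T) = T"
proof (rule nth_equalityI)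
  show "length (tab n (length T) (row_index T)) = length T" by (simp add: tab_def)
  fix i assume "i < length (tab n (length T) (row_index T))"
  then have i: "i < length T" by (simp add: tab_def)
  have "set (T ! i) = {x \<in> {1..n}. row_index T x = i}"
  proof safe
    fix x assume x: "x \<in> set (T ! i)"
    then show "row_index T x = i" using row_index_eq assms i by blast
    have "x \<in> set (concat T)" using x i nth_mem by fastforce
    then show "x \<in> {1..n}" unfolding assms(2) .
  next
    fix x assume "x \<in> {1..n}" "i = row_index T x"
    then show "x \<in> set (T ! row_index T x)" using row_index_props assms by metis
  qed
  moreover have "set (filter (\<lambda>x. row_index T x = i) [1..<n + 1]) = {x \<in> {1..n}. row_index T x = i}"
    by auto
  ultimately have "set (filter (\<lambda>x. row_index T x = i) [1..<n + 1]) = set (T ! i)" by (rule_tac trans) simp_all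
  moreover have "distinct (T ! i)" using assms(1) i by (simp add: distinct_concat_iff)
  moreover have "sorted (T ! i)" using assms(3) i by simp
  ultimately have "filter (\<lambda>x. row_index T x = i) [1..<n + 1] = T ! i"
    using sorted_filter[of "\<lambda>x. x" "[1..<n + 1]" "\<lambda>x. row_index T x = i"]
    by (intro sorted_distinct_set_unique) simp_all
  then show "tab n (length T) (row_index T) ! i = T ! i" using i by (simp add: tab_def)
qed

lemma SYT_tab: "T \<in> SYT lam \<Longrightarrow> tab (sum_list lam) (length lam) (row_index T) = T"
  using tab_row_index[of T "sum_list lam"] SYT_basic[of T lam] by simp

lemma SYT_inj:
  assumes "T \<in> SYT lam" "T' \<in> SYT lam" "\<And>x. x \<in> {1..sum_list lam} \<Longrightarrow> row_index T x = row_index T' x"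
  shows "T = T'"
proof -
  have "T = tab (sum_list lam) (length lam) (row_index T)" using SYT_tab[OF assms(1)] by (rule sym)
  also have "\<dots> = tab (sum_list lam) (length lam) (row_index T')" by (rule tab_cong[OF assms(3)])
  also have "\<dots> = T'" using SYT_tab[OF assms(2)] .
  finally show ?thesis .
qed

lemma SYT_yam:
  assumes "T \<in> SYT lam"
  shows "yam lam (row_index T)"
proof -
  let ?n = "sum_list lam" and ?r = "row_index T"
  have r: "?r x < length lam" if "x \<in> {1..?n}" for x
    using that row_index_props(1) SYT_basic[OF assms] by metis
  have "semistandard (tab ?n (length lam) ?r)" using SYT_tab[OF assms] assms by (simp add: SYT_def)
  then have "bal ?n ?r" using semistandard_tab[of ?n ?r] r by blast
  moreover have "cnt ?r ?n \<rho> = (if \<rho> < length lam then lam ! \<rho> else 0)" for \<rho>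
  proof (cases "\<rho> < length lam")
    case True
    then have "cnt ?r ?n \<rho> = length (tab ?n (length lam) ?r ! \<rho>)"
      using length_filter_cnt[of ?r \<rho> ?n] by (simp add: tab_def)
    also have "\<dots> = lam ! \<rho>" using True assms unfolding SYT_tab[OF assms] SYT_def by force
    finally show ?thesis using True by simp
  next
    case False
    then have "{x \<in> {1..?n}. ?r x = \<rho>} = {}" using r by auto
    then have "cnt ?r ?n \<rho> = 0" unfolding cnt_def by (metis card.empty)
    then show ?thesis using False by simp
  qed
  ultimately show ?thesis unfolding yam_def by blast
qed

lemma yam_less:
  assumes "yam lam r" "x \<in> {1..sum_list lam}"
  shows "r x < length lam"
proof (rule ccontr)
  assume "\<not> r x < length lam"
  then have "cnt r (sum_list lam) (r x) = 0" using assms(1) unfolding yam_def by auto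
  then show False using assms(2) unfolding cnt_def by auto
qed

text \<open>The converse of \<open>SYT_yam\<close>: to produce a tableau it suffices to check the
  counts of a function, and columns need not be mentioned.\<close>

lemma yam_SYT:
  assumes "yam lam r"
  shows "tab (sum_list lam) (length lam) r \<in> SYT lam"
    "\<And>x. x \<in> {1..sum_list lam} \<Longrightarrow> row_index (tab (sum_list lam) (length lam) r) x = r x"
proof -
  let ?n = "sum_list lam" and ?T = "tab (sum_list lam) (length lam) r"
  note less = yam_less[OF assms]
  have m: "mset (concat ?T) = mset [1..<?n + 1]"
    unfolding mset_concat_tab using less by (auto intro!: arg_cong[of _ _ mset] filter_True)
  have "semistandard ?T" using semistandard_tab[of ?n r "length lam"] less assms yam_def by blast
  moreover have "map length ?T = lam"
  proof (rule nth_equalityI)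
    fix i assume "i < length (map length ?T)"
    then have "i < length lam" by (simp add: tab_def)
    then show "map length ?T ! i = lam ! i"
      using length_filter_cnt[of r i ?n] assms unfolding yam_def by (simp add: tab_def)
  qed (simp add: tab_def)
  ultimately show S: "?T \<in> SYT lam" using m unfolding SYT_def by blast
  fix x assume x: "x \<in> {1..?n}"
  then have "x \<in> set (?T ! r x)" "r x < length ?T" using less[OF x] by (auto simp: tab_def)
  then show "row_index ?T x = r x" using row_index_eq SYT_basic(2)[OF S] by blast
qed

lemma bef_row_SYT:
  assumes "T \<in> SYT lam" "x \<in> {1..sum_list lam}" "y \<in> {1..sum_list lam}"
  shows "bef (row T) x y \<longleftrightarrow> rel_of (row_index T) x y"
  by (rule bef_row) (use SYT_basic[OF assms(1)] assms in blast)+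

section \<open>Columns, and the evaluation of the Greene invariants\<close>

definition col :: "(nat \<Rightarrow> nat) \<Rightarrow> nat \<Rightarrow> nat" where
  "col r x = cnt r (x - 1) (r x)"

lemma cnt_ex:
  "c < cnt r k \<rho> \<Longrightarrow> \<exists>x\<in>{1..k}. r x = \<rho> \<and> cnt r (x - 1) \<rho> = c"
proof (induction k)
  case (Suc k)
  show ?case
  proof (cases "c < cnt r k \<rho>")
    case True
    then show ?thesis using Suc by fastforce
  next
    case False
    then have "r (Suc k) = \<rho>" "cnt r k \<rho> = c" using Suc.prems by (auto simp: cnt_Suc split: if_splits)
    then show ?thesis by (intro bexI[of _ "Suc k"]) auto
  qed
qed simp

lemma col_less:
  assumes "x < y" "1 \<le> x" "r x = r y"
  shows "col r x < col r y"
proof -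
  have "col r x < cnt r x (r x)" using cnt_Suc[of r "x - 1" "r x"] assms by (simp add: col_def)
  also have "\<dots> \<le> cnt r (y - 1) (r x)" using assms by (intro cnt_mono) auto
  finally show ?thesis using assms by (simp add: col_def)
qed

text \<open>By the ballot condition, row \<open>\<rho>\<close> has more than \<open>col r y\<close>
  letters by the time \<open>y\<close> arrives; the one with this very index is the cell
  below.\<close>

lemma col_below:
  assumes "bal n r" "y \<in> {1..n}" "r y = Suc \<rho>"
  shows "\<exists>x\<ge>1. x < y \<and> r x = \<rho> \<and> col r x = col r y"
proof -
  have "col r y < cnt r y (Suc \<rho>)" using cnt_Suc[of r "y - 1" "Suc \<rho>"] assms by (simp add: col_def)
  also have "\<dots> \<le> cnt r y \<rho>" using assms unfolding bal_def by auto
  finally obtain x where x: "x \<in> {1..y}" "r x = \<rho>" "cnt r (x - 1) \<rho> = col r y" using cnt_ex by blast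
  then have "x \<noteq> y" using assms by auto
  then show ?thesis using x by (intro exI[of _ x]) (auto simp: col_def)
qed

lemma col_inj: "1 \<le> x \<Longrightarrow> 1 \<le> y \<Longrightarrow> r x = r y \<Longrightarrow> col r x = col r y \<Longrightarrow> x = y"
  using col_less[of x y r] col_less[of y x r] by (cases x y rule: linorder_cases) auto

lemma col_row_less:
  assumes "bal n r" "x \<in> {1..n}" "y \<in> {1..n}" "col r x = col r y" "r x < r y"
  shows "x < y"
  using assms(3-5)
proof (induction "r y" arbitrary: y)
  case (Suc \<rho>)
  obtain z where z: "1 \<le> z" "z < y" "r z = \<rho>" "col r z = col r y"
    using col_below[OF assms(1) Suc.prems(1)] Suc.hyps(2) by metis
  show ?case
  proof (cases "r x = \<rho>")
    case True
    then have "x = z" using col_inj[of x z r] z assms(2) Suc.prems by auto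
    then show ?thesis using z by simp
  next
    case False
    then have "x < z" using Suc.hyps(1)[of z] z Suc.prems Suc.hyps(2) by auto
    then show ?thesis using z by simp
  qed
qed simp

lemma down_closed:
  fixes S :: "nat set"
  assumes "finite S" "\<And>s. Suc s \<in> S \<Longrightarrow> s \<in> S"
  shows "S = {..<card S}"
proof (cases "S = {}")
  case False
  have *: "t \<in> S \<Longrightarrow> s \<le> t \<Longrightarrow> s \<in> S" for s t
  proof (induction t)
    case (Suc t) then show ?case using assms(2) by (cases "s = Suc t") auto
  qed simp
  have "S = {..Max S}"
  proof
    show "S \<subseteq> {..Max S}" using assms(1) by auto
    show "{..Max S} \<subseteq> S" using * Max_in[OF assms(1) False] by auto
  qed
  then have "S = {..<Suc (Max S)}" by (simp add: lessThan_Suc_atMost)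
  moreover from this have "card S = Suc (Max S)" by (metis card_lessThan)
  ultimately show ?thesis by simp
qed simp

text \<open>Letters grow upwards in a column while the reading word meets them from the top, so a
  column is a decreasing subsequence and each colour class takes at most one of its letters. Thus
  \<open>U\<close> has there at most the minimum of \<open>k\<close> and the height of the column,
  and the first \<open>k\<close> rows reach this number.\<close>

lemma col_bound:
  assumes b: "bal n r" and j: "j \<le> n" and U: "U \<subseteq> {1..j}"
    and f: "\<forall>x\<in>U. f x < (k::nat)" "\<forall>x\<in>U. \<forall>y\<in>U. f x = f y \<longrightarrow> x < y \<longrightarrow> rel_of r x y"
  shows "card {x \<in> U. col r x = c} \<le> card {x \<in> {x \<in> {1..j}. r x < k}. col r x = c}"
proof -
  define C where "C = {x \<in> {1..j}. col r x = c}"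
  have fC: "finite C" unfolding C_def by simp
  have inj: "inj_on r C" using col_inj[of _ _ r] unfolding inj_on_def C_def by fastforce
  \<comment> \<open>Cut off at \<open>j\<close>, the column still fills its rows without gaps,
    because the cell below holds a smaller letter.\<close>
  have im: "r ` C = {..<card C}"
  proof -
    have "r ` C = {..<card (r ` C)}"
    proof (rule down_closed)
      fix s assume "Suc s \<in> r ` C"
      then obtain y where y: "y \<in> C" "r y = Suc s" by auto
      then have "y \<in> {1..n}" using j unfolding C_def by auto
      from col_below[OF b this y(2)] obtain x where "1 \<le> x" "x < y" "r x = s" "col r x = col r y" by blast
      then show "s \<in> r ` C" using y unfolding C_def by (intro image_eqI[of _ _ x]) auto
    qed (use fC in simp)
    then show ?thesis using card_image[OF inj] by simp
  qed
  have "card {x \<in> C. r x < k} = card (r ` {x \<in> C. r x < k})"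
    using inj by (metis (no_types, lifting) card_image inj_on_subset mem_Collect_eq subsetI)
  also have "r ` {x \<in> C. r x < k} = {..<min k (card C)}"
  proof -
    have "r ` {x \<in> C. r x < k} = r ` C \<inter> {..<k}" by auto
    then show ?thesis using im by auto
  qed
  finally have R: "card {x \<in> C. r x < k} = min k (card C)" by simp
  define V where "V = {x \<in> U. col r x = c}"
  have VC: "V \<subseteq> C" using U unfolding V_def C_def by auto
  have "inj_on f V"
  proof -
    have False if xy: "x \<in> V" "y \<in> V" "f x = f y" "x < y" for x y
    proof -
      have "rel_of r x y" using f(2) xy unfolding V_def by auto
      moreover have "r x \<noteq> r y" using inj_onD[OF inj, of x y] xy VC by auto
      ultimately have "r y < r x" unfolding rel_of_def by auto
      then have "y < x" using col_row_less[OF b, of y x] subsetD[OF VC xy(1)] subsetD[OF VC xy(2)] j unfolding C_def by auto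
      then show False using xy by simp
    qed
    then show ?thesis unfolding inj_on_def by (metis linorder_neqE_nat)
  qed
  then have "card V \<le> card {..<k}" using f(1) by (intro card_inj_on_le[of f]) (auto simp: V_def)
  moreover have "card V \<le> card C" using card_mono[OF fC VC] .
  ultimately have "card V \<le> card {x \<in> C. r x < k}" using R by simp
  moreover have "{x \<in> C. r x < k} = {x \<in> {x \<in> {1..j}. r x < k}. col r x = c}" unfolding C_def by auto
  ultimately show ?thesis unfolding V_def by simp
qed

lemma card_by_col:
  fixes g :: "nat \<Rightarrow> nat"
  assumes "finite S" "\<And>x. x \<in> S \<Longrightarrow> g x \<le> M"
  shows "card S = (\<Sum>c\<le>M. card {x \<in> S. g x = c})"
proof -
  have "(\<Sum>c\<in>{..M}. sum (\<lambda>_. 1::nat) {x \<in> S. g x = c}) = sum (\<lambda>_. 1) S"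
    by (rule sum.group) (use assms in auto)
  then show ?thesis by simp
qed

lemma greene_le:
  assumes b: "bal n r" and j: "j \<le> n" and w: "set w = {1..n}"
    and r: "\<And>x y. x \<in> {1..n} \<Longrightarrow> y \<in> {1..n} \<Longrightarrow> bef w x y \<longleftrightarrow> rel_of r x y"
    and g: "greene w k j s"
  shows "s \<le> card {x \<in> {1..j}. r x < k}"
proof -
  obtain U f where U: "U \<subseteq> {1..j}" "card U = s"
      and f: "\<forall>x\<in>U. f x < k" "\<forall>x\<in>U. \<forall>y\<in>U. f x = f y \<longrightarrow> x < y \<longrightarrow> bef w x y"
    using g unfolding greene_def colorable_def by blast
  have f2: "\<forall>x\<in>U. \<forall>y\<in>U. f x = f y \<longrightarrow> x < y \<longrightarrow> rel_of r x y"
  proof (intro ballI impI)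
    fix x y assume "x \<in> U" "y \<in> U" "f x = f y" "x < y"
    moreover from this have "x \<in> {1..n}" "y \<in> {1..n}" using U j by auto
    ultimately show "rel_of r x y" using f(2) r[of x y] by blast
  qed
  have colM: "col r x \<le> n" if "x \<in> {1..j}" for x
  proof -
    have "col r x \<le> card {1..x - 1}" unfolding col_def cnt_def by (rule card_mono) auto
    moreover have "x - 1 \<le> n" using that j by auto
    ultimately show ?thesis by simp
  qed
  have "card U = (\<Sum>c\<le>n. card {x \<in> U. col r x = c})"
    by (rule card_by_col) (use U finite_subset colM in auto)
  also have "\<dots> \<le> (\<Sum>c\<le>n. card {x \<in> {x \<in> {1..j}. r x < k}. col r x = c})"
    by (rule sum_mono) (rule col_bound[OF b j U(1) f(1) f2])
  also have "\<dots> = card {x \<in> {1..j}. r x < k}"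
    by (rule card_by_col[symmetric]) (use colM in auto)
  finally show ?thesis using U by simp
qed

text \<open>The bottom \<open>k\<close> rows are themselves \<open>k\<close> increasing
  subsequences, with the row function as colouring.\<close>

lemma greene_ge:
  assumes j: "j \<le> n" and w: "set w = {1..n}"
    and r: "\<And>x y. x \<in> {1..n} \<Longrightarrow> y \<in> {1..n} \<Longrightarrow> bef w x y \<longleftrightarrow> rel_of r x y"
  shows "greene w k j (card {x \<in> {1..j}. r x < k})"
proof -
  define S where "S = {x \<in> {1..j}. r x < k}"
  have "bef w x y" if "x \<in> {1..j}" "y \<in> {1..j}" "r x = r y" "x < y" for x y
    using r[of x y] that j by (simp add: rel_of_def)
  then have "colorable w k S"
    unfolding colorable_def S_def by (intro exI[of _ r]) blast
  moreover have "S \<subseteq> {1..j}" unfolding S_def by blast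
  moreover from this have "S \<subseteq> set w" using w j by auto
  ultimately show ?thesis unfolding greene_def S_def[symmetric] by blast
qed

text \<open>By Greene, the number of letters up to \<open>j\<close> in the bottom \<open>k\<close>
  rows depends only on the Knuth class. Passing from \<open>j - 1\<close> to \<open>j\<close> shows
  for every \<open>k\<close> whether the row of \<open>j\<close> is less than \<open>k\<close>,
  hence which row it is.\<close>

lemma keq_tableau_unique:
  assumes b: "bal n r" "bal n r'" and w: "set w = {1..n}" "distinct w"
    and r: "\<And>x y. x \<in> {1..n} \<Longrightarrow> y \<in> {1..n} \<Longrightarrow> bef w x y \<longleftrightarrow> rel_of r x y"
       "\<And>x y. x \<in> {1..n} \<Longrightarrow> y \<in> {1..n} \<Longrightarrow> bef w' x y \<longleftrightarrow> rel_of r' x y"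
    and k: "keq w w'" and x: "x \<in> {1..n}"
  shows "r x = r' x"
proof -
  have w': "set w' = {1..n}" "distinct w'" using keq_set[OF k] keq_distinct[OF k] w by auto
  have le: "s \<le> card {x \<in> {1..j}. r x < k}" if "j \<le> n" "greene w k j s" for j k s
    by (rule greene_le[OF b(1) that(1) w(1) _ that(2)], rule r(1))
  have le': "s \<le> card {x \<in> {1..j}. r' x < k}" if "j \<le> n" "greene w' k j s" for j k s
    by (rule greene_le[OF b(2) that(1) w'(1) _ that(2)], rule r(2))
  have ge: "greene w k j (card {x \<in> {1..j}. r x < k})" if "j \<le> n" for j k
    by (rule greene_ge[OF that w(1)], rule r(1))
  have ge': "greene w' k j (card {x \<in> {1..j}. r' x < k})" if "j \<le> n" for j k
    by (rule greene_ge[OF that w'(1)], rule r(2))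
  have E: "card {x \<in> {1..j}. r x < k} = card {x \<in> {1..j}. r' x < k}" if j: "j \<le> n" for j k
  proof (rule antisym)
    show "card {x \<in> {1..j}. r x < k} \<le> card {x \<in> {1..j}. r' x < k}"
      by (rule le'[OF j],
          rule keq_greene[OF k w(2), THEN iffD1], rule ge[OF j])
    show "card {x \<in> {1..j}. r' x < k} \<le> card {x \<in> {1..j}. r x < k}"
      by (rule le[OF j],
          rule keq_greene[OF k w(2), THEN iffD2], rule ge'[OF j])
  qed
  have S: "card {x \<in> {1..Suc j}. t x < k} = card {x \<in> {1..j}. t x < k} + (if t (Suc j) < k then 1 else 0)" for t :: "nat \<Rightarrow> nat" and j k
  proof -
    have "{x \<in> {1..Suc j}. t x < k} = {x \<in> {1..j}. t x < k} \<union> (if t (Suc j) < k then {Suc j} else {})"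
      by (auto simp: le_Suc_eq)
    then show ?thesis by (auto simp: card_insert_if)
  qed
  obtain j where j: "x = Suc j" "Suc j \<le> n" using x by (cases x) auto
  have "r x < k \<longleftrightarrow> r' x < k" for k
    using E[OF j(2), of k] E[OF Suc_leD[OF j(2)], of k] S[of j r k] S[of j r' k] unfolding j(1)
    by (cases "r (Suc j) < k"; cases "r' (Suc j) < k") simp_all
  from this[of "r x"] this[of "r' x"] show ?thesis by auto
qed

text \<open>Both inequalities come from the same transport of increasing subsequences:
  \<open>rc n\<close> is an involution on these words, so \<open>rc n w'\<close> is in turn
  equivalent to \<open>w\<close>.\<close>

lemma rc_content:
  assumes b: "bal n r" "bal n r'" and w: "set w = {1..n}" "distinct w"
    and r: "\<And>x y. x \<in> {1..n} \<Longrightarrow> y \<in> {1..n} \<Longrightarrow> bef w x y \<longleftrightarrow> rel_of r x y"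
       "\<And>x y. x \<in> {1..n} \<Longrightarrow> y \<in> {1..n} \<Longrightarrow> bef w' x y \<longleftrightarrow> rel_of r' x y"
    and k: "keq (rc n w) w'"
  shows "cnt r n \<rho> = cnt r' n \<rho>"
proof -
  have rw: "set (rc n w) = {1..n}" "distinct (rc n w)" using set_rc distinct_rc w by auto
  have w': "set w' = {1..n}" "distinct w'" using keq_set[OF k] keq_distinct[OF k] rw by auto
  have k': "keq (rc n w') w"
    using keq_rc[OF k, of n] rc_rc[of w n] w rw keq_sym by auto
  have le: "s \<le> card {x \<in> {1..n}. r x < k}" if "greene w k n s" for k s
    by (rule greene_le[OF b(1) le_refl w(1) _ that], rule r(1))
  have le': "s \<le> card {x \<in> {1..n}. r' x < k}" if "greene w' k n s" for k s
    by (rule greene_le[OF b(2) le_refl w'(1) _ that], rule r(2))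
  have ge: "greene w k n (card {x \<in> {1..n}. r x < k})" for k
    by (rule greene_ge[OF le_refl w(1)], rule r(1))
  have ge': "greene w' k n (card {x \<in> {1..n}. r' x < k})" for k
    by (rule greene_ge[OF le_refl w'(1)], rule r(2))
  have E: "card {x \<in> {1..n}. r x < k} = card {x \<in> {1..n}. r' x < k}" for k
  proof (rule antisym)
    show "card {x \<in> {1..n}. r x < k} \<le> card {x \<in> {1..n}. r' x < k}"
      by (rule le', rule keq_greene[OF k rw(2), THEN iffD1],
          rule greene_rc[OF w(1)], rule ge)
    have rw': "distinct (rc n w')" using distinct_rc w' by auto
    show "card {x \<in> {1..n}. r' x < k} \<le> card {x \<in> {1..n}. r x < k}"
      by (rule le, rule keq_greene[OF k' rw', THEN iffD1],
          rule greene_rc[OF w'(1)], rule ge')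
  qed
  have S: "card {x \<in> {1..n}. (t::nat \<Rightarrow> nat) x < Suc \<rho>} = card {x \<in> {1..n}. t x < \<rho>} + cnt t n \<rho>" for t
    unfolding cnt_def by (subst card_Un_disjoint[symmetric]) (auto intro!: arg_cong[of _ _ card])
  show ?thesis using E[of "Suc \<rho>"] E[of \<rho>] S[of r] S[of r'] by simp
qed

subsection \<open>Insertion tableaux\<close>

lemma row_insert_append:
  "\<forall>z\<in>set r. \<not> x < z \<Longrightarrow> row_insert x (r # rs) = (r @ [x]) # rs"
  by (auto split: option.split simp: find_Some_iff)

lemma row_insert_bump:
  assumes "\<forall>z\<in>set p. \<not> x < z" "x < y"
  shows "row_insert x ((p @ y # q) # rs) = (p @ x # q) # row_insert y rs"
proof -
  have "find (\<lambda>y. x < y) (p @ y # q) = Some y"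
    unfolding find_Some_iff using assms by (intro exI[of _ "length p"]) (auto simp: nth_append)
  moreover have "(LEAST k. k < length (p @ y # q) \<and> x < (p @ y # q) ! k) = length p"
  proof (rule Least_equality)
    fix k assume "k < length (p @ y # q) \<and> x < (p @ y # q) ! k"
    then show "length p \<le> k" using assms(1) nth_mem[of k p] by (auto simp: nth_append split: if_splits)
  qed (use assms in auto)
  ultimately show ?thesis by simp
qed

lemma bump_cases:
  obtains "\<forall>z\<in>set r. \<not> x < (z::nat)"
  | p y q where "r = p @ y # q" "\<forall>z\<in>set p. \<not> x < z" "x < y"
  using split_list_first_prop[of r "\<lambda>z. x < z"] by blast

lemma mset_row_insert: "mset (concat (row_insert x T)) = add_mset x (mset (concat T))"
proof (induction T arbitrary: x)
  case (Cons r rs)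
  show ?case
  proof (cases r x rule: bump_cases)
    case 1 then show ?thesis by (simp only: row_insert_append) simp
  next
    case (2 p y q)
    then show ?thesis using Cons.IH[of y] by (simp only: row_insert_bump[OF 2(2,3)] 2(1)) simp
  qed
qed simp

lemma semistandard_Cons:
  "semistandard (r # rs) \<longleftrightarrow> sorted r \<and> semistandard rs \<and>
     (rs \<noteq> [] \<longrightarrow> (\<forall>j<length (hd rs). j < length r \<and> r ! j < hd rs ! j))"
proof -
  have "(\<forall>i j. Suc i < length (r # rs) \<longrightarrow> j < length ((r # rs) ! Suc i) \<longrightarrow>
            j < length ((r # rs) ! i) \<and> (r # rs) ! i ! j < (r # rs) ! Suc i ! j) \<longleftrightarrow>
     (rs \<noteq> [] \<longrightarrow> (\<forall>j<length (hd rs). j < length r \<and> r ! j < hd rs ! j)) \<and>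
     (\<forall>i j. Suc i < length rs \<longrightarrow> j < length (rs ! Suc i) \<longrightarrow>
            j < length (rs ! i) \<and> rs ! i ! j < rs ! Suc i ! j)" (is "?A \<longleftrightarrow> ?B \<and> ?C")
  proof
    assume A: ?A
    have ?B using A[rule_format, of 0] by (cases rs) auto
    moreover have ?C using A[rule_format, of "Suc _"] by auto
    ultimately show "?B \<and> ?C" ..
  next
    assume B: "?B \<and> ?C"
    show ?A
    proof (intro allI impI)
      fix i j assume "Suc i < length (r # rs)" "j < length ((r # rs) ! Suc i)"
      then show "j < length ((r # rs) ! i) \<and> (r # rs) ! i ! j < (r # rs) ! Suc i ! j"
        using B by (cases i; cases rs) auto
    qed
  qed
  then show ?thesis unfolding semistandard_def by auto
qed

lemma sorted_replace:
  fixes x y :: nat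
  assumes "sorted (p @ y # q)" "\<forall>z\<in>set p. \<not> x < z" "x < y"
  shows "sorted (p @ x # q)"
  using assms by (auto simp: sorted_append)

text \<open>The bumped letter \<open>y\<close> enters the next row weakly to the left of the place
  it leaves, since an entry above that place exceeds \<open>y\<close>. The entry below its new cell
  is therefore \<open>x\<close> or one to the left of \<open>x\<close>, and so less than
  \<open>y\<close>.\<close>

lemma semistandard_row_insert:
  "semistandard T \<Longrightarrow> semistandard (row_insert x T)"
proof (induction T arbitrary: x)
  case Nil
  then show ?case by (simp add: semistandard_def)
next
  case (Cons r rs)
  have S: "sorted r" "semistandard rs"
    "rs \<noteq> [] \<Longrightarrow> j < length (hd rs) \<Longrightarrow> j < length r \<and> r ! j < hd rs ! j" for j
    using Cons.prems semistandard_Cons by blast+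
  show ?case
  proof (cases r x rule: bump_cases)
    case 1
    have "sorted (r @ [x])" using S 1 by (auto simp: sorted_append not_less)
    moreover have "j < length (r @ [x]) \<and> (r @ [x]) ! j < hd rs ! j" if "rs \<noteq> []" "j < length (hd rs)" for j
      using S(3)[OF that] by (simp add: nth_append)
    ultimately show ?thesis unfolding row_insert_append[OF 1] semistandard_Cons using S by blast
  next
    case (2 p y q)
    have px: "(p @ x # q) ! j < y" if "j \<le> length p" for j
    proof (cases "j = length p")
      case False
      then have "p ! j \<in> set p" using that by simp
      then have "p ! j < y" using 2 by (auto simp: not_less)
      then show ?thesis using False that by (simp add: nth_append)
    qed (use 2 in simp)
    have le: "(p @ x # q) ! j \<le> r ! j" for j
      using 2 by (auto simp: nth_append nth_Cons split: nat.split)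
    have len: "length (p @ x # q) = length r" using 2 by simp
    let ?R = "row_insert y rs"
    have "?R \<noteq> [] \<longrightarrow> (\<forall>j<length (hd ?R). j < length (p @ x # q) \<and> (p @ x # q) ! j < hd ?R ! j)"
    proof (cases rs)
      case Nil
      then show ?thesis using px[of 0] by simp
    next
      case (Cons r2 rs2)
      note D = S(3)[unfolded Cons, simplified]
      show ?thesis
      proof (cases r2 y rule: bump_cases)
        case 1
        \<comment> \<open>A cell above the old place of \<open>y\<close> would hold a letter larger
          than \<open>y\<close>, against the choice of this case.\<close>
        have l: "length r2 \<le> length p"
        proof (rule ccontr)
          assume a: "\<not> length r2 \<le> length p"
          then have "r ! length p < r2 ! length p" using D[of "length p"] by simp
          moreover have "r2 ! length p \<in> set r2" using a by simp
          ultimately show False using 1 2(1) by simp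
        qed
        have "j < length (p @ x # q) \<and> (p @ x # q) ! j < (r2 @ [y]) ! j" if "j < length (r2 @ [y])" for j
        proof (cases "j < length r2")
          case True
          then show ?thesis using D[of j] le[of j] len by (simp add: nth_append)
        next
          case False
          then show ?thesis using that l px[of j] by (simp add: nth_append)
        qed
        then show ?thesis unfolding Cons row_insert_append[OF 1] by simp
      next
        case (2 p2 y2 q2)
        have l: "length p2 \<le> length p"
        proof (rule ccontr)
          assume a: "\<not> length p2 \<le> length p"
          then have "r ! length p < r2 ! length p" using D[of "length p"] 2(1) by simp
          moreover have "r2 ! length p = p2 ! length p" "p2 ! length p \<in> set p2" using a 2(1) by (auto simp: nth_append)
          ultimately show False using 2 \<open>r = p @ y # q\<close> by (metis nth_append_length)
        qed
        have "j < length (p @ x # q) \<and> (p @ x # q) ! j < (p2 @ y # q2) ! j" if j: "j < length (p2 @ y # q2)" for j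
        proof (cases "j = length p2")
          case True
          then show ?thesis using l px[of j] by simp
        next
          case False
          then have "(p2 @ y # q2) ! j = r2 ! j" using 2(1) by (auto simp: nth_append nth_Cons split: nat.split)
          moreover have "j < length r2" using j 2(1) by simp
          ultimately show ?thesis using D[of j] le[of j] len by simp
        qed
        then show ?thesis unfolding Cons 2(1) row_insert_bump[OF 2(2,3)] by simp
      qed
    qed
    moreover have "sorted (p @ x # q)" using S(1) 2 sorted_replace by blast
    ultimately show ?thesis unfolding 2(1) row_insert_bump[OF 2(2,3)] semistandard_Cons
      using Cons.IH[OF S(2)] by blast
  qed
qed

section \<open>Row insertion as a sequence of Knuth moves\<close>

lemma kmove_keq: "kmove u v \<Longrightarrow> keq u v" by (rule r_into_equivclp)

lemma kmove_keq': "kmove v u \<Longrightarrow> keq u v" by (rule converse_r_into_equivclp)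

text \<open>The letter \<open>x\<close> moves left past the letters of \<open>q\<close> one at a
  time: if \<open>b\<close> is the entry before \<open>z\<close>, then \<open>x < b < z\<close>
  relates \<open>bzx\<close> and \<open>bxz\<close>.\<close>

lemma keq_insert_right:
  assumes "sorted (y # q)" "distinct (y # q)" "x < y"
  shows "keq (y # q @ [x]) (y # x # q)"
  using assms
proof (induction q rule: rev_induct)
  case (snoc z q)
  obtain u b where ub: "y # q = u @ [b]" by (metis append_Cons append_butlast_last_id list.distinct(1))
  have "sorted (u @ [b] @ [z])" "distinct (u @ [b] @ [z])" using snoc.prems ub by (metis append_Cons append_assoc)+
  moreover have "x < b"
  proof -
    have "b \<in> set (y # q)" unfolding ub by simp
    then show ?thesis using snoc.prems by (auto simp: sorted_append)
  qed
  ultimately have "kmove (u @ [b, x, z] @ []) (u @ [b, z, x] @ [])"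
    unfolding kmove_def by (intro exI[of _ u] exI[of _ "[]"] exI[of _ x] exI[of _ b] exI[of _ z]) (auto simp: sorted_append)
  then have "keq ((u @ [b]) @ [z, x]) ((u @ [b]) @ [x, z])" using kmove_keq' by simp
  then have 1: "keq (y # q @ [z, x]) (y # q @ [x, z])" unfolding ub[symmetric] by simp
  have "keq (y # q @ [x]) (y # x # q)" using snoc by (simp add: sorted_append)
  from keq_ctx[OF this, of "[]" "[z]"] have 2: "keq (y # q @ [x, z]) (y # x # q @ [z])" by simp
  show ?case using keq_trans[OF 1 2] by simp
qed simp

text \<open>The letter \<open>y\<close> moves left past the letters of \<open>p\<close>, the last
  one first: \<open>z < x < y\<close> relates \<open>zyx\<close> and \<open>yzx\<close>.\<close>

lemma keq_insert_left:
  assumes "sorted (p @ [x])" "distinct (p @ [x])" "x < y"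
  shows "keq (p @ y # x # q) (y # p @ x # q)"
  using assms
proof (induction p arbitrary: x q rule: rev_induct)
  case (snoc z p)
  have "z < x" using snoc.prems by (auto simp: sorted_append less_le)
  then have "kmove (p @ [z, y, x] @ q) (p @ [y, z, x] @ q)"
    unfolding kmove_def using snoc.prems(3)
    by (intro exI[of _ p] exI[of _ q] exI[of _ z] exI[of _ x] exI[of _ y]) simp
  then have "keq (p @ z # y # x # q) (p @ y # z # x # q)" using kmove_keq by simp
  moreover have "keq (p @ y # z # x # q) (y # p @ z # x # q)"
    using snoc.prems \<open>z < x\<close> by (intro snoc.IH) (auto simp: sorted_append)
  ultimately show ?case using keq_trans by simp
qed simp

lemma row_Cons: "row (r # rs) = row rs @ r" by (simp add: row_def)

text \<open>Bumping in words: the row \<open>p y q\<close> followed by \<open>x\<close> passes to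
  \<open>p y x q\<close> and then to \<open>y p x q\<close>, where \<open>y\<close> stands as the
  letter to be inserted into the next row.\<close>

lemma keq_row_insert:
  "\<forall>r\<in>set T. sorted r \<Longrightarrow> distinct (x # concat T) \<Longrightarrow> keq (row T @ [x]) (row (row_insert x T))"
proof (induction T arbitrary: x)
  case (Cons r rs)
  show ?case
  proof (cases r x rule: bump_cases)
    case 1 then show ?thesis by (simp only: row_insert_append row_Cons) simp
  next
    case (2 p y q)
    have sd: "sorted (p @ y # q)" "distinct (p @ y # q)" "x \<notin> set (p @ y # q)"
      using Cons.prems 2 by auto
    have "keq (p @ (y # q @ [x]) @ []) (p @ (y # x # q) @ [])"
      by (rule keq_ctx, rule keq_insert_right) (use sd 2 in \<open>auto simp: sorted_append\<close>)
    moreover have "keq (p @ y # x # q) (y # p @ x # q)"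
      by (rule keq_insert_left) (use sd 2 in \<open>auto simp: sorted_append not_less\<close>)
    ultimately have "keq (r @ [x]) (y # p @ x # q)" using keq_trans 2(1) by simp
    from keq_ctx[OF this, of "row rs" "[]"]
    have 1: "keq (row (r # rs) @ [x]) ((row rs @ [y]) @ p @ x # q)" by (simp add: row_Cons)
    have "keq (row rs @ [y]) (row (row_insert y rs))"
      by (rule Cons.IH) (use Cons.prems 2 in auto)
    from keq_ctx[OF this, of "[]" "p @ x # q"]
    have "keq ((row rs @ [y]) @ p @ x # q) (row (row_insert x (r # rs)))"
      unfolding 2(1) row_insert_bump[OF 2(2,3)] by (simp add: row_Cons)
    then show ?thesis using 1 keq_trans by blast
  qed
qed (simp add: row_def)

lemma mset_rsk_P: "mset (concat (rsk_P w)) = mset w"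
  by (induction w rule: rev_induct) (auto simp: rsk_P_def mset_row_insert simp del: mset_concat)

lemma semistandard_rsk_P: "semistandard (rsk_P w)"
  by (induction w rule: rev_induct) (auto simp: rsk_P_def semistandard_row_insert, auto simp: semistandard_def)

lemma distinct_rsk_P: "distinct w \<Longrightarrow> distinct (concat (rsk_P w))"
  using mset_rsk_P mset_eq_imp_distinct_iff by blast

lemma set_rsk_P: "set (concat (rsk_P w)) = set w"
  using mset_rsk_P mset_eq_setD by blast

lemma keq_rsk_P: "distinct w \<Longrightarrow> keq w (row (rsk_P w))"
proof (induction w rule: rev_induct)
  case (snoc x w)
  have e: "rsk_P (w @ [x]) = row_insert x (rsk_P w)" by (simp add: rsk_P_def)
  have "keq (w @ [x]) (row (rsk_P w) @ [x])" using keq_ctx[OF snoc.IH, of "[]" "[x]"] snoc.prems by simp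
  moreover have "keq (row (rsk_P w) @ [x]) (row (rsk_P (w @ [x])))"
    unfolding e
  proof (rule keq_row_insert)
    show "\<forall>r\<in>set (rsk_P w). sorted r" using semistandard_rsk_P unfolding semistandard_def by blast
    show "distinct (x # concat (rsk_P w))" using distinct_rsk_P[of w] set_rsk_P[of w] snoc.prems by simp
  qed
  ultimately show ?case using keq_trans by blast
qed (simp add: rsk_P_def row_def)

lemma bef_rsk_P:
  assumes "distinct w" "x \<in> set w" "y \<in> set w"
  shows "bef (row (rsk_P w)) x y \<longleftrightarrow> rel_of (row_index (rsk_P w)) x y"
  by (rule bef_row) (use assms distinct_rsk_P set_rsk_P semistandard_rsk_P[unfolded semistandard_def] in blast)+

lemma bal_rsk_P:
  assumes "distinct w" "set w = {1..n}"
  shows "bal n (row_index (rsk_P w))"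
proof -
  have s: "\<forall>r\<in>set (rsk_P w). sorted r" using semistandard_rsk_P unfolding semistandard_def by blast
  have "tab n (length (rsk_P w)) (row_index (rsk_P w)) = rsk_P w"
    by (rule tab_row_index) (use assms distinct_rsk_P set_rsk_P s in auto)
  then have "semistandard (tab n (length (rsk_P w)) (row_index (rsk_P w)))" using semistandard_rsk_P by simp
  moreover have "row_index (rsk_P w) x < length (rsk_P w)" if "x \<in> {1..n}" for x
    using row_index_props(1)[of x "rsk_P w"] set_rsk_P assms that by blast
  ultimately show ?thesis using semistandard_tab by blast
qed

subsection \<open>Dyck patterns under Knuth moves\<close>

text \<open>The RSK condition on a Dyck pattern interval, expressed by places of letters; the
  equivalence is \<open>rsk_dyck\<close>. Comparisons of places are what a Knuth move changes in a
  controlled way.\<close>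

definition dyck :: "(nat \<Rightarrow> nat) \<Rightarrow> nat \<Rightarrow> nat \<Rightarrow> bool" where
  "dyck P i m \<longleftrightarrow> 1 \<le> m \<and> (\<forall>q<m. P (i + q) < P (i + q + 1)) \<and>
     (\<forall>q. 1 \<le> q \<longrightarrow> q < m \<longrightarrow> P (i + m + q) < P (i + m + q + 1)) \<and>
     (\<forall>q. 1 \<le> q \<longrightarrow> q \<le> m \<longrightarrow> P (i + m + q) < P (i + q))"

text \<open>The letters \<open>i, \<dots>, i+m\<close> play the role of \<open>1\<close> and \<open>i+m+1, \<dots>, i+2m\<close> that of \<open>2\<close>;
  \<open>P\<close> gives the place of a letter, and \<open>i+p\<close> is the unbracketed \<open>1\<close>.\<close>
definition dyck_at :: "(nat \<Rightarrow> nat) \<Rightarrow> nat \<Rightarrow> nat \<Rightarrow> nat \<Rightarrow> bool" where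
  "dyck_at P i m p \<longleftrightarrow> 1 \<le> m \<and> p \<le> m \<and> (\<forall>q<m. P (i + q) < P (i + q + 1)) \<and>
     (\<forall>q. 1 \<le> q \<longrightarrow> q < m \<longrightarrow> P (i + m + q) < P (i + m + q + 1)) \<and>
     (\<forall>q<p. P (i + m + 1 + q) < P (i + q)) \<and>
     (\<forall>q. p < q \<longrightarrow> q \<le> m \<longrightarrow> P (i + m + q) < P (i + q)) \<and>
     (p < m \<longrightarrow> P (i + p) < P (i + m + 1 + p))"

lemma chain_less:
  fixes f :: "nat \<Rightarrow> nat"
  assumes "\<And>q. l \<le> q \<Longrightarrow> q < u \<Longrightarrow> f q < f (q + 1)" "l \<le> s" "s < t" "t \<le> u"
  shows "f s < f t"
  using assms(3,4)
proof (induction t)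
  case (Suc t)
  have "f t < f (t + 1)" using assms(1)[of t] assms(2) Suc.prems by simp
  then show ?case using Suc by (cases "s = t") auto
qed simp

lemma dyck_x: "dyck P i m \<Longrightarrow> s < t \<Longrightarrow> t \<le> m \<Longrightarrow> P (i + s) < P (i + t)"
  by (rule chain_less[of 0 m "\<lambda>q. P (i + q)"]) (auto simp: dyck_def)

lemma dyck_y: "dyck P i m \<Longrightarrow> 1 \<le> s \<Longrightarrow> s < t \<Longrightarrow> t \<le> m \<Longrightarrow> P (i + m + s) < P (i + m + t)"
  by (rule chain_less[of 1 m "\<lambda>q. P (i + m + q)"]) (auto simp: dyck_def)

lemma dyck_yx: "dyck P i m \<Longrightarrow> 1 \<le> q \<Longrightarrow> q \<le> m \<Longrightarrow> P (i + m + q) < P (i + q)"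
  by (auto simp: dyck_def)

lemma dyck_at_dyck:
  assumes "dyck_at P i m p" shows "dyck P i m"
proof -
  note d = assms[unfolded dyck_at_def]
  have "P (i + m + q) < P (i + q)" if q: "1 \<le> q" "q \<le> m" for q
  proof (cases "p < q")
    case False
    obtain q' where q': "q = Suc q'" using q by (cases q) auto
    then have "P (i + m + 1 + q') < P (i + q')" using d False by auto
    moreover have "P (i + q') < P (i + q' + 1)" using d q q' by auto
    ultimately show ?thesis using q' by simp
  qed (use d q in auto)
  then show ?thesis using d unfolding dyck_def by blast
qed

text \<open>Counting ranks from 0, \<open>i+p\<close> is the first \<open>1\<close> that comes
  before the \<open>2\<close> of the same rank: the earlier \<open>1\<close>s follow the
  \<open>2\<close> of their own rank, the later ones that of the preceding rank. If there is no such
  \<open>1\<close> of rank below \<open>m\<close>, then it is the last one, which has no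
  \<open>2\<close> of its rank; hence the default \<open>p = m\<close>.\<close>

lemma dyck_at_ex:
  assumes "dyck P i m" "inj_on P {i..i + 2 * m}"
  shows "\<exists>p. dyck_at P i m p"
proof -
  define p where "p = (LEAST q. q = m \<or> P (i + q) < P (i + m + 1 + q))"
  have p: "p = m \<or> P (i + p) < P (i + m + 1 + p)"
    unfolding p_def by (rule LeastI_ex) blast
  have pm: "p \<le> m" unfolding p_def by (rule Least_le) simp
  have "P (i + m + 1 + q) < P (i + q)" if "q < p" for q
  proof -
    have "\<not> P (i + q) < P (i + m + 1 + q)" using not_less_Least[of q] that unfolding p_def by blast
    moreover have "P (i + m + 1 + q) \<noteq> P (i + q)"
      using inj_onD[OF assms(2), of "i + m + 1 + q" "i + q"] that pm by auto
    ultimately show ?thesis by simp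
  qed
  then show ?thesis using assms(1) p pm unfolding dyck_at_def dyck_def
    by (intro exI[of _ p]) auto
qed

lemma dyck_at_unique:
  assumes "dyck_at P i m p" "dyck_at P i m p'" shows "p = p'"
proof (cases p p' rule: linorder_cases)
  case less
  then have "P (i + m + 1 + p) < P (i + p)" "P (i + p) < P (i + m + 1 + p)"
    using assms unfolding dyck_at_def by auto
  then show ?thesis by simp
next
  case greater
  then have "P (i + m + 1 + p') < P (i + p')" "P (i + p') < P (i + m + 1 + p')"
    using assms unfolding dyck_at_def by auto
  then show ?thesis by simp
qed

text \<open>Only comparisons of places enter, so a word and its subword of the letters concerned
  have the same patterns.\<close>

lemma dyck_at_cong:
  assumes "\<And>x y. x \<in> {i..i + 2 * m} \<Longrightarrow> y \<in> {i..i + 2 * m} \<Longrightarrow> P x < P y \<longleftrightarrow> Q x < Q y"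
  shows "dyck_at P i m p = dyck_at Q i m p" "dyck P i m = dyck Q i m"
proof -
  have *: "P x < P y \<longleftrightarrow> Q x < Q y" if "i \<le> x" "x \<le> i + 2 * m" "i \<le> y" "y \<le> i + 2 * m" for x y
    using assms that by simp
  show "dyck_at P i m p = dyck_at Q i m p"
    unfolding dyck_at_def by (intro conj_cong all_cong imp_cong refl; subst *) auto
  show "dyck P i m = dyck Q i m"
    unfolding dyck_def by (intro conj_cong all_cong imp_cong refl; subst *) auto
qed

section \<open>Dyck patterns and edges under one Knuth move\<close>

lemma kpos_swap_iff:
  assumes "kpos A P Q a b c" "x \<in> A" "y \<in> A" "x \<noteq> y" "{x, y} \<noteq> {a, c}"
  shows "P x < P y \<longleftrightarrow> Q x < Q y"
proof
  show "P x < P y \<Longrightarrow> Q x < Q y" using kpos_fwd[OF assms(1-3)] assms(5) by blast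
  assume q: "Q x < Q y"
  have "P x \<noteq> P y" using assms unfolding kpos_def inj_on_def by blast
  moreover have "P y < P x \<Longrightarrow> Q y < Q x" using kpos_fwd[OF assms(1,3,2)] assms(5) by blast
  ultimately show "P x < P y" using q by linarith
qed

text \<open>The exchanged letters \<open>a\<close> and \<open>c\<close> are never consecutive,
  because \<open>b\<close> lies between them, so only a comparison of \<open>i+q\<close> with
  \<open>i+m+q\<close> could change. In \<open>P\<close> such a pair would stand in the wrong order
  already. In \<open>Q\<close> the letter \<open>b\<close>, adjacent in place and intermediate in
  value, leaves no room for a partner that the pattern demands.\<close>

lemma dyck_kpos:
  assumes k: "kpos A P Q a b c" and A: "{i..i + 2 * m} \<subseteq> A"
  shows "dyck P i m \<longleftrightarrow> dyck Q i m"
proof -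
  have K: "a < b" "b < c" "a \<in> A" "b \<in> A" "c \<in> A" "P c = Suc (P a)" "Q a = P c" "Q c = P a" "Q b = P b"
    "Suc (P b) = P a \<or> P b = Suc (P c)" "inj_on P A" "\<And>z. z \<noteq> a \<Longrightarrow> z \<noteq> c \<Longrightarrow> Q z = P z"
    using k unfolding kpos_def by auto
  have s: "P x < P (Suc x) \<longleftrightarrow> Q x < Q (Suc x)" if "x \<in> {i..<i + 2 * m}" for x
  proof (rule kpos_swap_iff[OF k])
    show "x \<in> A" "Suc x \<in> A" using that A by auto
    show "{x, Suc x} \<noteq> {a, c}" using K(1,2) by (auto simp: doubleton_eq_iff)
  qed simp
  have yx: "P (i + m + q) < P (i + q) \<longleftrightarrow> Q (i + m + q) < Q (i + q)"
    if "1 \<le> q" "q \<le> m" "\<not> (a = i + q \<and> c = i + m + q)" for q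
  proof (rule kpos_swap_iff[OF k])
    show "i + m + q \<in> A" "i + q \<in> A" using that A by auto
    show "{i + m + q, i + q} \<noteq> {a, c}" using K(1,2) that by (auto simp: doubleton_eq_iff)
  qed (use that in auto)
  show ?thesis
  proof
    assume d: "dyck P i m"
    have "\<not> (a = i + q \<and> c = i + m + q)" if "1 \<le> q" "q \<le> m" for q
      using dyck_yx[OF d that] K(6) by auto
    then show "dyck Q i m" using d yx s unfolding dyck_def by auto
  next
    assume d: "dyck Q i m"
    have injQ: "Q x \<noteq> Q y" if "x \<in> A" "y \<in> A" "x \<noteq> y" for x y
    proof -
      have "P x \<noteq> P y" using K(11) that unfolding inj_on_def by blast
      then have "P x < P y \<or> P y < P x" by linarith
      moreover have "Q a \<noteq> Q c" using K(6-8) by simp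
      ultimately show ?thesis
        using kpos_fwd[OF k that(1,2)] kpos_fwd[OF k that(2,1)] by force
    qed
    have "\<not> (a = i + q \<and> c = i + m + q)" if q: "1 \<le> q" "q \<le> m" for q
    proof
      assume ac: "a = i + q \<and> c = i + m + q"
      consider (x) t where "b = i + t" "q < t" "t \<le> m" | (y) t where "b = i + m + t" "1 \<le> t" "t < q"
      proof (cases "b \<le> i + m")
        case True
        then show thesis using that(1)[of "b - i"] ac K(1) by auto
      next
        case False
        then show thesis using that(2)[of "b - i - m"] ac K(2) by auto
      qed
      then show False
      proof cases
        \<comment> \<open>The places read \<open>c, a, b\<close>. Then \<open>b\<close> is the
          \<open>1\<close> following \<open>a\<close>, and the \<open>2\<close> that must precede it
          would have to stand between \<open>c\<close> and \<open>b\<close>, where there is only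
          \<open>a\<close>.\<close>
        case x
        have ab: "Q a < Q b" using dyck_x[OF d, of q t] x ac by simp
        then have B: "Q b = Suc (Q a)" "Q a = Suc (Q c)" using K by auto
        have "Q (i + q) < Q (i + (q + 1))" using dyck_x[OF d, of q "q + 1"] x by simp
        moreover have "Q (i + (q + 1)) \<le> Q b"
          using dyck_x[OF d, of "q + 1" t] x by (cases "q + 1 = t") auto
        ultimately have "Q (i + (q + 1)) = Q b" using B ac by simp
        moreover have "Q (i + m + (q + 1)) < Q (i + (q + 1))" using dyck_yx[OF d, of "q + 1"] x by simp
        moreover have "Q c < Q (i + m + (q + 1))" using dyck_y[OF d, of q "q + 1"] q x ac by simp
        ultimately have "Q (i + m + (q + 1)) = Q a" using B by simp
        moreover have "i + m + (q + 1) \<in> A" by (rule subsetD[OF A]) (use x in auto)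
        ultimately show False using injQ[of "i + m + (q + 1)" a] ac K(3) by auto
      next
        \<comment> \<open>The places read \<open>b, c, a\<close>. The \<open>1\<close> that must
          follow the \<open>2\<close> called \<open>b\<close> would have to stand between
          \<open>b\<close> and \<open>a\<close>, where there is only \<open>c\<close>.\<close>
        case y
        have bc: "Q b < Q c" using dyck_y[OF d, of t q] y q ac by simp
        then have B: "Q c = Suc (Q b)" "Q a = Suc (Q c)" using K by auto
        have "Q (i + m + t) < Q (i + t)" using dyck_yx[OF d, of t] y q by simp
        moreover have "Q (i + t) < Q a" using dyck_x[OF d, of t q] y q ac by simp
        ultimately have "Q (i + t) = Q c" using B y by simp
        moreover have "i + t \<in> A" by (rule subsetD[OF A]) (use y q in auto)
        ultimately show False using injQ[of "i + t" c] ac K(5) y q by auto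
      qed
    qed
    then show "dyck P i m" using d yx s unfolding dyck_def by auto
  qed
qed

definition sg :: "nat \<Rightarrow> nat \<Rightarrow> nat \<Rightarrow> nat" where
  "sg a b x = (if x = a then b else if a < x \<and> x \<le> b then x - 1 else x)"

text \<open>If the unbracketed letter stays the same, the cycle \<open>sg\<close> keeps the order of
  \<open>a, b, c\<close> and the move survives in the images. It changes only when the move
  exchanges \<open>i+p\<close> with the \<open>2\<close> of equal rank; adjacency of places then
  forces \<open>b = i+p+1\<close>, and this becomes the unbracketed letter.\<close>

lemma dyck_at_kpos:
  assumes k: "kpos A P Q a b c" and A: "{i..i + 2 * m} \<subseteq> A"
    and p: "dyck_at P i m p" and p': "dyck_at Q i m p'"
  shows "p' = p \<and> sg (i + p) (i + m + p) a < sg (i + p) (i + m + p) b \<and>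
      sg (i + p) (i + m + p) b < sg (i + p) (i + m + p) c \<or>
    p' = p + 1 \<and> a = i + p \<and> b = i + p + 1 \<and> c = i + m + 1 + p \<and> P b = Suc (P c)"
proof -
  have K: "a < b" "b < c" "a \<in> A" "b \<in> A" "c \<in> A" "P c = Suc (P a)" "Q a = P c" "Q c = P a" "Q b = P b"
    "Suc (P b) = P a \<or> P b = Suc (P c)" "inj_on P A"
    using k unfolding kpos_def by auto
  have inj: "P x = P y \<Longrightarrow> x = y" if "x \<in> A" "y \<in> A" for x y
    using K(11) that unfolding inj_on_def by blast
  have D: "1 \<le> m" "p \<le> m" "\<And>q. q < p \<Longrightarrow> P (i + m + 1 + q) < P (i + q)"
     "\<And>q. p < q \<Longrightarrow> q \<le> m \<Longrightarrow> P (i + m + q) < P (i + q)" "p < m \<Longrightarrow> P (i + p) < P (i + m + 1 + p)"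
    using p unfolding dyck_at_def by auto
  have D': "p' \<le> m" "\<And>q. q < p' \<Longrightarrow> Q (i + m + 1 + q) < Q (i + q)"
     "p' < m \<Longrightarrow> Q (i + p') < Q (i + m + 1 + p')"
    using p' unfolding dyck_at_def by auto
  note dP = dyck_at_dyck[OF p] and dQ = dyck_at_dyck[OF p']
  have inA: "i + q \<in> A" if "q \<le> 2 * m" for q using A that by auto
  show ?thesis
  proof (cases "p' = p")
    case False
    \<comment> \<open>A \<open>1\<close> before a \<open>2\<close> after the move stood before it
      already by \<open>kpos_back\<close>, so the unbracketed index cannot decrease.\<close>
    have "\<not> p' < p"
    proof
      assume l: "p' < p"
      then have "P (i + m + 1 + p') < P (i + p')" "Q (i + p') < Q (i + m + 1 + p')" using D D' by auto
      moreover from kpos_back[OF k, of "i + p'" "i + m + 1 + p'"] this(2)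
      have "P (i + p') < P (i + m + 1 + p')" using inA[of p'] inA[of "m + 1 + p'"] D(2) l by (simp add: add.assoc)
      ultimately show False by simp
    qed
    then have l: "p < p'" using False by simp
    then have pm: "p < m" using D' by simp
    have ac: "a = i + p \<and> c = i + m + 1 + p"
    proof (rule ccontr)
      assume "\<not> ?thesis"
      moreover have "P (i + p) < P (i + m + 1 + p)" using D(5) pm by simp
      moreover have "i + p \<in> A" "i + m + 1 + p \<in> A" using A pm by auto
      ultimately have "Q (i + p) < Q (i + m + 1 + p)"
        using kpos_fwd[OF k, of "i + p" "i + m + 1 + p"] by blast
      then show False using D'(2)[OF l] by simp
    qed
    have Pb: "P b = Suc (P c)"
    proof (rule ccontr)
      assume "\<not> ?thesis"
      then have sb: "Suc (P b) = P a" using K by auto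
      show False
      proof (cases "b \<le> i + m")
        case True
        then have "P a < P b" using dyck_x[OF dP, of p "b - i"] ac K(1) by simp
        then show False using sb by simp
      next
        case False
        define t where "t = b - i - m"
        have t: "b = i + m + t" "1 \<le> t" "t \<le> p" using False ac K(2) unfolding t_def by auto
        have "P (i + m + 1 + (t - 1)) < P (i + (t - 1))" using D(3)[of "t - 1"] t by simp
        moreover have "P (i + (t - 1)) < P (i + p)" using dyck_x[OF dP, of "t - 1" p] t D(2) by simp
        ultimately show False using t sb ac by simp
      qed
    qed
    have "b \<le> i + m"
    proof (rule ccontr)
      assume "\<not> b \<le> i + m"
      then have "P b < P c" using dyck_y[OF dP, of "b - i - m" "p + 1"] ac K(2) pm by simp
      then show False using Pb by simp
    qed
    then obtain t where t: "b = i + t" "p + 1 \<le> t" "t \<le> m"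
      using ac K(1) that[of "b - i"] by auto
    have bt: "P (i + (p + 1)) \<le> P b"
      using dyck_x[OF dP, of "p + 1" t] t by (cases "t = p + 1") auto
    moreover have "P a < P (i + (p + 1))" using dyck_x[OF dP, of p "p + 1"] ac pm by simp
    moreover have "P (i + (p + 1)) \<noteq> P c" using inj[of "i + (p + 1)" c] inA[of "p + 1"] K(5) ac pm by auto
    ultimately have "P (i + (p + 1)) = P b" using Pb K(6) by simp
    then have b: "b = i + p + 1" using inj[of "i + (p + 1)" b] inA[of "p + 1"] K(4) pm by auto
    have "p' = p + 1"
    proof (rule ccontr)
      assume "p' \<noteq> p + 1"
      then have l2: "p + 1 < p'" using l by simp
      then have "Q (i + m + 1 + (p + 1)) < Q b" using D'(2)[of "p + 1"] b by simp
      moreover have "Q c < Q (i + m + 1 + (p + 1))" using dyck_y[OF dQ, of "p + 1" "p + 2"] ac l2 D'(1) by simp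
      ultimately have "Q (i + m + 1 + (p + 1)) = Q a" using K Pb by simp
      moreover have "Q (i + m + 1 + (p + 1)) = P (i + m + 1 + (p + 1))"
        using k ac unfolding kpos_def by simp
      ultimately have "i + m + 1 + (p + 1) = c"
        using inj[of "i + m + 1 + (p + 1)" c] inA[of "m + 1 + (p + 1)"] K(5,7) l2 D'(1) by (simp add: add.assoc)
      then show False using ac by simp
    qed
    then show ?thesis using ac b Pb by simp
  next
    case True
    \<comment> \<open>The cycle reverses a pair of letters only if the smaller one is
      \<open>i+p\<close> and the larger one is among those it jumps over. Facts 1 and 2 rule this
      out for \<open>a, b\<close> and for \<open>b, c\<close>.\<close>
    have 1: "\<not> (a = i + p \<and> b \<le> i + m + p)"
    proof
      assume a: "a = i + p \<and> b \<le> i + m + p"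
      show False
      proof (cases "b \<le> i + m")
        case bm: True
        define t where "t = b - i"
        have t: "b = i + t" "p < t" "t \<le> m" using bm a K(1) unfolding t_def by auto
        have "P a < P b" using dyck_x[OF dP, of p t] t a by simp
        then have Pb: "P b = Suc (P c)" using K by auto
        have 1: "P (i + p) < P (i + m + 1 + p)" "P (i + m + 1 + p) < P (i + (p + 1))"
          using D(5) D(4)[of "p + 1"] t by auto
        have 2: "P (i + (p + 1)) \<le> P b" using dyck_x[OF dP, of "p + 1" t] t by (cases "p + 1 = t") auto
        then have "P (i + m + 1 + p) = P c" using 1 Pb K(6) a by simp
        then have c: "c = i + m + 1 + p" using inj[of c "i + m + 1 + p"] K(5) inA[of "m + 1 + p"] t by (simp add: add.assoc)
        have "Q (i + p) < Q (i + m + 1 + p)" using D'(3) True t by simp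
        then show False using c a K by simp
      next
        case False
        define t where "t = b - i - m"
        have t: "b = i + m + t" "1 \<le> t" "t \<le> p" using False a unfolding t_def by auto
        have "P (i + m + 1 + (t - 1)) < P (i + (t - 1))" using D(3)[of "t - 1"] t by simp
        moreover have "P (i + (t - 1)) < P (i + p)" using dyck_x[OF dP, of "t - 1" p] t D(2) by simp
        ultimately show False using t a K(6,10) by auto
      qed
    qed
    have 2: "\<not> (b = i + p \<and> c \<le> i + m + p)"
    proof
      assume b: "b = i + p \<and> c \<le> i + m + p"
      show False
      proof (cases "c \<le> i + m")
        case cm: True
        define t where "t = c - i"
        have t: "c = i + t" "p < t" "t \<le> m" using cm b K(2) unfolding t_def by auto
        have "P b < P c" using dyck_x[OF dP, of p t] t b by simp
        then have Pb: "Suc (P b) = P a" using K by auto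
        have 1: "P (i + p) < P (i + m + 1 + p)" "P (i + m + 1 + p) < P (i + (p + 1))"
          using D(5) D(4)[of "p + 1"] t by auto
        have 2: "P (i + (p + 1)) \<le> P c" using dyck_x[OF dP, of "p + 1" t] t by (cases "p + 1 = t") auto
        then have "P (i + m + 1 + p) = P a" using 1 Pb K(6) b by simp
        then have "a = i + m + 1 + p" using inj[of a "i + m + 1 + p"] K(3) inA[of "m + 1 + p"] t by (simp add: add.assoc)
        then show False using b K(1) by simp
      next
        case False
        define t where "t = c - i - m"
        have t: "c = i + m + t" "1 \<le> t" "t \<le> p" using False b unfolding t_def by auto
        have "P (i + m + 1 + (t - 1)) < P (i + (t - 1))" using D(3)[of "t - 1"] t by simp
        moreover have "P (i + (t - 1)) < P (i + p)" using dyck_x[OF dP, of "t - 1" p] t D(2) by simp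
        ultimately show False using t b K(6,10) by auto
      qed
    qed
    have "sg (i + p) (i + m + p) a < sg (i + p) (i + m + p) b" using 1 K(1) unfolding sg_def by auto
    moreover have "sg (i + p) (i + m + p) b < sg (i + p) (i + m + p) c" using 2 K(2) unfolding sg_def by auto
    ultimately show ?thesis using True by blast
  qed
qed

definition edgew :: "nat list \<Rightarrow> nat \<Rightarrow> nat \<Rightarrow> nat list \<Rightarrow> bool" where
  "edgew w i m w' \<longleftrightarrow> (\<exists>p. dyck_at (pos w) i m p \<and> w' = map (sg (i + p) (i + m + p)) w)"

lemma kmove_pos:
  assumes "a < b" "b < c" "distinct (u @ [b, a, c] @ v)"
  shows "kpos (set (u @ [b, a, c] @ v)) (pos (u @ [b, a, c] @ v)) (pos (u @ [b, c, a] @ v)) a b c"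
  unfolding kpos_def using assms pos_inj[of "u @ [b, a, c] @ v"]
  by (auto simp: pos_append pos_Cons)

lemma kmove_pos':
  assumes "a < b" "b < c" "distinct (u @ [a, c, b] @ v)"
  shows "kpos (set (u @ [a, c, b] @ v)) (pos (u @ [a, c, b] @ v)) (pos (u @ [c, a, b] @ v)) a b c"
    "pos (u @ [a, c, b] @ v) b = Suc (pos (u @ [a, c, b] @ v) c)"
  unfolding kpos_def using assms pos_inj[of "u @ [a, c, b] @ v"]
  by (auto simp: pos_append pos_Cons)

lemma kmove_edgew_pair:
  assumes "kmove w w'" "distinct w" "{i..i + 2 * m} \<subseteq> set w"
    and p: "dyck_at (pos w) i m p" and p': "dyck_at (pos w') i m p'"
  shows "keq (map (sg (i + p) (i + m + p)) w) (map (sg (i + p') (i + m + p')) w')"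
proof -
  obtain u v a b c where abc: "a < b" "b < c" and
    "w = u @ [b, a, c] @ v \<and> w' = u @ [b, c, a] @ v \<or>
     w = u @ [a, c, b] @ v \<and> w' = u @ [c, a, b] @ v"
    using assms(1) unfolding kmove_def by blast
  then consider (1) "w = u @ [b, a, c] @ v" "w' = u @ [b, c, a] @ v"
    | (2) "w = u @ [a, c, b] @ v" "w' = u @ [c, a, b] @ v" by blast
  then show ?thesis
  proof cases
    case 1
    let ?s = "sg (i + p) (i + m + p)"
    have k: "kpos (set w) (pos w) (pos w') a b c" using kmove_pos[OF abc] assms(2) 1 by simp
    have "pos w b \<noteq> Suc (pos w c)" using 1 assms(2) abc by (auto simp: pos_append pos_Cons)
    then have s: "p' = p" "?s a < ?s b" "?s b < ?s c"
      using dyck_at_kpos[OF k assms(3) p p'] by auto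
    then have "kmove (map ?s w) (map ?s w')"
      unfolding kmove_def using 1
      by (intro exI[of _ "map ?s u"] exI[of _ "map ?s v"] exI[of _ "?s a"] exI[of _ "?s b"] exI[of _ "?s c"]) simp
    then show ?thesis using s kmove_keq by simp
  next
    case 2
    let ?s = "sg (i + p) (i + m + p)"
    have k: "kpos (set w) (pos w) (pos w') a b c" using kmove_pos'[OF abc] assms(2) 2 by simp
    from dyck_at_kpos[OF k assms(3) p p'] show ?thesis
    proof
      assume s: "p' = p \<and> ?s a < ?s b \<and> ?s b < ?s c"
      then have "kmove (map ?s w) (map ?s w')"
        unfolding kmove_def using 2
        by (intro exI[of _ "map ?s u"] exI[of _ "map ?s v"] exI[of _ "?s a"] exI[of _ "?s b"] exI[of _ "?s c"]) simp
      then show ?thesis using s kmove_keq by simp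
    next
      assume s: "p' = p + 1 \<and> a = i + p \<and> b = i + p + 1 \<and> c = i + m + 1 + p \<and> pos w b = Suc (pos w c)"
      let ?s' = "sg (i + p') (i + m + p')"
      have m: "1 \<le> m" using p unfolding dyck_at_def by simp
      have eq: "?s z = ?s' z" if "z \<noteq> a" "z \<noteq> b" "z \<noteq> c" for z
        using that s unfolding sg_def by auto
      have uv: "map ?s u = map ?s' u" "map ?s v = map ?s' v"
        using 2 assms(2) by (auto intro!: eq)
      have v: "?s a = i + m + p" "?s c = i + m + p + 1" "?s b = i + p"
        "?s' c = i + m + p" "?s' a = i + p" "?s' b = i + m + p + 1"
        using s m unfolding sg_def by auto
      \<comment> \<open>With \<open>A < B < C\<close> for \<open>i+p\<close>, \<open>i+m+p\<close>,
        \<open>i+m+p+1\<close>, the images of \<open>acb\<close> and \<open>cab\<close> are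
        \<open>BCA\<close> and \<open>BAC\<close>: again a Knuth move, but of the other kind and run
        backwards.\<close>
      have "kmove (map ?s' w') (map ?s w)"
        unfolding kmove_def 2 list.map map_append uv v using m
        by (intro exI[of _ "map ?s' u"] exI[of _ "map ?s' v"] exI[of _ "i + p"] exI[of _ "i + m + p"] exI[of _ "i + m + p + 1"]) simp
      then show ?thesis using kmove_keq' by blast
    qed
  qed
qed

lemma kmove_dyck:
  assumes "kmove w w'" "distinct w" "{i..i + 2 * m} \<subseteq> set w"
  shows "dyck (pos w) i m \<longleftrightarrow> dyck (pos w') i m"
proof -
  obtain u v a b c where abc: "a < b" "b < c" and
    "w = u @ [b, a, c] @ v \<and> w' = u @ [b, c, a] @ v \<or>
     w = u @ [a, c, b] @ v \<and> w' = u @ [c, a, b] @ v"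
    using assms(1) unfolding kmove_def by blast
  then have "kpos (set w) (pos w) (pos w') a b c"
    using kmove_pos[OF abc] kmove_pos'(1)[OF abc] assms(2) by auto
  then show ?thesis using dyck_kpos assms(3) by blast
qed

lemma keq_dyck:
  "keq w w' \<Longrightarrow> distinct w \<Longrightarrow> {i..i + 2 * m} \<subseteq> set w \<Longrightarrow> dyck (pos w) i m \<longleftrightarrow> dyck (pos w') i m"
proof (induction rule: equivclp_induct)
  case (step v w')
  have "distinct v" "set v = set w" using step keq_distinct[of w v] keq_set[of w v] by auto
  moreover have "distinct w'" "set w' = set w" using calculation step(2) kmove_mset mset_eq_imp_distinct_iff mset_eq_setD by blast+
  ultimately show ?case using step kmove_dyck[of v w'] kmove_dyck[of w' v] by blast
qed auto

text \<open>The unbracketed letter may differ from word to word within the class, yet the results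
  stay equivalent. So an edge may be computed on any word of a Knuth class.\<close>

lemma keq_edgew:
  "keq w w' \<Longrightarrow> distinct w \<Longrightarrow> {i..i + 2 * m} \<subseteq> set w \<Longrightarrow> edgew w i m v \<Longrightarrow>
   \<exists>v'. edgew w' i m v' \<and> keq v v'"
proof (induction rule: equivclp_induct)
  case (step x w')
  have dx: "distinct x" "set x = set w" using step keq_distinct[of w x] keq_set[of w x] by auto
  have dw: "distinct w'" "set w' = set w" using dx step(2) kmove_mset mset_eq_imp_distinct_iff mset_eq_setD by blast+
  obtain v' where v': "edgew x i m v'" "keq v v'" using step by blast
  then obtain p where p: "dyck_at (pos x) i m p" "v' = map (sg (i + p) (i + m + p)) x"
    unfolding edgew_def by blast
  have sub: "{i..i + 2 * m} \<subseteq> set x" "{i..i + 2 * m} \<subseteq> set w'" using step.prems dx dw by auto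
  have "dyck (pos w') i m"
    using step(2) kmove_dyck[of x w'] kmove_dyck[of w' x] dx(1) dw(1) sub dyck_at_dyck[OF p(1)] by blast
  then obtain p' where p': "dyck_at (pos w') i m p'"
    using dyck_at_ex inj_on_subset[OF pos_inj sub(2)] by blast
  have "keq v' (map (sg (i + p') (i + m + p')) w')"
    using step(2) kmove_edgew_pair[of x w' i m p p'] kmove_edgew_pair[of w' x i m p' p]
      dx(1) dw(1) sub p p' keq_sym by blast
  then show ?case using v' p' keq_trans unfolding edgew_def by blast
qed auto

section \<open>Reversal and complement of an edge\<close>

lemma sg_image: "a \<le> b \<Longrightarrow> {a..b} \<subseteq> A \<Longrightarrow> sg a b ` A = A"
proof safe
  fix x assume A: "a \<le> b" "{a..b} \<subseteq> A" "x \<in> A"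
  have "b \<in> A" "a < x \<Longrightarrow> x \<le> b \<Longrightarrow> x - 1 \<in> A" using A by (auto intro!: subsetD[OF A(2)])
  then show "sg a b x \<in> A" using A(3) unfolding sg_def by auto
next
  fix x assume A: "a \<le> b" "{a..b} \<subseteq> A" "x \<in> A"
  show "x \<in> sg a b ` A"
    by (rule image_eqI[of _ _ "if x = b then a else if a \<le> x \<and> x < b then x + 1 else x"])
      (use A in \<open>auto simp: sg_def\<close>)
qed

lemma sg_inj: "a \<le> b \<Longrightarrow> inj_on (sg a b) A"
  by (auto simp: inj_on_def sg_def split: if_splits)

lemma pos_map: "inj_on f (insert x (set w)) \<Longrightarrow> pos (map f w) (f x) = pos w x"
  by (induction w) (auto simp: pos_Cons inj_on_def, simp add: pos_def)

lemma pos_sg: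
  assumes "a \<le> b"
  shows "pos (map (sg a b) w) x = pos w (if x = b then a else if a \<le> x \<and> x < b then x + 1 else x)"
proof -
  let ?y = "if x = b then a else if a \<le> x \<and> x < b then x + 1 else x"
  have "sg a b ?y = x" using assms by (auto simp: sg_def)
  then show ?thesis using pos_map[OF sg_inj[OF assms], where x = ?y and w = w] by simp
qed

lemma pos_rc:
  assumes "distinct w" "set w = {1..N}" "x \<in> {1..N}" "y \<in> {1..N}"
  shows "pos (rc N w) (N + 1 - x) < pos (rc N w) (N + 1 - y) \<longleftrightarrow> pos w y < pos w x"
proof -
  have "bef (rc N w) (N + 1 - x) (N + 1 - y) \<longleftrightarrow> bef w y x"
    using bef_rc assms by auto
  moreover have "distinct (rc N w)" "set (rc N w) = {1..N}" using distinct_rc set_rc assms by auto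
  moreover have "N + 1 - x \<in> {1..N}" "N + 1 - y \<in> {1..N}" using assms by auto
  ultimately show ?thesis using bef_pos[of "rc N w"] bef_pos[of w] assms by simp
qed

text \<open>The changed letter is a new \<open>2\<close> in \<open>w'\<close>; in the mirror image
  it becomes the unbracketed \<open>1\<close>, and changing it amounts to undoing the original edge.
  Its index is \<open>m - p\<close> because the \<open>1\<close>s before it mirror the
  \<open>m - p\<close> letters \<open>2\<close> that come after it in \<open>w'\<close>.\<close>

lemma edgew_rc:
  assumes e: "edgew w i m w'" and w: "distinct w" "set w = {1..N}" and i: "1 \<le> i" "i + 2 * m \<le> N"
  shows "edgew (rc N w') (N + 1 - (i + 2 * m)) m (rc N w)"
proof -
  obtain p where p: "dyck_at (pos w) i m p" and w'_def: "w' = map (sg (i + p) (i + m + p)) w"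
    using e unfolding edgew_def by blast
  let ?a = "i + p" and ?b = "i + m + p"
  note D = p[unfolded dyck_at_def]
  have pm: "p \<le> m" "1 \<le> m" using D by auto
  have w': "distinct w'" "set w' = {1..N}"
    using w sg_inj[of ?a ?b] sg_image[of ?a ?b "{1..N}"] i pm unfolding w'_def by (auto simp: distinct_map)
  define i' where "i' = N + 1 - (i + 2 * m)"
  define Q where "Q = pos (rc N w')"
  have Q: "Q (N + 1 - x) < Q (N + 1 - y) \<longleftrightarrow> pos w' y < pos w' x" if "x \<in> {1..N}" "y \<in> {1..N}" for x y
    unfolding Q_def using pos_rc[OF w' that] .
  have P: "pos w' x = pos w (if x = ?b then ?a else if ?a \<le> x \<and> x < ?b then x + 1 else x)" for x
    unfolding w'_def by (rule pos_sg) simp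
  have Qx: "Q (i' + s) < Q (i' + t) \<longleftrightarrow> pos w' (i + 2 * m - t) < pos w' (i + 2 * m - s)"
    if "s \<le> 2 * m" "t \<le> 2 * m" for s t
  proof -
    have "i' + s = N + 1 - (i + 2 * m - s)" "i' + t = N + 1 - (i + 2 * m - t)"
      using that i unfolding i'_def by auto
    moreover have "i + 2 * m - s \<in> {1..N}" "i + 2 * m - t \<in> {1..N}" using that i by auto
    ultimately show ?thesis using Q[of "i + 2 * m - s" "i + 2 * m - t"] by (simp only:)
  qed
  have x: "pos w' (i + q) = (if q < p then pos w (i + q) else pos w (i + (q + 1)))" if "q < m" for q
    unfolding P using that by auto
  have y: "pos w' (i + m + q) = (if q < p then pos w (i + m + 1 + q) else if q = p then pos w (i + p) else pos w (i + m + q))" for q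
    unfolding P using pm by auto
  note dP = dyck_at_dyck[OF p]
  \<comment> \<open>In \<open>w'\<close> the \<open>1\<close>s are \<open>i, ..., i+m-1\<close> and
    the \<open>2\<close>s are \<open>i+m, ..., i+2m\<close>. Facts 1 to 5 are the mirrored
    conditions of \<open>dyck_at\<close>.\<close>
  have 1: "pos w' (i + m + q) < pos w' (i + m + (q + 1))" if "q < m" for q
  proof -
    consider "q + 1 < p" | "q + 1 = p" | "q = p" | "p < q" by linarith
    then show ?thesis
    proof cases
      case 1
      then show ?thesis using y[of q] y[of "q + 1"] dyck_y[OF dP, of "q + 1" "q + 2"] pm by simp
    next
      case 2
      then have "pos w (i + m + 1 + q) < pos w (i + q)" "pos w (i + q) < pos w (i + p)"
        using D dyck_x[OF dP, of q p] pm by auto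
      moreover have "q < p" "i + m + (q + 1) = i + m + p" using 2 by auto
      ultimately show ?thesis using y[of q] y[of p] by simp
    next
      case 3
      then show ?thesis using y[of q] y[of "q + 1"] D that by (simp add: add.assoc add.left_commute)
    next
      case 4
      then show ?thesis using y[of q] y[of "q + 1"] dyck_y[OF dP, of "q" "q + 1"] that by simp
    qed
  qed
  have 2: "pos w' (i + q) < pos w' (i + (q + 1))" if "q + 1 < m" for q
    using x[of q] x[of "q + 1"] dyck_x[OF dP, of q "q + 1"] dyck_x[OF dP, of q "q + 2"] dyck_x[OF dP, of "q + 1" "q + 2"] that
    by (auto simp: add.assoc)
  have 3: "pos w' (i + m + q) < pos w' (i + (q - 1))" if "p < q" "q \<le> m" for q
    using y[of q] x[of "q - 1"] D that by auto
  have 4: "pos w' (i + m + q) < pos w' (i + q)" if "q < p" for q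
    using y[of q] x[of q] D that by auto
  have 5: "pos w' (i + (p - 1)) < pos w' (i + m + p)" if "0 < p"
    using y[of p] x[of "p - 1"] dyck_x[OF dP, of "p - 1" p] that pm by auto
  have "dyck_at Q i' m (m - p)"
    unfolding dyck_at_def
  proof (intro conjI allI impI)
    fix q assume q: "q < m"
    have "Q (i' + q) < Q (i' + (q + 1)) \<longleftrightarrow> pos w' (i + 2 * m - (q + 1)) < pos w' (i + 2 * m - q)"
      using Qx[of q "q + 1"] q by simp
    moreover have "i + 2 * m - (q + 1) = i + m + (m - (q + 1))" "i + 2 * m - q = i + m + (m - (q + 1) + 1)" using q by auto
    ultimately show "Q (i' + q) < Q (i' + q + 1)" using 1[of "m - (q + 1)"] q by simp
  next
    fix q assume q: "1 \<le> q" "q < m"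
    have "Q (i' + (m + q)) < Q (i' + (m + q + 1)) \<longleftrightarrow> pos w' (i + 2 * m - (m + q + 1)) < pos w' (i + 2 * m - (m + q))"
      using Qx[of "m + q" "m + q + 1"] q by simp
    moreover have "i + 2 * m - (m + q + 1) = i + (m - (q + 1))" "i + 2 * m - (m + q) = i + (m - (q + 1) + 1)" using q by auto
    ultimately show "Q (i' + m + q) < Q (i' + m + q + 1)" using 2[of "m - (q + 1)"] q by (simp add: add.assoc)
  next
    fix q assume q: "q < m - p"
    have "Q (i' + (m + 1 + q)) < Q (i' + q) \<longleftrightarrow> pos w' (i + 2 * m - q) < pos w' (i + 2 * m - (m + 1 + q))"
      using Qx[of "m + 1 + q" q] q by simp
    moreover have "i + 2 * m - q = i + m + (m - q)" "i + 2 * m - (m + 1 + q) = i + (m - q - 1)" using q by auto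
    ultimately show "Q (i' + m + 1 + q) < Q (i' + q)" using 3[of "m - q"] q by (simp add: add.assoc)
  next
    fix q assume q: "m - p < q" "q \<le> m"
    have "Q (i' + (m + q)) < Q (i' + q) \<longleftrightarrow> pos w' (i + 2 * m - q) < pos w' (i + 2 * m - (m + q))"
      using Qx[of "m + q" q] q by simp
    moreover have "i + 2 * m - q = i + m + (m - q)" "i + 2 * m - (m + q) = i + (m - q)" using q by auto
    ultimately show "Q (i' + m + q) < Q (i' + q)" using 4[of "m - q"] q pm by (simp add: add.assoc)
  next
    assume "m - p < m"
    then have p0: "0 < p" using pm by simp
    have "Q (i' + (m - p)) < Q (i' + (m + 1 + (m - p))) \<longleftrightarrow> pos w' (i + 2 * m - (m + 1 + (m - p))) < pos w' (i + 2 * m - (m - p))"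
      using Qx[of "m - p" "m + 1 + (m - p)"] p0 pm by simp
    moreover have "i + 2 * m - (m - p) = i + m + p" "i + 2 * m - (m + 1 + (m - p)) = i + (p - 1)" using p0 pm by auto
    ultimately show "Q (i' + (m - p)) < Q (i' + m + 1 + (m - p))" using 5 p0 by (simp add: add.assoc)
  qed (use pm in auto)
  \<comment> \<open>The inverse cycle lowers one letter; conjugated by the complement, it raises one
    letter again.\<close>
  moreover have "rc N w = map (sg (i' + (m - p)) (i' + m + (m - p))) (rc N w')"
  proof -
    have "N + 1 - x = sg (i' + (m - p)) (i' + m + (m - p)) (N + 1 - sg ?a ?b x)" if "x \<in> {1..N}" for x
      using that i pm unfolding sg_def i'_def by auto
    then show ?thesis unfolding rc_def w'_def using w(2) by (auto simp: rev_map)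
  qed
  ultimately show ?thesis unfolding edgew_def Q_def i'_def by blast
qed

section \<open>Dyck patterns and the insertion tableau\<close>

lemma row_insert_ne: "[] \<notin> set T \<Longrightarrow> [] \<notin> set (row_insert x T)"
proof (induction T arbitrary: x)
  case (Cons r rs)
  show ?case
  proof (cases r x rule: bump_cases)
    case 1 then show ?thesis using Cons.prems unfolding row_insert_append[OF 1] by auto
  next
    case (2 p y q)
    show ?thesis using Cons unfolding 2(1) row_insert_bump[OF 2(2,3)] by auto
  qed
qed simp

lemma rsk_P_ne: "[] \<notin> set (rsk_P w)"
  by (induction w rule: rev_induct) (auto simp: rsk_P_def row_insert_ne)

lemma semistandard_below:
  assumes "semistandard T" "x \<in> set (T ! Suc \<rho>)" "Suc \<rho> < length T"
  shows "\<exists>z\<in>set (T ! \<rho>). z < x"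
proof -
  obtain j where "j < length (T ! Suc \<rho>)" "T ! Suc \<rho> ! j = x" using assms(2) by (auto simp: in_set_conv_nth)
  then have "j < length (T ! \<rho>) \<and> T ! \<rho> ! j < x" using assms(1,3) unfolding semistandard_def by blast
  then show ?thesis using nth_mem by blast
qed

lemma pos_upt: "x \<in> {a..<b} \<Longrightarrow> pos [a..<b] x = x - a"
proof (induction "b - a" arbitrary: a)
  case (Suc n)
  then have "[a..<b] = a # [Suc a..<b]" by (simp add: upt_rec)
  then show ?case using Suc by (auto simp: pos_Cons)
qed simp

text \<open>The pattern is invariant under Knuth moves, so it can be tested on the reading word of
  \<open>rsk_P u\<close> itself. There it fixes the rows: the least letter \<open>i\<close> lies at
  the bottom, the further \<open>1\<close>s can only go weakly down from it, and each
  \<open>2\<close> is read before a \<open>1\<close> and so lies above row 0.\<close>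

lemma rsk_dyck:
  assumes u: "distinct u" "set u = {i..i + 2 * m}" and m: "1 \<le> m"
  shows "rsk_P u = [[i..<i + m + 1], [i + m + 1..<i + 2 * m + 1]] \<longleftrightarrow> dyck (pos u) i m"
proof -
  let ?T = "rsk_P u"
  have eq: "dyck (pos u) i m \<longleftrightarrow> dyck (pos (row ?T)) i m"
    using keq_dyck[OF keq_rsk_P[OF u(1)] u(1)] u(2) by simp
  show ?thesis
  proof
    assume "?T = [[i..<i + m + 1], [i + m + 1..<i + 2 * m + 1]]"
    then have row: "row ?T = [i + m + 1..<i + 2 * m + 1] @ [i..<i + m + 1]" by (simp add: row_def)
    have "pos (row ?T) x = (if x \<le> i + m then m + (x - i) else x - (i + m + 1))" if "i \<le> x" "x \<le> i + 2 * m" for x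
      unfolding row pos_append using that by (auto simp: pos_upt)
    then have "dyck (pos (row ?T)) i m" unfolding dyck_def using m by auto
    then show "dyck (pos u) i m" using eq by simp
  next
    assume "dyck (pos u) i m"
    then have d: "dyck (pos (row ?T)) i m" using eq by simp
    let ?r = "row_index ?T"
    have sT: "set (concat ?T) = {i..i + 2 * m}" "distinct (concat ?T)"
      using set_rsk_P distinct_rsk_P u by auto
    have rel: "pos (row ?T) x < pos (row ?T) y \<longleftrightarrow> rel_of ?r x y" if "x \<in> {i..i + 2 * m}" "y \<in> {i..i + 2 * m}" for x y
    proof -
      have "distinct (row ?T)" "set (row ?T) = {i..i + 2 * m}" using sT distinct_row set_row by auto
      then show ?thesis using bef_pos[of "row ?T" x y] bef_rsk_P[OF u(1), of x y] u(2) that by simp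
    qed
    have props: "?r x < length ?T" "x \<in> set (?T ! ?r x)" if "x \<in> {i..i + 2 * m}" for x
    proof -
      have "x \<in> set (concat ?T)" unfolding sT(1) using that .
      then show "?r x < length ?T" "x \<in> set (?T ! ?r x)" using row_index_props by blast+
    qed
    have in_row: "x \<in> {i..i + 2 * m} \<and> ?r x = \<rho>" if "x \<in> set (?T ! \<rho>)" "\<rho> < length ?T" for x \<rho>
      using row_index_eq[OF sT(2) that(2,1)] that sT(1) nth_mem[OF that(2)] by auto
    have below: "\<exists>z. z \<in> {i..i + 2 * m} \<and> z < x \<and> ?r z = \<rho>" if "x \<in> {i..i + 2 * m}" "?r x = Suc \<rho>" for x \<rho>
      using semistandard_below[OF semistandard_rsk_P, of x u \<rho>] props[OF that(1)] that(2) in_row[of _ \<rho>] by fastforce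
    have r0: "?r (i + q) = 0" if "q \<le> m" for q
      using that
    proof (induction q)
      case 0
      show ?case
      proof (cases "?r i")
        case (Suc \<rho>) then show ?thesis using below[of i \<rho>] by auto
      qed simp
    next
      case (Suc q)
      have "rel_of ?r (i + q) (i + q + 1)" using d Suc.prems rel[of "i + q" "i + q + 1"] unfolding dyck_def by auto
      then show ?case using Suc unfolding rel_of_def by auto
    qed
    have r1: "?r (i + m + q) \<noteq> 0" if "1 \<le> q" "q \<le> m" for q
      using dyck_yx[OF d that] rel[of "i + m + q" "i + q"] that unfolding rel_of_def by auto
    have r2: "?r (i + m + 1 + q) = 1" if "q < m" for q
      using that
    proof (induction q)
      case 0
      show ?case
      proof (rule ccontr)
        \<comment> \<open>In a higher row, \<open>i+m+1\<close> would have a smaller letter below it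
          outside row 0, but all smaller letters are \<open>1\<close>s.\<close>
        assume "?r (i + m + 1 + 0) \<noteq> 1"
        then obtain \<rho> where "?r (i + m + 1) = Suc (Suc \<rho>)" using r1[of 1] m by (cases "?r (i + m + 1)"; cases "?r (i + m + 1) - 1") auto
        then obtain z where z: "z \<in> {i..i + 2 * m}" "z < i + m + 1" "?r z = Suc \<rho>" using below[of "i + m + 1" "Suc \<rho>"] m by auto
        then have "z - i \<le> m" "i + (z - i) = z" by auto
        then show False using r0[of "z - i"] z by simp
      qed
    next
      case (Suc q)
      have "rel_of ?r (i + m + (q + 1)) (i + m + (q + 1) + 1)"
        using d Suc.prems rel[of "i + m + (q + 1)" "i + m + (q + 1) + 1"] unfolding dyck_def by auto
      then have "?r (i + m + (q + 1) + 1) \<le> ?r (i + m + (q + 1))" unfolding rel_of_def by auto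
      moreover have e: "i + m + (q + 1) + 1 = i + m + 1 + Suc q" "i + m + (q + 1) = i + m + 1 + q"
        "i + m + Suc (Suc q) = i + m + 1 + Suc q" by auto
      ultimately have "?r (i + m + 1 + Suc q) \<le> ?r (i + m + 1 + q)" by (simp only: e)
      moreover have "?r (i + m + 1 + q) = 1" using Suc by simp
      moreover have "?r (i + m + 1 + Suc q) \<noteq> 0" using r1[of "Suc (Suc q)"] Suc.prems unfolding e by simp
      ultimately show ?case by linarith
    qed
    have cases: "?r x = (if x \<le> i + m then 0 else 1)" if "x \<in> {i..i + 2 * m}" for x
      using that r0[of "x - i"] r2[of "x - i - m - 1"] by auto
    \<comment> \<open>A third row would be empty, and insertion never creates an empty row.\<close>
    have len: "length ?T = 2"
    proof -
      have "1 < length ?T" using props(1)[of "i + 2 * m"] cases[of "i + 2 * m"] m by auto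
      moreover have "\<not> 2 < length ?T"
      proof
        assume l: "2 < length ?T"
        then have "?T ! 2 \<noteq> []" using rsk_P_ne[of u] nth_mem[OF l] by metis
        then obtain x where "x \<in> set (?T ! 2)" by (cases "?T ! 2") auto
        then have "x \<in> {i..i + 2 * m} \<and> ?r x = 2" using in_row l by blast
        then show False using cases[of x] by (auto split: if_splits)
      qed
      ultimately show ?thesis by simp
    qed
    have rows: "set (?T ! \<rho>) = {x \<in> {i..i + 2 * m}. ?r x = \<rho>}" if "\<rho> < 2" for \<rho>
      using in_row[of _ \<rho>] props(2) that len by auto
    have "{x \<in> {i..i + 2 * m}. ?r x = 0} = {x \<in> {i..i + 2 * m}. x \<le> i + m}"
      "{x \<in> {i..i + 2 * m}. ?r x = 1} = {x \<in> {i..i + 2 * m}. \<not> x \<le> i + m}"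
      using cases by (auto split: if_splits)
    note c1 = this
    have c2: "{x \<in> {i..i + 2 * m}. x \<le> i + m} = set [i..<i + m + 1]"
      "{x \<in> {i..i + 2 * m}. \<not> x \<le> i + m} = set [i + m + 1..<i + 2 * m + 1]" by auto
    have z: "(0::nat) < 2" "(1::nat) < 2" by auto
    have s: "set (?T ! 0) = set [i..<i + m + 1]" "set (?T ! 1) = set [i + m + 1..<i + 2 * m + 1]"
      unfolding rows[OF z(1)] rows[OF z(2)] c1 c2 by (rule refl)+
    have sd: "sorted (?T ! \<rho>)" "distinct (?T ! \<rho>)" if "\<rho> < 2" for \<rho>
      using semistandard_rsk_P[of u] sT(2) that len unfolding semistandard_def by (auto simp: distinct_concat_iff)
    have "?T ! 0 = [i..<i + m + 1]" by (rule sorted_distinct_set_unique) (use s sd in auto)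
    moreover have "?T ! 1 = [i + m + 1..<i + 2 * m + 1]" by (rule sorted_distinct_set_unique) (use s sd in auto)
    ultimately show "?T = [[i..<i + m + 1], [i + m + 1..<i + 2 * m + 1]]"
      using len by (intro nth_equalityI) (auto simp: less_2_cases_iff nth_Cons split: nat.split)
  qed
qed

subsection \<open>Bracketing and standardization\<close>

text \<open>The state of the scan in \<open>unbracketed\<close> after a word. The truncated
  \<open>c - 1\<close> covers both a \<open>j\<close> that closes a bracket and one that remains
  unbracketed.\<close>

fun open_count :: "nat \<Rightarrow> nat list \<Rightarrow> nat \<Rightarrow> nat" where
  "open_count j [] c = c"
| "open_count j (x # xs) c = open_count j xs (if x = Suc j then Suc c else if x = j then c - 1 else c)"

lemma unbracketed_append:
  "unbracketed j (u @ v) p c = unbracketed j u p c @ unbracketed j v (p + length u) (open_count j u c)"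
  by (induction u arbitrary: p c) auto

lemma unbracketed_Nil_iff:
  "unbracketed j w p c = [] \<longleftrightarrow>
   (\<forall>k. count_list (take k w) j \<le> c + count_list (take k w) (Suc j))"
proof (induction w arbitrary: p c)
  case (Cons x w)
  have all: "(\<forall>k. Q k) \<longleftrightarrow> Q 0 \<and> (\<forall>k. Q (Suc k))" for Q :: "nat \<Rightarrow> bool"
    by (metis not0_implies_Suc)
  have E: "(\<forall>k. count_list (take k (x # w)) j \<le> c + count_list (take k (x # w)) (Suc j)) \<longleftrightarrow>
    (\<forall>k. count_list (x # take k w) j \<le> c + count_list (x # take k w) (Suc j))"
    by (subst all) simp
  consider "x = Suc j" | "x = j" "0 < c" | "x = j" "c = 0" | "x \<noteq> j" "x \<noteq> Suc j" by blast
  then show ?case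
  proof cases
    case 2
    then obtain d where "c = Suc d" by (cases c) auto
    then show ?thesis unfolding E using 2 Cons.IH[of "Suc p" d] by simp
  next
    case 3
    have "\<not> (\<forall>k. count_list (x # take k w) j \<le> c + count_list (x # take k w) (Suc j))"
      using 3 by (intro notI) (drule spec[of _ 0], simp)
    then show ?thesis unfolding E using 3 by simp
  qed (use E Cons.IH in auto)
qed simp

text \<open>A suffix with more letters \<open>j+1\<close> than \<open>j\<close> leaves one of them
  open. The first clause is this count for the whole word together with the \<open>c\<close>
  brackets that were open before it.\<close>

lemma open_count_0_iff:
  "open_count j w c = 0 \<longleftrightarrow> c + count_list w (Suc j) \<le> count_list w j \<and>
   (\<forall>k. count_list (drop k w) (Suc j) \<le> count_list (drop k w) j)"
proof (induction w arbitrary: c)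
  case (Cons x w)
  have all: "(\<forall>k. Q k) \<longleftrightarrow> Q 0 \<and> (\<forall>k. Q (Suc k))" for Q :: "nat \<Rightarrow> bool"
    by (metis not0_implies_Suc)
  have 0: "\<forall>k. count_list (drop k w) (Suc j) \<le> count_list (drop k w) j \<Longrightarrow> count_list w (Suc j) \<le> count_list w j"
    by (metis drop0)
  show ?case
    by (subst all) (use Cons 0 in auto)
qed simp

lemma unbracketed_last:
  "unbracketed j w p c \<noteq> [] \<Longrightarrow>
   \<exists>u v. w = u @ j # v \<and> last (unbracketed j w p c) = p + length u \<and>
     open_count j u c = 0 \<and> unbracketed j v (Suc (p + length u)) 0 = []"
proof (induction w arbitrary: p c)
  case (Cons x w)
  show ?case
  proof (cases "x = j \<and> c = 0 \<and> unbracketed j w (Suc p) 0 = []")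
    case True
    then show ?thesis by (intro exI[of _ "[]"] exI[of _ w]) auto
  next
    case False
    define c' where "c' = (if x = Suc j then Suc c else if x = j then c - 1 else c)"
    have "unbracketed j (x # w) p c = unbracketed j w (Suc p) c' \<or>
      x = j \<and> c = 0 \<and> unbracketed j (x # w) p c = p # unbracketed j w (Suc p) c'"
      unfolding c'_def by auto
    then have ne: "unbracketed j w (Suc p) c' \<noteq> []" "last (unbracketed j (x # w) p c) = last (unbracketed j w (Suc p) c')"
      using Cons.prems False c'_def by auto
    from Cons.IH[OF ne(1)] obtain u v where uv: "w = u @ j # v"
      "last (unbracketed j w (Suc p) c') = Suc p + length u" "open_count j u c' = 0"
      "unbracketed j v (Suc (Suc p + length u)) 0 = []" by blast
    then show ?thesis using ne(2) by (intro exI[of _ "x # u"] exI[of _ v]) (simp add: c'_def)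
  qed
qed simp

text \<open>The last unbracketed \<open>j\<close> cuts the word so that nothing is open before it
  and no \<open>j\<close> is unbracketed after it. In this form the scan has disappeared: to show
  that a crystal operator acts, or to use that it does, means counting letters in suffixes of
  \<open>u\<close> and prefixes of \<open>v\<close>.\<close>

lemma f_word_iff:
  "f_word j w = Some w' \<longleftrightarrow> (\<exists>u v. w = u @ j # v \<and> w' = u @ Suc j # v \<and>
     (\<forall>k. count_list (drop k u) (Suc j) \<le> count_list (drop k u) j) \<and>
     (\<forall>k. count_list (take k v) j \<le> count_list (take k v) (Suc j)))"
proof
  assume f: "f_word j w = Some w'"
  then have ne: "unbracketed j w 0 0 \<noteq> []" and w': "w' = w[last (unbracketed j w 0 0) := Suc j]"
    unfolding f_word_def by (auto split: list.splits)
  from unbracketed_last[OF ne] obtain u v where uv: "w = u @ j # v" "last (unbracketed j w 0 0) = 0 + length u"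
    "open_count j u 0 = 0" "unbracketed j v (Suc (0 + length u)) 0 = []" by blast
  then have "w' = u @ Suc j # v" using w' by simp
  then show "\<exists>u v. w = u @ j # v \<and> w' = u @ Suc j # v \<and>
     (\<forall>k. count_list (drop k u) (Suc j) \<le> count_list (drop k u) j) \<and>
     (\<forall>k. count_list (take k v) j \<le> count_list (take k v) (Suc j))"
    using uv open_count_0_iff[of j u 0] unbracketed_Nil_iff[of j v _ 0] by auto
next
  assume "\<exists>u v. w = u @ j # v \<and> w' = u @ Suc j # v \<and>
     (\<forall>k. count_list (drop k u) (Suc j) \<le> count_list (drop k u) j) \<and>
     (\<forall>k. count_list (take k v) j \<le> count_list (take k v) (Suc j))"
  then obtain u v where uv: "w = u @ j # v" "w' = u @ Suc j # v"
     and k: "\<forall>k. count_list (drop k u) (Suc j) \<le> count_list (drop k u) j"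
     "\<forall>k. count_list (take k v) j \<le> count_list (take k v) (Suc j)" by blast
  have "open_count j u 0 = 0" using open_count_0_iff[of j u 0] k(1) k(1)[rule_format, of 0] by simp
  moreover have "unbracketed j v (Suc (length u)) 0 = []" using unbracketed_Nil_iff k(2) by simp
  ultimately have "unbracketed j w 0 0 = unbracketed j u 0 0 @ [length u]"
    unfolding uv by (simp add: unbracketed_append)
  then have l: "unbracketed j w 0 0 \<noteq> []" "last (unbracketed j w 0 0) = length u" by auto
  then have "f_word j w = Some (w[last (unbracketed j w 0 0) := Suc j])"
    unfolding f_word_def by (cases "unbracketed j w 0 0") simp_all
  moreover have "w[length u := Suc j] = w'" using uv by simp
  ultimately show "f_word j w = Some w'" using l(2) by simp
qed

section \<open>Standardization of collapsed words\<close>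

lemma split_lens_concat: "split_lens (map length xs) (concat xs) = xs"
  by (induction xs) auto

lemma refill_map: "refill T (map f (row T)) = map (map f) T"
proof -
  have "map f (row T) = concat (map (map f) (rev T))" by (simp add: row_def map_concat)
  moreover have "rev (map length T) = map length (map (map f) (rev T))" by (simp add: rev_map comp_def)
  ultimately have "refill T (map f (row T)) = rev (map (map f) (rev T))"
    unfolding refill_def using split_lens_concat by metis
  then show ?thesis by (simp add: rev_map)
qed

lemma refill_cong: "map length T = map length S \<Longrightarrow> refill T w = refill S w"
  by (simp add: refill_def)

lemma row_map: "row (map (map f) T) = map f (row T)"
  by (simp add: row_def map_concat rev_map)

text \<open>A letter of a permutation of \<open>1, ..., n\<close> is the number of letters not
  exceeding it, and \<open>std_word\<close> counts just the positions that come no later when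
  ordered by letter, then by place.\<close>

lemma std_word_eqI:
  assumes "distinct u" "set u = {1..length u}" "length v = length u"
    and o: "\<And>p q. p < length u \<Longrightarrow> q < length u \<Longrightarrow> u ! p < u ! q \<longleftrightarrow> v ! p < v ! q \<or> v ! p = v ! q \<and> p < q"
  shows "std_word v = u"
proof (rule nth_equalityI)
  show "length (std_word v) = length u" using assms(3) by (simp add: std_word_def)
  fix p assume "p < length (std_word v)"
  then have p: "p < length v" "p < length u" using assms(3) by (auto simp: std_word_def)
  have "std_word v ! p = card {q. q < length v \<and> v ! q < v ! p} +
     card {q. q < length (take (Suc p) v) \<and> take (Suc p) v ! q = v ! p}"
    using p unfolding std_word_def by (simp only: length_filter_conv_card length_map nth_map nth_upt length_upt) simp
  also have "{q. q < length (take (Suc p) v) \<and> take (Suc p) v ! q = v ! p} = {q. q \<le> p \<and> v ! q = v ! p}"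
    using p by auto
  also have "card {q. q < length v \<and> v ! q < v ! p} + card {q. q \<le> p \<and> v ! q = v ! p} =
     card ({q. q < length v \<and> v ! q < v ! p} \<union> {q. q \<le> p \<and> v ! q = v ! p})"
    by (rule card_Un_disjoint[symmetric]) auto
  also have "{q. q < length v \<and> v ! q < v ! p} \<union> {q. q \<le> p \<and> v ! q = v ! p} = {q. q < length u \<and> u ! q \<le> u ! p}"
  proof (intro set_eqI iffI)
    fix q assume "q \<in> {q. q < length v \<and> v ! q < v ! p} \<union> {q. q \<le> p \<and> v ! q = v ! p}"
    then show "q \<in> {q. q < length u \<and> u ! q \<le> u ! p}"
      using p o[of q p] assms(3) by (cases "q = p") auto
  next
    fix q assume q: "q \<in> {q. q < length u \<and> u ! q \<le> u ! p}"
    then have "q = p \<or> u ! q < u ! p" using p nth_eq_iff_index_eq[OF assms(1), of q p] by auto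
    then show "q \<in> {q. q < length v \<and> v ! q < v ! p} \<union> {q. q \<le> p \<and> v ! q = v ! p}"
      using p o[of q p] assms(3) q by auto
  qed
  also have "card {q. q < length u \<and> u ! q \<le> u ! p} = card ((!) u ` {q. q < length u \<and> u ! q \<le> u ! p})"
    by (rule card_image[symmetric]) (auto simp: inj_on_def nth_eq_iff_index_eq[OF assms(1)])
  also have "(!) u ` {q. q < length u \<and> u ! q \<le> u ! p} = {x \<in> set u. x \<le> u ! p}"
    by (auto simp: in_set_conv_nth)
  also have "\<dots> = {1..u ! p}"
  proof -
    have "u ! p \<in> {1..length u}" using p assms(2) nth_mem by blast
    then show ?thesis unfolding assms(2) by auto
  qed
  finally show "std_word v ! p = u ! p" by simp
qed

text \<open>The collapsed letters before and after the crystal operator has been applied.\<close>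
definition cl :: "nat \<Rightarrow> nat \<Rightarrow> nat \<Rightarrow> nat" where
  "cl i m x = (if i \<le> x \<and> x \<le> i + m then i else if i + m < x \<and> x \<le> i + 2 * m then Suc i else x)"

definition cl' :: "nat \<Rightarrow> nat \<Rightarrow> nat \<Rightarrow> nat \<Rightarrow> nat" where
  "cl' i m p x = (if x = i + p then Suc i else cl i m x)"

text \<open>Letters other than \<open>i+p\<close> keep their order, because within a collapsed class
  they are read in increasing order. Comparisons with \<open>i+p\<close> use the bracketing. This is
  how standardizing after the crystal operator becomes a cycle.\<close>

lemma sg_order_less:
  assumes d: "dyck_at P i m p" and xy: "x < y"
  shows "sg (i + p) (i + m + p) x < sg (i + p) (i + m + p) y \<longleftrightarrow>
    cl' i m p x < cl' i m p y \<or> cl' i m p x = cl' i m p y \<and> P x < P y"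
proof -
  note D = d[unfolded dyck_at_def]
  note dP = dyck_at_dyck[OF d]
  have m: "1 \<le> m" "p \<le> m" using D by auto
  have X: "P x < P y" if "i \<le> x" "y \<le> i + m"
  proof -
    have "P (i + (x - i)) < P (i + (y - i))" by (rule dyck_x[OF dP]) (use that xy in auto)
    then show ?thesis using that xy by simp
  qed
  have Y: "P x < P y" if "i + m < x" "y \<le> i + 2 * m"
  proof -
    have "P (i + m + (x - (i + m))) < P (i + m + (y - (i + m)))" by (rule dyck_y[OF dP]) (use that xy in auto)
    then show ?thesis using that xy by simp
  qed
  \<comment> \<open>Among the \<open>2\<close>s, the letter \<open>i+p\<close> comes directly behind
    \<open>i+m+1, ..., i+m+p\<close> by facts \<open>Z\<close> and \<open>W\<close>. As there are
    now only \<open>m\<close> letters \<open>1\<close>, the numbers of the \<open>2\<close>s start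
    at \<open>i+m\<close>, and it receives \<open>i+m+p\<close>.\<close>
  have Z: "P (i + m + q) < P (i + p)" if q: "1 \<le> q" "q \<le> p" for q
  proof -
    obtain t where t: "q = Suc t" using q(1) by (cases q) auto
    then have "P (i + m + 1 + t) < P (i + t)" using D q by auto
    moreover have "P (i + t) < P (i + p)" using dyck_x[OF dP, of t p] q m t by simp
    ultimately show ?thesis using t by simp
  qed
  have W: "P (i + p) < P (i + m + q)" if "p < q" "q \<le> m" for q
  proof -
    have "P (i + p) < P (i + m + (p + 1))" using D that by auto
    also have "\<dots> \<le> P (i + m + q)" using dyck_y[OF dP, of "p + 1" q] that by (cases "p + 1 = q") auto
    finally show ?thesis .
  qed
  consider "x = i + p" | "y = i + p" | "x \<noteq> i + p" "y \<noteq> i + p" by blast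
  then show ?thesis
  proof cases
    case 1
    consider "y \<le> i + m" | "i + m < y" "y \<le> i + m + p" | "i + m + p < y" "y \<le> i + 2 * m" | "i + 2 * m < y" by linarith
    then show ?thesis
    proof cases
      case 2
      then have "P y < P x" using Z[of "y - (i + m)"] 1 xy by simp
      then show ?thesis using 1 2 m xy by (auto simp: sg_def cl'_def cl_def)
    next
      case 3
      then have "P x < P y" using W[of "y - (i + m)"] 1 xy by simp
      then show ?thesis using 1 3 m xy by (auto simp: sg_def cl'_def cl_def)
    qed (use 1 m xy in \<open>auto simp: sg_def cl'_def cl_def\<close>)
  next
    case 2
    then show ?thesis using m xy by (auto simp: sg_def cl'_def cl_def)
  next
    case 3
    have s: "sg (i + p) (i + m + p) x < sg (i + p) (i + m + p) y" using 3 xy by (auto simp: sg_def)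
    have "cl' i m p x \<le> cl' i m p y" using 3 xy m by (auto simp: cl'_def cl_def)
    moreover have "P x < P y" if "cl' i m p x = cl' i m p y"
    proof (rule ccontr)
      assume n: "\<not> P x < P y"
      then have "\<not> (i \<le> x \<and> y \<le> i + m)" "\<not> (i + m < x \<and> y \<le> i + 2 * m)" using X Y by blast+
      then show False using that 3 xy m by (auto simp: cl'_def cl_def split: if_splits)
    qed
    ultimately show ?thesis using s by auto
  qed
qed

lemma sg_order:
  assumes d: "dyck_at P i m p" and xy: "x \<noteq> y" "P x \<noteq> P y"
  shows "sg (i + p) (i + m + p) x < sg (i + p) (i + m + p) y \<longleftrightarrow>
    cl' i m p x < cl' i m p y \<or> cl' i m p x = cl' i m p y \<and> P x < P y"
proof (cases "x < y")
  case True then show ?thesis using sg_order_less[OF d] by blast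
next
  case False
  then have "y < x" using xy by simp
  from sg_order_less[OF d this] have "sg (i + p) (i + m + p) y < sg (i + p) (i + m + p) x \<longleftrightarrow>
    cl' i m p y < cl' i m p x \<or> cl' i m p y = cl' i m p x \<and> P y < P x" .
  moreover have "sg (i + p) (i + m + p) y \<noteq> sg (i + p) (i + m + p) x"
    using sg_inj[of "i + p" "i + m + p" UNIV] xy(1) by (auto simp: inj_on_def)
  ultimately show ?thesis using xy(2) by linarith
qed

lemma std_word_cl':
  assumes d: "dyck_at (pos w) i m p" and w: "distinct w" "set w = {1..length w}" "1 \<le> i" "i + 2 * m \<le> length w"
  shows "std_word (map (cl' i m p) w) = map (sg (i + p) (i + m + p)) w"
proof (rule std_word_eqI)
  let ?s = "sg (i + p) (i + m + p)"
  have m: "p \<le> m" using d by (simp add: dyck_at_def)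
  show "distinct (map ?s w)" using w(1) sg_inj[of "i + p" "i + m + p"] by (simp add: distinct_map)
  show "set (map ?s w) = {1..length (map ?s w)}"
    using sg_image[of "i + p" "i + m + p" "{1..length w}"] w m by simp
  fix k l assume kl: "k < length (map ?s w)" "l < length (map ?s w)"
  have pk: "pos w (w ! k) = k" if "k < length w" for k
    using w(1) that
  proof (induction w arbitrary: k)
    case (Cons z w) then show ?case by (cases k) (auto simp: pos_Cons)
  qed simp
  show "map ?s w ! k < map ?s w ! l \<longleftrightarrow> map (cl' i m p) w ! k < map (cl' i m p) w ! l \<or>
     map (cl' i m p) w ! k = map (cl' i m p) w ! l \<and> k < l"
  proof (cases "k = l")
    case False
    then have "w ! k \<noteq> w ! l" using kl nth_eq_iff_index_eq[OF w(1)] by simp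
    moreover have "pos w (w ! k) \<noteq> pos w (w ! l)" using pk kl False by simp
    ultimately show ?thesis using sg_order[OF d, of "w ! k" "w ! l"] pk kl by simp
  qed simp
qed simp

lemma count_list_map_card:
  "distinct u \<Longrightarrow> count_list (map g u) y = card {x \<in> set u. g x = y}"
proof (induction u)
  case (Cons z u)
  have "{x \<in> set (z # u). g x = y} = (if g z = y then {z} else {}) \<union> {x \<in> set u. g x = y}" by auto
  then show ?case using Cons by (auto simp: card_insert_if)
qed simp

text \<open>Collapsing the letters by \<open>g\<close> may create letters \<open>j\<close> and \<open>j+1\<close> outside \<open>[i, i+2m]\<close>,
  as long as they do not lie on the wrong side of the unbracketed letter \<open>i+p\<close>.\<close>
lemma f_word_collapse:
  assumes d: "dyck_at (pos w) i m p" and w: "distinct w" "{i..i + 2 * m} \<subseteq> set w"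
    and gx: "\<And>x. i \<le> x \<Longrightarrow> x \<le> i + m \<Longrightarrow> g x = j"
    and gy: "\<And>x. i + m < x \<Longrightarrow> x \<le> i + 2 * m \<Longrightarrow> g x = Suc j"
    and gx': "\<And>x. x \<in> set w \<Longrightarrow> g x = j \<Longrightarrow> x \<le> i + m \<and> (x < i \<longrightarrow> pos w x < pos w (i + p))"
    and gy': "\<And>x. x \<in> set w \<Longrightarrow> g x = Suc j \<Longrightarrow> i + m < x \<and> (i + 2 * m < x \<longrightarrow> pos w (i + p) < pos w x)"
  shows "f_word j (map g w) = Some (map (g(i + p := Suc j)) w)"
proof -
  note D = d[unfolded dyck_at_def]
  note dP = dyck_at_dyck[OF d]
  have m: "1 \<le> m" "p \<le> m" using D by auto
  have "i + p \<in> set w" using w(2) m by auto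
  then obtain u v where uv: "w = u @ (i + p) # v" by (meson split_list)
  have du: "distinct u" "distinct v" "i + p \<notin> set u" "i + p \<notin> set v" using w(1) uv by auto
  have pu: "x \<in> set u \<longleftrightarrow> pos w x < pos w (i + p)" for x
    using uv du pos_less[of x u] by (auto simp: pos_append pos_Cons)
  have pv: "x \<in> set v" if "x \<in> set w" "pos w (i + p) < pos w x" for x
  proof -
    have "x \<notin> set u" using pu that by simp
    then show ?thesis using that uv by auto
  qed
  have suw: "set u \<subseteq> set w" "set v \<subseteq> set w" using uv by auto
  have 1: "count_list (drop k (map g u)) (Suc j) \<le> count_list (drop k (map g u)) j" for k
  proof -
    define s where "s = drop k u"
    have sw: "u = take k u @ s" by (simp add: s_def)
    have ds: "distinct s" using du s_def by simp
    have sub: "set s \<subseteq> set u" unfolding s_def by (rule set_drop_subset)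
    have "card {x \<in> set s. g x = Suc j} \<le> card {x \<in> set s. g x = j}"
    \<comment> \<open>Before \<open>i+p\<close>, a \<open>2\<close> is matched with the
      \<open>1\<close> of the same rank. This stands further right, but still before
      \<open>i+p\<close>, and so belongs to the same suffix.\<close>
    proof (rule card_inj_on_le[of "\<lambda>x. x - m - 1"])
      show "(\<lambda>x. x - m - 1) ` {x \<in> set s. g x = Suc j} \<subseteq> {x \<in> set s. g x = j}"
      proof (rule image_subsetI)
        fix x assume "x \<in> {x \<in> set s. g x = Suc j}"
        then have xs: "x \<in> set s" "g x = Suc j" by auto
        then have x: "x \<in> set s" "i + m < x" "x \<le> i + 2 * m"
          using gy'[of x] pu[of x] sub suw by (auto dest!: subsetD)
        define q where "q = x - (i + m + 1)"
        have q: "x = i + m + 1 + q" "q < m" using x unfolding q_def by auto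
        have xu: "pos w x < pos w (i + p)" using pu x(1) sw by (metis Un_iff set_append)
        have "q < p"
        proof (rule ccontr)
          assume "\<not> q < p"
          then have "pos w (i + m + (p + 1)) \<le> pos w (i + m + (q + 1))"
            using dyck_y[OF dP, of "p + 1" "q + 1"] q by (cases "p = q") auto
          moreover have "pos w (i + p) < pos w (i + m + 1 + p)" using D \<open>\<not> q < p\<close> q by auto
          ultimately show False using xu q by simp
        qed
        then have b: "pos w x < pos w (i + q)" "pos w (i + q) < pos w (i + p)"
          using D q dyck_x[OF dP, of q p] m by auto
        have iu: "i + q \<in> set u" using b pu by simp
        have "i + q \<in> set s"
        proof (rule ccontr)
          assume "i + q \<notin> set s"
          then have t: "i + q \<in> set (take k u)" using iu sw by (metis Un_iff set_append)
          have w2: "w = take k u @ (s @ (i + p) # v)" using uv sw by (metis append_assoc)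
          have "x \<notin> set (take k u)" using x(1) du(1) sw by (metis disjoint_iff distinct_append)
          then have "length (take k u) \<le> pos w x" unfolding w2 pos_append by (simp del: length_take)
          moreover have "pos w (i + q) < length (take k u)"
            using t pos_less[OF t] unfolding w2 pos_append by (simp del: length_take)
          ultimately show False using b(1) by linarith
        qed
        then have "x - m - 1 \<in> set s" using q by simp
        moreover have "g (x - m - 1) = j" by (rule gx) (use q in auto)
        ultimately show "x - m - 1 \<in> {x \<in> set s. g x = j}" by simp
      qed
      show "inj_on (\<lambda>x. x - m - 1) {x \<in> set s. g x = Suc j}"
      proof (rule inj_onI)
        fix x y assume xy: "x \<in> {x \<in> set s. g x = Suc j}" "y \<in> {x \<in> set s. g x = Suc j}" "x - m - 1 = y - m - 1"
        then have "x \<in> set w" "y \<in> set w" using sub suw by auto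
        then have "i + m < x" "i + m < y" using gy' xy by auto
        then show "x = y" using xy(3) by simp
      qed
    qed simp
    then show ?thesis
      unfolding drop_map s_def[symmetric] count_list_map_card[OF ds] .
  qed
  have 2: "count_list (take k (map g v)) j \<le> count_list (take k (map g v)) (Suc j)" for k
  proof -
    define s where "s = take k v"
    have sw: "v = s @ drop k v" by (simp add: s_def)
    have ds: "distinct s" using du s_def by simp
    have "card {x \<in> set s. g x = j} \<le> card {x \<in> set s. g x = Suc j}"
    \<comment> \<open>After \<open>i+p\<close>, a \<open>1\<close> is matched with the
      \<open>2\<close> of the preceding rank. This stands further left, but still after
      \<open>i+p\<close>, and so belongs to the same prefix.\<close>
    proof (rule card_inj_on_le[of "\<lambda>x. x + m"])
      show "(\<lambda>x. x + m) ` {x \<in> set s. g x = j} \<subseteq> {x \<in> set s. g x = Suc j}"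
      proof (rule image_subsetI)
        fix x assume "x \<in> {x \<in> set s. g x = j}"
        then have xs: "x \<in> set s" "g x = j" by auto
        have xv: "x \<in> set v" using xs(1) sw by (metis Un_iff set_append)
        then have "x \<notin> set u" "x \<in> set w" using du w(1) uv by auto
        then have x: "x \<in> set s" "i \<le> x" "x \<le> i + m"
          using xs gx'[of x] pu[of x] by auto
        define q where "q = x - i"
        have q: "x = i + q" "q \<le> m" using x unfolding q_def by auto
        have ne: "x \<noteq> i + p" "x \<notin> set u" using xv du w(1) uv by auto
        then have "pos w (i + p) < pos w x" using pu[of x] pos_inj[of w] xv uv
          by (metis Un_iff inj_onD list.set_intros(1,2) linorder_neqE_nat set_append)
        then have "\<not> q \<le> p" using dyck_x[OF dP, of q p] q m ne by (cases "q = p") auto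
        then have b: "pos w (i + m + q) < pos w x" "pos w (i + p) < pos w (i + m + q)"
          using D q dyck_y[OF dP, of "p + 1" q] by (auto, cases "p + 1 = q", auto)
        have "i + m + q \<in> set w" by (rule subsetD[OF w(2)]) (use q in auto)
        then have iv: "i + m + q \<in> set v" using pv b by blast
        have "i + m + q \<in> set s"
        proof (rule ccontr)
          assume n: "i + m + q \<notin> set s"
          have w2: "w = (u @ [i + p]) @ s @ drop k v" using uv sw by simp
          have "i + m + q \<noteq> i + p" using b(2) by (metis less_irrefl)
          then have nu: "i + m + q \<notin> set (u @ [i + p])" "x \<notin> set (u @ [i + p])"
            using iv xv w(1) unfolding uv by auto
          have "pos w x < length (u @ [i + p]) + length s" using nu x(1) pos_less[OF x(1)] unfolding w2 pos_append by simp
          moreover have "length (u @ [i + p]) + length s \<le> pos w (i + m + q)" using nu n unfolding w2 pos_append by simp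
          ultimately show False using b by simp
        qed
        then have "x + m \<in> set s" using q by (simp add: add.commute add.left_commute)
        moreover have "g (x + m) = Suc j" by (rule gy) (use q \<open>\<not> q \<le> p\<close> in auto)
        ultimately show "x + m \<in> {x \<in> set s. g x = Suc j}" by simp
      qed
    qed (auto simp: inj_on_def)
    then show ?thesis
      unfolding take_map s_def[symmetric] count_list_map_card[OF ds] .
  qed
  have "map g w = map g u @ j # map g v" using uv m gx[of "i + p"] by simp
  moreover have "map (g(i + p := Suc j)) w = map g u @ Suc j # map g v"
    using uv du by auto
  ultimately show ?thesis unfolding f_word_iff using 1 2 by blast
qed

lemma f_word_cl:
  assumes d: "dyck_at (pos w) i m p" and w: "distinct w" "{i..i + 2 * m} \<subseteq> set w"
  shows "f_word i (map (cl i m) w) = Some (map (cl' i m p) w)"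
proof -
  have "1 \<le> m" using d unfolding dyck_at_def by simp
  then have "f_word i (map (cl i m) w) = Some (map ((cl i m)(i + p := Suc i)) w)"
    by (intro f_word_collapse[OF d w]) (auto simp: cl_def split: if_splits)
  moreover have "(cl i m)(i + p := Suc i) = cl' i m p" by (auto simp: cl'_def)
  ultimately show ?thesis by simp
qed

subsection \<open>Edges of the crystal skeleton\<close>

lemma pos_row:
  assumes "T \<in> SYT lam" "x \<in> {1..sum_list lam}" "y \<in> {1..sum_list lam}"
  shows "pos (row T) x < pos (row T) y \<longleftrightarrow> rel_of (row_index T) x y"
proof -
  have "distinct (row T)" "set (row T) = {1..sum_list lam}"
    using SYT_basic[OF assms(1)] distinct_row[of T] set_row[of T] by blast+
  then show ?thesis using bef_pos[of "row T" x y] bef_row_SYT[OF assms] assms by auto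
qed

text \<open>\<open>dyck_at\<close> for a reading word: of two letters the smaller is read first just
  if the larger does not lie in a higher row.\<close>

definition edr :: "(nat \<Rightarrow> nat) \<Rightarrow> nat \<Rightarrow> nat \<Rightarrow> nat \<Rightarrow> bool" where
  "edr r i m p \<longleftrightarrow> 1 \<le> m \<and> p \<le> m \<and> (\<forall>q<m. r (i + q + 1) \<le> r (i + q)) \<and>
     (\<forall>q. 1 \<le> q \<longrightarrow> q < m \<longrightarrow> r (i + m + q + 1) \<le> r (i + m + q)) \<and>
     (\<forall>q<p. r (i + q) < r (i + m + 1 + q)) \<and>
     (\<forall>q. p < q \<longrightarrow> q \<le> m \<longrightarrow> r (i + q) < r (i + m + q)) \<and>
     (p < m \<longrightarrow> r (i + m + 1 + p) \<le> r (i + p))"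

lemma rel_of_up: "x < y \<Longrightarrow> rel_of r x y \<longleftrightarrow> r y \<le> r x"
  and rel_of_down: "x < y \<Longrightarrow> rel_of r y x \<longleftrightarrow> r x < r y"
  by (auto simp: rel_of_def)

lemma dyck_at_edr:
  assumes T: "T \<in> SYT lam" and i: "1 \<le> i" "i + 2 * m \<le> sum_list lam"
  shows "dyck_at (pos (row T)) i m p \<longleftrightarrow> edr (row_index T) i m p"
proof -
  let ?P = "pos (row T)" and ?r = "row_index T"
  have up: "?P x < ?P y \<longleftrightarrow> ?r y \<le> ?r x" if "i \<le> x" "x < y" "y \<le> i + 2 * m" for x y
    using pos_row[OF T, of x y] that i rel_of_up[of x y ?r] by auto
  have down: "?P y < ?P x \<longleftrightarrow> ?r x < ?r y" if "i \<le> x" "x < y" "y \<le> i + 2 * m" for x y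
    using pos_row[OF T, of y x] that i rel_of_down[of x y ?r] by auto
  have 1: "?P (i + q) < ?P (i + q + 1) \<longleftrightarrow> ?r (i + q + 1) \<le> ?r (i + q)" if "q < m" for q
    using that by (intro up) auto
  have 2: "?P (i + m + q) < ?P (i + m + q + 1) \<longleftrightarrow> ?r (i + m + q + 1) \<le> ?r (i + m + q)" if "q < m" for q
    using that by (intro up) auto
  have 3: "?P (i + m + 1 + q) < ?P (i + q) \<longleftrightarrow> ?r (i + q) < ?r (i + m + 1 + q)" if "q < m" for q
    using that by (intro down) auto
  have 4: "?P (i + m + q) < ?P (i + q) \<longleftrightarrow> ?r (i + q) < ?r (i + m + q)" if "1 \<le> m" "q \<le> m" for q
    using that by (intro down) auto
  have 5: "?P (i + q) < ?P (i + m + 1 + q) \<longleftrightarrow> ?r (i + m + 1 + q) \<le> ?r (i + q)" if "q < m" for q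
    using that by (intro up) auto
  show ?thesis unfolding dyck_at_def edr_def
    by (intro conj_cong refl all_cong imp_cong) (use 1 2 3 4 5 in auto)
qed

lemma chain_ge:
  fixes f :: "nat \<Rightarrow> nat"
  assumes "\<And>q. l \<le> q \<Longrightarrow> q < u \<Longrightarrow> f (q + 1) \<le> f q" "l \<le> s" "s \<le> t" "t \<le> u"
  shows "f t \<le> f s"
  using assms(3,4)
proof (induction t)
  case (Suc t)
  show ?case
  proof (cases "s = Suc t")
    case False
    then have "f (t + 1) \<le> f t" using assms(1)[of t] assms(2) Suc.prems by simp
    then show ?thesis using Suc False by simp
  qed simp
qed simp

lemma edr_x: "edr r i m p \<Longrightarrow> s \<le> t \<Longrightarrow> t \<le> m \<Longrightarrow> r (i + t) \<le> r (i + s)"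
  by (rule chain_ge[of 0 m "\<lambda>q. r (i + q)"]) (auto simp: edr_def)

lemma edr_y: "edr r i m p \<Longrightarrow> 1 \<le> s \<Longrightarrow> s \<le> t \<Longrightarrow> t \<le> m \<Longrightarrow> r (i + m + t) \<le> r (i + m + s)"
  by (rule chain_ge[of 1 m "\<lambda>q. r (i + m + q)"]) (auto simp: edr_def)

text \<open>The \<open>1\<close>s after \<open>i+p\<close> lie strictly below its row, and the
  \<open>2\<close>s it jumps over strictly above. So raising \<open>i+p\<close> to
  \<open>i+m+p\<close> passes no letter of its own row, and rows stay increasing.\<close>

lemma edr_row_ne:
  assumes e: "edr r i m p" and v: "i + p < v" "v \<le> i + m + p"
  shows "r v \<noteq> r (i + p)"
proof
  assume eq: "r v = r (i + p)"
  show False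
  proof (cases "v \<le> i + m")
    case True
    then have pm: "p < m" using v by simp
    have "r (i + (v - i)) \<le> r (i + (p + 1))" by (rule edr_x[OF e]) (use v True in auto)
    then have "r v \<le> r (i + (p + 1))" using v by simp
    moreover have "r (i + (p + 1)) < r (i + m + (p + 1))" "r (i + m + 1 + p) \<le> r (i + p)"
      using e pm unfolding edr_def by auto
    ultimately show False using eq by simp
  next
    case False
    define q where "q = v - (i + m + 1)"
    have q: "v = i + m + 1 + q" "q < p" using False v unfolding q_def by auto
    then have "r (i + q) < r v" using e unfolding edr_def by auto
    moreover have "r (i + p) \<le> r (i + q)" by (rule edr_x[OF e]) (use q e in \<open>auto simp: edr_def\<close>)
    ultimately show False using eq by simp
  qed
qed

definition cyc :: "nat \<Rightarrow> nat \<Rightarrow> nat \<Rightarrow> nat" where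
  "cyc a b x = (if x = b then a else if a \<le> x \<and> x < b then x + 1 else x)"

lemma sg_cyc: "a \<le> b \<Longrightarrow> sg a b (cyc a b x) = x"
  by (auto simp: sg_def cyc_def)

text \<open>For \<open>a \<le> k < b\<close> the first \<open>k\<close> values of the shifted
  function are the first \<open>k+1\<close> values of \<open>r\<close> without the one at
  \<open>a\<close>, which returns only at \<open>b\<close>.\<close>

lemma cnt_cyc:
  assumes "1 \<le> a" "a \<le> b"
  shows "cnt (\<lambda>x. r (cyc a b x)) k \<rho> + (if a \<le> k \<and> k < b \<and> r a = \<rho> then 1 else 0) =
    cnt r (if a \<le> k \<and> k < b then Suc k else k) \<rho>"
proof (induction k)
  case (Suc k)
  consider "Suc k < a" | "Suc k = a" "a = b" | "Suc k = a" "a < b" | "a \<le> k" "Suc k < b" | "a \<le> k" "Suc k = b" | "b \<le> k" by linarith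
  then show ?case
    by cases (use Suc assms in \<open>auto simp: cnt_Suc cyc_def\<close>)
qed (use assms in auto)

text \<open>As long as \<open>i+p\<close> is missing, its row \<open>R\<close> has one letter less,
  so it must have been strictly longer than row \<open>R+1\<close>. The letters
  \<open>i+s, ..., i+p\<close> all lie in row \<open>R\<close>, while from \<open>i+s\<close> to
  \<open>t\<close> only letters from \<open>i+m+1+s\<close> on can lie in row \<open>R+1\<close>,
  and these are fewer.\<close>

lemma edr_strict:
  assumes b: "bal n r" and e: "edr r i m p" and i: "1 \<le> i" "i + 2 * m \<le> n"
    and t: "i + p < t" "t \<le> i + m + p"
  shows "cnt r t (Suc (r (i + p))) < cnt r t (r (i + p))"
proof -
  define R where "R = r (i + p)"
  have pm: "p \<le> m" using e unfolding edr_def by simp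
  \<comment> \<open>\<open>s\<close> is the first rank whose \<open>2\<close> lies in row
    \<open>R+1\<close>, or \<open>p\<close> if no smaller rank has this property. The
    \<open>1\<close> of rank \<open>s\<close> then lies in row \<open>R\<close> already.\<close>
  define s where "s = (LEAST s. s = p \<or> r (i + m + 1 + s) = Suc R)"
  have s: "s = p \<or> r (i + m + 1 + s) = Suc R" unfolding s_def by (rule LeastI_ex) blast
  have sp: "s \<le> p" unfolding s_def by (rule Least_le) simp
  have ns: "r (i + m + 1 + q) \<noteq> Suc R" if "q < s" for q
    using not_less_Least[of q] that unfolding s_def by blast
  have rs: "r (i + s) = R"
  proof (cases "s = p")
    case False
    then have "r (i + s) < Suc R" using s sp e unfolding edr_def by (metis le_neq_implies_less)
    moreover have "R \<le> r (i + s)" using edr_x[OF e sp pm] by (simp add: R_def)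
    ultimately show ?thesis by simp
  qed (simp add: R_def)
  have "{x \<in> {1..t}. r x = Suc R} \<subseteq> {x \<in> {1..i + s - 1}. r x = Suc R} \<union> {i + m + 1 + s..t}"
  proof
    fix x assume x: "x \<in> {x \<in> {1..t}. r x = Suc R}"
    have "\<not> (i + s \<le> x \<and> x \<le> i + m)"
    proof
      assume a: "i + s \<le> x \<and> x \<le> i + m"
      have "r (i + (x - i)) \<le> r (i + s)" by (rule edr_x[OF e]) (use a in auto)
      then show False using rs x a by simp
    qed
    moreover have "\<not> (i + m + 1 \<le> x \<and> x < i + m + 1 + s)"
    proof
      assume a: "i + m + 1 \<le> x \<and> x < i + m + 1 + s"
      then have "x - (i + m + 1) < s" "i + m + 1 + (x - (i + m + 1)) = x" by auto
      then show False using ns[of "x - (i + m + 1)"] x by simp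
    qed
    ultimately show "x \<in> {x \<in> {1..i + s - 1}. r x = Suc R} \<union> {i + m + 1 + s..t}" using x by auto
  qed
  then have "cnt r t (Suc R) \<le> card ({x \<in> {1..i + s - 1}. r x = Suc R} \<union> {i + m + 1 + s..t})"
    unfolding cnt_def by (intro card_mono) auto
  also have "\<dots> \<le> cnt r (i + s - 1) (Suc R) + card {i + m + 1 + s..t}"
    unfolding cnt_def by (rule card_Un_le)
  also have "\<dots> \<le> cnt r (i + s - 1) (Suc R) + (p - s)" using t by simp
  also have "\<dots> \<le> cnt r (i + s - 1) R + (p - s)"
  proof -
    have "i + s - 1 \<le> n" using i sp pm by simp
    then have "cnt r (i + s - 1) (Suc R) \<le> cnt r (i + s - 1) R" using b unfolding bal_def by blast
    then show ?thesis by linarith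
  qed
  also have "\<dots> < cnt r (i + s - 1) R + card {i + s..i + p}" using sp by simp
  also have "\<dots> = card ({x \<in> {1..i + s - 1}. r x = R} \<union> {i + s..i + p})"
    unfolding cnt_def by (rule card_Un_disjoint[symmetric]) (use i in auto)
  also have "\<dots> \<le> cnt r t R"
    unfolding cnt_def
  proof (rule card_mono)
    have "r x = R" if "i + s \<le> x" "x \<le> i + p" for x
    proof -
      have "r (i + (x - i)) \<le> r (i + s)" by (rule edr_x[OF e]) (use that pm in auto)
      moreover have "r (i + p) \<le> r (i + (x - i))" by (rule edr_x[OF e]) (use that pm in auto)
      ultimately show ?thesis using rs that R_def by simp
    qed
    then show "{x \<in> {1..i + s - 1}. r x = R} \<union> {i + s..i + p} \<subseteq> {x \<in> {1..t}. r x = R}"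
      using i t sp by auto
  qed simp
  finally show ?thesis by (simp add: R_def)
qed

lemma bal_cyc:
  assumes b: "bal n r" and e: "edr r i m p" and i: "1 \<le> i" "i + 2 * m \<le> n"
  shows "bal n (\<lambda>x. r (cyc (i + p) (i + m + p) x))"
  unfolding bal_def
proof (intro allI impI)
  fix k \<rho> assume k: "k \<le> n"
  have pm: "p \<le> m" using e unfolding edr_def by simp
  let ?a = "i + p" and ?b = "i + m + p" and ?r' = "\<lambda>x. r (cyc (i + p) (i + m + p) x)"
  have c: "cnt ?r' k \<rho>' + (if ?a \<le> k \<and> k < ?b \<and> r ?a = \<rho>' then 1 else 0) =
    cnt r (if ?a \<le> k \<and> k < ?b then Suc k else k) \<rho>'" for \<rho>'
    by (rule cnt_cyc) (use i in auto)
  show "cnt ?r' k (Suc \<rho>) \<le> cnt ?r' k \<rho>"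
  proof (cases "?a \<le> k \<and> k < ?b")
    case False
    then show ?thesis using c[of \<rho>] c[of "Suc \<rho>"] b k unfolding bal_def by auto
  next
    case True
    then have kn: "Suc k \<le> n" using i pm by simp
    show ?thesis
    proof (cases "r ?a = \<rho>")
      case R: True
      have "cnt r (Suc k) (Suc \<rho>) < cnt r (Suc k) \<rho>"
        using edr_strict[OF b e i, of "Suc k"] True R by simp
      then show ?thesis using c[of \<rho>] c[of "Suc \<rho>"] True R by simp
    next
      case False
      have "cnt r (Suc k) (Suc \<rho>) \<le> cnt r (Suc k) \<rho>" using b kn unfolding bal_def by blast
      then show ?thesis using c[of \<rho>] c[of "Suc \<rho>"] True False by simp
    qed
  qed
qed

lemma cnt_cyc_end:
  assumes "edr r i m p" "1 \<le> i" "i + 2 * m \<le> n"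
  shows "cnt (\<lambda>x. r (cyc (i + p) (i + m + p) x)) n \<rho> = cnt r n \<rho>"
  using cnt_cyc[of "i + p" "i + m + p" r n \<rho>] assms unfolding edr_def by auto

text \<open>On entries the edge is the relabelling \<open>sg\<close>, on row functions composition
  with the inverse \<open>cyc\<close>. Rows stay increasing by \<open>edr_row_ne\<close>, and the
  columns are taken care of by the ballot count in \<open>bal_cyc\<close>.\<close>

lemma edge_target:
  assumes T: "T \<in> SYT lam" and e: "edr (row_index T) i m p" and i: "1 \<le> i" "i + 2 * m \<le> sum_list lam"
  defines "T' \<equiv> map (map (sg (i + p) (i + m + p))) T"
  shows "T' \<in> SYT lam"
    "\<And>x. x \<in> {1..sum_list lam} \<Longrightarrow> row_index T' x = row_index T (cyc (i + p) (i + m + p) x)"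
proof -
  let ?n = "sum_list lam" and ?s = "sg (i + p) (i + m + p)" and ?c = "cyc (i + p) (i + m + p)"
  let ?r = "row_index T"
  let ?r' = "\<lambda>x. ?r (?c x)"
  note B = SYT_basic[OF T]
  have pm: "p \<le> m" using e unfolding edr_def by simp
  have cc: "concat T' = map ?s (concat T)" by (simp add: T'_def map_concat)
  have d: "distinct (concat T')" unfolding cc using B(2) sg_inj[of "i + p" "i + m + p"] by (simp add: distinct_map)
  have st: "set (concat T') = {1..?n}"
    unfolding cc set_map B(3) by (rule sg_image) (use i pm in auto)
  have sorted: "\<forall>w\<in>set T'. sorted w"
  proof
    fix w assume "w \<in> set T'"
    then obtain v where v: "v \<in> set T" "w = map ?s v" by (auto simp: T'_def)
    then obtain k where k: "k < length T" "v = T ! k" by (auto simp: in_set_conv_nth)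
    have "sorted_wrt (\<le>) v" using B(4) v by auto
    then have "sorted_wrt (\<lambda>x y. ?s x \<le> ?s y) v"
    proof (rule sorted_wrt_mono_rel[rotated])
      fix x y assume xy: "x \<in> set v" "y \<in> set v" "x \<le> y"
      have "?r x = k" "?r y = k" using row_index_eq[OF B(2) k(1)] xy k(2) by auto
      then have "\<not> (x = i + p \<and> i + p < y \<and> y \<le> i + m + p)" using edr_row_ne[OF e, of y] by auto
      then show "?s x \<le> ?s y" using xy(3) by (auto simp: sg_def)
    qed
    then show "sorted w" unfolding v(2) sorted_map .
  qed
  show r': "row_index T' x = ?r' x" if x: "x \<in> {1..?n}" for x
  proof -
    have cx: "?c x \<in> {1..?n}" using x i pm unfolding cyc_def by auto
    then have "?c x \<in> set (concat T)" unfolding B(3) .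
    from row_index_props[OF this] have k: "?r' x < length T" "?c x \<in> set (T ! ?r' x)" .
    then have "?s (?c x) \<in> set (T' ! ?r' x)" unfolding T'_def by simp
    then have "x \<in> set (T' ! ?r' x)" using sg_cyc[of "i + p" "i + m + p" x] by simp
    then show ?thesis using row_index_eq[OF d] k(1) by (simp add: T'_def)
  qed
  have "T' = tab ?n (length T') (row_index T')" using tab_row_index[OF d st sorted] by simp
  also have "\<dots> = tab ?n (length lam) ?r'"
    using tab_cong[of ?n "row_index T'" ?r'] r' B(1) by (simp add: T'_def)
  finally have T'_tab: "T' = tab ?n (length lam) ?r'" .
  have "yam lam ?r'"
    using SYT_yam[OF T] bal_cyc[OF _ e i] cnt_cyc_end[OF e i] unfolding yam_def by auto
  then show "T' \<in> SYT lam" unfolding T'_tab by (rule yam_SYT(1))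
qed

lemma dyck_pattern_interval_iff:
  assumes T: "T \<in> SYT lam"
  shows "dyck_pattern_interval (row T) i m \<longleftrightarrow>
    1 \<le> i \<and> i + 2 * m \<le> sum_list lam \<and> dyck (pos (row T)) i m"
proof -
  let ?w = "row T" and ?u = "filter (\<lambda>x. i \<le> x \<and> x \<le> i + 2 * m) (row T)"
  have w: "distinct ?w" "set ?w = {1..sum_list lam}"
    using SYT_basic[OF T] distinct_row[of T] set_row[of T] by blast+
  have len: "length ?w = sum_list lam" using distinct_card[OF w(1)] w(2) by simp
  have "rsk_P ?u = [[i..<i + m + 1], [i + m + 1..<i + 2 * m + 1]] \<longleftrightarrow> dyck (pos ?w) i m"
    if i: "1 \<le> i" "1 \<le> m" "i + 2 * m \<le> sum_list lam"
  proof -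
    have u: "distinct ?u" "set ?u = {i..i + 2 * m}" using w i by auto
    have "dyck (pos ?u) i m \<longleftrightarrow> dyck (pos ?w) i m"
    proof (rule dyck_at_cong)
      fix x y assume xy: "x \<in> {i..i + 2 * m}" "y \<in> {i..i + 2 * m}"
      then have "x \<in> set ?w" "y \<in> set ?w" using w i by auto
      then show "pos ?u x < pos ?u y \<longleftrightarrow> pos ?w x < pos ?w y"
        using bef_pos[OF u(1), of x y] bef_pos[OF w(1), of x y] u(2) xy by (simp add: bef_filter)
    qed
    then show ?thesis using rsk_dyck[OF u i(2)] by simp
  qed
  then show ?thesis unfolding dyck_pattern_interval_def len by (auto simp: dyck_def)
qed

text \<open>Collapsing, applying the crystal operator and standardizing amount to one relabelling,
  whose only hidden datum is the index \<open>p\<close> of the unbracketed letter.\<close>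

lemma CS_edges:
  "(T, I, T') \<in> edges (CS lam) \<longleftrightarrow> (\<exists>i m p. I = (i, i + 2 * m) \<and> T \<in> SYT lam \<and> 1 \<le> i \<and>
     i + 2 * m \<le> sum_list lam \<and> edr (row_index T) i m p \<and>
     T' = map (map (sg (i + p) (i + m + p))) T)" (is "?L \<longleftrightarrow> ?R")
proof -
  have step: "f_tab i (map (map (cl i m)) T) = Some (map (map (cl' i m p)) T)"
     "std (map (map (cl' i m p)) T) = map (map (sg (i + p) (i + m + p))) T"
    if T: "T \<in> SYT lam" and i: "1 \<le> i" "i + 2 * m \<le> sum_list lam"
      and d: "dyck_at (pos (row T)) i m p" for i m p
  proof -
    have w: "distinct (row T)" "set (row T) = {1..sum_list lam}"
      using SYT_basic[OF T] distinct_row[of T] set_row[of T] by blast+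
    have len: "length (row T) = sum_list lam" using distinct_card[OF w(1)] w(2) by simp
    have rf: "refill (map (map g) T) v = refill T v" for g :: "nat \<Rightarrow> nat" and v
      by (rule refill_cong) (simp add: comp_def)
    have "f_word i (map (cl i m) (row T)) = Some (map (cl' i m p) (row T))"
      by (rule f_word_cl[OF d w(1)]) (use w i in auto)
    then show "f_tab i (map (map (cl i m)) T) = Some (map (map (cl' i m p)) T)"
      unfolding f_tab_def row_map by (simp add: rf refill_map)
    have "std_word (map (cl' i m p) (row T)) = map (sg (i + p) (i + m + p)) (row T)"
      by (rule std_word_cl'[OF d w(1)]) (use w i len in auto)
    then show "std (map (map (cl' i m p)) T) = map (map (sg (i + p) (i + m + p))) T"
      unfolding std_def row_map by (simp add: rf refill_map)
  qed
  have E: "?L \<longleftrightarrow> (\<exists>i m. I = (i, i + 2 * m) \<and> T \<in> SYT lam \<and> dyck_pattern_interval (row T) i m \<and>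
     (\<exists>c. f_tab i (map (map (cl i m)) T) = Some c \<and> T' = std c))"
    unfolding CS_def cl_def[abs_def] by auto
  show ?thesis
  proof
    assume ?L
    then obtain i m c where I: "I = (i, i + 2 * m)" and T: "T \<in> SYT lam" and
      d: "dyck_pattern_interval (row T) i m" and c: "f_tab i (map (map (cl i m)) T) = Some c" "T' = std c"
      unfolding E by blast
    have i: "1 \<le> i" "i + 2 * m \<le> sum_list lam" "dyck (pos (row T)) i m"
      using d dyck_pattern_interval_iff[OF T] by auto
    have "set (row T) = {1..sum_list lam}" using SYT_basic(3)[OF T] set_row[of T] by blast
    then have "inj_on (pos (row T)) {i..i + 2 * m}" using i by (intro inj_on_subset[OF pos_inj]) auto
    then obtain p where p: "dyck_at (pos (row T)) i m p" using dyck_at_ex i(3) by blast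
    have "c = map (map (cl' i m p)) T" using step(1)[OF T i(1,2) p] c(1) by simp
    then have "T' = map (map (sg (i + p) (i + m + p))) T" using step(2)[OF T i(1,2) p] c(2) by simp
    moreover have "edr (row_index T) i m p" using p dyck_at_edr[OF T i(1,2)] by simp
    ultimately show ?R using I T i by blast
  next
    assume ?R
    then obtain i m p where I: "I = (i, i + 2 * m)" and T: "T \<in> SYT lam" and i: "1 \<le> i" "i + 2 * m \<le> sum_list lam"
      and e: "edr (row_index T) i m p" and T': "T' = map (map (sg (i + p) (i + m + p))) T" by blast
    have p: "dyck_at (pos (row T)) i m p" using e dyck_at_edr[OF T i(1,2)] by simp
    then have "dyck_pattern_interval (row T) i m" using dyck_at_dyck i dyck_pattern_interval_iff[OF T] by blast
    then show ?L unfolding E using I T T' step[OF T i p] by metis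
  qed
qed

lemma CS_edges_row_index:
  "(T, I, T') \<in> edges (CS lam) \<longleftrightarrow> (\<exists>i m p. I = (i, i + 2 * m) \<and> T \<in> SYT lam \<and> T' \<in> SYT lam \<and> 1 \<le> i \<and>
     i + 2 * m \<le> sum_list lam \<and> edr (row_index T) i m p \<and>
     (\<forall>x\<in>{1..sum_list lam}. row_index T' x = row_index T (cyc (i + p) (i + m + p) x)))" (is "?L \<longleftrightarrow> ?R")
proof
  assume ?L
  then show ?R unfolding CS_edges using edge_target by blast
next
  assume ?R
  then obtain i m p where I: "I = (i, i + 2 * m)" and T: "T \<in> SYT lam" "T' \<in> SYT lam" and i: "1 \<le> i" "i + 2 * m \<le> sum_list lam"
      and e: "edr (row_index T) i m p"
      and r: "\<forall>x\<in>{1..sum_list lam}. row_index T' x = row_index T (cyc (i + p) (i + m + p) x)" by blast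
  have "T' = map (map (sg (i + p) (i + m + p))) T"
    by (rule SYT_inj[OF T(2) edge_target(1)[OF T(1) e i]]) (use r edge_target(2)[OF T(1) e i] in simp)
  then show ?L unfolding CS_edges using I T i e by blast
qed

subsection \<open>Descent compositions\<close>

text \<open>The right ends of the blocks. A change of descents is an insertion or deletion in this
  list, while it affects several parts of the composition at once.\<close>

definition dl :: "nat \<Rightarrow> nat set \<Rightarrow> nat list" where
  "dl n D = sorted_list_of_set (insert n D)"

lemma dl_unique: "sorted_wrt (<) X \<Longrightarrow> set X = insert n D \<Longrightarrow> dl n D = X"
  unfolding dl_def by (metis sorted_list_of_set.idem_if_sorted_distinct strict_sorted_iff)

lemma dl_props: "finite D \<Longrightarrow> sorted_wrt (<) (dl n D)" "finite D \<Longrightarrow> set (dl n D) = insert n D"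
  unfolding dl_def by (rule strict_sorted_list_of_set) (rule set_sorted_list_of_set, simp)

lemma dl_last:
  assumes "D \<subseteq> {1..<n}" shows "dl n D = sorted_list_of_set D @ [n]"
proof (rule dl_unique)
  have f: "finite D" using assms finite_subset by blast
  show "sorted_wrt (<) (sorted_list_of_set D @ [n])" using f assms by (auto simp: sorted_wrt_append)
  show "set (sorted_list_of_set D @ [n]) = insert n D" using f by auto
qed

lemma comp_of_set_dl: "0 < n \<Longrightarrow> D \<subseteq> {1..<n} \<Longrightarrow> comp_of_set n D = diffs 0 (dl n D)"
  by (simp add: comp_of_set_def dl_last)

lemma dl_sorted0: "D \<subseteq> {1..<n} \<Longrightarrow> 0 < n \<Longrightarrow> sorted_wrt (<) (0 # dl n D)"
  using dl_props[of D n] finite_subset[of D "{1..<n}"] by auto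

lemma length_diffs [simp]: "length (diffs p xs) = length xs"
  by (induction xs arbitrary: p) auto

lemma diffs_sum:
  "sorted_wrt (<) (p # xs) \<Longrightarrow> k \<le> length xs \<Longrightarrow> sum_list (take k (diffs p xs)) + p = (p # xs) ! k"
proof (induction xs arbitrary: p k)
  case (Cons x xs)
  show ?case
  proof (cases k)
    case (Suc l)
    have "sum_list (take l (diffs x xs)) + x = (x # xs) ! l" using Cons Suc by auto
    then show ?thesis using Suc Cons.prems by simp
  qed simp
qed simp

lemma diffs_sum0:
  "sorted_wrt (<) (0 # X) \<Longrightarrow> sum_list (take k (diffs 0 X)) = (0 # X) ! (min k (length X))"
  using diffs_sum[of 0 X "min k (length X)"]
  by (cases "k \<le> length X") (auto simp: min_def)

lemma diffs_pos: "sorted_wrt (<) (p # xs) \<Longrightarrow> \<forall>x\<in>set (diffs p xs). 0 < x"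
  by (induction xs arbitrary: p) auto

lemma block_diffs:
  "sorted_wrt (<) (0 # X) \<Longrightarrow> j \<le> length X \<Longrightarrow> block (diffs 0 X) j = {(0 # X) ! (j - 1) + 1..(0 # X) ! j}"
  by (simp add: block_def diffs_sum0 min_absorb1 del: sorted_wrt.simps)

fun bl :: "nat \<Rightarrow> nat list \<Rightarrow> nat set list" where
  "bl p [] = []"
| "bl p (x # xs) = {p + 1..x} # bl x xs"

lemma length_bl [simp]: "length (bl p xs) = length xs"
  by (induction xs arbitrary: p) auto

lemma bl_append: "bl p (xs @ ys) = bl p xs @ bl (last (p # xs)) ys"
  by (induction xs arbitrary: p) auto

lemma nth_bl: "k < length xs \<Longrightarrow> bl p xs ! k = {(p # xs) ! k + 1..xs ! k}"
proof (induction xs arbitrary: p k)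
  case (Cons x xs) then show ?case by (cases k) auto
qed simp

lemma blocks_diffs: "sorted_wrt (<) (0 # X) \<Longrightarrow> blocks (diffs 0 X) = bl 0 X"
proof (rule nth_equalityI)
  assume s: "sorted_wrt (<) (0 # X)"
  fix k assume "k < length (blocks (diffs 0 X))"
  then have k: "k < length X" by (simp add: blocks_def)
  then have "blocks (diffs 0 X) ! k = block (diffs 0 X) (k + 1)" by (simp add: blocks_def)
  then show "blocks (diffs 0 X) ! k = bl 0 X ! k"
    using block_diffs[OF s, of "k + 1"] nth_bl[OF k, of 0] k by simp
qed (simp add: blocks_def)

lemma nth_last: "(p # xs @ zs) ! length xs = last (p # xs)"
  by (cases xs rule: rev_cases) (auto simp: nth_append nth_Cons split: nat.split)

text \<open>In the next lemmas \<open>X = xs @ [K, y] @ ys\<close> lists the ends of the blocks, so that \<open>K\<close>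
  ends the block number \<open>length xs + 1\<close>.\<close>
lemma split_blocks:
  assumes S: "sorted_wrt (<) (0 # xs @ K # y # ys)"
  defines "al \<equiv> diffs 0 (xs @ K # y # ys)"
  shows "block al (length xs + 1) = {last (0 # xs) + 1..K}" "block al (length xs + 2) = {K + 1..y}"
    "drop (length xs + 2) (blocks al) = bl y ys"
    "take (length xs - 1) (blocks al) @ filter (\<lambda>X. X \<noteq> {}) [block al (length xs)] = bl 0 xs"
proof -
  have n: "(0 # xs @ K # y # ys) ! (length xs + 1) = K" "(0 # xs @ K # y # ys) ! (length xs + 2) = y"
    by (auto simp: nth_append)
  show "block al (length xs + 1) = {last (0 # xs) + 1..K}"
    unfolding al_def using block_diffs[OF S, of "length xs + 1"] n nth_last[of 0 xs "K # y # ys"] by simp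
  show "block al (length xs + 2) = {K + 1..y}"
    unfolding al_def using block_diffs[OF S, of "length xs + 2"] n by simp
  have b: "blocks al = bl 0 xs @ {last (0 # xs) + 1..K} # {K + 1..y} # bl y ys"
    unfolding al_def blocks_diffs[OF S] by (simp add: bl_append)
  show "drop (length xs + 2) (blocks al) = bl y ys" unfolding b by simp
  show "take (length xs - 1) (blocks al) @ filter (\<lambda>X. X \<noteq> {}) [block al (length xs)] = bl 0 xs"
  proof (cases xs rule: rev_cases)
    case Nil
    then show ?thesis by (simp add: block_def)
  next
    case (snoc xs' x)
    have "block al (length xs) = {(0 # xs @ K # y # ys) ! (length xs - 1) + 1..(0 # xs @ K # y # ys) ! length xs}"
      unfolding al_def by (rule block_diffs[OF S]) simp
    also have "(0 # xs @ K # y # ys) ! (length xs - 1) = last (0 # xs')"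
      using nth_last[of 0 xs' "x # K # y # ys"] snoc by simp
    also have "(0 # xs @ K # y # ys) ! length xs = x" using nth_last[of 0 xs "K # y # ys"] snoc by simp
    finally have "block al (length xs) = {last (0 # xs') + 1..x}" .
    moreover have "last (0 # xs') < x"
      using S unfolding snoc by (cases xs' rule: rev_cases) (auto simp: sorted_wrt_append)
    ultimately show ?thesis unfolding b snoc by (auto simp: bl_append)
  qed
qed

lemma list_A0_split:
  assumes S: "sorted_wrt (<) (0 # xs @ K # y # ys)" and i: "last (0 # xs) < i" "K = i + m" "1 \<le> m" "i + 2 * m \<le> y"
  shows "A0_split (diffs 0 (xs @ K # y # ys)) (i, i + 2 * m) K (length xs + 1)"
  using split_blocks(1,2)[OF S] i unfolding A0_split_def by auto

text \<open>In a composition the block before block \<open>j\<close> is empty only for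
  \<open>j = 1\<close>. For types I and II it is unchanged and can be joined to the beginning as
  \<open>pre\<close>, which spares this case distinction; in type III it absorbs \<open>I^-\<close>
  and has to stay separate.\<close>

lemma edge_typeI:
  assumes "A0_split al I k j"
    "pre = take (j - 2) (blocks al) @ filter (\<lambda>X. X \<noteq> {}) [block al (j - 1)]"
  shows "blocks be = pre @ filter (\<lambda>X. X \<noteq> {}) [block al j - {k}, block al (Suc j) \<union> {k}] @
      drop (Suc j) (blocks al) \<Longrightarrow> edge_type 1 al I be"
    "length be = Suc (length al) \<Longrightarrow> blocks be = pre @ filter (\<lambda>X. X \<noteq> {}) [block al j - {k},
      {Suc k..snd I} \<union> {k}, block al (Suc j) - {Suc k..snd I}] @ drop (Suc j) (blocks al) \<Longrightarrow> edge_type 2 al I be"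
    "Suc (length be) = length al \<Longrightarrow> block al j = {fst I..<k} \<union> {k} \<Longrightarrow>
      blocks be = take (j - 2) (blocks al) @ filter (\<lambda>X. X \<noteq> {}) [block al (j - 1) \<union> {fst I..<k},
      block al (Suc j) \<union> {k}] @ drop (Suc j) (blocks al) \<Longrightarrow> edge_type 3 al I be"
proof -
  have eq: "filter P (A # L) = filter P [A] @ filter P L" for P :: "nat set \<Rightarrow> bool" and A L by simp
  note D = edge_type_def Let_def
  show "edge_type 1 al I be" if "blocks be = pre @ filter (\<lambda>X. X \<noteq> {}) [block al j - {k}, block al (Suc j) \<union> {k}] @
      drop (Suc j) (blocks al)"
  proof -
    have "blocks be = take (j - 2) (blocks al) @ filter (\<lambda>X. X \<noteq> {}) [block al (j - 1), block al j - {k},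
      block al (Suc j) \<union> {k}] @ drop (Suc j) (blocks al)"
      unfolding that assms(2) by (subst (3) eq) (simp only: append_assoc)
    then show ?thesis unfolding D using assms(1) by blast
  qed
  show "edge_type 2 al I be" if "length be = Suc (length al)" "blocks be = pre @ filter (\<lambda>X. X \<noteq> {}) [block al j - {k},
      {Suc k..snd I} \<union> {k}, block al (Suc j) - {Suc k..snd I}] @ drop (Suc j) (blocks al)"
  proof -
    have "blocks be = take (j - 2) (blocks al) @ filter (\<lambda>X. X \<noteq> {}) [block al (j - 1), block al j - {k},
      {Suc k..snd I} \<union> {k}, block al (Suc j) - {Suc k..snd I}] @ drop (Suc j) (blocks al)"
      unfolding that(2) assms(2) by (subst (3) eq) (simp only: append_assoc)
    then show ?thesis unfolding D using assms(1) that(1) by blast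
  qed
  show "edge_type 3 al I be" if "Suc (length be) = length al" "block al j = {fst I..<k} \<union> {k}"
      "blocks be = take (j - 2) (blocks al) @ filter (\<lambda>X. X \<noteq> {}) [block al (j - 1) \<union> {fst I..<k},
      block al (Suc j) \<union> {k}] @ drop (Suc j) (blocks al)"
    unfolding D using assms(1) that by blast
qed

text \<open>In terms of block ends, type I lowers the end \<open>K\<close> by one; type II also
  inserts the end \<open>i+2m\<close>, and type III also deletes the end \<open>i-1\<close>.\<close>

lemma list_type_1:
  assumes S: "sorted_wrt (<) (0 # xs @ K # y # ys)" and i: "last (0 # xs) < i" "K = i + m" "1 \<le> m" "i + 2 * m \<le> y"
  shows "edge_type 1 (diffs 0 (xs @ K # y # ys)) (i, i + 2 * m) (diffs 0 (xs @ (K - 1) # y # ys))"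
proof -
  have S': "sorted_wrt (<) (0 # xs @ (K - 1) # y # ys)"
    using S i by (cases xs rule: rev_cases) (auto simp: sorted_wrt_append)
  have "blocks (diffs 0 (xs @ (K - 1) # y # ys)) = bl 0 xs @ {last (0 # xs) + 1..K - 1} # {K - 1 + 1..y} # bl y ys"
    unfolding blocks_diffs[OF S'] by (simp add: bl_append)
  moreover have "{last (0 # xs) + 1..K - 1} = {last (0 # xs) + 1..K} - {K}" "{K - 1 + 1..y} = {K + 1..y} \<union> {K}"
    using i S by auto
  moreover have "i \<in> {last (0 # xs) + 1..K} - {K}" using i by auto
  then have "{last (0 # xs) + 1..K} - {K} \<noteq> {}" by blast
  ultimately have "blocks (diffs 0 (xs @ (K - 1) # y # ys)) = bl 0 xs @
      filter (\<lambda>X. X \<noteq> {}) [{last (0 # xs) + 1..K} - {K}, {K + 1..y} \<union> {K}] @ bl y ys" by simp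
  then show ?thesis
    using edge_typeI(1)[OF list_A0_split[OF assms], of "bl 0 xs"] split_blocks[OF S] by simp
qed

lemma list_type_2:
  assumes S: "sorted_wrt (<) (0 # xs @ K # y # ys)" and i: "last (0 # xs) < i" "K = i + m" "1 \<le> m" "i + 2 * m < y"
  shows "edge_type 2 (diffs 0 (xs @ K # y # ys)) (i, i + 2 * m) (diffs 0 (xs @ (K - 1) # (i + 2 * m) # y # ys))"
proof -
  have S': "sorted_wrt (<) (0 # xs @ (K - 1) # (i + 2 * m) # y # ys)"
    using S i by (cases xs rule: rev_cases) (auto simp: sorted_wrt_append)
  have "blocks (diffs 0 (xs @ (K - 1) # (i + 2 * m) # y # ys)) =
    bl 0 xs @ {last (0 # xs) + 1..K - 1} # {K - 1 + 1..i + 2 * m} # {i + 2 * m + 1..y} # bl y ys"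
    unfolding blocks_diffs[OF S'] by (simp add: bl_append)
  moreover have "{last (0 # xs) + 1..K - 1} = {last (0 # xs) + 1..K} - {K}" "{K - 1 + 1..i + 2 * m} = {Suc K..i + 2 * m} \<union> {K}"
    "{i + 2 * m + 1..y} = {K + 1..y} - {Suc K..i + 2 * m}"
    using i S by auto
  moreover have "i \<in> {last (0 # xs) + 1..K} - {K}" "y \<in> {K + 1..y} - {Suc K..i + 2 * m}" using i by auto
  then have "{last (0 # xs) + 1..K} - {K} \<noteq> {}" "{K + 1..y} - {Suc K..i + 2 * m} \<noteq> {}" by blast+
  ultimately have "blocks (diffs 0 (xs @ (K - 1) # (i + 2 * m) # y # ys)) = bl 0 xs @
      filter (\<lambda>X. X \<noteq> {}) [{last (0 # xs) + 1..K} - {K}, {Suc K..i + 2 * m} \<union> {K},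
        {K + 1..y} - {Suc K..i + 2 * m}] @ bl y ys" by simp
  then show ?thesis
    using edge_typeI(2)[OF list_A0_split[OF S i(1-3)], of "bl 0 xs"] i(4) split_blocks[OF S] by simp
qed

lemma list_type_3:
  assumes S: "sorted_wrt (<) (0 # (xs @ [i - 1]) @ K # y # ys)" and i: "K = i + m" "1 \<le> m" "i + 2 * m \<le> y"
  shows "edge_type 3 (diffs 0 ((xs @ [i - 1]) @ K # y # ys)) (i, i + 2 * m) (diffs 0 (xs @ (K - 1) # y # ys))"
proof -
  have "\<forall>x\<in>set ((xs @ [i - 1]) @ K # y # ys). 0 < x" using S unfolding sorted_wrt.simps by blast
  then have "2 \<le> i" by auto
  moreover have "last (0 # xs) < i - 1"
  proof (cases xs rule: rev_cases)
    case Nil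
    then show ?thesis using \<open>2 \<le> i\<close> by simp
  next
    case (snoc xs' x)
    then show ?thesis using S by (simp add: sorted_wrt_append)
  qed
  ultimately have i0: "last (0 # xs) < i - 1" "2 \<le> i" by auto
  have S': "sorted_wrt (<) (0 # xs @ (K - 1) # y # ys)"
    using S i by (cases xs rule: rev_cases) (auto simp: sorted_wrt_append)
  have b: "blocks (diffs 0 (xs @ (K - 1) # y # ys)) =
    bl 0 xs @ {last (0 # xs) + 1..K - 1} # {K - 1 + 1..y} # bl y ys"
    unfolding blocks_diffs[OF S'] by (simp add: bl_append)
  have e: "{last (0 # xs) + 1..K - 1} = {last (0 # xs) + 1..i - 1} \<union> {i..<K}" "{K - 1 + 1..y} = {K + 1..y} \<union> {K}"
    "{last (0 # xs) + 1..i - 1} \<noteq> {}" "{i - 1 + 1..K} = {i..<K} \<union> {K}"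
    using i i0 by auto
  let ?al = "diffs 0 ((xs @ [i - 1]) @ K # y # ys)"
  note sb = split_blocks[OF S]
  have bj: "block ?al (length xs + 1) = {last (0 # xs) + 1..i - 1}"
  proof -
    have S2: "sorted_wrt (<) (0 # xs @ (i - 1) # K # y # ys)" using S by simp
    show ?thesis using split_blocks(1)[OF S2] by simp
  qed
  have "take (length xs) (blocks ?al) @ filter (\<lambda>X. X \<noteq> {}) [block ?al (length xs + 1)] = bl 0 (xs @ [i - 1])"
    using sb(4) by simp
  then have tk: "take (length xs) (blocks ?al) = bl 0 xs" using bj e by (simp add: bl_append)
  have A: "A0_split ?al (i, i + 2 * m) K (length xs + 2)"
    using list_A0_split[OF S _ i] i0 by simp
  have "{i - 1 + 1..K} = {i..<K} \<union> {K}" using e(4) .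
  moreover have "blocks (diffs 0 (xs @ (K - 1) # y # ys)) = bl 0 xs @
      filter (\<lambda>X. X \<noteq> {}) [{last (0 # xs) + 1..i - 1} \<union> {i..<K}, {K + 1..y} \<union> {K}] @ bl y ys"
    unfolding b e(1,2) using e(3) by simp
  ultimately show ?thesis
    using edge_typeI(3)[OF A refl] sb bj tk by simp
qed

text \<open>Partial sums are block ends; the \<open>min\<close> continues both lists constantly, as
  partial sums do beyond the last part.\<close>

lemma dominates_diffs:
  assumes "sorted_wrt (<) (0 # X)" "sorted_wrt (<) (0 # Y)"
  shows "dominates (diffs 0 X) (diffs 0 Y) \<longleftrightarrow>
    (\<forall>k. (0 # Y) ! (min k (length Y)) \<le> (0 # X) ! (min k (length X)))"
  unfolding dominates_def diffs_sum0[OF assms(1)] diffs_sum0[OF assms(2)] ..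

lemma list_dominates_1:
  assumes "sorted_wrt (<) (0 # xs @ K # zs)" "sorted_wrt (<) (0 # xs @ (K - 1) # zs)"
  shows "dominates (diffs 0 (xs @ K # zs)) (diffs 0 (xs @ (K - 1) # zs))"
  unfolding dominates_diffs[OF assms] by (auto simp: nth_append nth_Cons split: nat.split)

lemma list_dominates_2:
  assumes "sorted_wrt (<) (0 # xs @ K # y # ys)" "sorted_wrt (<) (0 # xs @ (K - 1) # e # y # ys)"
  shows "dominates (diffs 0 (xs @ K # y # ys)) (diffs 0 (xs @ (K - 1) # e # y # ys))"
  unfolding dominates_diffs[OF assms]
proof
  fix k
  have s: "sorted (y # ys)" using assms(1) by (auto simp: sorted_wrt_append strict_sorted_iff)
  consider "k \<le> length xs" | "k = length xs + 1" | "k = length xs + 2" | l where "k = length xs + 3 + l"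
    by (metis (no_types, lifting) add.assoc add_2_eq_Suc' le_Suc_eq le_iff_add not_less_eq_eq numeral_3_eq_3 One_nat_def add_Suc_right add_0_right numeral_2_eq_2)
  then show "(0 # xs @ (K - 1) # e # y # ys) ! min k (length (xs @ (K - 1) # e # y # ys))
         \<le> (0 # xs @ K # y # ys) ! min k (length (xs @ K # y # ys))"
  proof cases
    case 1 then show ?thesis by (auto simp: nth_append nth_Cons split: nat.split)
  next
    case 2 then show ?thesis by (auto simp: nth_append)
  next
    case 3 then show ?thesis using assms(2) by (auto simp: nth_append sorted_wrt_append)
  next
    case (4 l)
    have "(y # ys) ! (min l (length ys)) \<le> (y # ys) ! (min (Suc l) (length ys))"
      by (rule sorted_nth_mono[OF s]) auto
    moreover have "(0 # xs @ (K - 1) # e # y # ys) ! min k (length (xs @ (K - 1) # e # y # ys)) = (y # ys) ! (min l (length ys))"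
      using 4 by (auto simp: nth_append min_def)
    moreover have "(0 # xs @ K # y # ys) ! min k (length (xs @ K # y # ys)) = (y # ys) ! (min (Suc l) (length ys))"
      using 4 by (auto simp: nth_append min_def)
    ultimately show ?thesis by simp
  qed
qed

text \<open>Once the end \<open>x\<close> is deleted, the larger \<open>K'\<close> moves into its
  position, so one partial sum grows.\<close>

lemma list_not_dominates:
  assumes "sorted_wrt (<) (0 # (xs @ [x]) @ K # zs)" "sorted_wrt (<) (0 # xs @ K' # zs)" "x < K'"
  shows "\<not> dominates (diffs 0 ((xs @ [x]) @ K # zs)) (diffs 0 (xs @ K' # zs))"
  unfolding dominates_diffs[OF assms(1,2)]
  using assms(3) by (auto simp: nth_append intro!: exI[of _ "length xs + 1"])

section \<open>Descent sets, condition (A0) and the three types\<close>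

definition descents :: "nat \<Rightarrow> (nat \<Rightarrow> nat) \<Rightarrow> nat set" where
  "descents n r = {d. 1 \<le> d \<and> d < n \<and> r d < r (Suc d)}"

lemma descents_sub: "descents n r \<subseteq> {1..<n}" by (auto simp: descents_def)

lemma Des_descents: "T \<in> SYT lam \<Longrightarrow> Des T = comp_of_set (sum_list lam) (descents (sum_list lam) (row_index T))"
  unfolding Des_def descents_def Let_def using SYT_basic(5)[of T lam] by (simp del: length_concat)

lemma descents_cong: "(\<And>x. x \<in> {1..n} \<Longrightarrow> r x = s x) \<Longrightarrow> descents n r = descents n s"
  unfolding descents_def by auto

text \<open>(A0) for the interval \<open>[i, i+2m]\<close>. The positions \<open>i-1\<close> and
  \<open>i+2m\<close> are left open; what an edge does there decides its type.\<close>

definition flat :: "nat set \<Rightarrow> nat \<Rightarrow> nat \<Rightarrow> bool" where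
  "flat D i m \<longleftrightarrow> 1 \<le> m \<and> 1 \<le> i \<and> i + m \<in> D \<and> (\<forall>d. i \<le> d \<longrightarrow> d < i + m \<longrightarrow> d \<notin> D) \<and>
     (\<forall>d. i + m < d \<longrightarrow> d < i + 2 * m \<longrightarrow> d \<notin> D)"

lemma dl_split:
  assumes D: "D \<subseteq> {1..<n}" and f: "flat D i m" and n: "i + 2 * m \<le> n"
  obtains xs y ys where "dl n D = xs @ (i + m) # y # ys" "last (0 # xs) < i" "i + 2 * m \<le> y"
    "sorted_wrt (<) (0 # xs @ (i + m) # y # ys)"
proof -
  have fin: "finite D" using D finite_subset by blast
  have K: "i + m \<in> D" "i + m < n" using f D unfolding flat_def by auto
  then have "i + m \<in> set (dl n D)" using dl_props(2)[OF fin] by simp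
  then obtain xs zs where X: "dl n D = xs @ (i + m) # zs" by (meson split_list)
  have S: "sorted_wrt (<) (0 # xs @ (i + m) # zs)" using dl_sorted0[OF D] K X by simp
  have set: "set xs \<union> {i + m} \<union> set zs = insert n D" using dl_props(2)[OF fin, of n] X by auto
  have lt: "\<forall>x\<in>set xs. x < i + m" "\<forall>z\<in>set zs. i + m < z" using S by (auto simp: sorted_wrt_append)
  have "n \<in> set xs \<union> {i + m} \<union> set zs" unfolding set by simp
  then have "n \<in> set zs" using lt K by auto
  then obtain y ys where zs: "zs = y # ys" by (cases zs) auto
  have "i + 2 * m \<le> y"
  proof (rule ccontr)
    assume "\<not> i + 2 * m \<le> y"
    moreover have "y \<in> insert n D" "i + m < y" using set zs lt by auto
    ultimately show False using f n unfolding flat_def by auto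
  qed
  moreover have "last (0 # xs) < i"
  proof (cases xs rule: rev_cases)
    case Nil then show ?thesis using f unfolding flat_def by simp
  next
    case (snoc xs' x)
    then have "x \<in> insert n D" "x < i + m" using set lt by auto
    then show ?thesis using f K(2) snoc unfolding flat_def by (metis insertE last_snoc last_ConsR leI less_asym snoc_eq_iff_butlast)
  qed
  ultimately show thesis using that X S zs by blast
qed

text \<open>As \<open>k\<close> and \<open>k+1\<close> lie in consecutive blocks, \<open>k\<close>
  must be the end of block \<open>j\<close>; equal lengths of the two sides make it the middle
  \<open>i+m\<close>.\<close>

lemma A0_ok_flat:
  assumes D: "D \<subseteq> {1..<n}"
  shows "A0_ok (comp_of_set n D) I \<longleftrightarrow> (\<exists>i m. I = (i, i + 2 * m) \<and> flat D i m \<and> i + 2 * m \<le> n)"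
proof (cases "n = 0")
  case True
  then show ?thesis using D by (auto simp: A0_ok_def A0_split_def comp_of_set_def flat_def)
next
  case False
  then have al: "comp_of_set n D = diffs 0 (dl n D)" and S: "sorted_wrt (<) (0 # dl n D)"
    using comp_of_set_dl[OF _ D] dl_sorted0[OF D] by auto
  have fin: "finite D" using D finite_subset by blast
  let ?X = "dl n D"
  show ?thesis
  proof
    assume "A0_ok (comp_of_set n D) I"
    then obtain k j where A: "A0_split (diffs 0 ?X) I k j" unfolding A0_ok_def al by blast
    obtain a b where I: "I = (a, b)" by (cases I)
    have j: "1 \<le> j" "j < length ?X" "a < k" "k - a = b - k" using A I unfolding A0_split_def by auto
    define m where "m = k - a"
    have m: "1 \<le> m" "k = a + m" "b = a + 2 * m" using j m_def by auto
    have b1: "block (diffs 0 ?X) j = {(0 # ?X) ! (j - 1) + 1..(0 # ?X) ! j}"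
      and b2: "block (diffs 0 ?X) (Suc j) = {(0 # ?X) ! j + 1..(0 # ?X) ! Suc j}"
      using block_diffs[OF S, of j] block_diffs[OF S, of "Suc j"] j by auto
    have "{a..k} \<subseteq> block (diffs 0 ?X) j" "{Suc k..b} \<subseteq> block (diffs 0 ?X) (Suc j)"
      using A I unfolding A0_split_def by auto
    then have i1: "(0 # ?X) ! (j - 1) < a" "k \<le> (0 # ?X) ! j" "(0 # ?X) ! j \<le> k" "b \<le> (0 # ?X) ! Suc j"
      unfolding b1 b2 using m by (auto simp: subset_iff)
    then have k: "k = (0 # ?X) ! j" by simp
    have kX: "k = ?X ! (j - 1)" using k j by (simp add: nth_Cons split: nat.splits)
    have mem: "d \<in> D \<Longrightarrow> \<exists>t<length ?X. d = (0 # ?X) ! Suc t" for d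
      using dl_props(2)[OF fin, of n] by (metis in_set_conv_nth insertCI nth_Cons_Suc)
    have mono: "s < t \<Longrightarrow> t < length (0 # ?X) \<Longrightarrow> (0 # ?X) ! s < (0 # ?X) ! t" for s t
      using S sorted_wrt_nth_less by blast
    have "k \<in> set ?X" unfolding kX using j by simp
    moreover have "k < (0 # ?X) ! Suc j" unfolding k by (rule mono) (use j in auto)
    moreover have "(0 # ?X) ! Suc j \<le> n"
    proof -
      have "(0 # ?X) ! Suc j \<in> set ?X" using j by simp
      then show ?thesis using dl_props(2)[OF fin, of n] D by auto
    qed
    ultimately have kD: "k \<in> D" "b \<le> n" using dl_props(2)[OF fin, of n] i1 by auto
    have "d \<notin> D" if "a \<le> d" "d < k" for d
    proof
      assume "d \<in> D"
      then obtain t where t: "t < length ?X" "d = (0 # ?X) ! Suc t" using mem by blast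
      have "\<not> j \<le> Suc t" using mono[of j "Suc t"] t that k by (cases "j = Suc t") auto
      then have "Suc t = j - 1 \<or> Suc t < j - 1" by linarith
      then have "(0 # ?X) ! Suc t \<le> (0 # ?X) ! (j - 1)"
      proof
        assume "Suc t < j - 1"
        then show ?thesis by (intro less_imp_le mono) (use j in auto)
      qed (simp only:)
      then show False using t(2) that i1(1) by linarith
    qed
    moreover have "d \<notin> D" if "k < d" "d < b" for d
    proof
      assume "d \<in> D"
      then obtain t where t: "t < length ?X" "d = (0 # ?X) ! Suc t" using mem by blast
      have "\<not> Suc j \<le> Suc t" using mono[of "Suc j" "Suc t"] t that i1 by (cases "j = t") auto
      then have "Suc t = j \<or> Suc t < j" by linarith
      then have "(0 # ?X) ! Suc t \<le> (0 # ?X) ! j" using mono[of "Suc t" j] j by auto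
      then show False using t(2) that k by linarith
    qed
    moreover have "1 \<le> a" using i1 by simp
    ultimately have "flat D a m" unfolding flat_def using m kD by auto
    then show "\<exists>i m. I = (i, i + 2 * m) \<and> flat D i m \<and> i + 2 * m \<le> n" using I m kD by blast
  next
    assume "\<exists>i m. I = (i, i + 2 * m) \<and> flat D i m \<and> i + 2 * m \<le> n"
    then obtain i m where I: "I = (i, i + 2 * m)" and f: "flat D i m" "i + 2 * m \<le> n" by blast
    obtain xs y ys where X: "dl n D = xs @ (i + m) # y # ys" "last (0 # xs) < i" "i + 2 * m \<le> y"
      "sorted_wrt (<) (0 # xs @ (i + m) # y # ys)" using dl_split[OF D f] by metis
    have "A0_split (diffs 0 (dl n D)) (i, i + 2 * m) (i + m) (length xs + 1)"
      unfolding X(1) by (rule list_A0_split[OF X(4,2)]) (use f X in \<open>auto simp: flat_def\<close>)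
    then show "A0_ok (comp_of_set n D) I" unfolding A0_ok_def al I by blast
  qed
qed

lemma comp_change_1:
  assumes D: "D \<subseteq> {1..<n}" and f: "flat D i m" and n: "i + 2 * m \<le> n"
    and D': "D' = D - {i + m} \<union> {i + m - 1}"
  shows "edge_type 1 (comp_of_set n D) (i, i + 2 * m) (comp_of_set n D')"
    "length (comp_of_set n D') = length (comp_of_set n D)"
    "dominates (comp_of_set n D) (comp_of_set n D')"
proof -
  obtain xs y ys where X: "dl n D = xs @ (i + m) # y # ys" "last (0 # xs) < i" "i + 2 * m \<le> y"
    "sorted_wrt (<) (0 # xs @ (i + m) # y # ys)" using dl_split[OF D f n] by metis
  have fin: "finite D" using D finite_subset by blast
  have m: "1 \<le> m" "1 \<le> i" "i + m < n" using f D unfolding flat_def by auto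
  have D'n: "D' \<subseteq> {1..<n}" using D D' m by auto
  have S': "sorted_wrt (<) (0 # xs @ (i + m - 1) # y # ys)"
    using X(2-4) m by (cases xs rule: rev_cases) (auto simp: sorted_wrt_append)
  have "dl n D' = xs @ (i + m - 1) # y # ys"
  proof (rule dl_unique)
    show "sorted_wrt (<) (xs @ (i + m - 1) # y # ys)" using S' by simp
    have "set (xs @ (i + m) # y # ys) = insert n D" using dl_props(2)[OF fin, of n] X(1) by simp
    moreover have "i + m \<notin> set (xs @ y # ys)" using X(4) by (auto simp: sorted_wrt_append)
    ultimately have "set (xs @ y # ys) = insert n D - {i + m}" by auto
    then show "set (xs @ (i + m - 1) # y # ys) = insert n D'" unfolding D' using m by auto
  qed
  then have c: "comp_of_set n D = diffs 0 (xs @ (i + m) # y # ys)" "comp_of_set n D' = diffs 0 (xs @ (i + m - 1) # y # ys)"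
    using comp_of_set_dl[of n] D D'n X(1) m by auto
  show "edge_type 1 (comp_of_set n D) (i, i + 2 * m) (comp_of_set n D')"
    unfolding c by (rule list_type_1[OF X(4,2) refl m(1) X(3)])
  show "length (comp_of_set n D') = length (comp_of_set n D)" unfolding c by simp
  show "dominates (comp_of_set n D) (comp_of_set n D')"
    unfolding c by (rule list_dominates_1[OF X(4) S'])
qed

lemma comp_change_2:
  assumes D: "D \<subseteq> {1..<n}" and f: "flat D i m" and n: "i + 2 * m < n" "i + 2 * m \<notin> D"
    and D': "D' = D - {i + m} \<union> {i + m - 1, i + 2 * m}"
  shows "edge_type 2 (comp_of_set n D) (i, i + 2 * m) (comp_of_set n D')"
    "length (comp_of_set n D') = Suc (length (comp_of_set n D))"
    "dominates (comp_of_set n D) (comp_of_set n D')"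
proof -
  obtain xs y ys where X: "dl n D = xs @ (i + m) # y # ys" "last (0 # xs) < i" "i + 2 * m \<le> y"
    "sorted_wrt (<) (0 # xs @ (i + m) # y # ys)" using dl_split[OF D f less_imp_le[OF n(1)]] by metis
  have fin: "finite D" using D finite_subset by blast
  have m: "1 \<le> m" "1 \<le> i" "i + m < n" using f D unfolding flat_def by auto
  have D'n: "D' \<subseteq> {1..<n}" using D D' m n by auto
  have XD: "set (xs @ (i + m) # y # ys) = insert n D" using dl_props(2)[OF fin, of n] X(1) by simp
  then have "y \<noteq> i + 2 * m" using n by auto
  then have y: "i + 2 * m < y" using X(3) by simp
  have S': "sorted_wrt (<) (0 # xs @ (i + m - 1) # (i + 2 * m) # y # ys)"
    using X(2-4) m y by (cases xs rule: rev_cases) (auto simp: sorted_wrt_append)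
  have "dl n D' = xs @ (i + m - 1) # (i + 2 * m) # y # ys"
  proof (rule dl_unique)
    show "sorted_wrt (<) (xs @ (i + m - 1) # (i + 2 * m) # y # ys)" using S' by simp
    have "i + m \<notin> set (xs @ y # ys)" using X(4) by (auto simp: sorted_wrt_append)
    then have "set (xs @ y # ys) = insert n D - {i + m}" using XD by auto
    then show "set (xs @ (i + m - 1) # (i + 2 * m) # y # ys) = insert n D'" unfolding D' using m by auto
  qed
  then have c: "comp_of_set n D = diffs 0 (xs @ (i + m) # y # ys)" "comp_of_set n D' = diffs 0 (xs @ (i + m - 1) # (i + 2 * m) # y # ys)"
    using comp_of_set_dl[of n] D D'n X(1) m by auto
  show "edge_type 2 (comp_of_set n D) (i, i + 2 * m) (comp_of_set n D')"
    unfolding c by (rule list_type_2[OF X(4,2) refl m(1) y])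
  show "length (comp_of_set n D') = Suc (length (comp_of_set n D))" unfolding c by simp
  show "dominates (comp_of_set n D) (comp_of_set n D')"
    unfolding c by (rule list_dominates_2[OF X(4) S'])
qed

lemma comp_change_3:
  assumes D: "D \<subseteq> {1..<n}" and f: "flat D i m" and n: "i + 2 * m \<le> n" "i - 1 \<in> D"
    and D': "D' = D - {i - 1, i + m} \<union> {i + m - 1}"
  shows "edge_type 3 (comp_of_set n D) (i, i + 2 * m) (comp_of_set n D')"
    "Suc (length (comp_of_set n D')) = length (comp_of_set n D)"
    "\<not> dominates (comp_of_set n D) (comp_of_set n D')"
proof -
  obtain xs y ys where X: "dl n D = xs @ (i + m) # y # ys" "last (0 # xs) < i" "i + 2 * m \<le> y"
    "sorted_wrt (<) (0 # xs @ (i + m) # y # ys)" using dl_split[OF D f n(1)] by metis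
  have fin: "finite D" using D finite_subset by blast
  have m: "1 \<le> m" "1 \<le> i" "i + m < n" "2 \<le> i"
    using f D subsetD[OF D n(2)] unfolding flat_def by auto
  have D'n: "D' \<subseteq> {1..<n}" using D D' m by auto
  have XD: "set (xs @ (i + m) # y # ys) = insert n D" using dl_props(2)[OF fin, of n] X(1) by simp
  have "i - 1 \<in> set xs"
  proof -
    have "i - 1 \<in> set (xs @ (i + m) # y # ys)" using XD n by auto
    moreover have "\<forall>z\<in>set (y # ys). i + m < z" using X(4) by (auto simp: sorted_wrt_append)
    ultimately show ?thesis using m by auto
  qed
  moreover obtain xs' x where xs: "xs = xs' @ [x]" using calculation by (cases xs rule: rev_cases) auto
  ultimately have "i - 1 = x \<or> i - 1 < x" using X(4) by (auto simp: sorted_wrt_append)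
  then have x: "x = i - 1" using X(2) xs by auto
  note X4 = X(4)[unfolded xs x]
  have S': "sorted_wrt (<) (0 # xs' @ (i + m - 1) # y # ys)"
    using X4 X(3) m by (cases xs' rule: rev_cases) (auto simp: sorted_wrt_append)
  have "dl n D' = xs' @ (i + m - 1) # y # ys"
  proof (rule dl_unique)
    show "sorted_wrt (<) (xs' @ (i + m - 1) # y # ys)" using S' by simp
    have "i + m \<notin> set (xs' @ y # ys)" "i - 1 \<notin> set (xs' @ y # ys)" using X4 by (auto simp: sorted_wrt_append)
    then have "set (xs' @ y # ys) = insert n D - {i - 1, i + m}" using XD xs x by auto
    moreover have "insert n D - {i - 1, i + m} = insert n (D - {i - 1, i + m})" using m by auto
    moreover have "set (xs' @ (i + m - 1) # y # ys) = insert (i + m - 1) (set (xs' @ y # ys))" by auto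
    ultimately show "set (xs' @ (i + m - 1) # y # ys) = insert n D'" unfolding D' by auto
  qed
  then have c: "comp_of_set n D = diffs 0 ((xs' @ [i - 1]) @ (i + m) # y # ys)" "comp_of_set n D' = diffs 0 (xs' @ (i + m - 1) # y # ys)"
    using comp_of_set_dl[of n] D D'n X(1) m xs x by auto
  show "edge_type 3 (comp_of_set n D) (i, i + 2 * m) (comp_of_set n D')"
    unfolding c by (rule list_type_3[OF X4 refl m(1) X(3)])
  show "Suc (length (comp_of_set n D')) = length (comp_of_set n D)" unfolding c by simp
  show "\<not> dominates (comp_of_set n D) (comp_of_set n D')"
    unfolding c by (rule list_not_dominates[OF X4 S']) (use m in auto)
qed

section \<open>Reversal and truncation of compositions\<close>

lemma diffs_append: "diffs p (xs @ ys) = diffs p xs @ diffs (last (p # xs)) ys"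
  by (induction xs arbitrary: p) auto

lemma rev_diffs:
  "sorted (p # xs @ [q]) \<Longrightarrow> q \<le> M \<Longrightarrow>
   rev (diffs p (xs @ [q])) = diffs (M - q) (map (\<lambda>x. M - x) (rev xs) @ [M - p])"
proof (induction xs arbitrary: p)
  case (Cons x xs)
  have le: "p \<le> x" "x \<le> q" using Cons.prems by auto
  have "rev (diffs p ((x # xs) @ [q])) = rev (diffs x (xs @ [q])) @ [x - p]" by simp
  also have "rev (diffs x (xs @ [q])) = diffs (M - q) (map (\<lambda>x. M - x) (rev xs) @ [M - x])"
    using Cons by auto
  also have "\<dots> @ [x - p] = diffs (M - q) (map (\<lambda>x. M - x) (rev (x # xs)) @ [M - p])"
    using le Cons.prems(2) by (simp add: diffs_append)
  finally show ?case .
qed auto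

text \<open>Reversal sends the end \<open>d\<close> of a block to \<open>n - d\<close>, and the two
  outer borders 0 and \<open>n\<close> exchange their roles.\<close>

lemma rev_comp:
  assumes D: "D \<subseteq> {1..<n}"
  shows "rev (comp_of_set n D) = comp_of_set n ((\<lambda>d. n - d) ` D)"
proof (cases "n = 0")
  case False
  have fin: "finite D" using D finite_subset by blast
  define L where "L = sorted_list_of_set D"
  have L: "sorted_wrt (<) L" "set L = D" using fin by (auto simp: L_def)
  have "1 \<le> d \<and> d < n" if "d \<in> D" for d using D that by auto
  then have D': "(\<lambda>d. n - d) ` D \<subseteq> {1..<n}" by fastforce
  have "sorted_wrt (\<lambda>x y. n - y < n - x) L"
    using L(1) by (rule sorted_wrt_mono_rel[rotated]) (use L(2) D in auto)
  then have "sorted_wrt (<) (map (\<lambda>x. n - x) (rev L))"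
    by (simp add: sorted_wrt_map sorted_wrt_rev)
  then have "dl n ((\<lambda>d. n - d) ` D) = map (\<lambda>x. n - x) (rev L) @ [n]"
    by (intro dl_unique) (use L D' in \<open>auto simp: sorted_wrt_append\<close>)
  moreover have "dl n D = L @ [n]" using dl_last[OF D] by (simp add: L_def)
  moreover have "rev (diffs 0 (L @ [n])) = diffs (n - n) (map (\<lambda>x. n - x) (rev L) @ [n - 0])"
    by (rule rev_diffs) (use L D in \<open>auto simp: sorted_append strict_sorted_iff\<close>)
  ultimately show ?thesis using comp_of_set_dl[OF _ D] comp_of_set_dl[OF _ D'] False by simp
qed (simp add: comp_of_set_def)

text \<open>The last part is 1, and disappears with the element \<open>n\<close>, just if
  \<open>n - 1\<close> is a descent.\<close>

lemma drop_last_comp: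
  assumes D: "D \<subseteq> {1..<n}"
  shows "drop_last_elem (comp_of_set n D) = comp_of_set (n - 1) (D \<inter> {1..<n - 1})"
proof -
  consider "n = 0" | "n = 1" | "2 \<le> n" by linarith
  then show ?thesis
  proof cases
    case 1 then show ?thesis by (simp add: comp_of_set_def drop_last_elem_def)
  next
    case 2
    then have "D = {}" using D by auto
    then show ?thesis using 2 by (simp add: comp_of_set_def drop_last_elem_def)
  next
    case 3
    have Dm: "1 \<le> d \<and> d < n" if "d \<in> D" for d using D that by auto
    let ?E = "D \<inter> {1..<n - 1}"
    define L where "L = sorted_list_of_set ?E"
    have L: "sorted_wrt (<) L" "set L = ?E" unfolding L_def by auto
    have cE: "comp_of_set (n - 1) ?E = diffs 0 (L @ [n - 1])"
      using comp_of_set_dl[of "n - 1" ?E] dl_last[of ?E "n - 1"] 3 by (simp add: L_def)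
    have cD: "comp_of_set n D = diffs 0 (dl n D)" using comp_of_set_dl[OF _ D] 3 by simp
    have lt: "last (0 # L) < n - 1"
      using L(2) 3 by (cases L rule: rev_cases) auto
    show ?thesis
    proof (cases "n - 1 \<in> D")
      case True
      have "dl n D = L @ [n - 1, n]"
      proof (rule dl_unique)
        show "sorted_wrt (<) (L @ [n - 1, n])" using L 3 by (auto simp: sorted_wrt_append)
        have "d \<in> ?E \<or> d = n - 1" if "d \<in> D" for d using Dm[OF that] that by auto
        then have "insert (n - 1) ?E = D" using True by blast
        moreover have "set (L @ [n - 1, n]) = insert n (insert (n - 1) ?E)" using L(2) by auto
        ultimately show "set (L @ [n - 1, n]) = insert n D" by simp
      qed
      then have "comp_of_set n D = diffs 0 (L @ [n - 1]) @ [1]" using cD 3 by (simp add: diffs_append)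
      then show ?thesis unfolding cE by (simp add: drop_last_elem_def)
    next
      case False
      have "dl n D = L @ [n]"
      proof (rule dl_unique)
        show "sorted_wrt (<) (L @ [n])" using L 3 by (auto simp: sorted_wrt_append)
        show "set (L @ [n]) = insert n D"
        proof -
          have "d < n - 1" if "d \<in> D" for d using Dm[OF that] False that by (cases "d = n - 1") auto
          then have "D = ?E" using Dm by auto
          then show ?thesis using L(2) by auto
        qed
      qed
      then have "comp_of_set n D = diffs 0 L @ [n - last (0 # L)]" using cD by (simp add: diffs_append)
      then show ?thesis unfolding cE using lt by (auto simp: drop_last_elem_def diffs_append)
    qed
  qed
qed

subsection \<open>Evacuation\<close>

text \<open>The reading word of the subtableau of entries up to \<open>N\<close>, on which the
  partial evacuation works.\<close>

definition wN :: "nat \<Rightarrow> tableau \<Rightarrow> nat list" where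
  "wN N T = filter (\<lambda>x. x \<le> N) (row T)"

lemma wN_props:
  assumes T: "T \<in> SYT lam" and N: "N \<le> sum_list lam"
  shows "distinct (wN N T)" "set (wN N T) = {1..N}"
    "\<And>x y. x \<in> {1..N} \<Longrightarrow> y \<in> {1..N} \<Longrightarrow> bef (wN N T) x y \<longleftrightarrow> rel_of (row_index T) x y"
proof -
  have w: "distinct (row T)" "set (row T) = {1..sum_list lam}"
    using SYT_basic[OF T] distinct_row[of T] set_row[of T] by blast+
  show "distinct (wN N T)" "set (wN N T) = {1..N}" using w N by (auto simp: wN_def)
  fix x y assume "x \<in> {1..N}" "y \<in> {1..N}"
  then show "bef (wN N T) x y \<longleftrightarrow> rel_of (row_index T) x y"
    using bef_row_SYT[OF T, of x y] N by (simp add: wN_def bef_filter)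
qed

lemma wN_dyck_at:
  assumes T: "T \<in> SYT lam" and N: "N \<le> sum_list lam" and i: "1 \<le> i" "i + 2 * m \<le> N"
  shows "dyck_at (pos (wN N T)) i m p \<longleftrightarrow> edr (row_index T) i m p"
    "dyck (pos (wN N T)) i m \<longleftrightarrow> dyck (pos (row T)) i m"
proof -
  have c: "pos (wN N T) x < pos (wN N T) y \<longleftrightarrow> pos (row T) x < pos (row T) y"
    if "x \<in> {i..i + 2 * m}" "y \<in> {i..i + 2 * m}" for x y
  proof -
    have x: "x \<in> {1..N}" "y \<in> {1..N}" "x \<in> {1..sum_list lam}" "y \<in> {1..sum_list lam}" using that i N by auto
    then show ?thesis
      using pos_row[OF T x(3,4)] wN_props[OF T N] bef_pos[of "wN N T" x y] by simp
  qed
  show "dyck_at (pos (wN N T)) i m p \<longleftrightarrow> edr (row_index T) i m p"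
    using dyck_at_cong(1)[of i m "pos (wN N T)" "pos (row T)" p] c dyck_at_edr[OF T, of i m p] i N by simp
  show "dyck (pos (wN N T)) i m \<longleftrightarrow> dyck (pos (row T)) i m"
    using dyck_at_cong(2)[of i m "pos (wN N T)" "pos (row T)"] c by simp
qed

definition evac_of :: "nat list \<Rightarrow> nat \<Rightarrow> tableau \<Rightarrow> tableau \<Rightarrow> bool" where
  "evac_of lam N T S \<longleftrightarrow> S \<in> SYT lam \<and> keq (rc N (wN N T)) (wN N S) \<and>
     (\<forall>x\<in>{N + 1..sum_list lam}. row_index S x = row_index T x)"

lemma wN_unique:
  assumes "S \<in> SYT lam" "S' \<in> SYT lam" and N: "N \<le> sum_list lam" and k: "keq (wN N S) (wN N S')"
    and r: "\<And>x. x \<in> {N + 1..sum_list lam} \<Longrightarrow> row_index S x = row_index S' x"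
  shows "S = S'"
proof (rule SYT_inj[OF assms(1,2)])
  fix x assume x: "x \<in> {1..sum_list lam}"
  have b: "bal N (row_index S)" "bal N (row_index S')"
    using SYT_yam assms(1,2) N unfolding yam_def bal_def by (meson le_trans)+
  show "row_index S x = row_index S' x"
  proof (cases "x \<le> N")
    case True
    show ?thesis
      by (rule keq_tableau_unique[OF b wN_props(2)[OF assms(1) N] wN_props(1)[OF assms(1) N]
          wN_props(3)[OF assms(1) N] wN_props(3)[OF assms(2) N] k]) (use True x in auto)
  qed (use r x in auto)
qed

text \<open>The insertion tableau of the reversed and complemented word has the row lengths of the
  subtableau by \<open>rc_content\<close>. So the letters above \<open>N\<close> can be put back
  into their rows without disturbing the ballot condition.\<close>

lemma evac_ex:
  assumes T: "T \<in> SYT lam" and N: "N \<le> sum_list lam"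
  shows "\<exists>S. evac_of lam N T S"
proof -
  let ?r = "row_index T" and ?n = "sum_list lam"
  note W = wN_props[OF T N]
  define u where "u = rc N (wN N T)"
  have u: "distinct u" "set u = {1..N}" using distinct_rc set_rc W unfolding u_def by auto
  define s where "s = row_index (rsk_P u)"
  have bs: "bal N s" unfolding s_def using bal_rsk_P[OF u] .
  have y: "bal ?n ?r" using SYT_yam[OF T] unfolding yam_def by blast
  have br: "bal N ?r" using y N unfolding bal_def by (meson le_trans)
  have rs: "bef (row (rsk_P u)) x y \<longleftrightarrow> rel_of s x y" if "x \<in> {1..N}" "y \<in> {1..N}" for x y
    unfolding s_def using bef_rsk_P[OF u(1)] that u(2) by simp
  have k: "keq (rc N (wN N T)) (row (rsk_P u))" using keq_rsk_P[OF u(1)] unfolding u_def .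
  have c: "cnt ?r N \<rho> = cnt s N \<rho>" for \<rho>
    by (rule rc_content[OF br bs W(2,1,3) rs k])
  define t where "t = (\<lambda>x. if x \<le> N then s x else ?r x)"
  have t1: "cnt t j \<rho> = cnt s j \<rho>" if "j \<le> N" for j \<rho>
    using that by (intro cnt_cong) (auto simp: t_def)
  have t2: "cnt t j \<rho> = cnt ?r j \<rho>" if "N \<le> j" for j \<rho>
    using that
  proof (induction j)
    case (Suc j)
    then show ?case using t1[of "Suc j" \<rho>] c[of \<rho>]
      by (cases "N = Suc j") (auto simp: cnt_Suc t_def)
  qed (use t1 c in auto)
  have yt: "yam lam t"
    unfolding yam_def
  proof
    show "bal ?n t" unfolding bal_def
    proof (intro allI impI)
      fix j \<rho> assume "j \<le> ?n"
      then show "cnt t j (Suc \<rho>) \<le> cnt t j \<rho>"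
        using t1[of j] t2[of j] bs y unfolding bal_def by (cases "j \<le> N") auto
    qed
    show "\<forall>\<rho>. cnt t ?n \<rho> = (if \<rho> < length lam then lam ! \<rho> else 0)"
      using t2[OF N] SYT_yam[OF T] unfolding yam_def by simp
  qed
  let ?S = "tab ?n (length lam) t"
  note S = yam_SYT[OF yt]
  have "wN N ?S = row (rsk_P u)"
  proof (rule bef_unique)
    show "distinct (wN N ?S)" using wN_props(1)[OF S(1) N] .
    show "distinct (row (rsk_P u))" using distinct_row distinct_rsk_P[OF u(1)] by blast
    show st: "set (wN N ?S) = set (row (rsk_P u))" using wN_props(2)[OF S(1) N] set_row set_rsk_P u(2) by metis
    fix x y assume "x \<in> set (wN N ?S)" "y \<in> set (wN N ?S)"
    then have xy: "x \<in> {1..N}" "y \<in> {1..N}" using wN_props(2)[OF S(1) N] by auto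
    then have "row_index ?S x = s x" "row_index ?S y = s y" using S(2)[of x] S(2)[of y] N by (auto simp: t_def)
    then have "rel_of (row_index ?S) x y \<longleftrightarrow> rel_of s x y" by (simp add: rel_of_def)
    then show "bef (wN N ?S) x y = bef (row (rsk_P u)) x y"
      using wN_props(3)[OF S(1) N xy] rs[OF xy] by simp
  qed
  then have "evac_of lam N T ?S" unfolding evac_of_def using S k by (auto simp: t_def)
  then show ?thesis by blast
qed

definition evac :: "nat list \<Rightarrow> nat \<Rightarrow> tableau \<Rightarrow> tableau" where
  "evac lam N T = (SOME S. evac_of lam N T S)"

lemma evac_props:
  assumes T: "T \<in> SYT lam" and N: "N \<le> sum_list lam"
  shows "evac lam N T \<in> SYT lam" "keq (rc N (wN N T)) (wN N (evac lam N T))"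
    "\<And>x. x \<in> {N + 1..sum_list lam} \<Longrightarrow> row_index (evac lam N T) x = row_index T x"
  using someI_ex[OF evac_ex[OF T N]] unfolding evac_of_def evac_def by auto

text \<open>Up to Knuth moves the word is reversed and complemented twice; uniqueness of the tableau
  in its class turns the equivalence into an equality.\<close>

lemma evac_evac:
  assumes T: "T \<in> SYT lam" and N: "N \<le> sum_list lam"
  shows "evac lam N (evac lam N T) = T"
proof -
  note E = evac_props[OF T N] and E2 = evac_props[OF evac_props(1)[OF T N] N]
  have w: "set (wN N T) = {1..N}" using wN_props(2)[OF T N] .
  have "keq (rc N (rc N (wN N T))) (rc N (wN N (evac lam N T)))"
    by (rule keq_rc[OF E(2)]) (use set_rc[OF w] in simp)
  then have "keq (wN N T) (rc N (wN N (evac lam N T)))" using rc_rc[of "wN N T" N] w by simp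
  then have "keq (wN N T) (wN N (evac lam N (evac lam N T)))" using E2(2) keq_trans by blast
  then show ?thesis using wN_unique[OF E2(1) T N keq_sym] E2(3) E(3) by simp
qed

text \<open>The exchanged letters have \<open>b\<close> between them, so they are never
  \<open>d\<close> and \<open>d+1\<close>. Descents can therefore be read off any word of the Knuth
  class.\<close>

lemma kmove_descent:
  assumes "kmove w w'" "distinct w" "d \<in> set w" "Suc d \<in> set w"
  shows "bef w (Suc d) d \<longleftrightarrow> bef w' (Suc d) d"
proof -
  obtain P Q a b c where K: "kpos (set w) P Q a b c"
    and b: "\<And>x y. x \<in> set w \<Longrightarrow> y \<in> set w \<Longrightarrow> bef w x y \<longleftrightarrow> P x < P y"
    "\<And>x y. x \<in> set w \<Longrightarrow> y \<in> set w \<Longrightarrow> bef w' x y \<longleftrightarrow> Q x < Q y"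
    using kmove_kpos[OF assms(1,2)] by blast
  have "a < b" "b < c" using K unfolding kpos_def by auto
  then have "{Suc d, d} \<noteq> {a, c}" by (auto simp: doubleton_eq_iff)
  then show ?thesis using kpos_swap_iff[OF K, of "Suc d" d] b assms(3,4) by simp
qed

lemma keq_descent:
  "keq w w' \<Longrightarrow> distinct w \<Longrightarrow> d \<in> set w \<Longrightarrow> Suc d \<in> set w \<Longrightarrow> bef w (Suc d) d \<longleftrightarrow> bef w' (Suc d) d"
proof (induction rule: equivclp_induct)
  case (step v w')
  have dx: "distinct v" "set v = set w" using step keq_distinct[of w v] keq_set[of w v] by auto
  have dw: "distinct w'" "set w' = set w" using dx step(2) kmove_mset mset_eq_imp_distinct_iff mset_eq_setD by blast+
  have "bef v (Suc d) d \<longleftrightarrow> bef w' (Suc d) d"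
    using step(2) kmove_descent[of v w' d] kmove_descent[of w' v d] dx dw step.prems by auto
  then show ?case using step.IH step.prems by blast
qed auto

lemma evac_descents:
  assumes T: "T \<in> SYT lam" and N: "N \<le> sum_list lam"
  shows "descents N (row_index (evac lam N T)) = (\<lambda>d. N - d) ` descents N (row_index T)"
proof -
  note E = evac_props[OF T N]
  note W = wN_props[OF T N] and W' = wN_props[OF E(1) N]
  let ?r = "row_index T" and ?s = "row_index (evac lam N T)"
  have R: "set (rc N (wN N T)) = {1..N}" "distinct (rc N (wN N T))" using set_rc distinct_rc W by auto
  have *: "?s d < ?s (Suc d) \<longleftrightarrow> ?r (N - d) < ?r (Suc (N - d))" if d: "1 \<le> d" "d < N" for d
  proof -
    have "?s d < ?s (Suc d) \<longleftrightarrow> bef (wN N (evac lam N T)) (Suc d) d"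
      using W'(3)[of "Suc d" d] d by (simp add: rel_of_down)
    also have "\<dots> \<longleftrightarrow> bef (rc N (wN N T)) (Suc d) d"
      using keq_descent[OF E(2) R(2), of d] R(1) d by auto
    also have "\<dots> \<longleftrightarrow> bef (rc N (wN N T)) (N + 1 - (N - d)) (N + 1 - (Suc (N - d)))"
      using d by (simp add: Suc_diff_le)
    also have "\<dots> \<longleftrightarrow> bef (wN N T) (Suc (N - d)) (N - d)"
      using W(2) d by (intro bef_rc) auto
    also have "\<dots> \<longleftrightarrow> ?r (N - d) < ?r (Suc (N - d))"
      using W(3)[of "Suc (N - d)" "N - d"] d by (simp add: rel_of_down)
    finally show ?thesis .
  qed
  show ?thesis
  proof (intro set_eqI iffI)
    fix d assume "d \<in> descents N ?s"
    then show "d \<in> (\<lambda>d. N - d) ` descents N ?r"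
      using *[of d] by (intro image_eqI[of _ _ "N - d"]) (auto simp: descents_def)
  next
    fix d assume "d \<in> (\<lambda>d. N - d) ` descents N ?r"
    then obtain e where e: "d = N - e" "e \<in> descents N ?r" by blast
    then show "d \<in> descents N ?s" using *[of "N - e"] by (auto simp: descents_def)
  qed
qed

lemma wN_map_sg:
  "a \<le> b \<Longrightarrow> b \<le> N \<Longrightarrow> wN N (map (map (sg a b)) T) = map (sg a b) (wN N T)"
proof -
  assume "a \<le> b" "b \<le> N"
  then have "(\<lambda>x. sg a b x \<le> N) = (\<lambda>x. x \<le> N)" by (auto simp: sg_def fun_eq_iff)
  then show ?thesis unfolding wN_def row_map filter_map comp_def by simp
qed

text \<open>\<open>edgew_rc\<close> gives the reversed edge between words. Carried over to the
  reading word of the evacuated target, it ends in a word equivalent to that of the evacuated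
  source. By uniqueness the tableaux coincide, since the cycles fix all letters above
  \<open>N\<close>.\<close>

lemma evac_edge:
  assumes e: "(T, (a, b), T') \<in> edges (CS lam)" and N: "N \<le> sum_list lam" "b \<le> N"
  shows "(evac lam N T', (N + 1 - b, N + 1 - a), evac lam N T) \<in> edges (CS lam)"
proof -
  obtain i m p where ab: "a = i" "b = i + 2 * m" and T: "T \<in> SYT lam" and i: "1 \<le> i" "i + 2 * m \<le> sum_list lam"
    and er: "edr (row_index T) i m p" and T'_def: "T' = map (map (sg (i + p) (i + m + p))) T"
    using e unfolding CS_edges by auto
  note T' = edge_target[OF T er i, folded T'_def]
  have iN: "i + 2 * m \<le> N" using N ab by simp
  have pm: "p \<le> m" "1 \<le> m" using er unfolding edr_def by auto
  let ?S = "evac lam N T'"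
  note E = evac_props[OF T N(1)] and E' = evac_props[OF T'(1) N(1)]
  have wT': "wN N T' = map (sg (i + p) (i + m + p)) (wN N T)"
    unfolding T'_def by (rule wN_map_sg) (use iN pm in auto)
  then have "edgew (wN N T) i m (wN N T')"
    unfolding edgew_def using wN_dyck_at(1)[OF T N(1) i(1) iN] er by blast
  then have ew: "edgew (rc N (wN N T')) (N + 1 - (i + 2 * m)) m (rc N (wN N T))"
    by (rule edgew_rc) (use wN_props[OF T N(1)] i iN in auto)
  define i' where "i' = N + 1 - (i + 2 * m)"
  have i': "1 \<le> i'" "i' + 2 * m \<le> N" "N + 1 - a = i' + 2 * m" "N + 1 - b = i'" using i iN ab unfolding i'_def by auto
  have R: "set (rc N (wN N T')) = {1..N}" "distinct (rc N (wN N T'))"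
    using set_rc distinct_rc wN_props[OF T'(1) N(1)] by auto
  obtain v where v: "edgew (wN N ?S) i' m v" "keq (rc N (wN N T)) v"
    using keq_edgew[OF E'(2) R(2) _ ew[folded i'_def]] R(1) i' by auto
  then obtain p' where p': "dyck_at (pos (wN N ?S)) i' m p'" "v = map (sg (i' + p') (i' + m + p')) (wN N ?S)"
    unfolding edgew_def by blast
  have er': "edr (row_index ?S) i' m p'" using p'(1) wN_dyck_at(1)[OF E'(1) N(1) i'(1,2)] by blast
  have pm': "p' \<le> m" using er' unfolding edr_def by auto
  define S' where "S' = map (map (sg (i' + p') (i' + m + p'))) ?S"
  have i'n: "i' + 2 * m \<le> sum_list lam" using i' N by simp
  note S' = edge_target[OF E'(1) er' i'(1) i'n, folded S'_def]
  have "wN N S' = v" unfolding S'_def p'(2) by (rule wN_map_sg) (use i' pm' in auto)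
  then have "keq (wN N S') (wN N (evac lam N T))" using v(2) E(2) keq_trans keq_sym by metis
  then have "S' = evac lam N T"
  proof (rule wN_unique[OF S'(1) E(1) N(1)])
    fix x assume x: "x \<in> {N + 1..sum_list lam}"
    then have c: "cyc (i' + p') (i' + m + p') x = x" "cyc (i + p) (i + m + p) x = x"
      using i' pm' iN pm unfolding cyc_def by auto
    show "row_index S' x = row_index (evac lam N T) x"
      using S'(2)[of x] T'(2)[of x] E(3)[OF x] E'(3)[OF x] x c by simp
  qed
  then show ?thesis unfolding CS_edges i'(3,4)
    using E'(1) i' i'n er' S'_def by blast
qed

lemma CS_edge_bounds:
  "(T, (a, b), T') \<in> edges (CS lam) \<Longrightarrow> 1 \<le> a \<and> a < b \<and> b \<le> sum_list lam \<and> T \<in> SYT lam \<and> T' \<in> SYT lam"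
  unfolding CS_edges_row_index by (auto simp: edr_def)

text \<open>\<open>G\<close> stands for the skeleton with labels cut off at \<open>N\<close>, so
  that both halves of (A4) are instances. As evacuation is an involution, transporting edges in one
  direction suffices.\<close>

lemma evac_iso:
  assumes N: "N \<le> sum_list lam"
    and G: "verts G = SYT lam" "\<And>T. T \<in> SYT lam \<Longrightarrow> vlab G T = comp_of_set N (descents N (row_index T))"
    "\<And>v I w. (v, I, w) \<in> edges G \<longleftrightarrow> (v, I, w) \<in> edges (CS lam) \<and> snd I \<le> N"
  shows "lgraph_iso (L_op N G) G"
  unfolding lgraph_iso_def
proof (intro exI[of _ "evac lam N"] conjI ballI allI)
  show "bij_betw (evac lam N) (verts (L_op N G)) (verts G)"
    unfolding L_op_def G(1) lgraph.simps
    by (rule bij_betw_byWitness[of _ "evac lam N"]) (use evac_evac[OF _ N] evac_props(1)[OF _ N] in auto)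
next
  fix v assume "v \<in> verts (L_op N G)"
  then have v: "v \<in> SYT lam" by (simp add: L_op_def G(1))
  show "vlab G (evac lam N v) = vlab (L_op N G) v"
    using G(2)[OF v] G(2)[OF evac_props(1)[OF v N]] evac_descents[OF v N] rev_comp[OF descents_sub, of N "row_index v"]
    by (simp add: L_op_def)
next
  fix v w I assume "v \<in> verts (L_op N G)" "w \<in> verts (L_op N G)"
  then have v: "v \<in> SYT lam" "w \<in> SYT lam" by (auto simp: L_op_def G(1))
  have L: "(v, I, w) \<in> edges (L_op N G) \<longleftrightarrow>
     (\<exists>a b. I = (N + 1 - b, N + 1 - a) \<and> (w, (a, b), v) \<in> edges (CS lam) \<and> b \<le> N)"
    unfolding L_op_def by (auto simp: G(3))
  show "(v, I, w) \<in> edges (L_op N G) \<longleftrightarrow> (evac lam N v, I, evac lam N w) \<in> edges G"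
  proof
    assume "(v, I, w) \<in> edges (L_op N G)"
    then obtain a b where ab: "I = (N + 1 - b, N + 1 - a)" "(w, (a, b), v) \<in> edges (CS lam)" "b \<le> N" unfolding L by blast
    then show "(evac lam N v, I, evac lam N w) \<in> edges G"
      using evac_edge[OF ab(2) N ab(3)] CS_edge_bounds[OF ab(2)] unfolding G(3) by auto
  next
    assume "(evac lam N v, I, evac lam N w) \<in> edges G"
    moreover obtain a b where I: "I = (a, b)" by (cases I)
    ultimately have ab: "(evac lam N v, (a, b), evac lam N w) \<in> edges (CS lam)" "b \<le> N" unfolding G(3) by auto
    have "(w, (N + 1 - b, N + 1 - a), v) \<in> edges (CS lam)"
      using evac_edge[OF ab(1) N ab(2)] evac_evac[OF _ N] v by simp
    moreover have "I = (N + 1 - (N + 1 - a), N + 1 - (N + 1 - b))" "N + 1 - a \<le> N"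
      using I CS_edge_bounds[OF ab(1)] ab(2) by auto
    ultimately show "(v, I, w) \<in> edges (L_op N G)" unfolding L by blast
  qed
qed

lemma CS_A4: "A4 (sum_list lam) (CS lam)"
  unfolding A4_def
proof
  let ?n = "sum_list lam"
  have b: "snd I \<le> ?n" if "(v, I, w) \<in> edges (CS lam)" for v I w
    using CS_edge_bounds[of v "fst I" "snd I" w lam] that by simp
  show "lgraph_iso (L_op ?n (CS lam)) (CS lam)"
  proof (rule evac_iso[of ?n])
    show "verts (CS lam) = SYT lam" by (simp add: CS_def)
    show "vlab (CS lam) T = comp_of_set ?n (descents ?n (row_index T))" if "T \<in> SYT lam" for T
      using Des_descents[OF that] by (simp add: CS_def)
  qed (use b in auto)
  show "lgraph_iso (L_op (?n - 1) (restrict_last ?n (CS lam))) (restrict_last ?n (CS lam))"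
  proof (rule evac_iso[of "?n - 1"])
    show "verts (restrict_last ?n (CS lam)) = SYT lam" by (simp add: restrict_last_def CS_def)
    fix T assume T: "T \<in> SYT lam"
    have "descents ?n (row_index T) \<inter> {1..<?n - 1} = descents (?n - 1) (row_index T)"
      by (auto simp: descents_def)
    then show "vlab (restrict_last ?n (CS lam)) T = comp_of_set (?n - 1) (descents (?n - 1) (row_index T))"
      using drop_last_comp[OF descents_sub, of ?n "row_index T"] Des_descents[OF T]
      by (simp add: restrict_last_def CS_def)
  next
    fix v I w
    show "(v, I, w) \<in> edges (restrict_last ?n (CS lam)) \<longleftrightarrow> (v, I, w) \<in> edges (CS lam) \<and> snd I \<le> ?n - 1"
    proof -
      have "?n \<notin> ivl I \<longleftrightarrow> snd I \<le> ?n - 1" if "(v, I, w) \<in> edges (CS lam)"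
        using CS_edge_bounds[of v "fst I" "snd I" w lam] that by (auto simp: ivl_def)
      then show ?thesis by (auto simp: restrict_last_def)
    qed
  qed simp
qed

subsection \<open>The types of edges\<close>

text \<open>The case of a new descent at \<open>i+2m\<close>. This letter changes its row only for
  \<open>p = m\<close>, when it takes the row of \<open>i+m\<close>; the descent is new if there was
  none before and this row is below that of \<open>i+2m+1\<close>.\<close>

definition typ2 :: "nat \<Rightarrow> (nat \<Rightarrow> nat) \<Rightarrow> nat \<Rightarrow> nat \<Rightarrow> nat \<Rightarrow> bool" where
  "typ2 n r i m p \<longleftrightarrow> p = m \<and> i + 2 * m < n \<and> r (i + 2 * m + 1) \<le> r (i + 2 * m) \<and> r (i + m) < r (i + 2 * m + 1)"

text \<open>The case of a lost descent at \<open>i-1\<close>. The letter \<open>i\<close> is moved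
  only for \<open>p = 0\<close>, when it takes the row of \<open>i+1\<close>; the descent is lost if
  this is not above the row of \<open>i-1\<close>.\<close>

definition typ3 :: "(nat \<Rightarrow> nat) \<Rightarrow> nat \<Rightarrow> nat \<Rightarrow> nat \<Rightarrow> bool" where
  "typ3 r i m p \<longleftrightarrow> p = 0 \<and> 2 \<le> i \<and> r (i - 1) < r i \<and> r (i + 1) \<le> r (i - 1)"

lemma edr_x1: "edr r i m p \<Longrightarrow> i \<le> d \<Longrightarrow> d < i + m \<Longrightarrow> r (d + 1) \<le> r d"
  using edr_x[of r i m p "d - i" "d - i + 1"] by simp

lemma edr_y1: "edr r i m p \<Longrightarrow> i + m < d \<Longrightarrow> d < i + 2 * m \<Longrightarrow> r (d + 1) \<le> r d"
  using edr_y[of r i m p "d - (i + m)" "d - (i + m) + 1"] by simp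

lemma edr_mid:
  assumes e: "edr r i m p" shows "r (i + m) < r (i + m + 1)"
proof (cases "p = m")
  case True
  then have "r (i + 0) < r (i + m + 1 + 0)" using e unfolding edr_def by force
  moreover have "r (i + m) \<le> r (i + 0)" using edr_x[OF e, of 0 m] by simp
  ultimately show ?thesis by simp
next
  case False
  then have "r (i + m) < r (i + m + m)" using e unfolding edr_def by auto
  also have "\<dots> \<le> r (i + m + 1)" using edr_y[OF e, of 1 m] e unfolding edr_def by simp
  finally show ?thesis .
qed

text \<open>Inside the interval there is one \<open>1\<close> less, so the descent moves from
  \<open>i+m\<close> to \<open>i+m-1\<close>. Otherwise a change is possible only at the two
  borders, where a letter of the interval meets one outside.\<close>

lemma descents_edge:
  assumes e: "edr r i m p" and i: "1 \<le> i" "i + 2 * m \<le> n"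
  defines "s \<equiv> \<lambda>x. r (cyc (i + p) (i + m + p) x)"
  shows "flat (descents n r) i m"
    "descents n s = descents n r - {i + m} - (if typ3 r i m p then {i - 1} else {}) \<union>
       ({i + m - 1} \<union> (if typ2 n r i m p then {i + 2 * m} else {}))"
proof -
  note E = e[unfolded edr_def]
  have pm: "1 \<le> m" "p \<le> m" using E by auto
  have in_r: "r d < r (Suc d) \<longleftrightarrow> d = i + m" if d: "i \<le> d" "d < i + 2 * m" for d
  proof -
    consider "d < i + m" | "d = i + m" | "i + m < d" by linarith
    then show ?thesis
    proof cases
      case 1
      then show ?thesis using edr_x1[OF e d(1)] by simp
    next
      case 2 then show ?thesis using edr_mid[OF e] by simp
    next
      case 3
      then show ?thesis using edr_y1[OF e 3 d(2)] by simp
    qed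
  qed
  show "flat (descents n r) i m" unfolding flat_def descents_def using in_r i pm by auto
  have sx: "s (i + q) = (if q < p then r (i + q) else r (i + q + 1))" if "q < m" for q
    unfolding s_def cyc_def using that pm by auto
  have sy: "s (i + m + q) = (if q < p then r (i + m + q + 1) else if q = p then r (i + p) else r (i + m + q))" for q
    unfolding s_def cyc_def using pm by auto
  have so: "s x = r x" if "x < i \<or> i + 2 * m < x" for x
    unfolding s_def cyc_def using that pm by auto
  have s1: "s (i + q + 1) \<le> s (i + q)" if "q + 1 < m" for q
  proof -
    have "r (i + q + 1) \<le> r (i + q)" "r (i + (q + 1) + 1) \<le> r (i + (q + 1))" using E that by auto
    then show ?thesis using sx[of q] sx[of "q + 1"] that by (auto simp: add.assoc)
  qed
  have s2: "s (i + m + q + 1) \<le> s (i + m + q)" if "q < m" for q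
  proof -
    consider "q + 1 < p" | "q + 1 = p" | "q = p" | "p < q" by linarith
    then show ?thesis
    proof cases
      case 1
      then have "r (i + m + (q + 1) + 1) \<le> r (i + m + (q + 1))" using pm by (intro edr_y1[OF e]) auto
      then show ?thesis using sy[of q] sy[of "q + 1"] 1 by (simp add: add.assoc)
    next
      case 2
      then have "r (i + q) < r (i + m + 1 + q)" "r (i + q + 1) \<le> r (i + q)" using E that by auto
      then show ?thesis using sy[of q] sy[of "q + 1"] 2 by (auto simp: add.assoc)
    next
      case 3
      then have "r (i + m + 1 + p) \<le> r (i + p)" using E that by auto
      then show ?thesis using sy[of q] sy[of "q + 1"] 3 by (simp add: add.assoc add.left_commute)
    next
      case 4
      then have "r (i + m + q + 1) \<le> r (i + m + q)" using E that by auto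
      then show ?thesis using sy[of q] sy[of "q + 1"] 4 by (simp add: add.assoc)
    qed
  qed
  have s3: "s (i + m - 1) < s (i + m)"
  proof -
    have m1: "i + m - 1 = i + (m - 1)" "m - 1 < m" using pm by auto
    have 0: "s (i + m) = (if p = 0 then r i else r (i + m + 1))" using sy[of 0] by simp
    have a: "r (i + (m - 1)) \<le> r (i + 0)" "r (i + m) \<le> r (i + 0)"
      using edr_x[OF e, of 0 "m - 1"] edr_x[OF e, of 0 m] pm by auto
    consider "p = m" | "p < m" "p \<noteq> 0" | "p = 0" "p < m" using pm by linarith
    then show ?thesis
    proof cases
      case 1
      then have "r (i + 0) < r (i + m + 1 + 0)" using E by force
      then show ?thesis using 0 a sx[OF m1(2)] m1(1) 1 pm by simp
    next
      case 2
      then have "r (i + 0) < r (i + m + 1 + 0)" using E by force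
      then show ?thesis using 0 a sx[OF m1(2)] m1(1) 2 by (auto simp: add.assoc)
    next
      case 3
      then have "r (i + m) < r (i + m + m)" "r (i + m + m) \<le> r (i + m + 1)" "r (i + m + 1 + 0) \<le> r (i + 0)"
        using E edr_y[OF e, of 1 m] pm by auto
      then show ?thesis using 0 a sx[OF m1(2)] m1(1) 3 pm by (auto simp: add.assoc)
    qed
  qed
  have in_s: "s d < s (Suc d) \<longleftrightarrow> d = i + m - 1" if d: "i \<le> d" "d < i + 2 * m" for d
  proof -
    consider "d < i + m - 1" | "d = i + m - 1" | "i + m - 1 < d" by linarith
    then show ?thesis
    proof cases
      case 1
      then have "s (i + (d - i) + 1) \<le> s (i + (d - i))" using d by (intro s1) auto
      then show ?thesis using 1 d by simp
    next
      case 2 then show ?thesis using s3 pm i by simp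
    next
      case 3
      then have "s (i + m + (d - (i + m)) + 1) \<le> s (i + m + (d - (i + m)))" using d by (intro s2) auto
      then show ?thesis using 3 by simp
    qed
  qed
  have left: "s (i - 1) < s i \<longleftrightarrow> r (i - 1) < r i \<and> \<not> typ3 r i m p" if "2 \<le> i"
  proof -
    have "s (i - 1) = r (i - 1)" by (rule so) (use i in auto)
    moreover have "s i = (if p = 0 then r (i + 1) else r i)" using sx[of 0] pm by simp
    moreover have "r (i + 1) \<le> r i" using E pm by (metis add_0_right less_eq_Suc_le One_nat_def)
    ultimately show ?thesis using that unfolding typ3_def by auto
  qed
  have right: "s (i + 2 * m) < s (Suc (i + 2 * m)) \<longleftrightarrow> r (i + 2 * m) < r (Suc (i + 2 * m)) \<or> typ2 n r i m p" if "i + 2 * m < n"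
  proof -
    have "s (Suc (i + 2 * m)) = r (Suc (i + 2 * m))" by (rule so) auto
    moreover have "s (i + m + m) = (if p = m then r (i + m) else r (i + m + m))" using sy[of m] pm by simp
    moreover have "p = m \<Longrightarrow> r (i + m) < r (i + m + m)"
    proof -
      assume "p = m"
      obtain q where q: "m = Suc q" using pm by (cases m) auto
      then have "r (i + q) < r (i + m + 1 + q)" using E \<open>p = m\<close> by auto
      moreover have "r (i + m) \<le> r (i + q)" using edr_x[OF e, of q m] q by simp
      ultimately show ?thesis using q by simp
    qed
    ultimately show ?thesis using that unfolding typ2_def by (auto simp: mult_2 add.assoc)
  qed
  show "descents n s = descents n r - {i + m} - (if typ3 r i m p then {i - 1} else {}) \<union>
       ({i + m - 1} \<union> (if typ2 n r i m p then {i + 2 * m} else {}))" (is "_ = ?R")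
  proof (intro set_eqI)
    fix d
    have t3: "typ3 r i m p \<Longrightarrow> 2 \<le> i" and t2: "typ2 n r i m p \<Longrightarrow> i + 2 * m < n"
      unfolding typ3_def typ2_def by auto
    consider "d + 1 < i" | "d + 1 = i" | "i \<le> d" "d < i + 2 * m" | "d = i + 2 * m" | "i + 2 * m < d" by linarith
    then show "d \<in> descents n s \<longleftrightarrow> d \<in> ?R"
    proof cases
      case 1
      then show ?thesis using so[of d] so[of "Suc d"] t3 i pm by (auto simp: descents_def)
    next
      case 2
      then have d: "d = i - 1" "Suc d = i" by auto
      show ?thesis
      proof (cases "2 \<le> i")
        case True
        then show ?thesis using left d i pm by (auto simp: descents_def)
      next
        case False
        then have "d = 0" using d by simp
        then show ?thesis using pm i t3 False by (auto simp: descents_def)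
      qed
    next
      case 3
      then show ?thesis using in_r[of d] in_s[of d] i pm t3 by (auto simp: descents_def)
    next
      case 4
      then show ?thesis using right i pm t2 by (auto simp: descents_def)
    next
      case 5
      then show ?thesis using so[of d] so[of "Suc d"] i pm by (auto simp: descents_def)
    qed
  qed
qed

text \<open>The types differ in the change of length, and only in type III does the source fail to
  dominate the target. Later arguments recognize a type by one of these two signs.\<close>

lemma edge_types:
  assumes T: "T \<in> SYT lam" "T' \<in> SYT lam" and i: "1 \<le> i" "i + 2 * m \<le> sum_list lam"
    and e: "edr (row_index T) i m p"
    and r: "\<forall>x\<in>{1..sum_list lam}. row_index T' x = row_index T (cyc (i + p) (i + m + p) x)"
  shows "A0_ok (Des T) (i, i + 2 * m)"
    "typ2 (sum_list lam) (row_index T) i m p \<Longrightarrow> edge_type 2 (Des T) (i, i + 2 * m) (Des T') \<and>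
      length (Des T') = Suc (length (Des T)) \<and> dominates (Des T) (Des T')"
    "typ3 (row_index T) i m p \<Longrightarrow> edge_type 3 (Des T) (i, i + 2 * m) (Des T') \<and>
      Suc (length (Des T')) = length (Des T) \<and> \<not> dominates (Des T) (Des T')"
    "\<not> typ2 (sum_list lam) (row_index T) i m p \<Longrightarrow> \<not> typ3 (row_index T) i m p \<Longrightarrow>
      edge_type 1 (Des T) (i, i + 2 * m) (Des T') \<and>
      length (Des T') = length (Des T) \<and> dominates (Des T) (Des T')"
proof -
  let ?n = "sum_list lam" and ?r = "row_index T"
  let ?D = "descents ?n ?r"
  define D' where "D' = descents ?n (row_index T')"
  have D'_eq: "D' = descents ?n (\<lambda>x. ?r (cyc (i + p) (i + m + p) x))"
    unfolding D'_def by (rule descents_cong) (use r in auto)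
  note f = descents_edge(1)[OF e i] and D' = descents_edge(2)[OF e i, folded D'_eq]
  have c: "Des T = comp_of_set ?n ?D" "Des T' = comp_of_set ?n D'"
    using Des_descents T unfolding D'_def by auto
  note sub = descents_sub[of ?n ?r]
  have m: "1 \<le> m" using e unfolding edr_def by simp
  show "A0_ok (Des T) (i, i + 2 * m)" unfolding c A0_ok_flat[OF sub] using f i by blast
  show "edge_type 2 (Des T) (i, i + 2 * m) (Des T') \<and>
      length (Des T') = Suc (length (Des T)) \<and> dominates (Des T) (Des T')" if t: "typ2 ?n ?r i m p"
  proof -
    have "\<not> typ3 ?r i m p" using t m unfolding typ2_def typ3_def by auto
    then have "D' = ?D - {i + m} \<union> {i + m - 1, i + 2 * m}" using D' t by auto
    moreover have "i + 2 * m < ?n" "i + 2 * m \<notin> ?D" using t unfolding typ2_def descents_def by auto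
    ultimately show ?thesis unfolding c using comp_change_2[OF sub f] by blast
  qed
  show "edge_type 3 (Des T) (i, i + 2 * m) (Des T') \<and>
      Suc (length (Des T')) = length (Des T) \<and> \<not> dominates (Des T) (Des T')" if t: "typ3 ?r i m p"
  proof -
    have "\<not> typ2 ?n ?r i m p" using t m unfolding typ2_def typ3_def by auto
    then have "D' = ?D - {i - 1, i + m} \<union> {i + m - 1}" using D' t by auto
    moreover have "i - 1 \<in> ?D" using t i m unfolding typ3_def descents_def by auto
    ultimately show ?thesis unfolding c using comp_change_3[OF sub f i(2)] by blast
  qed
  show "edge_type 1 (Des T) (i, i + 2 * m) (Des T') \<and>
      length (Des T') = length (Des T) \<and> dominates (Des T) (Des T')"
    if t: "\<not> typ2 ?n ?r i m p" "\<not> typ3 ?r i m p"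
  proof -
    have "D' = ?D - {i + m} \<union> {i + m - 1}" using D' t by simp
    then show ?thesis unfolding c using comp_change_1[OF sub f i(2)] by blast
  qed
qed

lemma CS_simps [simp]: "verts (CS lam) = SYT lam" "vlab (CS lam) = Des"
  by (simp_all add: CS_def)

lemma dyck_r:
  assumes T: "T \<in> SYT lam" and i: "1 \<le> i" "i + 2 * m \<le> sum_list lam"
  shows "(\<exists>p. edr (row_index T) i m p) \<longleftrightarrow> 1 \<le> m \<and> (\<forall>q<m. row_index T (i + q + 1) \<le> row_index T (i + q)) \<and>
     (\<forall>q. 1 \<le> q \<longrightarrow> q < m \<longrightarrow> row_index T (i + m + q + 1) \<le> row_index T (i + m + q)) \<and>
     (\<forall>q. 1 \<le> q \<longrightarrow> q \<le> m \<longrightarrow> row_index T (i + q) < row_index T (i + m + q))"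
proof -
  let ?P = "pos (row T)" and ?r = "row_index T"
  have up: "?P x < ?P y \<longleftrightarrow> ?r y \<le> ?r x" if "i \<le> x" "x < y" "y \<le> i + 2 * m" for x y
    using pos_row[OF T, of x y] that i rel_of_up[of x y ?r] by auto
  have down: "?P y < ?P x \<longleftrightarrow> ?r x < ?r y" if "i \<le> x" "x < y" "y \<le> i + 2 * m" for x y
    using pos_row[OF T, of y x] that i rel_of_down[of x y ?r] by auto
  have 1: "?P (i + q) < ?P (i + q + 1) \<longleftrightarrow> ?r (i + q + 1) \<le> ?r (i + q)" if "q < m" for q
    using that by (intro up) auto
  have 2: "?P (i + m + q) < ?P (i + m + q + 1) \<longleftrightarrow> ?r (i + m + q + 1) \<le> ?r (i + m + q)" if "q < m" for q
    using that by (intro up) auto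
  have 4: "?P (i + m + q) < ?P (i + q) \<longleftrightarrow> ?r (i + q) < ?r (i + m + q)" if "1 \<le> m" "q \<le> m" for q
    using that by (intro down) auto
  have "set (row T) = {1..sum_list lam}" using SYT_basic(3)[OF T] set_row[of T] by blast
  then have "inj_on ?P {i..i + 2 * m}" using i by (intro inj_on_subset[OF pos_inj]) auto
  then have "(\<exists>p. edr ?r i m p) \<longleftrightarrow> dyck ?P i m"
    using dyck_at_ex dyck_at_dyck dyck_at_edr[OF T i] by blast
  also have "\<dots> \<longleftrightarrow> 1 \<le> m \<and> (\<forall>q<m. ?r (i + q + 1) \<le> ?r (i + q)) \<and>
     (\<forall>q. 1 \<le> q \<longrightarrow> q < m \<longrightarrow> ?r (i + m + q + 1) \<le> ?r (i + m + q)) \<and>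
     (\<forall>q. 1 \<le> q \<longrightarrow> q \<le> m \<longrightarrow> ?r (i + q) < ?r (i + m + q))"
    unfolding dyck_def by (intro conj_cong refl all_cong imp_cong) (use 1 2 4 in auto)
  finally show ?thesis .
qed

text \<open>Incoming edges are found as the outgoing edges of the evacuated tableau.\<close>
lemma in_edge:
  assumes T: "T \<in> SYT lam" and j: "1 \<le> j" "1 \<le> M" "j + 2 * M \<le> sum_list lam"
    and r1: "\<And>q. 1 \<le> q \<Longrightarrow> q < M \<Longrightarrow> row_index T (j + M - q) \<le> row_index T (j + M - q - 1)"
    and r2: "\<And>q. q < M \<Longrightarrow> row_index T (j + 2 * M - q) \<le> row_index T (j + 2 * M - q - 1)"
    and r3: "\<And>s. s < M \<Longrightarrow> row_index T (j + s) < row_index T (j + M + s)"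
  shows "\<exists>u. (u, (j, j + 2 * M), T) \<in> edges (CS lam)"
proof -
  let ?n = "sum_list lam" and ?r = "row_index T" and ?S = "evac lam (sum_list lam) T"
  note E = evac_props[OF T le_refl] and W = wN_props[OF T le_refl] and W' = wN_props[OF evac_props(1)[OF T le_refl] le_refl]
  define i where "i = ?n + 1 - (j + 2 * M)"
  have i: "1 \<le> i" "i + 2 * M \<le> ?n" using j unfolding i_def by auto
  have R: "distinct (rc ?n (wN ?n T))" "set (rc ?n (wN ?n T)) = {1..?n}" using distinct_rc set_rc W by auto
  define Q where "Q = pos (rc ?n (wN ?n T))"
  have Q: "Q (i + s) < Q (i + t) \<longleftrightarrow> rel_of ?r (j + 2 * M - t) (j + 2 * M - s)" if "s \<le> 2 * M" "t \<le> 2 * M" for s t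
  proof -
    have e: "i + s = ?n + 1 - (j + 2 * M - s)" "i + t = ?n + 1 - (j + 2 * M - t)"
      and b: "j + 2 * M - s \<in> {1..?n}" "j + 2 * M - t \<in> {1..?n}"
      using that j unfolding i_def by auto
    have "Q (i + s) < Q (i + t) \<longleftrightarrow> pos (wN ?n T) (j + 2 * M - t) < pos (wN ?n T) (j + 2 * M - s)"
      unfolding Q_def e by (rule pos_rc[OF W(1,2) b])
    also have "\<dots> \<longleftrightarrow> bef (wN ?n T) (j + 2 * M - t) (j + 2 * M - s)"
      using bef_pos[OF W(1)] b W(2) by blast
    finally show ?thesis using W(3)[OF b(2,1)] by simp
  qed
  \<comment> \<open>In the target the \<open>1\<close>s are \<open>j, ..., j+M-1\<close> and the
    \<open>2\<close>s are \<open>j+M, ..., j+2M\<close>. Mirrored, \<open>r2\<close> orders the new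
    \<open>1\<close>s, \<open>r1\<close> the new \<open>2\<close>s, and \<open>r3\<close> compares
    the two.\<close>
  have "dyck Q i M"
    unfolding dyck_def
  proof (intro conjI allI impI)
    fix q assume q: "q < M"
    show "Q (i + q) < Q (i + q + 1)"
      using Q[of q "q + 1"] r2[OF q] q j rel_of_up[of "j + 2 * M - (q + 1)" "j + 2 * M - q" ?r] by simp
  next
    fix q assume q: "1 \<le> q" "q < M"
    have e: "j + 2 * M - (M + q + 1) = j + M - q - 1" "j + 2 * M - (M + q) = j + M - q" using q by auto
    show "Q (i + M + q) < Q (i + M + q + 1)"
      using Q[of "M + q" "M + q + 1", unfolded e] r1[OF q] q j rel_of_up[of "j + M - q - 1" "j + M - q" ?r]
      by (simp add: add.assoc)
  next
    fix q assume q: "1 \<le> q" "q \<le> M"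
    have e: "j + 2 * M - q = j + M + (M - q)" "j + 2 * M - (M + q) = j + (M - q)" using q by auto
    show "Q (i + M + q) < Q (i + q)"
      using Q[of "M + q" q, unfolded e] r3[of "M - q"] q j rel_of_down[of "j + (M - q)" "j + M + (M - q)" ?r]
      by (simp add: add.assoc)
  qed (use j in simp)
  then have "dyck (pos (wN ?n ?S)) i M"
    unfolding Q_def using keq_dyck[OF E(2) R(1), of i M] R(2) i by auto
  moreover have "inj_on (pos (wN ?n ?S)) {i..i + 2 * M}"
    using i by (intro inj_on_subset[OF pos_inj]) (auto simp: W'(2))
  ultimately obtain p where "dyck_at (pos (wN ?n ?S)) i M p" using dyck_at_ex by blast
  then have e: "edr (row_index ?S) i M p" using wN_dyck_at(1)[OF E(1) le_refl i] by blast
  define S' where "S' = map (map (sg (i + p) (i + M + p))) ?S"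
  have "(?S, (i, i + 2 * M), S') \<in> edges (CS lam)" unfolding CS_edges S'_def using E(1) i e by blast
  from evac_edge[OF this le_refl i(2)]
  have "(evac lam ?n S', (?n + 1 - (i + 2 * M), ?n + 1 - i), T) \<in> edges (CS lam)"
    using evac_evac[OF T le_refl] by simp
  moreover have "?n + 1 - (i + 2 * M) = j" "?n + 1 - i = j + 2 * M" using j i unfolding i_def by auto
  ultimately show ?thesis by auto
qed

section \<open>Condition (A1)\<close>

lemma CS_edge_unique:
  assumes "(T, I, S) \<in> edges (CS lam)" "(T, I, S') \<in> edges (CS lam)"
  shows "S = S'"
proof -
  obtain i m p where 1: "I = (i, i + 2 * m)" "T \<in> SYT lam" "1 \<le> i" "i + 2 * m \<le> sum_list lam"
    "edr (row_index T) i m p" "S = map (map (sg (i + p) (i + m + p))) T"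
    using assms(1) unfolding CS_edges by blast
  obtain i' m' p' where 2: "I = (i', i' + 2 * m')" "edr (row_index T) i' m' p'" "S' = map (map (sg (i' + p') (i' + m' + p'))) T"
    using assms(2) unfolding CS_edges by blast
  have e: "i' = i" "m' = m" using 1(1) 2(1) by auto
  have "p' = p" using dyck_at_unique dyck_at_edr[OF 1(2-4)] 1(5) 2(2) unfolding e by blast
  then show ?thesis using 1(6) 2(3) e by simp
qed

text \<open>Seen from the target \<open>s\<close>, type III means that the comparisons extend one
  step to the left: with \<open>j-1\<close> counted as a further \<open>1\<close>, the letters
  \<open>j-1, ..., j+M-1\<close> still lie below the \<open>M+1\<close> letters \<open>2\<close> one
  by one. This makes dominance a property of the target.\<close>

lemma typ3_conv:
  assumes e: "edr r j M p" and j: "2 \<le> j"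
  defines "s \<equiv> \<lambda>x. r (cyc (j + p) (j + M + p) x)"
  assumes nd: "s j \<le> s (j - 1)"
  shows "typ3 r j M p \<longleftrightarrow> (\<forall>t\<le>M. s (j - 1 + t) < s (j + M + t))"
proof
  have M: "1 \<le> M" "p \<le> M" using e unfolding edr_def by auto
  {
    assume t: "typ3 r j M p"
    then have p: "p = 0" "r (j - 1) < r j" unfolding typ3_def by auto
    show "\<forall>t\<le>M. s (j - 1 + t) < s (j + M + t)"
    proof (intro allI impI)
      fix t assume t: "t \<le> M"
      show "s (j - 1 + t) < s (j + M + t)"
      proof (cases t)
        case 0
        then show ?thesis unfolding s_def cyc_def using p M j by simp
      next
        case (Suc u)
        have "r (j + t) < r (j + M + t)" using e t Suc p unfolding edr_def by auto
        moreover have "j - 1 + t = j + u" "j + u + 1 = j + t" using Suc j by auto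
        ultimately show ?thesis unfolding s_def cyc_def using p M Suc t by simp
      qed
    qed
  }
  {
    assume C: "\<forall>t\<le>M. s (j - 1 + t) < s (j + M + t)"
    have p: "p = 0"
    proof (rule ccontr)
      assume p: "p \<noteq> 0"
      have "s (j - 1 + p) < s (j + M + p)" using C M by simp
      moreover have "s (j + M + p) = r (j + p)" unfolding s_def cyc_def by simp
      moreover have "s (j - 1 + p) = r (j + (p - 1))" unfolding s_def cyc_def using p j M by auto
      moreover have "r (j + p) \<le> r (j + (p - 1))" using edr_x[OF e, of "p - 1" p] M by simp
      ultimately show False by simp
    qed
    have "s (j - 1 + 0) < s (j + M + 0)" using C by blast
    moreover have "s (j - 1) = r (j - 1)" "s (j + M) = r j" "s j = r (j + 1)" unfolding s_def cyc_def using p j M by auto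
    ultimately show "typ3 r j M p" unfolding typ3_def using p j nd by simp
  }
qed

text \<open>Let \<open>C M\<close> say that the \<open>M\<close> letters ending at the descent
  \<open>K = i+m\<close> lie, one by one, below the \<open>M\<close> letters from \<open>K+1\<close>
  on. An edge labelled \<open>I\<close> leaves \<open>T\<close> just if \<open>C m\<close>. An edge
  into \<open>T\<close> with label inside \<open>I\<close> has label \<open>[K+1-M, K+1+M]\<close>
  for some \<open>M < m\<close>; it exists if \<open>C M\<close>, and its source dominates just if
  \<open>C (M+1)\<close> fails. Since \<open>C 1\<close> is the descent itself, no source dominates
  just if \<open>C\<close> persists up to \<open>m\<close>.\<close>

lemma CS_A1: "A1 (CS lam)"
  unfolding A1_def CS_simps
proof (intro ballI allI impI)
  fix T I assume T: "T \<in> SYT lam" and A: "A0_ok (Des T) I"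
  let ?n = "sum_list lam" and ?r = "row_index T"
  let ?D = "descents ?n ?r"
  obtain i m where I: "I = (i, i + 2 * m)" and f: "flat ?D i m" and n: "i + 2 * m \<le> ?n"
    using A A0_ok_flat[OF descents_sub] Des_descents[OF T] by auto
  have i: "1 \<le> i" "1 \<le> m" using f unfolding flat_def by auto
  define K where "K = i + m"
  have nd: "?r (d + 1) \<le> ?r d" if "i \<le> d" "d < i + 2 * m" "d \<noteq> K" for d
  proof -
    have "d \<notin> ?D" using f that unfolding flat_def K_def by (cases "d < i + m") auto
    then show ?thesis using that i n unfolding descents_def by auto
  qed
  have KD: "K \<in> ?D" "?r K < ?r (K + 1)" using f unfolding flat_def K_def descents_def by auto
  have mono: "?r t \<le> ?r s" if "i \<le> s" "s \<le> t" "t \<le> K" for s t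
  proof (rule chain_ge[of i K ?r])
    fix q assume "i \<le> q" "q < K"
    then show "?r (q + 1) \<le> ?r q" by (intro nd) (auto simp: K_def)
  qed (use that in auto)
  define C where "C = (\<lambda>M. \<forall>s<M. ?r (K + 1 - M + s) < ?r (K + 1 + s))"
  \<comment> \<open>From \<open>i\<close> to \<open>K\<close> the rows weakly decrease, so a shorter
    stretch before \<open>K\<close> compares lower letters with the same ones after it.\<close>
  have C_mono: "C M" if "C m" "M \<le> m" for M
    unfolding C_def
  proof (intro allI impI)
    fix s assume "s < M"
    then have "?r (K + 1 - m + s) < ?r (K + 1 + s)" using that unfolding C_def by auto
    moreover have "?r (K + 1 - M + s) \<le> ?r (K + 1 - m + s)"
      by (rule mono) (use that \<open>s < M\<close> in \<open>auto simp: K_def\<close>)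
    ultimately show "?r (K + 1 - M + s) < ?r (K + 1 + s)" by simp
  qed
  have out: "(\<exists>!w. (T, I, w) \<in> edges (CS lam)) \<longleftrightarrow> C m"
  proof -
    have "(\<exists>!w. (T, I, w) \<in> edges (CS lam)) \<longleftrightarrow> (\<exists>w. (T, I, w) \<in> edges (CS lam))"
      using CS_edge_unique by blast
    also have "\<dots> \<longleftrightarrow> (\<exists>p. edr ?r i m p)" unfolding CS_edges I using T i n by auto
    also have "\<dots> \<longleftrightarrow> (\<forall>q. 1 \<le> q \<longrightarrow> q \<le> m \<longrightarrow> ?r (i + q) < ?r (i + m + q))"
    proof -
      have "?r (i + q + 1) \<le> ?r (i + q)" if "q < m" for q using that by (intro nd) (auto simp: K_def)
      moreover have "?r (i + m + q + 1) \<le> ?r (i + m + q)" if "1 \<le> q" "q < m" for q using that by (intro nd) (auto simp: K_def)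
      ultimately show ?thesis unfolding dyck_r[OF T i(1) n] using i by blast
    qed
    also have "\<dots> \<longleftrightarrow> C m"
    proof
      assume a: "\<forall>q. 1 \<le> q \<longrightarrow> q \<le> m \<longrightarrow> ?r (i + q) < ?r (i + m + q)"
      show "C m" unfolding C_def
      proof (intro allI impI)
        fix s assume "s < m"
        then show "?r (K + 1 - m + s) < ?r (K + 1 + s)" using a[rule_format, of "s + 1"] by (simp add: K_def)
      qed
    next
      assume a: "C m"
      show "\<forall>q. 1 \<le> q \<longrightarrow> q \<le> m \<longrightarrow> ?r (i + q) < ?r (i + m + q)"
      proof (intro allI impI)
        fix q assume "1 \<le> q" "q \<le> m"
        then show "?r (i + q) < ?r (i + m + q)" using a[unfolded C_def, rule_format, of "q - 1"] by (simp add: K_def)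
      qed
    qed
    finally show ?thesis .
  qed
  have inc: "dominates (Des u) (Des T) \<longleftrightarrow> \<not> C (M + 1)" "j + M = K + 1 \<and> M < m \<and> J = (j, j + 2 * M)"
    if u: "(u, J, T) \<in> edges (CS lam)" "ivl J \<subseteq> ivl I" "J = (j, j + 2 * M)" for u J j M
  proof -
    obtain p where U: "u \<in> SYT lam" "1 \<le> j" "j + 2 * M \<le> ?n" "edr (row_index u) j M p"
      and r: "\<forall>x\<in>{1..?n}. ?r x = row_index u (cyc (j + p) (j + M + p) x)"
      using u(1) unfolding CS_edges_row_index u(3) by auto
    have M: "1 \<le> M" "p \<le> M" using U(4) unfolding edr_def by auto
    have JI: "i \<le> j" "j + 2 * M \<le> i + 2 * m" using u(2) M unfolding u(3) I ivl_def by auto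
    \<comment> \<open>Every edge leaves a descent one place left of the middle of its label. Here
      this can only be \<open>K\<close>, which ties \<open>j\<close> to \<open>M\<close>.\<close>
    have "j + M - 1 \<in> ?D"
    proof -
      have "?D = descents ?n (\<lambda>x. row_index u (cyc (j + p) (j + M + p) x))"
        by (rule descents_cong) (use r in auto)
      then show ?thesis using descents_edge(2)[OF U(4,2,3)] by simp
    qed
    moreover have "i \<le> j + M - 1" "j + M - 1 < i + 2 * m" using JI M by auto
    ultimately have jK: "j + M - 1 = K" using nd[of "j + M - 1"] unfolding descents_def by fastforce
    then show jM: "j + M = K + 1 \<and> M < m \<and> J = (j, j + 2 * M)" using M JI u(3) unfolding K_def by auto
    define s where "s = (\<lambda>x. row_index u (cyc (j + p) (j + M + p) x))"
    have rs: "?r x = s x" if "1 \<le> x" "x \<le> ?n" for x using r that unfolding s_def by auto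
    have j2: "2 \<le> j" "i \<le> j - 1" using jM i unfolding K_def by auto
    have "?r (j - 1 + 1) \<le> ?r (j - 1)" by (rule nd) (use j2 jM M in \<open>auto simp: K_def\<close>)
    then have "s j \<le> s (j - 1)" using rs[of j] rs[of "j - 1"] j2 U by simp
    then have "typ3 (row_index u) j M p \<longleftrightarrow> (\<forall>t\<le>M. s (j - 1 + t) < s (j + M + t))"
      using typ3_conv[OF U(4) j2(1)] unfolding s_def by blast
    also have "\<dots> \<longleftrightarrow> (\<forall>t\<le>M. ?r (j - 1 + t) < ?r (j + M + t))"
      using rs j2 U(3) by auto
    also have "\<dots> \<longleftrightarrow> C (M + 1)"
    proof -
      have e: "K + 1 - (M + 1) + t = j - 1 + t" "K + 1 + t = j + M + t" for t using jM by auto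
      show ?thesis unfolding C_def e by (auto simp: less_Suc_eq_le)
    qed
    finally have t3: "typ3 (row_index u) j M p \<longleftrightarrow> C (M + 1)" .
    note et = edge_types[OF U(1) T U(2-4) r]
    show "dominates (Des u) (Des T) \<longleftrightarrow> \<not> C (M + 1)"
      using et(2-4) t3 by blast
  qed
  show "(\<exists>!w. (T, I, w) \<in> edges (CS lam)) \<longleftrightarrow>
     \<not> (\<exists>u J. (u, J, T) \<in> edges (CS lam) \<and> ivl J \<subseteq> ivl I \<and> dominates (Des u) (Des T))"
    unfolding out
  proof
    assume Cm: "C m"
    show "\<not> (\<exists>u J. (u, J, T) \<in> edges (CS lam) \<and> ivl J \<subseteq> ivl I \<and> dominates (Des u) (Des T))"
    proof
      assume "\<exists>u J. (u, J, T) \<in> edges (CS lam) \<and> ivl J \<subseteq> ivl I \<and> dominates (Des u) (Des T)"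
      then obtain u J where u: "(u, J, T) \<in> edges (CS lam)" "ivl J \<subseteq> ivl I" "dominates (Des u) (Des T)" by blast
      then obtain j M where J: "J = (j, j + 2 * M)" unfolding CS_edges by blast
      have "M + 1 \<le> m" using inc(2)[OF u(1,2) J] by simp
      then have "C (M + 1)" using C_mono[OF Cm] by blast
      then show False using inc(1)[OF u(1,2) J] u(3) by blast
    qed
  next
    assume no: "\<not> (\<exists>u J. (u, J, T) \<in> edges (CS lam) \<and> ivl J \<subseteq> ivl I \<and> dominates (Des u) (Des T))"
    have "C (M + 1)" if "M < m" for M
      using that
    proof (induction M)
      case 0
      then show ?case using KD(2) by (simp add: C_def)
    next
      case (Suc M0)
      define M where "M = Suc M0"
      have CM: "C M" using Suc unfolding M_def by simp
      have M: "1 \<le> M" "M < m" using Suc.prems unfolding M_def by auto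
      define j where "j = K + 1 - M"
      have j: "j + M = K + 1" "i < j" using M unfolding j_def K_def by auto
      have "\<exists>u. (u, (j, j + 2 * M), T) \<in> edges (CS lam)"
      proof (rule in_edge[OF T])
        show "1 \<le> j" "1 \<le> M" "j + 2 * M \<le> ?n" using j M n unfolding K_def by auto
      next
        fix q assume q: "1 \<le> q" "q < M"
        have "?r (j + M - q - 1 + 1) \<le> ?r (j + M - q - 1)" by (rule nd) (use q j M in \<open>auto simp: K_def\<close>)
        moreover have "j + M - q - 1 + 1 = j + M - q" using q by simp
        ultimately show "?r (j + M - q) \<le> ?r (j + M - q - 1)" by simp
      next
        fix q assume q: "q < M"
        have "?r (j + 2 * M - q - 1 + 1) \<le> ?r (j + 2 * M - q - 1)" by (rule nd) (use q j M in \<open>auto simp: K_def\<close>)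
        moreover have "j + 2 * M - q - 1 + 1 = j + 2 * M - q" using q by simp
        ultimately show "?r (j + 2 * M - q) \<le> ?r (j + 2 * M - q - 1)" by simp
      next
        fix s assume "s < M"
        then have "?r (K + 1 - M + s) < ?r (K + 1 + s)" using CM unfolding C_def by blast
        then show "?r (j + s) < ?r (j + M + s)" using j unfolding j_def by simp
      qed
      then obtain u where u: "(u, (j, j + 2 * M), T) \<in> edges (CS lam)" by blast
      have sub: "ivl (j, j + 2 * M) \<subseteq> ivl I" using j M unfolding I ivl_def K_def by auto
      have "\<not> dominates (Des u) (Des T)" using no u sub by blast
      then have "C (M + 1)" using inc(1)[OF u sub refl] by blast
      then show ?case unfolding M_def .
    qed
    from this[of "m - 1"] show "C m" using i by simp
  qed
qed

subsection \<open>Fans\<close>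

text \<open>The extra inequality of \<open>typ2\<close> supplies the comparison at rank
  \<open>m\<close>, which \<open>edr\<close> with \<open>p = m\<close> lacks. All ranks together
  survive when the interval shrinks symmetrically around \<open>K = i+m\<close>, since the remaining
  \<open>1\<close>s are not higher than those they replace.\<close>

lemma edr_shrink:
  assumes e: "edr r i m m" and t: "typ2 n r i m m" and M: "1 \<le> M" "M \<le> m"
  shows "edr r (i + m - M) M M" "typ2 n r (i + m - M) M M"
proof -
  have C: "r (i + q) < r (i + m + 1 + q)" if "q \<le> m" for q
    using e t that unfolding edr_def typ2_def by (cases "q = m") (auto simp: mult_2 add.assoc)
  have a: "i + m - M + q = i + (m - M + q)" for q using M by simp
  show "edr r (i + m - M) M M"
    unfolding edr_def
  proof (intro conjI allI impI)
    fix q assume "q < M"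
    then show "r (i + m - M + q + 1) \<le> r (i + m - M + q)"
      by (intro edr_x1[OF e]) (use M in auto)
  next
    fix q assume "1 \<le> q" "q < M"
    then show "r (i + m - M + M + q + 1) \<le> r (i + m - M + M + q)"
      by (intro edr_y1[OF e]) (use M in auto)
  next
    fix q assume q: "q < M"
    have "r (i + (m - M + q)) \<le> r (i + q)" by (rule edr_x[OF e]) (use q M in auto)
    also have "\<dots> < r (i + m + 1 + q)" using C q M by simp
    finally show "r (i + m - M + q) < r (i + m - M + M + 1 + q)" unfolding a using M by simp
  qed (use M in auto)
  have "r (i + m) \<le> r (i + M)" using edr_x[OF e, of M m] M by simp
  also have "\<dots> < r (i + m + 1 + M)" using C M by simp
  finally have 1: "r (i + m) < r (i + m + M + 1)" by (simp add: add.assoc)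
  have 2: "r (i + m + M + 1) \<le> r (i + m + M)"
    using e t M unfolding edr_def typ2_def by (cases "M = m") (auto simp: mult_2 add.assoc)
  have eqs: "i + m - M + 2 * M = i + m + M" "i + m - M + M = i + m" using M by auto
  have "i + m + M < n" using t M unfolding typ2_def by simp
  then show "typ2 n r (i + m - M) M M" unfolding typ2_def eqs using 1 2 by simp
qed

text \<open>All edges leaving \<open>T\<close> in the fan raise the same letter
  \<open>K = i+m\<close>, to \<open>K+M\<close> in \<open>w M\<close>. An edge with
  \<open>m = 1\<close> exchanges \<open>K+M-1\<close> and \<open>K+M\<close>, which lowers
  \<open>M\<close> by one; for \<open>M = 1\<close> it undoes the raise and returns to
  \<open>T\<close>.\<close>

lemma fan_step:
  assumes T: "T \<in> SYT lam" and i: "1 \<le> i" "i + 2 * m \<le> sum_list lam"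
    and e: "edr (row_index T) i m m" and t: "typ2 (sum_list lam) (row_index T) i m m" and M: "1 \<le> M" "M \<le> m"
  defines "w \<equiv> \<lambda>M. map (map (sg (i + m) (i + m + M))) T"
  shows "etype (CS lam) 2 T (i + m - M, i + m + M) (w M)" "w M \<in> SYT lam"
    "2 \<le> M \<Longrightarrow> etype (CS lam) 1 (w M) (i + m + M - 1, i + m + M + 1) (w (M - 1))"
    "M = 1 \<Longrightarrow> etype (CS lam) 3 (w M) (i + m, i + m + 2) T"
proof -
  let ?n = "sum_list lam" and ?r = "row_index T"
  define K where "K = i + m"
  note eM = edr_shrink[OF e t M, folded K_def]
  have iM: "1 \<le> K - M" "K - M + 2 * M \<le> ?n" "K - M + M = K" "K - M + 2 * M = K + M" using i M unfolding K_def by auto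
  have wM: "w M = map (map (sg (K - M + M) (K - M + M + M))) T" unfolding w_def iM(3) by (simp add: K_def)
  note tg = edge_target[OF T eM(1) iM(1,2), folded wM]
  show wS: "w M \<in> SYT lam" by (rule tg(1))
  let ?s = "row_index (w M)"
  have s: "?s x = ?r (cyc K (K + M) x)" if "1 \<le> x" "x \<le> ?n" for x
    using tg(2)[of x] that unfolding iM(3) by simp
  have "(T, (K - M, K + M), w M) \<in> edges (CS lam)"
    unfolding CS_edges using T iM eM(1) wM by (intro exI[of _ "K - M"] exI[of _ M] exI[of _ M]) simp
  moreover have "edge_type 2 (Des T) (K - M, K + M) (Des (w M))"
    using edge_types(2)[OF T wS iM(1,2) eM(1)] tg(2) eM(2) unfolding iM(4) by blast
  ultimately show "etype (CS lam) 2 T (i + m - M, i + m + M) (w M)"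
    unfolding etype_def CS_simps K_def by blast
  have t2: "K + M < ?n" "?r (K + M + 1) \<le> ?r (K + M)" "?r K < ?r (K + M + 1)"
    using eM(2) unfolding typ2_def iM(3,4) by auto
  let ?i = "K + M - 1"
  have i': "1 \<le> ?i" "?i + 2 * 1 \<le> ?n" "?i + 2 * 1 = K + M + 1" using t2 M i unfolding K_def by auto
  have sv: "?s (K + M - 1) = ?r (K + M)" "?s (K + M) = ?r K" "?s (K + M + 1) = ?r (K + M + 1)"
    using s[of "K + M - 1"] s[of "K + M"] s[of "K + M + 1"] M i t2 unfolding cyc_def K_def by auto
  have es: "edr ?s ?i 1 0"
  proof -
    have v: "?i + 0 = K + M - 1" "?i + 1 = K + M" "?i + 1 + 1 = K + M + 1" "?i + 0 + 1 = K + M" "K + M + 1 + 0 = K + M + 1"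
      using M by auto
    have "?s (?i + 0 + 1) \<le> ?s (?i + 0)" "?s (?i + 1) < ?s (?i + 1 + 1)" "?s (?i + 1 + 1 + 0) \<le> ?s (?i + 0)"
      unfolding v sv using t2 by auto
    then show ?thesis unfolding edr_def by (auto simp: less_Suc_eq le_Suc_eq)
  qed
  define S where "S = map (map (sg (?i + 0) (?i + 1 + 0))) (w M)"
  note tS = edge_target[OF wS es i'(1,2), folded S_def]
  have E: "(w M, (?i, ?i + 2 * 1), S) \<in> edges (CS lam)"
    unfolding CS_edges using wS i' es S_def by blast
  note et = edge_types[OF wS tS(1) i'(1,2) es]
  have nt2: "\<not> typ2 ?n ?s ?i 1 0" unfolding typ2_def by simp
  show "etype (CS lam) 1 (w M) (i + m + M - 1, i + m + M + 1) (w (M - 1))" if M2: "2 \<le> M"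
  proof -
    have "S = w (M - 1)"
      unfolding S_def w_def using M2 by (auto simp: sg_def K_def)
    have ge: "?r (K + M) \<le> ?r (K + M - 1)"
    proof -
      have "?r (i + m + (M - 1) + 1) \<le> ?r (i + m + (M - 1))" by (rule edr_y1[OF e]) (use M M2 in auto)
      then show ?thesis using M2 unfolding K_def by simp
    qed
    have "cyc K (K + M) (?i - 1) = K + M - 1" unfolding cyc_def using M2 by auto
    moreover have "1 \<le> ?i - 1" "?i - 1 \<le> ?n" using M2 i M t2 unfolding K_def by auto
    ultimately have "?s (?i - 1) = ?r (K + M - 1)" using s[of "?i - 1"] by simp
    then have "\<not> typ3 ?s ?i 1 0" unfolding typ3_def using sv ge by auto
    then have "edge_type 1 (Des (w M)) (?i, ?i + 2 * 1) (Des S)" using et(4) nt2 tS(2) by blast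
    then show ?thesis unfolding etype_def CS_simps using E \<open>S = w (M - 1)\<close> i'(3) unfolding K_def by simp
  qed
  show "etype (CS lam) 3 (w M) (i + m, i + m + 2) T" if M1: "M = 1"
  proof -
    have inv: "sg K (Suc K) (sg K (Suc K) x) = x" for x by (auto simp: sg_def)
    have "S = map (map (sg K (K + 1))) (map (map (sg K (K + 1))) T)" unfolding S_def w_def M1 K_def by simp
    then have "S = T" by (simp add: comp_def inv)
    have "?r (K - 1) \<le> ?r i" "?r i < ?r (K + 1)"
      using edr_x[OF e, of 0 "m - 1"] e M unfolding edr_def K_def by (auto dest!: spec[of _ 0])
    moreover have "?r K \<le> ?r (K - 1)" using edr_x[OF e, of "m - 1" m] M unfolding K_def by simp
    moreover have "?s (K - 1) = ?r (K - 1)" using s[of "K - 1"] M i t2 unfolding cyc_def K_def by auto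
    ultimately have "typ3 ?s ?i 1 0" unfolding typ3_def using sv M1 i M K_def by auto
    then have "edge_type 3 (Des (w M)) (?i, ?i + 2 * 1) (Des S)" using et(3) tS(2) by blast
    then show ?thesis unfolding etype_def CS_simps using E \<open>S = T\<close> M1 unfolding K_def by simp
  qed
qed

lemma fan_ex:
  assumes ed: "(T, (a, b), w) \<in> edges (CS lam)" and et: "etype (CS lam) 2 T (a, b) w"
  shows "\<exists>i m ws. 1 \<le> m \<and> length ws = m \<and> w \<in> set ws \<and> set ws \<subseteq> verts (CS lam) \<and>
        (\<forall>r\<in>{1..m}. etype (CS lam) 2 T (i + r - 1, i + 2 * m - r + 1) (ws ! (r - 1))) \<and>
        (\<forall>r\<in>{1..<m}. etype (CS lam) 1 (ws ! (r - 1)) (i + 2 * m - r, i + 2 * m - r + 2) (ws ! r)) \<and>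
        etype (CS lam) 3 (ws ! (m - 1)) (i + m, i + m + 2) T"
proof -
  let ?n = "sum_list lam" and ?r = "row_index T"
  obtain i m p where ab: "a = i" "b = i + 2 * m" and T: "T \<in> SYT lam" and w: "w \<in> SYT lam" and i: "1 \<le> i" "i + 2 * m \<le> ?n"
    and e: "edr ?r i m p" and r: "\<forall>x\<in>{1..?n}. row_index w x = ?r (cyc (i + p) (i + m + p) x)"
    using ed unfolding CS_edges_row_index by auto
  note ty = edge_types[OF T w i e r]
  \<comment> \<open>Only type II adds a part, so the length translates the label condition back into
    \<open>typ2\<close>.\<close>
  have "length (Des w) = Suc (length (Des T))"
    using et unfolding etype_def edge_type_def Let_def by auto
  then have t2: "typ2 ?n ?r i m p" using ty(3,4) by fastforce
  then have pm: "p = m" unfolding typ2_def by simp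
  have m1: "1 \<le> m" using e unfolding edr_def by simp
  define W where "W = (\<lambda>M. map (map (sg (i + m) (i + m + M))) T)"
  have F: "etype (CS lam) 2 T (i + m - M, i + m + M) (W M)" "W M \<in> SYT lam"
    "2 \<le> M \<Longrightarrow> etype (CS lam) 1 (W M) (i + m + M - 1, i + m + M + 1) (W (M - 1))"
    "M = 1 \<Longrightarrow> etype (CS lam) 3 (W M) (i + m, i + m + 2) T" if "1 \<le> M" "M \<le> m" for M
    unfolding W_def using fan_step[OF T i e[unfolded pm] t2[unfolded pm] that] by blast+
  \<comment> \<open>The interval \<open>I_r\<close> reaches \<open>m + 1 - r\<close> to each side of
    \<open>i+m\<close>, so the list runs through the raises in descending order.\<close>
  define ws where "ws = map (\<lambda>r. W (m + 1 - r)) [1..<m + 1]"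
  have nth: "ws ! (r - 1) = W (m + 1 - r)" if "r \<in> {1..m}" for r using that by (cases r) (auto simp: ws_def)
  have wW: "w = W m"
  proof -
    obtain i2 m2 p2 where 2: "(a, b) = (i2, i2 + 2 * m2)" "edr ?r i2 m2 p2" "w = map (map (sg (i2 + p2) (i2 + m2 + p2))) T"
      using ed unfolding CS_edges by blast
    have "(T, (a, b), W m) \<in> edges (CS lam)" using F(1)[of m] m1 ab unfolding etype_def by (simp add: mult_2 add.assoc)
    then show ?thesis using CS_edge_unique ed by blast
  qed
  show "\<exists>i m ws. 1 \<le> m \<and> length ws = m \<and> w \<in> set ws \<and> set ws \<subseteq> verts (CS lam) \<and>
        (\<forall>r\<in>{1..m}. etype (CS lam) 2 T (i + r - 1, i + 2 * m - r + 1) (ws ! (r - 1))) \<and>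
        (\<forall>r\<in>{1..<m}. etype (CS lam) 1 (ws ! (r - 1)) (i + 2 * m - r, i + 2 * m - r + 2) (ws ! r)) \<and>
        etype (CS lam) 3 (ws ! (m - 1)) (i + m, i + m + 2) T"
  proof (rule exI[of _ i], rule exI[of _ m], rule exI[of _ ws], intro conjI ballI)
    show "length ws = m" by (simp add: ws_def)
    show "w \<in> set ws" unfolding wW ws_def set_map by (rule image_eqI[of _ _ 1]) (use m1 in auto)
    show "set ws \<subseteq> verts (CS lam)" using F(2) by (auto simp: ws_def)
  next
    fix r assume r: "r \<in> {1..m}"
    have "i + m - (m + 1 - r) = i + r - 1" "i + m + (m + 1 - r) = i + 2 * m - r + 1" using r by auto
    then show "etype (CS lam) 2 T (i + r - 1, i + 2 * m - r + 1) (ws ! (r - 1))"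
      using F(1)[of "m + 1 - r"] r nth[OF r] by auto
  next
    fix r assume r: "r \<in> {1..<m}"
    have "i + m + (m + 1 - r) - 1 = i + 2 * m - r" "i + m + (m + 1 - r) + 1 = i + 2 * m - r + 2" using r by auto
    moreover have "ws ! r = W (m + 1 - r - 1)" using nth[of "r + 1"] r by simp
    ultimately show "etype (CS lam) 1 (ws ! (r - 1)) (i + 2 * m - r, i + 2 * m - r + 2) (ws ! r)"
      using F(3)[of "m + 1 - r"] r nth[of r] by auto
  next
    show "etype (CS lam) 3 (ws ! (m - 1)) (i + m, i + m + 2) T"
      using F(4)[of 1] nth[of m] m1 by auto
  qed (rule m1)
qed

lemma CS_A3: "A3 (CS lam)"
  unfolding A3_def by (intro ballI, clarify, rule fan_ex)

subsection \<open>Connectedness\<close>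

lemma edr_cong:
  assumes "\<And>x. i \<le> x \<Longrightarrow> x \<le> i + 2 * m \<Longrightarrow> r x = s x"
  shows "edr r i m p = edr s i m p"
proof -
  have 1: "r (i + q) = s (i + q)" if "q \<le> m" for q using that by (intro assms) auto
  have 2: "r (i + m + q) = s (i + m + q)" if "q \<le> m" for q using that by (intro assms) auto
  have 3: "r (i + q + 1) = s (i + q + 1)" "r (i + m + 1 + q) = s (i + m + 1 + q)" "r (i + m + q + 1) = s (i + m + q + 1)"
    if "q < m" for q using that by (auto intro!: assms)
  show ?thesis unfolding edr_def
    by (intro conj_cong refl all_cong imp_cong) (use 1 2 3 in auto)
qed

text \<open>Edges on ballot functions whose content is not fixed: removing the last letter changes
  the shape, and the induction has to pass through all shapes.\<close>

definition skstep :: "nat \<Rightarrow> ((nat \<Rightarrow> nat) \<times> (nat \<Rightarrow> nat)) set" where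
  "skstep n = {(r, s). bal n r \<and> (\<exists>i m p. 1 \<le> i \<and> i + 2 * m \<le> n \<and> edr r i m p \<and>
     s = (\<lambda>x. r (cyc (i + p) (i + m + p) x)))}"

abbreviation skconn :: "nat \<Rightarrow> ((nat \<Rightarrow> nat) \<times> (nat \<Rightarrow> nat)) set" where
  "skconn n \<equiv> (skstep n \<union> (skstep n)\<inverse>)\<^sup>*"

lemma skstep_props:
  assumes "(r, s) \<in> skstep n"
  shows "bal n r" "bal n s" "cnt s n \<rho> = cnt r n \<rho>" "n < x \<Longrightarrow> s x = r x"
  using assms bal_cyc cnt_cyc_end unfolding skstep_def by (auto simp: cyc_def edr_def)

lemma skconn_sym: "(r, s) \<in> skconn n \<Longrightarrow> (s, r) \<in> skconn n"
  by (metis converse_Un converse_converse rtrancl_converseI sup_commute)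

lemma bal_Suc: "bal (Suc n) r \<longleftrightarrow> bal n r \<and> (\<forall>\<rho>. cnt r (Suc n) (Suc \<rho>) \<le> cnt r (Suc n) \<rho>)"
  unfolding bal_def by (auto simp: le_Suc_eq)

lemma skstep_Suc:
  assumes "(r, s) \<in> skstep n" "bal (Suc n) r \<or> bal (Suc n) s"
  shows "(r, s) \<in> skstep (Suc n)" "bal (Suc n) r" "bal (Suc n) s"
proof -
  note P = skstep_props[OF assms(1)]
  have "cnt s (Suc n) \<rho> = cnt r (Suc n) \<rho>" for \<rho> using P(3)[of \<rho>] P(4)[of "Suc n"] by (simp add: cnt_Suc)
  then show b: "bal (Suc n) r" "bal (Suc n) s" using assms(2) P(1,2) unfolding bal_Suc by auto
  obtain i m p where "1 \<le> i" "i + 2 * m \<le> n" "edr r i m p" "s = (\<lambda>x. r (cyc (i + p) (i + m + p) x))"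
    using assms(1) unfolding skstep_def by blast
  then have "\<exists>i m p. 1 \<le> i \<and> i + 2 * m \<le> Suc n \<and> edr r i m p \<and> s = (\<lambda>x. r (cyc (i + p) (i + m + p) x))"
    using le_SucI by blast
  then show "(r, s) \<in> skstep (Suc n)" unfolding skstep_def using b by simp
qed

text \<open>Steps on the first \<open>n\<close> letters preserve their counts and leave letter
  \<open>n+1\<close> alone, so the ballot condition at \<open>n+1\<close> holds along the whole
  path.\<close>

lemma skconn_Suc:
  "(r, s) \<in> skconn n \<Longrightarrow> bal (Suc n) r \<Longrightarrow> (r, s) \<in> skconn (Suc n) \<and> bal (Suc n) s"
proof (induction rule: rtrancl_induct)
  case (step y z)
  then have y: "(r, y) \<in> skconn (Suc n)" "bal (Suc n) y" by auto
  from step(2) have "(y, z) \<in> skstep (Suc n) \<union> (skstep (Suc n))\<inverse> \<and> bal (Suc n) z"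
  proof
    assume "(y, z) \<in> skstep n"
    then show ?thesis using skstep_Suc[of y z n] y(2) by simp
  next
    assume "(y, z) \<in> (skstep n)\<inverse>"
    then show ?thesis using skstep_Suc[of z y n] y(2) by simp
  qed
  then show ?case using y(1) by (meson rtrancl.rtrancl_into_rtrancl)
qed simp

text \<open>The last letter goes to the topmost nonempty row \<open>R\<close>, whose end is always a
  corner.\<close>

lemma ex_bal:
  assumes "\<And>\<rho>. \<mu> (Suc \<rho>) \<le> (\<mu> \<rho> :: nat)" "\<And>\<rho>. M < \<rho> \<Longrightarrow> \<mu> \<rho> = 0" "(\<Sum>\<rho>\<le>M. \<mu> \<rho>) = n"
  shows "\<exists>r. bal n r \<and> (\<forall>\<rho>. cnt r n \<rho> = \<mu> \<rho>)"
  using assms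
proof (induction n arbitrary: \<mu>)
  case 0
  then have "\<mu> \<rho> = 0" for \<rho> by (cases "\<rho> \<le> M") auto
  then show ?case by (auto simp: bal_def)
next
  case (Suc n)
  have "\<exists>\<rho>. \<mu> \<rho> \<noteq> 0" using Suc.prems(3) by (metis Suc_neq_Zero sum.neutral)
  then obtain R where R: "\<mu> R \<noteq> 0" "\<And>\<rho>. \<mu> \<rho> \<noteq> 0 \<Longrightarrow> \<rho> \<le> R"
  proof -
    have f: "finite {\<rho>. \<mu> \<rho> \<noteq> 0}"
      by (rule finite_subset[of _ "{..M}"]) (use Suc.prems(2) in \<open>auto simp: not_less[symmetric]\<close>)
    then show thesis using that[of "Max {\<rho>. \<mu> \<rho> \<noteq> 0}"] Max_in[OF f] Max_ge[OF f] \<open>\<exists>\<rho>. \<mu> \<rho> \<noteq> 0\<close> by auto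
  qed
  define \<nu> where "\<nu> = (\<lambda>\<rho>. if \<rho> = R then \<mu> R - 1 else \<mu> \<rho>)"
  have RM: "R \<le> M" using R(1) Suc.prems(2) by (meson linorder_not_le)
  have e: "\<mu> \<rho> = \<nu> \<rho> + (if \<rho> = R then 1 else 0)" for \<rho> using R(1) by (simp add: \<nu>_def)
  have "\<mu> (Suc R) = 0" using R(2)[of "Suc R"] by force
  then have "\<nu> (Suc \<rho>) \<le> \<nu> \<rho>" for \<rho>
    using Suc.prems(1)[of \<rho>] by (cases "\<rho> = R") (auto simp: \<nu>_def)
  moreover have "\<nu> \<rho> = 0" if "M < \<rho>" for \<rho> using that Suc.prems(2) RM by (simp add: \<nu>_def)
  moreover have "(\<Sum>\<rho>\<le>M. \<nu> \<rho>) = n"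
  proof -
    have "(\<Sum>\<rho>\<le>M. \<mu> \<rho>) = (\<Sum>\<rho>\<le>M. \<nu> \<rho>) + (\<Sum>\<rho>\<le>M. if \<rho> = R then 1 else 0)"
      unfolding sum.distrib[symmetric] using e by (intro sum.cong) auto
    then show ?thesis using Suc.prems(3) RM by simp
  qed
  ultimately obtain r where r: "bal n r" "\<And>\<rho>. cnt r n \<rho> = \<nu> \<rho>" using Suc.IH[of \<nu>] by blast
  define s where "s = r(Suc n := R)"
  have c: "cnt s k \<rho> = cnt r k \<rho>" if "k \<le> n" for k \<rho> using that by (intro cnt_cong) (auto simp: s_def)
  have "cnt s (Suc n) \<rho> = \<mu> \<rho>" for \<rho> using c[of n \<rho>] r(2)[of \<rho>] e[of \<rho>] by (auto simp: cnt_Suc s_def)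
  moreover have "bal n s" using r(1) c unfolding bal_def by simp
  ultimately show ?case using Suc.prems(1) unfolding bal_Suc by (intro exI[of _ s]) auto
qed

lemma sum_cnt: "(\<And>x. x \<in> {1..n} \<Longrightarrow> r x \<le> M) \<Longrightarrow> (\<Sum>\<rho>\<le>M. cnt r n \<rho>) = n"
  unfolding cnt_def using card_by_col[of "{1..n}" r M] by simp

text \<open>For two different rows of the last letter, \<open>t\<close> and \<open>t'\<close> differ by a dual Knuth move
  which exchanges the last two letters, the letter before them lying between them.\<close>
lemma skconn_switch:
  assumes b: "bal (Suc n) r" "bal (Suc n) s" and c: "\<And>\<rho>. cnt r (Suc n) \<rho> = cnt s (Suc n) \<rho>"
    and R: "r (Suc n) < s (Suc n)"
  shows "\<exists>t t'. (t', t) \<in> skstep (Suc n) \<and> (\<forall>x>Suc n. t x = r x) \<and> (\<forall>x. x < 1 \<longrightarrow> t x = r x) \<and>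
     (\<forall>\<rho>. cnt t (Suc n) \<rho> = cnt r (Suc n) \<rho>) \<and> t (Suc n) = r (Suc n) \<and> t' (Suc n) = s (Suc n)"
proof -
  define R1 where "R1 = r (Suc n)"
  define R2 where "R2 = s (Suc n)"
  define \<mu> where "\<mu> = (\<lambda>\<rho>. cnt r (Suc n) \<rho>)"
  have R12: "R1 < R2" using R R1_def R2_def by simp
  have r: "\<mu> \<rho> = cnt r n \<rho> + (if \<rho> = R1 then 1 else 0)" for \<rho> by (auto simp: \<mu>_def cnt_Suc R1_def)
  have s: "\<mu> \<rho> = cnt s n \<rho> + (if \<rho> = R2 then 1 else 0)" for \<rho> unfolding \<mu>_def c by (auto simp: cnt_Suc R2_def)
  have mu: "\<mu> (Suc \<rho>) \<le> \<mu> \<rho>" for \<rho> using b(1) unfolding bal_Suc \<mu>_def by blast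
  have br: "cnt r n (Suc \<rho>) \<le> cnt r n \<rho>" and bs: "cnt s n (Suc \<rho>) \<le> cnt s n \<rho>" for \<rho>
    using b unfolding bal_def by auto
  have m1: "\<mu> (Suc R1) + 1 \<le> \<mu> R1" using r[of R1] r[of "Suc R1"] br[of R1] by simp
  have m2: "\<mu> (Suc R2) + 1 \<le> \<mu> R2" using s[of R2] s[of "Suc R2"] bs[of R2] by simp
  \<comment> \<open>\<open>R1\<close> and \<open>R2\<close> are rows of two corners. Placing a third
    letter in the row just below \<open>R2\<close> gives \<open>R1 \<le> R3 < R2\<close>, the
    condition for an edge with \<open>m = 1\<close>, and what remains after removing the three cells
    is still a partition, named \<open>\<nu>\<close>.\<close>
  define R3 where "R3 = R2 - 1"
  have R3: "R2 = Suc R3" "R1 \<le> R3" using R12 by (auto simp: R3_def)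
  define \<nu> where "\<nu> = (\<lambda>\<rho>. \<mu> \<rho> - (if \<rho> = R1 then 1 else 0) - (if \<rho> = R2 then 1 else 0) - (if \<rho> = R3 then 1 else 0))"
  have mu_nu: "\<mu> \<rho> = \<nu> \<rho> + (if \<rho> = R1 then 1 else 0) + (if \<rho> = R2 then 1 else 0) + (if \<rho> = R3 then 1 else 0)" for \<rho>
    using m1 m2 mu[of R3] R3 R12 unfolding \<nu>_def by (cases "R1 = R3") auto
  have nu: "\<nu> (Suc \<rho>) \<le> \<nu> \<rho>" for \<rho>
  proof -
    consider "\<rho> = R3" "R1 = R3" | "\<rho> = R3" "R1 \<noteq> R3" | "\<rho> = R2" | "\<rho> = R1" "R1 \<noteq> R3" | "\<rho> \<noteq> R1" "\<rho> \<noteq> R2" "\<rho> \<noteq> R3" by blast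
    then show ?thesis
      by cases (use m1 m2 mu[of \<rho>] mu[of R3] R3 R12 in \<open>auto simp: \<nu>_def\<close>)
  qed
  have nu3: "\<nu> (Suc \<rho>) + (if Suc \<rho> = R3 then 1 else 0) \<le> \<nu> \<rho> + (if \<rho> = R3 then 1 else 0)" for \<rho>
  proof -
    consider "\<rho> = R3" "R1 = R3" | "\<rho> = R3" "R1 \<noteq> R3" | "\<rho> = R2" | "\<rho> = R1" "R1 \<noteq> R3" | "\<rho> \<noteq> R1" "\<rho> \<noteq> R2" "\<rho> \<noteq> R3" by blast
    then show ?thesis
      by cases (use m1 m2 mu[of \<rho>] mu[of R3] R3 R12 in \<open>auto simp: \<nu>_def\<close>)
  qed
  define M where "M = Max (insert R2 (r ` {1..Suc n}))"
  have M: "R2 \<le> M" "\<And>x. x \<in> {1..Suc n} \<Longrightarrow> r x \<le> M"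
    unfolding M_def by (rule Max_ge; blast)+
  have z: "\<nu> \<rho> = 0" if "M < \<rho>" for \<rho>
  proof -
    have "{x \<in> {1..Suc n}. r x = \<rho>} = {}" using M(2) that by force
    then have "\<mu> \<rho> = 0" unfolding \<mu>_def cnt_def by (metis card.empty)
    then show ?thesis unfolding \<nu>_def by simp
  qed
  have "(\<Sum>\<rho>\<le>M. \<mu> \<rho>) = Suc n" unfolding \<mu>_def by (rule sum_cnt) (rule M(2))
  moreover have "(\<Sum>\<rho>\<le>M. \<mu> \<rho>) = (\<Sum>\<rho>\<le>M. \<nu> \<rho>) + (\<Sum>\<rho>\<le>M. if \<rho> = R1 then 1 else 0) +
      (\<Sum>\<rho>\<le>M. if \<rho> = R2 then 1 else 0) + (\<Sum>\<rho>\<le>M. if \<rho> = R3 then 1 else 0)"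
    unfolding sum.distrib[symmetric] using mu_nu by (intro sum.cong) auto
  ultimately have sum: "(\<Sum>\<rho>\<le>M. \<nu> \<rho>) + 3 = Suc n" using M(1) R3 by simp
  define k where "k = (\<Sum>\<rho>\<le>M. \<nu> \<rho>)"
  have n: "Suc n = k + 3" using sum by (simp add: k_def)
  obtain t0 where t0: "bal k t0" "\<And>\<rho>. cnt t0 k \<rho> = \<nu> \<rho>"
    using ex_bal[of \<nu> M k] nu z k_def by blast
  define t where "t = (\<lambda>x. if x = k + 1 then R3 else if x = k + 2 then R2 else if x = k + 3 then R1
    else if 1 \<le> x \<and> x \<le> k then t0 x else r x)"
  define t' where "t' = (\<lambda>x. if x = k + 2 then R1 else if x = k + 3 then R2 else t x)"
  have ct: "cnt t j \<rho> = cnt t0 j \<rho>" "cnt t' j \<rho> = cnt t0 j \<rho>" if "j \<le> k" for j \<rho>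
    using that by (auto intro!: cnt_cong simp: t_def t'_def)
  have k1: "k + 1 = Suc k" "k + 2 = Suc (Suc k)" "k + 3 = Suc (Suc (Suc k))" by auto
  have ct1: "cnt t (Suc k) \<rho> = \<nu> \<rho> + (if \<rho> = R3 then 1 else 0)" "cnt t' (Suc k) \<rho> = \<nu> \<rho> + (if \<rho> = R3 then 1 else 0)" for \<rho>
    using ct[of k \<rho>] t0(2)[of \<rho>] by (auto simp: cnt_Suc t_def t'_def)
  have ct2: "cnt t (Suc (Suc k)) \<rho> = cnt r n \<rho>" "cnt t' (Suc (Suc k)) \<rho> = cnt s n \<rho>" for \<rho>
    using ct1[of \<rho>] mu_nu[of \<rho>] r[of \<rho>] s[of \<rho>] by (auto simp: cnt_Suc[of _ "Suc k"] t_def t'_def split: if_splits)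
  have ct3: "cnt t (Suc (Suc (Suc k))) \<rho> = \<mu> \<rho>" "cnt t' (Suc (Suc (Suc k))) \<rho> = \<mu> \<rho>" for \<rho>
    using ct2[of \<rho>] r[of \<rho>] s[of \<rho>] by (auto simp: cnt_Suc[of _ "Suc (Suc k)"] t_def t'_def)
  have "bal k t'" using t0(1) ct unfolding bal_def by simp
  then have bt': "bal (k + 3) t'"
    unfolding k1 bal_Suc using nu3 mu bs by (simp add: ct1 ct2 ct3)
  have t_cyc: "t = (\<lambda>x. t' (cyc (k + 1 + 1) (k + 1 + 1 + 1) x))"
    by (auto simp: fun_eq_iff cyc_def t_def t'_def)
  have tv: "t' (k + 1) = R3" "t' (k + 2) = R1" "t' (k + 3) = R2" by (auto simp: t_def t'_def)
  have e: "edr t' (k + 1) 1 1"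
    unfolding edr_def using tv R3 by (auto simp: less_Suc_eq numeral_2_eq_2 numeral_3_eq_3)
  have "(t', t) \<in> skstep (k + 3)"
    unfolding skstep_def mem_Collect_eq case_prod_conv
    by (rule conjI[OF bt'], rule exI[of _ "k + 1"], rule exI[of _ 1], rule exI[of _ 1])
      (use e t_cyc in simp)
  moreover have "t (Suc n) = r (Suc n)" "t' (Suc n) = s (Suc n)" using n by (auto simp: t_def t'_def R1_def R2_def)
  moreover have "cnt t (Suc n) \<rho> = cnt r (Suc n) \<rho>" for \<rho> using ct3(1)[of \<rho>] unfolding n k1 \<mu>_def by simp
  moreover have "\<forall>x>Suc n. t x = r x" "\<forall>x. x < 1 \<longrightarrow> t x = r x" using n by (auto simp: t_def)
  ultimately show ?thesis unfolding n[symmetric] by blast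
qed

text \<open>If the last letters lie in different rows, the path leads through \<open>t\<close> and
  \<open>t'\<close> of \<open>skconn_switch\<close>: each agrees with one end in the row of the last
  letter, so both remaining stretches are covered by the induction on \<open>n\<close>.\<close>

lemma skconn_all:
  "bal n r \<Longrightarrow> bal n s \<Longrightarrow> (\<And>\<rho>. cnt r n \<rho> = cnt s n \<rho>) \<Longrightarrow> (\<And>x. x \<notin> {1..n} \<Longrightarrow> r x = s x) \<Longrightarrow>
   (r, s) \<in> skconn n"
proof (induction n arbitrary: r s)
  case 0
  then have "r = s" by auto
  then show ?case by simp
next
  case (Suc n)
  have same: "(u, v) \<in> skconn (Suc n)" if "bal (Suc n) u" "bal (Suc n) v" "\<And>\<rho>. cnt u (Suc n) \<rho> = cnt v (Suc n) \<rho>"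
     "\<And>x. x \<notin> {1..Suc n} \<Longrightarrow> u x = v x" "u (Suc n) = v (Suc n)" for u v
  proof -
    have "(u, v) \<in> skconn n"
    proof (rule Suc.IH)
      show "bal n u" "bal n v" using that unfolding bal_Suc by auto
      show "cnt u n \<rho> = cnt v n \<rho>" for \<rho> using that(3)[of \<rho>] that(5) by (simp add: cnt_Suc)
      show "u x = v x" if "x \<notin> {1..n}" for x
        using that \<open>u (Suc n) = v (Suc n)\<close> \<open>\<And>x. x \<notin> {1..Suc n} \<Longrightarrow> u x = v x\<close> by (cases "x = Suc n") auto
    qed
    then show ?thesis using skconn_Suc that(1) by blast
  qed
  have diff: "(u, v) \<in> skconn (Suc n)" if u: "bal (Suc n) u" "bal (Suc n) v" "\<And>\<rho>. cnt u (Suc n) \<rho> = cnt v (Suc n) \<rho>"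
     "\<And>x. x \<notin> {1..Suc n} \<Longrightarrow> u x = v x" "u (Suc n) < v (Suc n)" for u v
  proof -
    obtain t t' where t: "(t', t) \<in> skstep (Suc n)" "\<forall>x>Suc n. t x = u x" "\<forall>x. x < 1 \<longrightarrow> t x = u x"
      "\<forall>\<rho>. cnt t (Suc n) \<rho> = cnt u (Suc n) \<rho>" "t (Suc n) = u (Suc n)" "t' (Suc n) = v (Suc n)"
      using skconn_switch[OF u(1,2,3,5)] by blast
    note P = skstep_props[OF t(1)]
    have out: "t' x = t x" if "x \<notin> {1..Suc n}" for x
    proof (cases "x = 0")
      case True
      obtain i m p where "1 \<le> i" "t = (\<lambda>x. t' (cyc (i + p) (i + m + p) x))" using t(1) unfolding skstep_def by blast
      then show ?thesis using True by (auto simp: cyc_def)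
    next
      case False then show ?thesis using P(4)[of x] that by simp
    qed
    have "(u, t) \<in> skconn (Suc n)"
      by (rule same[OF u(1) P(2)]) (use t in \<open>auto simp: not_le\<close>)
    moreover have "(t, t') \<in> skconn (Suc n)" using t(1) by blast
    moreover have "(t', v) \<in> skconn (Suc n)"
    proof (rule same[OF P(1) u(2)])
      show "cnt t' (Suc n) \<rho> = cnt v (Suc n) \<rho>" for \<rho> using P(3)[of \<rho>] t(4) u(3) by simp
      show "t' x = v x" if "x \<notin> {1..Suc n}" for x
        using out[OF that] u(4)[OF that] t(2,3) that by (cases "x = 0") auto
    qed (rule t(6))
    ultimately show ?thesis by (meson rtrancl_trans)
  qed
  consider "r (Suc n) = s (Suc n)" | "r (Suc n) < s (Suc n)" | "s (Suc n) < r (Suc n)" by linarith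
  then show ?case
  proof cases
    case 1 then show ?thesis using same Suc.prems by blast
  next
    case 2 then show ?thesis using diff[of r s] Suc.prems by blast
  next
    case 3
    then have "(s, r) \<in> skconn (Suc n)" using diff[of s r] Suc.prems by metis
    then show ?thesis by (rule skconn_sym)
  qed
qed

lemma skstep_tab:
  assumes "(r, s) \<in> skstep (sum_list lam)" "yam lam r \<or> yam lam s"
  shows "yam lam r" "yam lam s"
    "\<exists>I. (tab (sum_list lam) (length lam) r, I, tab (sum_list lam) (length lam) s) \<in> edges (CS lam)"
proof -
  note P = skstep_props[OF assms(1)]
  show y: "yam lam r" "yam lam s" using assms(2) P(1-3) unfolding yam_def by auto
  obtain i m p where i: "1 \<le> i" "i + 2 * m \<le> sum_list lam" and e: "edr r i m p"
    and s: "s = (\<lambda>x. r (cyc (i + p) (i + m + p) x))" using assms(1) unfolding skstep_def by blast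
  note R = yam_SYT[OF y(1)] and S = yam_SYT[OF y(2)]
  have "edr (row_index (tab (sum_list lam) (length lam) r)) i m p"
    using e edr_cong[of i m r "row_index (tab (sum_list lam) (length lam) r)" p] R(2) i by simp
  moreover have "row_index (tab (sum_list lam) (length lam) s) x =
     row_index (tab (sum_list lam) (length lam) r) (cyc (i + p) (i + m + p) x)" if x: "x \<in> {1..sum_list lam}" for x
  proof -
    have "cyc (i + p) (i + m + p) x \<in> {1..sum_list lam}" using x i e unfolding cyc_def edr_def by auto
    then show ?thesis using R(2) S(2)[OF x] s by simp
  qed
  ultimately show "\<exists>I. (tab (sum_list lam) (length lam) r, I, tab (sum_list lam) (length lam) s) \<in> edges (CS lam)"
    unfolding CS_edges_row_index using R(1) S(1) i by blast
qed

lemma SYT_nonempty: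
  assumes "is_partition lam" shows "SYT lam \<noteq> {}"
proof -
  define \<mu> where "\<mu> = (\<lambda>\<rho>. if \<rho> < length lam then lam ! \<rho> else 0)"
  have "\<mu> (Suc \<rho>) \<le> \<mu> \<rho>" for \<rho>
    using assms sorted_rev_nth_mono[of lam \<rho> "Suc \<rho>"] unfolding is_partition_def \<mu>_def by auto
  moreover have "\<mu> \<rho> = 0" if "length lam < \<rho>" for \<rho> using that by (simp add: \<mu>_def)
  moreover have "(\<Sum>\<rho>\<le>length lam. \<mu> \<rho>) = sum_list lam"
  proof -
    have "(\<Sum>\<rho>\<le>length lam. \<mu> \<rho>) = (\<Sum>\<rho><length lam. \<mu> \<rho>)" unfolding lessThan_Suc_atMost[symmetric] by (simp add: \<mu>_def)
    also have "\<dots> = (\<Sum>\<rho><length lam. lam ! \<rho>)" by (intro sum.cong) (auto simp: \<mu>_def)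
    finally show ?thesis by (simp add: sum_list_sum_nth atLeast0LessThan)
  qed
  ultimately obtain r where "bal (sum_list lam) r" "\<forall>\<rho>. cnt r (sum_list lam) \<rho> = \<mu> \<rho>"
    using ex_bal[of \<mu> "length lam" "sum_list lam"] by blast
  then have "yam lam r" unfolding yam_def \<mu>_def by auto
  then show ?thesis using yam_SYT(1) by blast
qed

lemma CS_connected:
  assumes "is_partition lam" shows "connected_lg (CS lam)"
  unfolding connected_lg_def Let_def CS_simps
proof (intro conjI ballI)
  show "SYT lam \<noteq> {}" using SYT_nonempty[OF assms] .
  fix T T' assume T: "T \<in> SYT lam" and T': "T' \<in> SYT lam"
  let ?n = "sum_list lam" and ?L = "length lam"
  let ?E = "{(v, w). \<exists>I. (v, I, w) \<in> edges (CS lam)}"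
  let ?R = "(?E \<union> ?E\<inverse>)\<^sup>*"
  \<comment> \<open>Steps never change values outside \<open>{1..n}\<close>, so the end of the path
    is given those of its start.\<close>
  define s where "s = (\<lambda>x. if x \<in> {1..?n} then row_index T' x else row_index T x)"
  have ys: "yam lam s" using SYT_yam[OF T'] yam_cong[of lam s "row_index T'"] by (simp add: s_def)
  have ts: "tab ?n ?L s = T'" using tab_cong[of ?n s "row_index T'" ?L] SYT_tab[OF T'] by (simp add: s_def)
  have yr: "yam lam (row_index T)" using SYT_yam[OF T] .
  have "(row_index T, s) \<in> skconn ?n"
    by (rule skconn_all) (use yr ys in \<open>auto simp: yam_def s_def\<close>)
  then have "yam lam s \<and> (tab ?n ?L (row_index T), tab ?n ?L s) \<in> ?R"
  proof (induction rule: rtrancl_induct)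
    case base then show ?case using yr by simp
  next
    case (step y z)
    from step(2) have "yam lam z \<and> (tab ?n ?L y, tab ?n ?L z) \<in> ?E \<union> ?E\<inverse>"
    proof
      assume "(y, z) \<in> skstep ?n"
      then show ?thesis using skstep_tab[of y z lam] step.IH by blast
    next
      assume "(y, z) \<in> (skstep ?n)\<inverse>"
      then show ?thesis using skstep_tab[of z y lam] step.IH by blast
    qed
    then show ?case using step.IH by (meson rtrancl.rtrancl_into_rtrancl)
  qed
  then show "(T, T') \<in> ?R" unfolding ts SYT_tab[OF T] by blast
qed

lemma finite_SYT: "finite (SYT lam)"
proof (rule finite_imageD)
  have "row T \<in> {w. set w \<subseteq> {1..sum_list lam} \<and> length w = sum_list lam}" if T: "T \<in> SYT lam" for T
    using SYT_basic[OF T] set_row[of T] mset_eq_length[OF mset_row[of T]] by auto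
  then have "row ` SYT lam \<subseteq> {w. set w \<subseteq> {1..sum_list lam} \<and> length w = sum_list lam}" by blast
  then show "finite (row ` SYT lam)" using finite_lists_length_eq[of "{1..sum_list lam}"] finite_subset by blast
  show "inj_on row (SYT lam)"
  proof (rule inj_onI)
    fix T T' assume T: "T \<in> SYT lam" "T' \<in> SYT lam" and eq: "row T = row T'"
    have "refill T (row T) = T" "refill T' (row T') = T'"
      using refill_map[of T id] refill_map[of T' id] by (simp_all add: list.map_id0)
    moreover have "refill T (row T) = refill T' (row T)"
      by (rule refill_cong) (use T in \<open>simp add: SYT_def\<close>)
    ultimately show "T = T'" using eq by simp
  qed
qed

lemma Des_composition:
  assumes T: "T \<in> SYT lam" shows "is_composition (sum_list lam) (Des T)"
proof (cases "sum_list lam = 0")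
  case True
  then show ?thesis using Des_descents[OF T] by (simp add: comp_of_set_def is_composition_def)
next
  case False
  let ?n = "sum_list lam" and ?D = "descents (sum_list lam) (row_index T)"
  note sub = descents_sub[of ?n "row_index T"]
  have c: "Des T = diffs 0 (dl ?n ?D)" using Des_descents[OF T] comp_of_set_dl[OF _ sub] False by simp
  have s: "sorted_wrt (<) (0 # dl ?n ?D)" using dl_sorted0[OF sub] False by simp
  have "sum_list (diffs 0 (dl ?n ?D)) = (0 # dl ?n ?D) ! length (dl ?n ?D)"
    using diffs_sum0[OF s, of "length (dl ?n ?D)"] by simp
  also have "\<dots> = ?n" unfolding dl_last[OF sub] by (simp add: nth_append)
  finally show ?thesis unfolding is_composition_def c using diffs_pos[OF s] by blast
qed

lemma CS_well_formed: "well_formed (sum_list lam) (CS lam)"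
proof -
  have "v \<in> SYT lam \<and> w \<in> SYT lam \<and> 1 \<le> fst I \<and> fst I \<le> snd I \<and> snd I \<le> sum_list lam"
    if "(v, I, w) \<in> edges (CS lam)" for v I w
    using CS_edge_bounds[of v "fst I" "snd I" w lam] that by simp
  then show ?thesis unfolding well_formed_def CS_simps using finite_SYT Des_composition by blast
qed

lemma CS_edge_types:
  assumes "(v, I, w) \<in> edges (CS lam)"
  shows "A0_ok (Des v) I" "edge_type 1 (Des v) I (Des w) \<or> edge_type 2 (Des v) I (Des w) \<or> edge_type 3 (Des v) I (Des w)"
proof -
  obtain i m p where I: "I = (i, i + 2 * m)" and T: "v \<in> SYT lam" "w \<in> SYT lam" and i: "1 \<le> i" "i + 2 * m \<le> sum_list lam"
    and e: "edr (row_index v) i m p" and r: "\<forall>x\<in>{1..sum_list lam}. row_index w x = row_index v (cyc (i + p) (i + m + p) x)"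
    using assms unfolding CS_edges_row_index by blast
  note t = edge_types[OF T i e r]
  show "A0_ok (Des v) I" unfolding I by (rule t(1))
  show "edge_type 1 (Des v) I (Des w) \<or> edge_type 2 (Des v) I (Des w) \<or> edge_type 3 (Des v) I (Des w)"
    unfolding I using t(2-4) by blast
qed

subsection \<open>The crystal of tableaux with fewest descents\<close>

text \<open>Only descents strictly below \<open>x\<close> count, so a descent is the last element of
  its own block.\<close>

definition blk :: "nat set \<Rightarrow> nat \<Rightarrow> nat" where
  "blk D x = Suc (card {d \<in> D. d < x})"

lemma blk_mono: "finite D \<Longrightarrow> x \<le> y \<Longrightarrow> blk D x \<le> blk D y"
  unfolding blk_def by (auto intro!: card_mono)

lemma blk_Suc: "finite D \<Longrightarrow> blk D (Suc x) = blk D x + (if x \<in> D then 1 else 0)"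
proof -
  assume "finite D"
  moreover have "{d \<in> D. d < Suc x} = {d \<in> D. d < x} \<union> (if x \<in> D then {x} else {})"
    by (auto simp: less_Suc_eq)
  ultimately show ?thesis unfolding blk_def by (auto simp: card_insert_if)
qed

lemma blk_const:
  assumes "x \<le> y" "\<And>d. x \<le> d \<Longrightarrow> d < y \<Longrightarrow> d \<notin> D" shows "blk D x = blk D y"
proof -
  have "d < x" if "d \<in> D" "d < y" for d using assms(2)[of d] that by (cases "x \<le> d") auto
  then have "{d \<in> D. d < x} = {d \<in> D. d < y}" using assms(1) by force
  then show ?thesis by (simp add: blk_def)
qed

lemma blk_eqD:
  assumes "finite D" "blk D x = blk D y" "x \<le> d" "d < y" shows "d \<notin> D"
proof
  assume "d \<in> D"
  then have "blk D (Suc d) = Suc (blk D d)" using blk_Suc assms(1) by simp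
  moreover have "blk D x \<le> blk D d" "blk D (Suc d) \<le> blk D y"
    using blk_mono[OF assms(1), of x d] blk_mono[OF assms(1), of "Suc d" y] assms by auto
  ultimately show False using assms(2) by simp
qed

lemma blk_le: "finite D \<Longrightarrow> blk D x \<le> Suc (card D)"
  unfolding blk_def by (auto intro!: card_mono)

lemma finite_descents: "finite (descents n r)"
  using descents_sub finite_subset by blast

lemma block_blk:
  assumes n: "0 < n" and D: "D \<subseteq> {1..<n}"
  shows "block (comp_of_set n D) j = {x \<in> {1..n}. blk D x = j}"
proof -
  have fin: "finite D" using D finite_subset by blast
  let ?X = "dl n D"
  have S: "sorted_wrt (<) (0 # ?X)" using dl_sorted0[OF D n] .
  have setX: "set ?X = insert n D" using dl_props(2)[OF fin] .
  have al: "comp_of_set n D = diffs 0 ?X" using comp_of_set_dl[OF n D] .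
  have dX: "distinct ?X" using S by (auto simp: strict_sorted_iff)
  have mono: "s < t \<Longrightarrow> t < length (0 # ?X) \<Longrightarrow> (0 # ?X) ! s < (0 # ?X) ! t" for s t
    using sorted_wrt_nth_less[OF S] by blast
  have 1: "blk D x = Suc t \<and> x \<in> {1..n}" if t: "t < length ?X" "(0 # ?X) ! t < x" "x \<le> (0 # ?X) ! Suc t" for x t
  proof -
    have "(0 # ?X) ! Suc t \<in> set ?X" using t by simp
    then have xn: "x \<le> n" using t(3) setX D by auto
    have "{d \<in> D. d < x} = set (take t ?X)"
    proof (intro set_eqI iffI)
      fix d assume d: "d \<in> {d \<in> D. d < x}"
      then have "d \<in> set ?X" using setX by simp
      then obtain u where u: "u < length ?X" "d = (0 # ?X) ! Suc u" by (metis in_set_conv_nth nth_Cons_Suc)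
      have "u < t"
      proof (rule ccontr)
        assume "\<not> u < t"
        then have "(0 # ?X) ! Suc t \<le> (0 # ?X) ! Suc u" using mono[of "Suc t" "Suc u"] u by (cases "u = t") auto
        then show False using d u t by simp
      qed
      then show "d \<in> set (take t ?X)" using u t by (auto simp: in_set_conv_nth intro!: exI[of _ u])
    next
      fix d assume "d \<in> set (take t ?X)"
      then obtain u where u: "u < t" "d = (0 # ?X) ! Suc u" using t by (auto simp: in_set_conv_nth)
      have "(0 # ?X) ! Suc u \<le> (0 # ?X) ! t" using mono[of "Suc u" t] u t by (cases "Suc u = t") auto
      then have "d < x" using u t by simp
      moreover have "d \<in> set ?X" using u t by simp
      ultimately show "d \<in> {d \<in> D. d < x}" using setX xn by auto
    qed
    then have "card {d \<in> D. d < x} = t" using dX t by (simp add: distinct_card)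
    then show ?thesis using xn t by (auto simp: blk_def)
  qed
  have 2: "\<exists>t<length ?X. (0 # ?X) ! t < x \<and> x \<le> (0 # ?X) ! Suc t" if x: "x \<in> {1..n}" for x
  proof -
    define t where "t = (LEAST t. x \<le> (0 # ?X) ! t)"
    obtain u where u: "u < length ?X" "?X ! u = n" using setX by (metis in_set_conv_nth insertI1)
    then have ex: "x \<le> (0 # ?X) ! Suc u" using x by simp
    then have t: "x \<le> (0 # ?X) ! t" unfolding t_def by (rule LeastI)
    have "t \<le> Suc u" unfolding t_def using ex by (rule Least_le)
    note t = t this
    have "t \<noteq> 0" using t(1) x by (cases t) auto
    then obtain t' where t': "t = Suc t'" by (cases t) auto
    have "\<not> x \<le> (0 # ?X) ! t'" using not_less_Least[of t' "\<lambda>t. x \<le> (0 # ?X) ! t"] t' unfolding t_def by simp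
    then show ?thesis using t t' u by (intro exI[of _ t']) auto
  qed
  have bl: "block (comp_of_set n D) j = {(0 # ?X) ! min (j - 1) (length ?X) + 1..(0 # ?X) ! min j (length ?X)}"
    unfolding block_def al diffs_sum0[OF S] ..
  show ?thesis
  proof (intro set_eqI iffI)
    fix x assume x: "x \<in> block (comp_of_set n D) j"
    have "1 \<le> j" "j - 1 < length ?X"
      using x unfolding bl by (cases "j = 0"; cases "j - 1 < length ?X"; auto)+
    then obtain t where "j = Suc t" "t < length ?X" by (cases j) auto
    then show "x \<in> {x \<in> {1..n}. blk D x = j}" using x 1[of t x] unfolding bl by auto
  next
    fix x assume x: "x \<in> {x \<in> {1..n}. blk D x = j}"
    then obtain t where t: "t < length ?X" "(0 # ?X) ! t < x" "x \<le> (0 # ?X) ! Suc t" using 2[of x] by auto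
    then have "j = Suc t" using 1[OF t] x by simp
    then show "x \<in> block (comp_of_set n D) j" unfolding bl using t by (simp add: min_absorb1)
  qed
qed

lemma same_block:
  assumes T: "T \<in> SYT lam" and x: "1 \<le> x" "x \<le> y" "y \<le> sum_list lam"
    and b: "blk (descents (sum_list lam) (row_index T)) x = blk (descents (sum_list lam) (row_index T)) y"
  shows "row_index T y \<le> row_index T x"
proof (rule chain_ge[of x y "row_index T" x y])
  fix q assume q: "x \<le> q" "q < y"
  then have "q \<notin> descents (sum_list lam) (row_index T)" using blk_eqD[OF finite_descents b] by blast
  then show "row_index T (q + 1) \<le> row_index T q" using q x by (auto simp: descents_def)
qed (use x in auto)

lemma same_block_pos:
  assumes "T \<in> SYT lam" "1 \<le> x" "x < y" "y \<le> sum_list lam"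
    "blk (descents (sum_list lam) (row_index T)) x = blk (descents (sum_list lam) (row_index T)) y"
  shows "pos (row T) x < pos (row T) y"
  using same_block[of T lam x y] pos_row[of T lam x y] rel_of_up[of x y "row_index T"] assms by simp

lemma length_Des:
  assumes "T \<in> SYT lam" "0 < sum_list lam"
  shows "length (Des T) = Suc (card (descents (sum_list lam) (row_index T)))"
  unfolding Des_descents[OF assms(1)] comp_of_set_dl[OF assms(2) descents_sub] dl_last[OF descents_sub]
  by simp

lemma partition_0: "is_partition lam \<Longrightarrow> sum_list lam = 0 \<Longrightarrow> lam = []"
  unfolding is_partition_def by (cases lam) auto

text \<open>The first letter to reach row \<open>\<rho>\<close> or higher lies exactly in row
  \<open>\<rho>\<close>, because the cell below it holds an earlier letter. Its predecessor lies
  lower, which makes a descent, and different rows give different descents.\<close>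

lemma length_Des_ge:
  assumes lam: "is_partition lam" and T: "T \<in> SYT lam"
  shows "length lam \<le> length (Des T)"
proof (cases "sum_list lam = 0")
  case True then show ?thesis using partition_0[OF lam] by simp
next
  case False
  let ?n = "sum_list lam" and ?r = "row_index T"
  let ?D = "descents ?n ?r"
  have y: "yam lam ?r" and b: "bal ?n ?r" using SYT_yam[OF T] unfolding yam_def by auto
  have "\<rho> \<in> (\<lambda>d. ?r (Suc d)) ` ?D" if \<rho>: "\<rho> \<in> {1..<length lam}" for \<rho>
  proof -
    have "0 < lam ! \<rho>" using lam \<rho> unfolding is_partition_def by simp
    then have "{x \<in> {1..?n}. ?r x = \<rho>} \<noteq> {}" using y \<rho> unfolding yam_def cnt_def by (metis atLeastLessThan_iff card.empty less_irrefl)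
    then obtain x0 where x0: "1 \<le> x0 \<and> x0 \<le> ?n \<and> \<rho> \<le> ?r x0" by auto
    define x where "x = (LEAST x. 1 \<le> x \<and> x \<le> ?n \<and> \<rho> \<le> ?r x)"
    have x: "1 \<le> x \<and> x \<le> ?n \<and> \<rho> \<le> ?r x" unfolding x_def
      by (rule LeastI[where P = "\<lambda>x. 1 \<le> x \<and> x \<le> ?n \<and> \<rho> \<le> ?r x"]) (rule x0)
    have least: "\<not> \<rho> \<le> ?r z" if "1 \<le> z" "z < x" for z
      using not_less_Least[of z "\<lambda>x. 1 \<le> x \<and> x \<le> ?n \<and> \<rho> \<le> ?r x"] that x unfolding x_def by auto
    obtain \<sigma> where \<sigma>: "?r x = Suc \<sigma>" using x \<rho> by (cases "?r x") auto
    obtain z where z: "1 \<le> z" "z < x" "?r z = \<sigma>" using col_below[OF b _ \<sigma>] x by auto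
    have "\<sigma> < \<rho>" using least[OF z(1,2)] z(3) by simp
    then have rx: "?r x = \<rho>" using x \<sigma> by simp
    have "1 \<le> x - 1" "x - 1 < x" using z by auto
    then have "?r (x - 1) < \<rho>" using least[of "x - 1"] by simp
    then have "x - 1 \<in> ?D" using x z rx unfolding descents_def by auto
    then show ?thesis using rx x by (intro image_eqI[of _ _ "x - 1"]) auto
  qed
  then have "{1..<length lam} \<subseteq> (\<lambda>d. ?r (Suc d)) ` ?D" by blast
  then have "card {1..<length lam} \<le> card ?D" by (rule surj_card_le[OF finite_descents])
  then show ?thesis using length_Des[OF T] False by simp
qed

section \<open>Collapsing the blocks of a standard tableau\<close>

definition destd :: "nat list \<Rightarrow> tableau \<Rightarrow> tableau" where
  "destd lam T = map (map (blk (descents (sum_list lam) (row_index T)))) T"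

lemma count_concat_map:
  assumes "distinct (concat T)"
  shows "count (mset (concat (map (map g) T))) y = card {x \<in> set (concat T). g x = y}"
  using count_list_map_card[OF assms, of g y] by (simp only: map_concat[symmetric] count_mset)

lemma destd_weight:
  assumes T: "T \<in> SYT lam" and n: "0 < sum_list lam" and l: "length (Des T) = length lam"
  shows "Des T = weight (length lam) (destd lam T)"
proof (rule nth_equalityI)
  show "length (Des T) = length (weight (length lam) (destd lam T))" using l by (simp add: weight_def)
  fix k assume k: "k < length (Des T)"
  let ?D = "descents (sum_list lam) (row_index T)"
  note B = SYT_basic[OF T]
  have "weight (length lam) (destd lam T) ! k = count (mset (concat (destd lam T))) (Suc k)"
    using k l by (simp add: weight_def)
  also have "\<dots> = card {x \<in> set (concat T). blk ?D x = Suc k}"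
    unfolding destd_def by (rule count_concat_map[OF B(2)])
  also have "\<dots> = card (block (Des T) (Suc k))"
    unfolding B(3) Des_descents[OF T] block_blk[OF n descents_sub] ..
  also have "\<dots> = Des T ! k" using k by (simp add: block_def take_Suc_conv_app_nth)
  finally show "Des T ! k = weight (length lam) (destd lam T) ! k" by simp
qed

text \<open>Of two cells in a column the upper one holds the larger letter in a higher row, while
  rows weakly decrease along a block. So a descent separates them and the collapsed column is
  strict.\<close>

lemma destd_SSYT:
  assumes T: "T \<in> SYT lam" and n: "0 < sum_list lam" and l: "length (Des T) = length lam"
  shows "destd lam T \<in> SSYT lam (length lam)"
proof -
  let ?D = "descents (sum_list lam) (row_index T)"
  let ?g = "blk ?D"
  note B = SYT_basic[OF T]
  have ss: "semistandard T" using T by (simp add: SYT_def)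
  have len: "map length (destd lam T) = lam" using T by (simp add: destd_def SYT_def comp_def)
  have inT: "T ! i ! j \<in> {1..sum_list lam}" "row_index T (T ! i ! j) = i" if "i < length T" "j < length (T ! i)" for i j
  proof -
    have "T ! i ! j \<in> set (concat T)" using that nth_mem by fastforce
    then show "T ! i ! j \<in> {1..sum_list lam}" unfolding B(3) .
    show "row_index T (T ! i ! j) = i" using row_index_eq[OF B(2) that(1)] that(2) by simp
  qed
  have "semistandard (destd lam T)"
    unfolding semistandard_def
  proof (intro conjI ballI allI impI)
    fix w assume "w \<in> set (destd lam T)"
    then obtain v where v: "v \<in> set T" "w = map ?g v" by (auto simp: destd_def)
    then have "sorted v" using B(4) by blast
    then show "sorted w" unfolding v(2) sorted_map
      by (rule sorted_wrt_mono_rel[rotated]) (use blk_mono[OF finite_descents] in auto)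
  next
    fix i j assume ij: "Suc i < length (destd lam T)" "j < length (destd lam T ! Suc i)"
    then have i: "Suc i < length T" "j < length (T ! Suc i)" by (auto simp: destd_def)
    then have j: "j < length (T ! i)" "T ! i ! j < T ! Suc i ! j" using ss unfolding semistandard_def by blast+
    show "j < length (destd lam T ! i)" using i j by (simp add: destd_def)
    have "?g (T ! i ! j) \<le> ?g (T ! Suc i ! j)" using j by (intro blk_mono[OF finite_descents]) simp
    moreover have "?g (T ! i ! j) \<noteq> ?g (T ! Suc i ! j)"
    proof
      assume "?g (T ! i ! j) = ?g (T ! Suc i ! j)"
      then have "row_index T (T ! Suc i ! j) \<le> row_index T (T ! i ! j)"
        using same_block[OF T, of "T ! i ! j" "T ! Suc i ! j"] inT[of i j] inT[of "Suc i" j] i j by simp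
      then show False using inT(2)[of i j] inT(2)[of "Suc i" j] i j by simp
    qed
    ultimately show "destd lam T ! i ! j < destd lam T ! Suc i ! j" using i j by (simp add: destd_def)
  qed
  moreover have "1 \<le> x \<and> x \<le> length lam" if "x \<in> set (concat (destd lam T))" for x
  proof -
    have "concat (destd lam T) = map ?g (concat T)" by (simp add: destd_def map_concat)
    then have "x \<in> ?g ` set (concat T)" using that by (simp only: set_map)
    then obtain z where "x = ?g z" by blast
    then show ?thesis using blk_le[OF finite_descents] length_Des[OF T n] l by (auto simp: blk_def)
  qed
  ultimately show ?thesis unfolding SSYT_def using len by blast
qed

lemma pos_nth: "distinct w \<Longrightarrow> k < length w \<Longrightarrow> pos w (w ! k) = k"
proof (induction w arbitrary: k)
  case (Cons z w) then show ?case by (cases k) (auto simp: pos_Cons)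
qed simp

lemma nth_pos: "x \<in> set w \<Longrightarrow> w ! pos w x = x"
  by (induction w) (auto simp: pos_Cons)

text \<open>Within a block the letters are read in increasing order, so numbering equal collapsed
  letters from left to right restores them.\<close>

lemma std_destd:
  assumes T: "T \<in> SYT lam" shows "std (destd lam T) = T"
proof -
  let ?n = "sum_list lam"
  let ?g = "blk (descents ?n (row_index T))"
  have w: "distinct (row T)" "set (row T) = {1..?n}"
    using SYT_basic[OF T] distinct_row[of T] set_row[of T] by blast+
  have len: "length (row T) = ?n" using distinct_card[OF w(1)] w(2) by simp
  have lt: "x < y \<longleftrightarrow> ?g x < ?g y \<or> ?g x = ?g y \<and> pos (row T) x < pos (row T) y"
    if xy: "x \<in> {1..?n}" "y \<in> {1..?n}" for x y
  proof (cases x y rule: linorder_cases)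
    case less
    have "?g x \<le> ?g y" by (rule blk_mono[OF finite_descents]) (use less in simp)
    then show ?thesis using same_block_pos[OF T, of x y] less xy by auto
  next
    case greater
    have "?g y \<le> ?g x" by (rule blk_mono[OF finite_descents]) (use greater in simp)
    then show ?thesis using same_block_pos[OF T, of y x] greater xy by auto
  qed simp
  have "std_word (map ?g (row T)) = row T"
  proof (rule std_word_eqI[OF w(1)])
    show "set (row T) = {1..length (row T)}" using w len by simp
    fix p q assume pq: "p < length (row T)" "q < length (row T)"
    then have "row T ! p \<in> {1..?n}" "row T ! q \<in> {1..?n}" using w(2) nth_mem by blast+
    from lt[OF this] show "row T ! p < row T ! q \<longleftrightarrow>
       map ?g (row T) ! p < map ?g (row T) ! q \<or> map ?g (row T) ! p = map ?g (row T) ! q \<and> p < q"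
      using pq pos_nth[OF w(1)] by simp
  qed simp
  moreover have "refill (destd lam T) (row T) = refill T (row T)"
    by (rule refill_cong) (simp add: destd_def comp_def)
  ultimately show ?thesis
    unfolding std_def destd_def row_map using refill_map[of T id] by (simp add: list.map_id0)
qed

section \<open>Standardizing semistandard tableaux\<close>

lemma split_lens_props:
  "sum_list ls = length w \<Longrightarrow> map length (split_lens ls w) = ls \<and> concat (split_lens ls w) = w"
  by (induction ls w rule: split_lens.induct) auto

lemma refill_props:
  assumes "length w = length (row T)"
  shows "map length (refill T w) = map length T" "row (refill T w) = w"
proof -
  have "sum_list (rev (map length T)) = length w" unfolding assms row_def by (simp add: length_concat rev_map)
  note p = split_lens_props[OF this]
  show "map length (refill T w) = map length T" using p unfolding refill_def by (metis rev_map rev_rev_ident)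
  show "row (refill T w) = w" using p by (simp add: refill_def row_def)
qed

text \<open>The rows above are read first, so their total length is the offset of row
  \<open>i\<close>.\<close>

lemma row_nth:
  "i < length T \<Longrightarrow> j < length (T ! i) \<Longrightarrow>
   sum_list (drop (Suc i) (map length T)) + j < length (row T) \<and>
   row T ! (sum_list (drop (Suc i) (map length T)) + j) = T ! i ! j"
proof (induction T arbitrary: i)
  case (Cons t T)
  have len: "length (row T) = sum_list (map length T)" by (simp add: row_def length_concat rev_map[symmetric])
  show ?case
  proof (cases i)
    case 0
    then show ?thesis using Cons.prems len by (simp add: row_Cons nth_append)
  next
    case (Suc k)
    have "k < length T" "j < length (T ! k)" using Cons.prems Suc by auto
    note IH = Cons.IH[OF this]
    define e where "e = sum_list (drop (Suc k) (map length T)) + j"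
    have "e < length (row T)" "row T ! e = T ! k ! j" using IH unfolding e_def by blast+
    moreover have "sum_list (drop (Suc i) (map length (t # T))) + j = e" unfolding Suc e_def by simp
    ultimately show ?thesis unfolding Suc row_Cons by (simp add: nth_append)
  qed
qed simp

lemma std_word_props:
  "distinct (std_word v)" "set (std_word v) = {1..length v}" "length (std_word v) = length v"
  "\<And>p q. p < length v \<Longrightarrow> q < length v \<Longrightarrow>
    std_word v ! p < std_word v ! q \<longleftrightarrow> v ! p < v ! q \<or> v ! p = v ! q \<and> p < q"
proof -
  let ?n = "length v"
  define B where "B = (\<lambda>p. {q. q < ?n \<and> (v ! q < v ! p \<or> v ! q = v ! p \<and> q \<le> p)})"
  have fB: "finite (B p)" for p unfolding B_def by simp
  show len: "length (std_word v) = ?n" by (simp add: std_word_def)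
  have nth: "std_word v ! p = card (B p)" if p: "p < ?n" for p
  proof -
    have "std_word v ! p = card {q. q < length v \<and> v ! q < v ! p} +
       card {q. q < length (take (Suc p) v) \<and> take (Suc p) v ! q = v ! p}"
      using p unfolding std_word_def by (simp only: length_filter_conv_card length_map nth_map nth_upt length_upt) simp
    also have "{q. q < length (take (Suc p) v) \<and> take (Suc p) v ! q = v ! p} = {q. q \<le> p \<and> v ! q = v ! p}"
      using p by auto
    also have "card {q. q < length v \<and> v ! q < v ! p} + card {q. q \<le> p \<and> v ! q = v ! p} =
       card ({q. q < length v \<and> v ! q < v ! p} \<union> {q. q \<le> p \<and> v ! q = v ! p})"
      by (rule card_Un_disjoint[symmetric]) auto
    also have "{q. q < length v \<and> v ! q < v ! p} \<union> {q. q \<le> p \<and> v ! q = v ! p} = B p"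
      unfolding B_def using p by auto
    finally show ?thesis .
  qed
  have lt: "card (B p) < card (B q)" if "p < ?n" "q < ?n" "v ! p < v ! q \<or> v ! p = v ! q \<and> p < q" for p q
  proof (rule psubset_card_mono[OF fB])
    have "q \<in> B q" "q \<notin> B p" using that unfolding B_def by auto
    moreover have "B p \<subseteq> B q" using that unfolding B_def by auto
    ultimately show "B p \<subset> B q" by blast
  qed
  show o: "std_word v ! p < std_word v ! q \<longleftrightarrow> v ! p < v ! q \<or> v ! p = v ! q \<and> p < q"
    if pq: "p < ?n" "q < ?n" for p q
  proof -
    consider "v ! p < v ! q \<or> v ! p = v ! q \<and> p < q" | "v ! q < v ! p \<or> v ! q = v ! p \<and> q < p" | "p = q" by force
    then show ?thesis
    proof cases
      case 1 then show ?thesis using lt[OF pq] nth pq by simp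
    next
      case 2 then have "\<not> (v ! p < v ! q \<or> v ! p = v ! q \<and> p < q)" by auto
      then show ?thesis using lt[OF pq(2,1) 2] nth pq by simp
    qed simp
  qed
  have "std_word v ! p \<noteq> std_word v ! q" if "p < ?n" "q < ?n" "p \<noteq> q" for p q
    using o[OF that(1,2)] o[OF that(2,1)] that(3) by force
  then show d: "distinct (std_word v)" by (simp add: distinct_conv_nth len)
  have "set (std_word v) \<subseteq> {1..?n}"
  proof
    fix x assume "x \<in> set (std_word v)"
    then obtain p where p: "p < ?n" "x = card (B p)" using nth len by (auto simp: in_set_conv_nth)
    have "p \<in> B p" using p unfolding B_def by simp
    then have "0 < card (B p)" using fB card_gt_0_iff by blast
    moreover have "card (B p) \<le> card {..<?n}" by (rule card_mono) (auto simp: B_def)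
    ultimately show "x \<in> {1..?n}" using p by simp
  qed
  moreover have "card (set (std_word v)) = ?n" using distinct_card[OF d] len by simp
  ultimately show "set (std_word v) = {1..?n}" by (intro card_subset_eq) auto
qed

text \<open>The first column increases strictly through as many rows as there are letters available,
  which leaves a single filling.\<close>

lemma SSYT_first_column:
  assumes lam: "is_partition lam" and b: "b \<in> SSYT lam (length lam)"
  shows "i < length lam \<Longrightarrow> j < lam ! i \<Longrightarrow> i < b ! i ! j" "i < length lam \<Longrightarrow> b ! i ! 0 = Suc i"
proof -
  let ?L = "length lam"
  have len: "length b = ?L" "\<And>i. i < ?L \<Longrightarrow> length (b ! i) = lam ! i"
    using b unfolding SSYT_def by auto
  have ss: "semistandard b" using b by (simp add: SSYT_def)
  have pos: "i < ?L \<Longrightarrow> 0 < lam ! i" for i using lam by (simp add: is_partition_def)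
  have ent: "1 \<le> b ! i ! j \<and> b ! i ! j \<le> ?L" if "i < ?L" "j < lam ! i" for i j
  proof -
    have "i < length b" "j < length (b ! i)" using that len by auto
    then have "b ! i \<in> set b" "b ! i ! j \<in> set (b ! i)" by auto
    then have "b ! i ! j \<in> set (concat b)" by auto
    then show ?thesis using b unfolding SSYT_def by blast
  qed
  show 1: "i < ?L \<Longrightarrow> j < lam ! i \<Longrightarrow> i < b ! i ! j" for i j
  proof (induction i)
    case 0 then show ?case using ent[of 0 j] by simp
  next
    case (Suc i)
    then have "j < length (b ! i) \<and> b ! i ! j < b ! Suc i ! j" using ss len unfolding semistandard_def by simp
    then show ?case using Suc len by simp
  qed
  have "b ! (?L - 1 - k) ! 0 \<le> ?L - k" if "k < ?L" for k
    using that
  proof (induction k)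
    case 0 then show ?case using ent[of "?L - 1" 0] pos[of "?L - 1"] by simp
  next
    case (Suc k)
    let ?i = "?L - 1 - Suc k"
    have "Suc ?i < ?L" "Suc ?i = ?L - 1 - k" using Suc.prems by auto
    then have "b ! ?i ! 0 < b ! (?L - 1 - k) ! 0" using ss len pos[of "Suc ?i"] unfolding semistandard_def by (metis)
    then show ?case using Suc by simp
  qed
  from this[of "?L - 1 - i"] have "i < ?L \<Longrightarrow> b ! i ! 0 \<le> Suc i" by simp
  then show "i < ?L \<Longrightarrow> b ! i ! 0 = Suc i" using 1[of i 0] pos[of i] by simp
qed

lemma std_SYT:
  assumes b: "b \<in> SSYT lam L"
  defines "T \<equiv> std b" and "g \<equiv> \<lambda>x. row b ! pos (std_word (row b)) x"
  shows "T \<in> SYT lam" "b = map (map g) T"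
    "\<And>x y. x \<in> {1..sum_list lam} \<Longrightarrow> y \<in> {1..sum_list lam} \<Longrightarrow>
      x < y \<longleftrightarrow> g x < g y \<or> g x = g y \<and> pos (row T) x < pos (row T) y"
proof -
  let ?n = "sum_list lam"
  define v where "v = row b"
  define u where "u = std_word v"
  note U = std_word_props[where v = v, folded u_def]
  have lb: "map length b = lam" "semistandard b" using b by (auto simp: SSYT_def)
  have lv: "length v = ?n" unfolding v_def row_def using lb(1) by (auto simp: length_concat rev_map[symmetric])
  have Tu: "map length T = lam" "row T = u"
    unfolding T_def std_def using refill_props[of u b] U(3) lb(1) by (auto simp: u_def v_def)
  have nthT: "\<exists>k<?n. T ! i ! j = u ! k \<and> b ! i ! j = v ! k \<and> k = sum_list (drop (Suc i) lam) + j"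
    if "i < length lam" "j < lam ! i" for i j
  proof -
    have l: "length T = length lam" "length b = length lam" "length (T ! i) = lam ! i" "length (b ! i) = lam ! i"
      using Tu(1) lb(1) that by (metis length_map nth_map)+
    show ?thesis using row_nth[of i T j] row_nth[of i b j] l that Tu lb(1) lv v_def by auto
  qed
  have lT: "length T = length lam" "\<And>i. i < length lam \<Longrightarrow> length (T ! i) = lam ! i"
    "length b = length lam" "\<And>i. i < length lam \<Longrightarrow> length (b ! i) = lam ! i"
    using Tu(1) lb(1) by (metis length_map nth_map)+
  have "semistandard T"
    unfolding semistandard_def
  proof (intro conjI ballI allI impI)
    fix w assume "w \<in> set T"
    then obtain i where i: "i < length lam" "w = T ! i" using lT by (auto simp: in_set_conv_nth)
    show "sorted w" unfolding sorted_iff_nth_mono_less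
    proof (intro allI impI)
      fix j k assume jk: "j < k" "k < length w"
      then have k: "j < lam ! i" "k < lam ! i" using i lT by auto
      obtain x y where x: "x < ?n" "T ! i ! j = u ! x" "b ! i ! j = v ! x" "x = sum_list (drop (Suc i) lam) + j"
        and y: "y < ?n" "T ! i ! k = u ! y" "b ! i ! k = v ! y" "y = sum_list (drop (Suc i) lam) + k"
        using nthT[OF i(1) k(1)] nthT[OF i(1) k(2)] by blast
      have "sorted (b ! i)" using lb(2) i lT unfolding semistandard_def by simp
      then have "b ! i ! j \<le> b ! i ! k" using jk k lT(4)[OF i(1)] by (simp add: sorted_iff_nth_mono)
      then have "u ! x < u ! y" using U(4)[of x y] x y jk lv by auto
      then show "w ! j \<le> w ! k" using x y i by simp
    qed
  next
    fix i j assume ij: "Suc i < length T" "j < length (T ! Suc i)"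
    then have i: "Suc i < length lam" "j < lam ! Suc i" using lT by auto
    then have bj: "j < lam ! i" "b ! i ! j < b ! Suc i ! j"
      using lb(2) lT unfolding semistandard_def by (metis Suc_lessD)+
    show "j < length (T ! i)" using bj lT i by simp
    have i0: "i < length lam" using i by simp
    obtain x y where x: "x < ?n" "T ! i ! j = u ! x" "b ! i ! j = v ! x"
        and y: "y < ?n" "T ! Suc i ! j = u ! y" "b ! Suc i ! j = v ! y"
        using nthT[OF i0 bj(1)] nthT[OF i] by blast
    then show "T ! i ! j < T ! Suc i ! j" using U(4)[of x y] bj(2) lv by simp
  qed
  moreover have "mset (concat T) = mset [1..<?n + 1]"
  proof -
    have "mset (concat T) = mset u" using mset_row[of T] Tu(2) by simp
    also have "\<dots> = mset [1..<?n + 1]"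
    proof -
      have "set u = set [1..<?n + 1]" unfolding U(2) lv by auto
      then show ?thesis using set_eq_iff_mset_eq_distinct[OF U(1) distinct_upt] by blast
    qed
    finally show ?thesis .
  qed
  ultimately show "T \<in> SYT lam" unfolding SYT_def using Tu(1) by blast
  have gu: "g (u ! k) = v ! k" if "k < ?n" for k
    using that pos_nth[OF U(1), of k] U(3) lv unfolding g_def u_def v_def by simp
  have "map g u = v" by (rule nth_equalityI) (use gu U(3) lv in auto)
  then have "refill T (map g (row T)) = refill b v" using refill_cong[of T b] Tu lb by simp
  also have "\<dots> = b" using refill_map[of b id] unfolding v_def by (simp add: list.map_id0)
  finally show "b = map (map g) T" unfolding refill_map by simp
  fix x y assume xy: "x \<in> {1..?n}" "y \<in> {1..?n}"
  then have xu: "x \<in> set u" "y \<in> set u" using U(2) lv by auto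
  let ?p = "pos u x" and ?q = "pos u y"
  have pq: "?p < ?n" "?q < ?n" "u ! ?p = x" "u ! ?q = y"
    using pos_less[of x u] pos_less[of y u] nth_pos[of x u] nth_pos[of y u] xu U(3) lv by auto
  show "x < y \<longleftrightarrow> g x < g y \<or> g x = g y \<and> pos (row T) x < pos (row T) y"
    using U(4)[of ?p ?q] pq lv gu[of ?p] gu[of ?q] Tu(2) by simp
qed

text \<open>The letter \<open>k+1\<close> at the start of row \<open>k\<close> makes every change of
  letter a descent. If \<open>d+1\<close> is the first number with letter \<open>k+1\<close>, it is
  read no later than that cell and so lies in row \<open>k\<close> or higher, whereas
  \<open>d\<close>, with a letter at most \<open>k\<close>, lies below row \<open>k\<close>. As
  every letter occurs, blocks and letters carry the same numbers.\<close>

lemma destd_std: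
  assumes lam: "is_partition lam" and n: "0 < sum_list lam" and b: "b \<in> SSYT lam (length lam)"
  shows "std b \<in> SYT lam" "destd lam (std b) = b" "length (Des (std b)) = length lam"
proof -
  let ?n = "sum_list lam" and ?L = "length lam"
  define T where "T = std b"
  define g where "g = (\<lambda>x. row b ! pos (std_word (row b)) x)"
  have S: "T \<in> SYT lam" "b = map (map g) T" unfolding T_def g_def by (rule std_SYT(1,2)[OF b])+
  have S3: "x < y \<longleftrightarrow> g x < g y \<or> g x = g y \<and> pos (row T) x < pos (row T) y"
    if "x \<in> {1..?n}" "y \<in> {1..?n}" for x y
    unfolding T_def g_def by (rule std_SYT(3)[OF b that])
  show T: "std b \<in> SYT lam" using S(1) by (simp add: T_def)
  let ?r = "row_index T"
  let ?D = "descents ?n ?r"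
  note B = SYT_basic[OF S(1)]
  have lT: "length T = ?L" "\<And>i. i < ?L \<Longrightarrow> length (T ! i) = lam ! i"
    using S(1) unfolding SYT_def by (auto simp: map_eq_conv)
  have pos0: "0 < lam ! i" if "i < ?L" for i using lam that by (simp add: is_partition_def)
  have bT: "b ! i ! j = g (T ! i ! j)" if "i < ?L" "j < lam ! i" for i j
    using S(2) that lT by (metis nth_map)
  have inT: "T ! i ! j \<in> {1..?n}" "?r (T ! i ! j) = i" if "i < ?L" "j < lam ! i" for i j
  proof -
    have ij: "i < length T" "j < length (T ! i)" using that lT by auto
    then have "T ! i ! j \<in> set (concat T)" using nth_mem by fastforce
    then show "T ! i ! j \<in> {1..?n}" unfolding B(3) .
    show "?r (T ! i ! j) = i" using row_index_eq[OF B(2) ij(1)] ij(2) by simp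
  qed
  have gr: "?r x < g x" "g x \<le> ?L" "1 \<le> g x" if "x \<in> {1..?n}" for x
  proof -
    have "x \<in> set (concat T)" using that unfolding B(3) .
    from row_index_props[OF this] obtain j where j: "?r x < ?L" "j < lam ! ?r x" "T ! ?r x ! j = x"
      using lT by (auto simp: in_set_conv_nth)
    then show "?r x < g x" using SSYT_first_column(1)[OF lam b j(1,2)] bT[OF j(1,2)] by simp
    have "b ! ?r x ! j \<in> set (concat b)"
    proof -
      have "?r x < length b" "j < length (b ! ?r x)" using j b by (auto simp: SSYT_def)
      then show ?thesis using nth_mem by fastforce
    qed
    then show "g x \<le> ?L" "1 \<le> g x" using b bT[OF j(1,2)] j(3) by (auto simp: SSYT_def)
  qed
  have gmono: "g x \<le> g y" if "x \<in> {1..?n}" "y \<in> {1..?n}" "x \<le> y" for x y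
    using S3[OF that(1,2)] that(3) by (cases "x = y") auto
  have ex: "\<exists>z\<in>{1..?n}. g z = Suc k \<and> ?r z = k" if "k < ?L" for k
    using SSYT_first_column(2)[OF lam b that] bT[OF that pos0[OF that]] inT[OF that pos0[OF that]] by metis
  have D: "d \<in> ?D \<longleftrightarrow> g d < g (Suc d)" "g (Suc d) \<le> Suc (g d)" if d: "1 \<le> d" "d < ?n" for d
  proof -
    have dn: "d \<in> {1..?n}" "Suc d \<in> {1..?n}" using d by auto
    have hi: "Suc d \<le> z" if "z \<in> {1..?n}" "g d < g z" for z
      using gmono[OF that(1) dn(1)] that(2) by (meson not_less not_less_eq_eq)
    show "d \<in> ?D \<longleftrightarrow> g d < g (Suc d)"
    proof
      assume "d \<in> ?D"
      then have "?r d < ?r (Suc d)" by (simp add: descents_def)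
      then have "\<not> pos (row T) d < pos (row T) (Suc d)"
        using pos_row[OF S(1) dn] rel_of_up[of d "Suc d" ?r] by simp
      then show "g d < g (Suc d)" using S3[OF dn] by auto
    next
      assume lt: "g d < g (Suc d)"
      define k where "k = g (Suc d) - 1"
      have k: "k < ?L" "g (Suc d) = Suc k" using gr[OF dn(2)] unfolding k_def by auto
      obtain z where z: "z \<in> {1..?n}" "g z = Suc k" "?r z = k" using ex[OF k(1)] by blast
      have "Suc d \<le> z" using hi[OF z(1)] lt z(2) k(2) by simp
      then have "k \<le> ?r (Suc d)"
      proof (cases "z = Suc d")
        case False
        then have "Suc d < z" using \<open>Suc d \<le> z\<close> by simp
        then have "pos (row T) (Suc d) < pos (row T) z" using S3[OF dn(2) z(1)] k z by auto
        then show ?thesis using pos_row[OF S(1) dn(2) z(1)] rel_of_up[OF \<open>Suc d < z\<close>, of ?r] z by simp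
      qed (use z in simp)
      moreover have "?r d < g d" "g d \<le> k" using gr[OF dn(1)] lt k by auto
      ultimately show "d \<in> ?D" using d by (simp add: descents_def)
    qed
    show "g (Suc d) \<le> Suc (g d)"
    proof (rule ccontr)
      assume a: "\<not> g (Suc d) \<le> Suc (g d)"
      then have "g d < ?L" using gr(2)[OF dn(2)] by simp
      then obtain z where z: "z \<in> {1..?n}" "g z = Suc (g d)" using ex by blast
      then have "Suc d \<le> z" using hi by simp
      then show False using gmono[OF dn(2) z(1)] z a by simp
    qed
  qed
  have L0: "0 < ?L" using n by (cases lam) auto
  have g1: "g 1 = 1"
  proof -
    obtain z where "z \<in> {1..?n}" "g z = Suc 0" using ex[OF L0] by blast
    then have "g 1 \<le> 1" using gmono[of 1 z] n by auto
    then show ?thesis using gr(3)[of 1] n by simp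
  qed
  have bg: "blk ?D x = g x" if "1 \<le> x" "x \<le> ?n" for x
    using that
  proof (induction x)
    case (Suc x)
    show ?case
    proof (cases "x = 0")
      case True
      then have "{d \<in> ?D. d < Suc x} = {}" using descents_sub[of ?n ?r] by auto
      then show ?thesis using g1 True by (simp add: blk_def)
    next
      case False
      then have x: "1 \<le> x" "x < ?n" using Suc.prems by auto
      have "g x \<le> g (Suc x)" using gmono[of x "Suc x"] x by simp
      then show ?thesis using Suc.IH D[OF x] x blk_Suc[OF finite_descents, of ?n ?r x] by auto
    qed
  qed simp
  have dT: "destd lam T = map (map g) T"
  proof -
    have "blk ?D x = g x" if "w \<in> set T" "x \<in> set w" for w x
    proof -
      have "x \<in> set (concat T)" using that by auto
      then have "x \<in> {1..?n}" unfolding B(3) .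
      then show ?thesis using bg by simp
    qed
    then show ?thesis unfolding destd_def by simp
  qed
  show "destd lam (std b) = b" unfolding T_def[symmetric] dT by (rule S(2)[symmetric])
  have "?L - 1 < ?L" "Suc (?L - 1) = ?L" using L0 by auto
  then obtain z where z: "z \<in> {1..?n}" "g z = ?L" using ex[of "?L - 1"] by metis
  have nn: "?n \<in> {1..?n}" using n by simp
  have "z \<le> ?n" using z by simp
  then have "g ?n = ?L" using gmono[OF z(1) nn] gr(2)[OF nn] z(2) by simp
  then have "blk ?D ?n = ?L" using bg[of ?n] n by simp
  moreover have "{d \<in> ?D. d < ?n} = ?D" using descents_sub[of ?n ?r] by auto
  ultimately show "length (Des (std b)) = ?L" using length_Des[OF S(1) n] unfolding blk_def T_def by simp
qed

section \<open>From edges of the skeleton to crystal operators\<close>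

lemma blk_shift:
  assumes fin: "finite D" and K: "K + 1 \<in> D" "K \<notin> D"
  shows "blk (D - {K + 1} \<union> {K}) y = blk D y + (if y = K + 1 then 1 else 0)"
proof -
  have "blk (D - {K + 1} \<union> {K}) (Suc y) = blk D (Suc y) + (if Suc y = K + 1 then 1 else 0)" for y
  proof (induction y)
    case 0
    have "{d \<in> D - {K + 1} \<union> {K}. d < Suc 0} = (if K = 0 then insert 0 {d \<in> D. d < Suc 0} else {d \<in> D. d < Suc 0})"
      by (rule set_eqI) auto
    moreover have "0 \<notin> {d \<in> D. d < Suc 0}" if "K = 0" using K that by simp
    ultimately show ?case unfolding blk_def using fin by (cases "K = 0") simp_all
  next
    case (Suc y)
    then show ?case using K by (auto simp: blk_Suc[of _ "Suc y"] fin)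
  qed
  moreover have "blk (D - {K + 1} \<union> {K}) 0 = blk D 0" by (simp add: blk_def)
  ultimately show ?thesis by (cases y) auto
qed

text \<open>With types II and III excluded, one element changes its block, and following the cycle
  only the entry \<open>i+p\<close> of the collapsed tableau is raised, from \<open>j\<close> to
  \<open>j+1\<close>. Blocks may extend beyond the interval, which is why
  \<open>f_word_collapse\<close> allows further letters \<open>j\<close> and
  \<open>j+1\<close>.\<close>

lemma edge_destd:
  assumes T: "T \<in> SYT lam" "T' \<in> SYT lam" and i: "1 \<le> i" "i + 2 * m \<le> sum_list lam"
    and e: "edr (row_index T) i m p"
    and r: "\<forall>x\<in>{1..sum_list lam}. row_index T' x = row_index T (cyc (i + p) (i + m + p) x)"
    and t: "\<not> typ2 (sum_list lam) (row_index T) i m p" "\<not> typ3 (row_index T) i m p"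
  defines "j \<equiv> blk (descents (sum_list lam) (row_index T)) i"
  shows "f_tab j (destd lam T) = Some (destd lam T')" "1 \<le> j" "j < length (Des T)"
    "jidx (Des T) (i, i + 2 * m) = j"
proof -
  let ?n = "sum_list lam" and ?r = "row_index T"
  let ?D = "descents ?n ?r"
  let ?g = "blk ?D" and ?s = "sg (i + p) (i + m + p)"
  have E: "1 \<le> m" "p \<le> m" using e unfolding edr_def by auto
  have n: "0 < ?n" using i by simp
  note fl = descents_edge(1)[OF e i]
  define D' where "D' = descents ?n (row_index T')"
  have "D' = descents ?n (\<lambda>x. ?r (cyc (i + p) (i + m + p) x))"
    unfolding D'_def by (rule descents_cong) (use r in auto)
  then have "D' = ?D - {i + m} \<union> {i + m - 1}" using descents_edge(2)[OF e i] t by simp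
  moreover have "i + m - 1 + 1 = i + m" using E by simp
  ultimately have D': "D' = ?D - {i + m - 1 + 1} \<union> {i + m - 1}" by simp
  have K: "i + m - 1 + 1 \<in> ?D" "i + m - 1 \<notin> ?D" using fl E unfolding flat_def by auto
  have gD': "blk D' y = ?g y + (if y = i + m then 1 else 0)" for y
    unfolding D' using blk_shift[OF finite_descents K, of y] E by simp
  have gx: "?g x = j" if "i \<le> x" "x \<le> i + m" for x
    unfolding j_def by (rule blk_const[symmetric]) (use that fl in \<open>auto simp: flat_def\<close>)
  have gK: "?g (Suc (i + m)) = Suc j" using blk_Suc[OF finite_descents, of ?n ?r "i + m"] gx[of "i + m"] fl unfolding flat_def by simp
  have gy: "?g x = Suc j" if "i + m < x" "x \<le> i + 2 * m" for x
    unfolding gK[symmetric] by (rule blk_const[symmetric]) (use that fl in \<open>auto simp: flat_def\<close>)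
  have w: "distinct (row T)" "set (row T) = {1..?n}"
    using SYT_basic[OF T(1)] distinct_row[of T] set_row[of T] by blast+
  have d: "dyck_at (pos (row T)) i m p" using dyck_at_edr[OF T(1) i] e by simp
  have "f_word j (map ?g (row T)) = Some (map (?g(i + p := Suc j)) (row T))"
  proof (rule f_word_collapse[OF d w(1)])
    show "{i..i + 2 * m} \<subseteq> set (row T)" using w i by auto
    fix x assume x: "x \<in> set (row T)" "?g x = j"
    have "\<not> i + m < x"
    proof
      assume "i + m < x"
      then have "?g (Suc (i + m)) \<le> ?g x" by (intro blk_mono[OF finite_descents]) simp
      then show False using gK x by simp
    qed
    moreover have "pos (row T) x < pos (row T) (i + p)" if "x < i"
      by (rule same_block_pos[OF T(1)]) (use that x w i E gx[of "i + p"] in auto)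
    ultimately show "x \<le> i + m \<and> (x < i \<longrightarrow> pos (row T) x < pos (row T) (i + p))" by simp
  next
    fix x assume x: "x \<in> set (row T)" "?g x = Suc j"
    have "\<not> x \<le> i + m"
    proof
      assume "x \<le> i + m"
      then have "?g x \<le> ?g (i + m)" by (rule blk_mono[OF finite_descents])
      then show False using gx[of "i + m"] x by simp
    qed
    moreover have "pos (row T) (i + p) < pos (row T) x" if "i + 2 * m < x"
    proof -
      have xn: "x \<in> {1..?n}" "i + p \<in> {1..?n}" using x w i E by auto
      \<comment> \<open>\<open>y\<close> is the letter of rank \<open>p\<close> after the descent,
        which for \<open>p = m\<close> lies just outside the interval. There the failure of
        \<open>typ2\<close> ensures that it is not above \<open>i+p\<close>.\<close>
      define y where "y = (if p < m then i + m + 1 + p else i + 2 * m + 1)"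
      have y: "i + m < y" "y \<le> x" "y \<le> i + 2 * m + 1" using that E unfolding y_def by auto
      have "?g (Suc (i + m)) \<le> ?g y" "?g y \<le> ?g x" using y by (auto intro!: blk_mono[OF finite_descents])
      then have gyx: "?g y = ?g x" using x gK by simp
      have "?r y \<le> ?r (i + p)"
      proof (cases "p < m")
        case True then show ?thesis using e unfolding edr_def y_def by simp
      next
        case False
        then have p: "p = m" using E by simp
        have "?g (i + 2 * m) = ?g (i + 2 * m + 1)" using gy[of "i + 2 * m"] gyx x False E y_def by simp
        then have "?r (i + 2 * m + 1) \<le> ?r (i + 2 * m)"
          by (intro same_block[OF T(1)]) (use that xn i in auto)
        then show ?thesis using t(1) p that xn unfolding typ2_def y_def by auto
      qed
      moreover have "?r x \<le> ?r y" by (rule same_block[OF T(1) _ y(2) _ gyx]) (use y xn in auto)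
      ultimately show ?thesis using pos_row[OF T(1) xn(2,1)] rel_of_up[of "i + p" x ?r] that E by simp
    qed
    ultimately show "i + m < x \<and> (i + 2 * m < x \<longrightarrow> pos (row T) (i + p) < pos (row T) x)" by simp
  qed (use gx gy in auto)
  then have f: "f_tab j (destd lam T) = Some (map (map (?g(i + p := Suc j))) T)"
    unfolding f_tab_def destd_def row_map
    using refill_cong[of "map (map ?g) T" T] by (simp add: comp_def refill_map)
  have g': "blk D' (?s x) = (?g(i + p := Suc j)) x" if x: "x \<in> {1..?n}" for x
  proof -
    consider "x = i + p" | "i + p < x" "x \<le> i + m" | "x = i + m + 1" "i + p < x" "x \<le> i + m + p"
      | "i + m + 1 < x" "x \<le> i + m + p" | "x < i + p \<or> i + m + p < x" by linarith
    then show ?thesis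
    proof cases
      case 1
      then show ?thesis unfolding gD' using gx[of "i + m"] gy[of "i + m + p"] E by (auto simp: sg_def)
    next
      case 2
      then show ?thesis unfolding gD' using gx[of "x - 1"] gx[of x] E by (auto simp: sg_def)
    next
      case 3
      then show ?thesis unfolding gD' using gx[of "i + m"] gK E by (auto simp: sg_def)
    next
      case 4
      then show ?thesis unfolding gD' using gy[of "x - 1"] gy[of x] E by (auto simp: sg_def)
    next
      case 5
      then show ?thesis unfolding gD' using E by (auto simp: sg_def)
    qed
  qed
  have "T' = map (map ?s) T"
    by (rule SYT_inj[OF T(2) edge_target(1)[OF T(1) e i]]) (use r edge_target(2)[OF T(1) e i] in simp)
  then have "destd lam T' = map (map (\<lambda>x. blk D' (?s x))) T" by (simp add: destd_def D'_def)
  also have "\<dots> = map (map (?g(i + p := Suc j))) T"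
  proof -
    have "x \<in> {1..?n}" if "v \<in> set T" "x \<in> set v" for v x
    proof -
      have "x \<in> set (concat T)" using that by auto
      then show ?thesis unfolding SYT_basic(3)[OF T(1)] .
    qed
    then show ?thesis using g' by (intro map_cong refl) blast
  qed
  finally show "f_tab j (destd lam T) = Some (destd lam T')" using f by simp
  show "1 \<le> j" by (simp add: j_def blk_def)
  have "Suc j \<le> Suc (card ?D)" using gK blk_le[OF finite_descents, of ?n ?r "Suc (i + m)"] by simp
  then show "j < length (Des T)" using length_Des[OF T(1) n] by simp
  have "i \<in> block (Des T) j0 \<longleftrightarrow> j = j0" for j0
    unfolding Des_descents[OF T(1)] block_blk[OF n descents_sub] j_def using i by auto
  then show "jidx (Des T) (i, i + 2 * m) = j" unfolding jidx_def by (intro Least_equality) auto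
qed

section \<open>From crystal operators back to edges\<close>

lemma set_drop_pos: "distinct w \<Longrightarrow> set (drop k w) = {z \<in> set w. k \<le> pos w z}"
proof (induction w arbitrary: k)
  case (Cons x w)
  then show ?case by (cases k) (auto simp: pos_Cons)
qed simp

lemma set_take_pos: "distinct w \<Longrightarrow> set (take k w) = {z \<in> set w. pos w z < k}"
proof (induction w arbitrary: k)
  case (Cons x w)
  then show ?case by (cases k) (auto simp: pos_Cons)
qed simp

text \<open>Conversely, a crystal operator acting on the collapsed tableau determines the interval:
  if \<open>p\<close> letters of the block \<open>{K+1..C}\<close> precede the changed letter \<open>a\<close> of the block \<open>{A..K}\<close>
  and \<open>K - a\<close> letters of \<open>{A..K}\<close> follow it, then \<open>m = p + (K - a)\<close>.\<close>
lemma crystal_interval: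
  fixes P :: "nat \<Rightarrow> nat"
  assumes w: "distinct (u @ a # v)" and P: "P = pos (u @ a # v)"
    and sub: "{A..C} \<subseteq> set (u @ a # v)" and a: "A \<le> a" "a \<le> K" "K < C"
    and incx: "\<And>x y. A \<le> x \<Longrightarrow> x < y \<Longrightarrow> y \<le> K \<Longrightarrow> P x < P y"
    and incy: "\<And>x y. K < x \<Longrightarrow> x < y \<Longrightarrow> y \<le> C \<Longrightarrow> P x < P y"
    and des: "P (Suc K) < P K"
    and cu: "\<And>k. card (set (drop k u) \<inter> {K<..C}) \<le> card (set (drop k u) \<inter> {A..K})"
    and cv: "\<And>k. card (set (take k v) \<inter> {A..K}) \<le> card (set (take k v) \<inter> {K<..C})"
  shows "\<exists>i m p. A \<le> i \<and> i + m = K \<and> i + 2 * m \<le> C \<and> dyck_at P i m p \<and> i + p = a \<and>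
     (K + 1 + m \<le> C \<longrightarrow> p = m \<longrightarrow> P a < P (K + 1 + m))"
proof -
  let ?w = "u @ a # v"
  have du: "distinct u" "distinct v" "a \<notin> set u" "a \<notin> set v" "set u \<inter> set v = {}" using w by auto
  have inj: "P x = P y \<Longrightarrow> x = y" if "x \<in> set ?w" "y \<in> set ?w" for x y
    using pos_inj[of ?w] that unfolding P inj_on_def by blast
  have Pa: "P a = length u" unfolding P using du by (simp add: pos_append pos_Cons)
  have Pu: "P z = pos u z" "P z < P a" if "z \<in> set u" for z
    using that pos_less[OF that] Pa unfolding P by (auto simp: pos_append)
  have Pv: "P z = Suc (length u + pos v z)" "P a < P z" if "z \<in> set v" for z
  proof -
    have "z \<notin> set u" "z \<noteq> a" using that du by auto
    then show "P z = Suc (length u + pos v z)" unfolding P by (simp add: pos_append pos_Cons)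
    then show "P a < P z" using Pa by simp
  qed
  have inu: "z \<in> set u \<longleftrightarrow> P z < P a" and inv: "z \<in> set v \<longleftrightarrow> P a < P z" if "z \<in> set ?w" for z
    using that Pu(2)[of z] Pv(2)[of z] by auto
  have mem: "z \<in> set ?w" if "A \<le> z" "z \<le> C" for z using sub that by (meson atLeastAtMost_iff subsetD)
  \<comment> \<open>The letters of the second block that precede \<open>a\<close> form an initial
    segment of it, and \<open>p\<close> is their number.\<close>
  define p where "p = (LEAST q. \<not> (K + 1 + q \<le> C \<and> P (K + 1 + q) < P a))"
  have ex: "\<not> (K + 1 + C \<le> C \<and> P (K + 1 + C) < P a)" by simp
  have pf: "\<not> (K + 1 + p \<le> C \<and> P (K + 1 + p) < P a)"
    unfolding p_def by (rule LeastI[where P = "\<lambda>q. \<not> (K + 1 + q \<le> C \<and> P (K + 1 + q) < P a)"]) (rule ex)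
  have pb: "K + 1 + q \<le> C" "P (K + 1 + q) < P a" if "q < p" for q
    using not_less_Least[of q "\<lambda>q. \<not> (K + 1 + q \<le> C \<and> P (K + 1 + q) < P a)"] that unfolding p_def by auto
  have ygt: "P a < P y" if "K + 1 + p \<le> y" "y \<le> C" for y
  proof -
    have "\<not> P (K + 1 + p) < P a" using pf that by simp
    moreover have "P (K + 1 + p) \<noteq> P a"
      using inj[of "K + 1 + p" a] mem[of "K + 1 + p"] that a by auto
    moreover have "P (K + 1 + p) \<le> P y" using incy[of "K + 1 + p" y] that by (cases "y = K + 1 + p") auto
    ultimately show ?thesis by simp
  qed
  have ylt: "P y < P a" if "K < y" "y \<le> K + p" for y
    using pb(2)[of "y - (K + 1)"] that by simp
  have pC: "K + p \<le> C" using pb(1)[of "p - 1"] a by (cases "p = 0") auto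
  define q where "q = K - a"
  have q: "a + q = K" using a q_def by simp
  have uY: "set u \<inter> {K<..C} = {K<..K + p}"
  proof (intro set_eqI iffI)
    fix y assume y: "y \<in> set u \<inter> {K<..C}"
    then have "P y < P a" using Pu by auto
    then have "\<not> K + 1 + p \<le> y" using ygt[of y] y by auto
    then show "y \<in> {K<..K + p}" using y by auto
  next
    fix y assume y: "y \<in> {K<..K + p}"
    then have "y \<in> set ?w" by (intro mem) (use y pC a in auto)
    moreover have "P y < P a" using ylt y by simp
    ultimately have "y \<in> set u" by (rule inu[THEN iffD2])
    then show "y \<in> set u \<inter> {K<..C}" using y pC by simp
  qed
  have uX: "set u \<inter> {A..K} = {A..<a}"
  proof (intro set_eqI iffI)
    fix x assume x: "x \<in> set u \<inter> {A..K}"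
    then have "P x < P a" using Pu by auto
    then have "\<not> a < x" "x \<noteq> a" using incx[of a x] x a by auto
    then show "x \<in> {A..<a}" using x by auto
  next
    fix x assume x: "x \<in> {A..<a}"
    then have "x \<in> set ?w" by (intro mem) (use x a in auto)
    moreover have "P x < P a" using incx x a by simp
    ultimately have "x \<in> set u" by (rule inu[THEN iffD2])
    then show "x \<in> set u \<inter> {A..K}" using x a by simp
  qed
  have vX: "set v \<inter> {A..K} = {a<..K}"
  proof (intro set_eqI iffI)
    fix x assume x: "x \<in> set v \<inter> {A..K}"
    then have "P a < P x" using Pv by auto
    then have "\<not> x < a" "x \<noteq> a" using incx[of x a] x a by auto
    then show "x \<in> {a<..K}" using x by auto
  next
    fix x assume x: "x \<in> {a<..K}"
    then have "x \<in> set ?w" by (intro mem) (use x a in auto)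
    moreover have "P a < P x" using incx x a by simp
    ultimately have "x \<in> set v" by (rule inv[THEN iffD2])
    then show "x \<in> set v \<inter> {A..K}" using x a by simp
  qed
  have vY: "set v \<inter> {K<..C} = {K + p<..C}"
  proof (intro set_eqI iffI)
    fix y assume y: "y \<in> set v \<inter> {K<..C}"
    then have "P a < P y" using Pv by auto
    then have "\<not> y \<le> K + p" using ylt[of y] y by auto
    then show "y \<in> {K + p<..C}" using y by auto
  next
    fix y assume y: "y \<in> {K + p<..C}"
    then have "y \<in> set ?w" by (intro mem) (use a in auto)
    moreover have "P a < P y" using ygt y by simp
    ultimately have "y \<in> set v" by (rule inv[THEN iffD2])
    then show "y \<in> set v \<inter> {K<..C}" using y by simp
  qed
  have pA: "p \<le> a - A" using cu[of 0] uX uY by simp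
  have qC: "q \<le> C - (K + p)" using cv[of "length v"] vX vY q by simp
  define m where "m = p + q"
  define i where "i = a - p"
  have i: "A \<le> i" "i + p = a" "i + m = K" "i + 2 * m \<le> C" using pA a q qC pC unfolding i_def m_def by auto
  \<comment> \<open>For \<open>m = 0\<close> the letter \<open>a = K\<close> would precede the
    second block, against the descent at \<open>K\<close>.\<close>
  have m1: "1 \<le> m"
  proof (rule ccontr)
    assume "\<not> 1 \<le> m"
    then have "p = 0" "a = K" using q unfolding m_def by auto
    then show False using pf des a by simp
  qed
  \<comment> \<open>Otherwise the suffix of \<open>u\<close> from the place of \<open>K+1+t\<close>
    on contains the \<open>p - t\<close> letters \<open>K+1+t, ..., K+p\<close> of the second block,
    but of the first block at most the \<open>p - t - 1\<close> letters between \<open>i+t\<close>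
    and \<open>a\<close>, against \<open>cu\<close>.\<close>
  have c3: "P (K + 1 + t) < P (i + t)" if t: "t < p" for t
  proof (rule ccontr)
    let ?y = "K + 1 + t" and ?x = "i + t"
    assume "\<not> P ?y < P ?x"
    moreover have xy: "?y \<in> set ?w" "?x \<in> set ?w" by (intro mem; use t pC i a in linarith)+
    moreover have "?y \<noteq> ?x" using t i a by linarith
    ultimately have lt: "P ?x < P ?y" using inj[OF xy] by linarith
    let ?s = "drop (P ?y) u"
    have s: "z \<in> set ?s \<longleftrightarrow> z \<in> set u \<and> P ?y \<le> P z" for z
      unfolding set_drop_pos[OF du(1)] using Pu(1) by auto
    have "{K + t<..K + p} \<subseteq> set ?s \<inter> {K<..C}"
    proof
      fix z assume z: "z \<in> {K + t<..K + p}"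
      then have "z \<in> {K<..K + p}" using t by simp
      then have "z \<in> set u" unfolding uY[symmetric] by blast
      moreover have "P ?y \<le> P z" using incy[of ?y z] z pC by (cases "z = ?y") auto
      ultimately show "z \<in> set ?s \<inter> {K<..C}" using s z pC by auto
    qed
    then have "card {K + t<..K + p} \<le> card (set ?s \<inter> {K<..C})" by (intro card_mono) auto
    also have "\<dots> \<le> card (set ?s \<inter> {A..K})" by (rule cu)
    also have "\<dots> \<le> card {?x<..<a}"
    proof (rule card_mono)
      show "set ?s \<inter> {A..K} \<subseteq> {?x<..<a}"
      proof
        fix z assume z: "z \<in> set ?s \<inter> {A..K}"
        then have "z \<in> set u \<inter> {A..K}" "P ?x < P z" using s lt by auto
        then have "z < a" "\<not> z \<le> ?x" using uX incx[of z ?x] z i t a by (auto simp: le_less)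
        then show "z \<in> {?x<..<a}" by simp
      qed
    qed simp
    finally show False using t i(2) by simp
  qed
  \<comment> \<open>The mirrored count: otherwise the prefix of \<open>v\<close> up to
    \<open>i+t\<close> contains \<open>t - p\<close> letters of the first block and at most
    \<open>t - p - 1\<close> of the second, against \<open>cv\<close>.\<close>
  have c4: "P (i + m + t) < P (i + t)" if t: "p < t" "t \<le> m" for t
  proof (rule ccontr)
    let ?y = "K + t" and ?x = "i + t"
    assume "\<not> P (i + m + t) < P (i + t)"
    then have "\<not> P ?y < P ?x" using i by simp
    moreover have xy: "?y \<in> set ?w" "?x \<in> set ?w" by (intro mem; use t i a in linarith)+
    moreover have "?y \<noteq> ?x" using t i m1 by auto
    ultimately have lt: "P ?x < P ?y" using inj[OF xy] by linarith
    have xK: "a < ?x" "?x \<le> K" using t i by auto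
    then have "?x \<in> {a<..K}" by simp
    then have xv: "?x \<in> set v" unfolding vX[symmetric] by blast
    let ?s = "take (Suc (pos v ?x)) v"
    have s: "z \<in> set ?s \<longleftrightarrow> z \<in> set v \<and> P z \<le> P ?x" for z
      unfolding set_take_pos[OF du(2)] using Pv(1)[of z] Pv(1)[OF xv] by auto
    have "{a<..?x} \<subseteq> set ?s \<inter> {A..K}"
    proof
      fix z assume z: "z \<in> {a<..?x}"
      then have "z \<in> {a<..K}" using xK by simp
      then have "z \<in> set v" unfolding vX[symmetric] by blast
      moreover have "P z \<le> P ?x" using incx[of z ?x] z a xK by (cases "z = ?x") auto
      ultimately show "z \<in> set ?s \<inter> {A..K}" using s z a xK by auto
    qed
    then have "card {a<..?x} \<le> card (set ?s \<inter> {A..K})" by (intro card_mono) auto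
    also have "\<dots> \<le> card (set ?s \<inter> {K<..C})" by (rule cv)
    also have "\<dots> \<le> card {K + p<..<?y}"
    proof (rule card_mono)
      show "set ?s \<inter> {K<..C} \<subseteq> {K + p<..<?y}"
      proof
        fix z assume z: "z \<in> set ?s \<inter> {K<..C}"
        then have "z \<in> set v \<inter> {K<..C}" "P z < P ?y" using s lt by auto
        then have "K + p < z" "\<not> ?y \<le> z" using vY incy[of ?y z] z t by (auto simp: le_less)
        then show "z \<in> {K + p<..<?y}" by simp
      qed
    qed simp
    finally show False using t i(2) by simp
  qed
  have "dyck_at P i m p"
    unfolding dyck_at_def
  proof (intro conjI allI impI)
    show "p \<le> m" by (simp add: m_def)
    show "P (i + q) < P (i + q + 1)" if "q < m" for q by (rule incx) (use that i in auto)
    show "P (i + m + q) < P (i + m + q + 1)" if "1 \<le> q" "q < m" for q by (rule incy) (use that i in auto)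
    show "P (i + m + 1 + q) < P (i + q)" if "q < p" for q using c3[OF that] i(3) by simp
    show "P (i + p) < P (i + m + 1 + p)" if "p < m" using ygt[of "K + 1 + p"] i that by simp
  qed (use m1 c4 in auto)
  moreover have "P a < P (K + 1 + m)" if "K + 1 + m \<le> C" "p = m" using ygt[of "K + 1 + m"] that by simp
  ultimately show ?thesis using i by blast
qed

text \<open>The letter changed by the operator determines the interval through
  \<open>crystal_interval\<close>. The edge found there keeps the length: in type II the letter
  \<open>K+1+m\<close> would belong to the second block and be read before \<open>a\<close>, and
  type III would produce fewer blocks than \<open>lam\<close> has rows.\<close>

lemma crystal_edge_lift:
  assumes lam: "is_partition lam" and T: "T \<in> SYT lam" and l: "length (Des T) = length lam"
    and j: "1 \<le> j" "j < length lam" and f: "f_tab j (destd lam T) = Some c"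
  shows "\<exists>i m T'. (T, (i, i + 2 * m), T') \<in> edges (CS lam) \<and> length (Des T') = length lam \<and>
    c = destd lam T' \<and> jidx (Des T) (i, i + 2 * m) = j"
proof -
  let ?n = "sum_list lam" and ?r = "row_index T"
  let ?D = "descents ?n ?r"
  let ?g = "blk ?D" and ?P = "pos (row T)"
  have n: "0 < ?n"
  proof (rule ccontr)
    assume "\<not> 0 < ?n"
    then have "?n = 0" by blast
    then have "lam = []" by (rule partition_0[OF lam])
    then show False using j by simp
  qed
  have w: "distinct (row T)" "set (row T) = {1..?n}"
    using SYT_basic[OF T] distinct_row[of T] set_row[of T] by blast+
  obtain w' where "f_word j (map ?g (row T)) = Some w'"
    using f unfolding f_tab_def destd_def row_map by (cases "f_word j (map ?g (row T))") simp_all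
  from this[unfolded f_word_iff] obtain U V where UV: "map ?g (row T) = U @ j # V"
     "\<forall>k. count_list (drop k U) (Suc j) \<le> count_list (drop k U) j"
     "\<forall>k. count_list (take k V) j \<le> count_list (take k V) (Suc j)" by (elim exE conjE)
  from UV(1)[unfolded map_eq_append_conv] obtain u av where 1: "row T = u @ av" "U = map ?g u" "j # V = map ?g av"
    by (elim exE conjE)
  obtain a v where 2: "av = a # v" "?g a = j" "V = map ?g v" using 1(3) by (cases av) simp_all
  have rT: "row T = u @ a # v" using 1(1) 2(1) by simp
  have du: "distinct u" "distinct v" using w(1) unfolding rT by auto
  define S where "S = (\<lambda>k. sum_list (take k (Des T)))"
  define A where "A = S (j - 1) + 1"
  define K where "K = S j"
  define C where "C = S (Suc j)"
  have bl: "{x \<in> {1..?n}. ?g x = k} = {S (k - 1) + 1..S k}" for k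
  proof -
    have "block (Des T) k = {x \<in> {1..?n}. ?g x = k}"
      unfolding Des_descents[OF T] by (rule block_blk[OF n descents_sub])
    then show ?thesis unfolding block_def S_def ..
  qed
  have bx: "x \<in> {1..?n} \<and> ?g x = j \<longleftrightarrow> x \<in> {A..K}" for x
  proof -
    have "x \<in> {x \<in> {1..?n}. ?g x = j} \<longleftrightarrow> x \<in> {A..K}" unfolding bl A_def K_def ..
    then show ?thesis by (simp only: mem_Collect_eq)
  qed
  have by': "x \<in> {1..?n} \<and> ?g x = Suc j \<longleftrightarrow> x \<in> {K<..C}" for x
  proof -
    have "x \<in> {x \<in> {1..?n}. ?g x = Suc j} \<longleftrightarrow> x \<in> {K<..C}" unfolding bl C_def K_def by auto
    then show ?thesis by (simp only: mem_Collect_eq)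
  qed
  have KC: "K < C"
  proof -
    have "Des T ! j \<in> set (Des T)" using j l by simp
    then have "0 < Des T ! j" using Des_composition[OF T] unfolding is_composition_def by blast
    then show ?thesis unfolding K_def C_def S_def using j l by (simp add: take_Suc_conv_app_nth)
  qed
  have "a \<in> {1..?n}" using w(2) unfolding rT by auto
  then have a: "A \<le> a" "a \<le> K" using bx[of a] 2(2) by auto
  have A1: "1 \<le> A" by (simp add: A_def)
  have Cn: "C \<le> ?n" using by'[of C] KC by auto
  have incx: "?P x < ?P y" if "A \<le> x" "x < y" "y \<le> K" for x y
    by (rule same_block_pos[OF T]) (use that A1 KC Cn bx[of x] bx[of y] in auto)
  have incy: "?P x < ?P y" if "K < x" "x < y" "y \<le> C" for x y
    by (rule same_block_pos[OF T]) (use that KC Cn by'[of x] by'[of y] in auto)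
  have KD: "?r K < ?r (Suc K)"
  proof -
    have "?g K = j" "?g (Suc K) = Suc j" using bx[of K] by'[of "Suc K"] a KC by auto
    then have "K \<in> ?D" using blk_Suc[OF finite_descents, of ?n ?r K] by (auto split: if_splits)
    then show ?thesis by (simp add: descents_def)
  qed
  have Kn: "K \<in> {1..?n}" "Suc K \<in> {1..?n}" using a A1 KC Cn by auto
  have des: "?P (Suc K) < ?P K"
    using pos_row[OF T Kn(2,1)] rel_of_down[of K "Suc K" ?r] KD by simp
  have subu: "set u \<subseteq> {1..?n}" "set v \<subseteq> {1..?n}" using w(2) unfolding rT by auto
  have cx: "card {x \<in> set s. ?g x = j} = card (set s \<inter> {A..K})" "card {x \<in> set s. ?g x = Suc j} = card (set s \<inter> {K<..C})"
    if "set s \<subseteq> {1..?n}" for s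
  proof -
    have "{x \<in> set s. ?g x = j} = set s \<inter> {A..K}" "{x \<in> set s. ?g x = Suc j} = set s \<inter> {K<..C}"
      using that bx by' by blast+
    then show "card {x \<in> set s. ?g x = j} = card (set s \<inter> {A..K})" "card {x \<in> set s. ?g x = Suc j} = card (set s \<inter> {K<..C})"
      by simp_all
  qed
  have cu: "card (set (drop k u) \<inter> {K<..C}) \<le> card (set (drop k u) \<inter> {A..K})" for k
  proof -
    have "set (drop k u) \<subseteq> {1..?n}" using subu(1) set_drop_subset[of k u] by blast
    note c = cx[OF this]
    have "drop k U = map ?g (drop k u)" unfolding 1(2) by (rule drop_map)
    then show ?thesis using UV(2)[rule_format, of k] count_list_map_card[of "drop k u" ?g] du(1) c by simp
  qed
  have cv: "card (set (take k v) \<inter> {A..K}) \<le> card (set (take k v) \<inter> {K<..C})" for k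
  proof -
    have "set (take k v) \<subseteq> {1..?n}" using subu(2) set_take_subset[of k v] by blast
    note c = cx[OF this]
    have "take k V = map ?g (take k v)" unfolding 2(3) by (rule take_map)
    then show ?thesis using UV(3)[rule_format, of k] count_list_map_card[of "take k v" ?g] du(2) c by simp
  qed
  have "\<exists>i m p. A \<le> i \<and> i + m = K \<and> i + 2 * m \<le> C \<and> dyck_at ?P i m p \<and> i + p = a \<and>
     (K + 1 + m \<le> C \<longrightarrow> p = m \<longrightarrow> ?P a < ?P (K + 1 + m))"
  proof (rule crystal_interval[where u = u and v = v])
    show "distinct (u @ a # v)" "?P = pos (u @ a # v)" using w(1) unfolding rT by simp_all
    show "{A..C} \<subseteq> set (u @ a # v)" unfolding rT[symmetric] w(2) using A1 Cn by simp
  qed (fact a KC incx incy des cu cv)+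
  then obtain i m p where i: "A \<le> i" "i + m = K" "i + 2 * m \<le> C" "dyck_at ?P i m p" "i + p = a"
    and nt: "K + 1 + m \<le> C \<Longrightarrow> p = m \<Longrightarrow> ?P a < ?P (K + 1 + m)" by blast
  have i1: "1 \<le> i" "i + 2 * m \<le> ?n" using i A1 Cn by auto
  have e: "edr ?r i m p" using i(4) dyck_at_edr[OF T i1] by simp
  have E: "1 \<le> m" using e unfolding edr_def by simp
  have t2: "\<not> typ2 ?n ?r i m p"
  proof
    assume t: "typ2 ?n ?r i m p"
    then have p: "p = m" and k: "i + 2 * m < ?n" and r1: "?r (i + 2 * m + 1) \<le> ?r (i + 2 * m)"
      and r2: "?r (i + m) < ?r (i + 2 * m + 1)" unfolding typ2_def by auto
    have eq: "i + 2 * m = K + m" "K + 1 + m = i + 2 * m + 1" using i by auto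
    have "K + m \<notin> ?D" using r1 eq unfolding descents_def by simp
    then have "?g (Suc (K + m)) = ?g (K + m)" using blk_Suc[OF finite_descents] by simp
    moreover have "?g (K + m) = Suc j" using by'[of "K + m"] E i(3) eq by simp
    ultimately have "Suc (K + m) \<in> {K<..C}" using by'[of "Suc (K + m)"] k eq by simp
    then have "K + 1 + m \<le> C" by simp
    from nt[OF this p] have "?P a < ?P (i + 2 * m + 1)" unfolding eq(2) .
    moreover have "a = i + m" using i p by simp
    moreover have "?P (i + 2 * m + 1) < ?P (i + m)"
      using pos_row[OF T, of "i + 2 * m + 1" "i + m"] rel_of_down[of "i + m" "i + 2 * m + 1" ?r] r2 k i1 by simp
    ultimately show False by simp
  qed
  define T' where "T' = map (map (sg (i + p) (i + m + p))) T"
  note tg = edge_target[OF T e i1, folded T'_def]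
  have r: "\<forall>x\<in>{1..?n}. row_index T' x = ?r (cyc (i + p) (i + m + p) x)" using tg(2) by blast
  have edge: "(T, (i, i + 2 * m), T') \<in> edges (CS lam)" unfolding CS_edges T'_def using T i1 e by blast
  have t3: "\<not> typ3 ?r i m p"
  proof
    assume "typ3 ?r i m p"
    then have "Suc (length (Des T')) = length (Des T)" using edge_types(3)[OF T tg(1) i1 e r] by blast
    then show False using length_Des_ge[OF lam tg(1)] l by simp
  qed
  have lT': "length (Des T') = length lam" using edge_types(4)[OF T tg(1) i1 e r t2 t3] l by simp
  have gi: "?g i = j" using bx[of i] i by simp
  note F = edge_destd[OF T tg(1) i1 e r t2 t3, unfolded gi]
  show ?thesis using edge lT' F(1,4) f by auto
qed

text \<open>The cycle raises exactly one letter, and by \<open>m\<close>; so \<open>m\<close> can be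
  read off the relabelled tableau.\<close>

lemma sg_eq_interval:
  assumes "map (map (sg (i + p) (i + m + p))) T = map (map (sg (i' + p') (i' + m' + p'))) T"
    and "{1..n} \<subseteq> set (concat T)" "1 \<le> m" "1 \<le> m'" "1 \<le> i" "1 \<le> i'" "i + p \<le> n" "i' + p' \<le> n"
  shows "m = m'"
proof -
  have eq: "sg (i + p) (i + m + p) x = sg (i' + p') (i' + m' + p') x" if "x \<in> {1..n}" for x
  proof -
    have "map (sg (i + p) (i + m + p)) (concat T) = map (sg (i' + p') (i' + m' + p')) (concat T)"
      using arg_cong[OF assms(1), of concat] by (simp add: map_concat[symmetric])
    then show ?thesis using that assms(2) by (auto simp: map_eq_conv)
  qed
  have "i + p = i' + p'"
  proof (rule ccontr)
    assume ne: "i + p \<noteq> i' + p'"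
    have "i + p \<in> {1..n}" using assms by simp
    from eq[OF this] have "i + m + p = sg (i' + p') (i' + m' + p') (i + p)" by (simp add: sg_def)
    also have "\<dots> \<le> i + p" using ne by (simp add: sg_def)
    finally show False using assms(3) by simp
  qed
  moreover have "sg (i + p) (i + m + p) (i + p) = i + m + p" "sg (i' + p') (i' + m' + p') (i' + p') = i' + m' + p'"
    by (simp_all add: sg_def)
  ultimately show ?thesis using eq[of "i + p"] assms by auto
qed

lemma SSYT_nonempty:
  assumes lam: "is_partition lam" shows "SSYT lam (length lam) \<noteq> {}"
proof -
  let ?L = "length lam"
  \<comment> \<open>The highest weight tableau of this shape.\<close>
  define b where "b = map (\<lambda>j. replicate (lam ! j) (Suc j)) [0..<?L]"
  have nth: "b ! i = replicate (lam ! i) (Suc i)" if "i < ?L" for i using that by (simp add: b_def)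
  have "map length b = lam" unfolding b_def by (auto intro!: nth_equalityI)
  moreover have "semistandard b"
    unfolding semistandard_def
  proof (intro conjI ballI allI impI)
    fix w assume "w \<in> set b" then show "sorted w" by (auto simp: b_def)
  next
    fix i j assume ij: "Suc i < length b" "j < length (b ! Suc i)"
    then have i: "Suc i < ?L" by (simp add: b_def)
    have "lam ! Suc i \<le> lam ! i" using lam sorted_rev_nth_mono[of lam i "Suc i"] i unfolding is_partition_def by simp
    then have "j < lam ! i" "j < lam ! Suc i" using ij nth[OF i] by auto
    then show "j < length (b ! i)" "b ! i ! j < b ! Suc i ! j" using nth[OF i] nth[of i] i by auto
  qed
  moreover have "\<forall>x\<in>set (concat b). 1 \<le> x \<and> x \<le> ?L" by (auto simp: b_def)
  ultimately show ?thesis unfolding SSYT_def by blast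
qed

lemma SYT_Nil: "SYT [] = {[]}" "SSYT [] 0 = {[]}"
  unfolding SYT_def SSYT_def semistandard_def by auto

text \<open>The bound of \<open>length_Des_ge\<close> is attained, since standardizing any tableau
  in \<open>SSYT lam (length lam)\<close> gives this length. Crystal edges need two checks:
  \<open>edge_destd\<close> maps edges to edges and \<open>crystal_edge_lift\<close> finds a
  preimage for each; injectivity recovers the interval from the relabelling and the block
  number.\<close>

lemma CS_A5:
  assumes lam: "is_partition lam" shows "A5 (CS lam)"
proof -
  let ?n = "sum_list lam" and ?L = "length lam"
  define Vs where "Vs = {v \<in> SYT lam. length (Des v) = ?L}"
  have bij: "bij_betw (destd lam) Vs (SSYT lam ?L)" and wt: "\<And>v. v \<in> Vs \<Longrightarrow> Des v = weight ?L (destd lam v)"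
  proof -
    show "bij_betw (destd lam) Vs (SSYT lam ?L)"
    proof (cases "?n = 0")
      case True
      then have "lam = []" using partition_0[OF lam] by simp
      moreover have "Des [] = []" by (simp add: Des_def comp_of_set_def)
      ultimately show ?thesis unfolding Vs_def by (auto simp: SYT_Nil bij_betw_def inj_on_def destd_def)
    next
      case False
      then have n: "0 < ?n" by blast
      show ?thesis
      proof (rule bij_betw_byWitness[of _ std])
        show "\<forall>v\<in>Vs. std (destd lam v) = v" using std_destd unfolding Vs_def by blast
        show "\<forall>b\<in>SSYT lam ?L. destd lam (std b) = b" using destd_std[OF lam n] by blast
        show "destd lam ` Vs \<subseteq> SSYT lam ?L" using destd_SSYT n unfolding Vs_def by blast
        show "std ` SSYT lam ?L \<subseteq> Vs" using destd_std[OF lam n] unfolding Vs_def by blast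
      qed
    qed
    fix v assume v: "v \<in> Vs"
    show "Des v = weight ?L (destd lam v)"
    proof (cases "?n = 0")
      case True
      then have "lam = []" using partition_0[OF lam] by simp
      then show ?thesis using v unfolding Vs_def by (simp add: weight_def)
    next
      case False
      then have n: "0 < ?n" by blast
      show ?thesis by (rule destd_weight[OF _ n]) (use v in \<open>auto simp: Vs_def\<close>)
    qed
  qed
  have VsE: "Vs \<noteq> {}" using bij SSYT_nonempty[OF lam] unfolding bij_betw_def by auto
  have Min: "Min ((\<lambda>v. length (Des v)) ` SYT lam) = ?L"
  proof (rule Min_eqI)
    show "finite ((\<lambda>v. length (Des v)) ` SYT lam)" using finite_SYT by blast
    show "?L \<le> y" if "y \<in> (\<lambda>v. length (Des v)) ` SYT lam" for y using that length_Des_ge[OF lam] by auto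
    show "?L \<in> (\<lambda>v. length (Des v)) ` SYT lam" using VsE unfolding Vs_def by (auto simp: image_iff) (metis)
  qed
  define Es where "Es = {(v, I, w). (v, I, w) \<in> edges (CS lam) \<and> v \<in> Vs \<and> w \<in> Vs}"
  define h where "h = (\<lambda>(v, I, w). (destd lam v, jidx (Des v) I, destd lam w))"
  have inj: "destd lam v = destd lam w \<Longrightarrow> v = w" if "v \<in> Vs" "w \<in> Vs" for v w
    using bij that unfolding bij_betw_def inj_on_def by blast
  have data: "\<exists>i m p. I = (i, i + 2 * m) \<and> 1 \<le> i \<and> i + 2 * m \<le> ?n \<and> edr (row_index v) i m p \<and>
      w = map (map (sg (i + p) (i + m + p))) v \<and> jidx (Des v) I = blk (descents ?n (row_index v)) i \<and>
      1 \<le> jidx (Des v) I \<and> jidx (Des v) I < ?L \<and>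
      f_tab (jidx (Des v) I) (destd lam v) = Some (destd lam w)"
    if ed: "(v, I, w) \<in> Es" for v I w
  proof -
    have v: "v \<in> SYT lam" "w \<in> SYT lam" "length (Des v) = ?L" "length (Des w) = ?L" "(v, I, w) \<in> edges (CS lam)"
      using ed unfolding Es_def Vs_def by auto
    then obtain i m p where I: "I = (i, i + 2 * m)" and i: "1 \<le> i" "i + 2 * m \<le> ?n" and e: "edr (row_index v) i m p"
      and w: "w = map (map (sg (i + p) (i + m + p))) v" unfolding CS_edges by blast
    have r: "\<forall>x\<in>{1..?n}. row_index w x = row_index v (cyc (i + p) (i + m + p) x)"
      using edge_target(2)[OF v(1) e i] unfolding w by blast
    note et = edge_types[OF v(1,2) i e r]
    have t: "\<not> typ2 ?n (row_index v) i m p" "\<not> typ3 (row_index v) i m p"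
      using et(2,3) v(3,4) by auto
    note F = edge_destd[OF v(1,2) i e r t]
    have J: "jidx (Des v) I = blk (descents ?n (row_index v)) i" unfolding I by (rule F(4))
    show ?thesis
      by (rule exI[of _ i], rule exI[of _ m], rule exI[of _ p], unfold J) (use I i e w F(1-3) v(3) in simp)
  qed
  have "bij_betw h Es (crystal_edges lam ?L)"
    unfolding bij_betw_def
  proof
    show "inj_on h Es"
    proof (rule inj_onI)
      fix e1 e2 assume e: "e1 \<in> Es" "e2 \<in> Es" "h e1 = h e2"
      obtain v I w v' I' w' where e12: "e1 = (v, I, w)" "e2 = (v', I', w')" by (metis prod_cases3)
      have vw: "v = v'" "w = w'" and jj: "jidx (Des v) I = jidx (Des v') I'"
        using e inj unfolding e12 h_def Es_def by auto
      obtain i m p where 1: "I = (i, i + 2 * m)" "1 \<le> i" "i + 2 * m \<le> ?n" "edr (row_index v) i m p"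
        "w = map (map (sg (i + p) (i + m + p))) v" "jidx (Des v) I = blk (descents ?n (row_index v)) i"
        using data[OF e(1)[unfolded e12]] by blast
      obtain i' m' p' where 2: "I' = (i', i' + 2 * m')" "1 \<le> i'" "i' + 2 * m' \<le> ?n" "edr (row_index v) i' m' p'"
        "w = map (map (sg (i' + p') (i' + m' + p'))) v" "jidx (Des v) I' = blk (descents ?n (row_index v)) i'"
        using data[OF e(2)[unfolded e12]] unfolding vw[symmetric] by blast
      have v: "v \<in> SYT lam" using e(1) unfolding e12 Es_def Vs_def by auto
      have E: "1 \<le> m" "p \<le> m" "1 \<le> m'" "p' \<le> m'" using 1(4) 2(4) unfolding edr_def by auto
      have mm: "m = m'"
        by (rule sg_eq_interval[of i p m v i' p' m' ?n]) (use 1 2 E SYT_basic(3)[OF v] in auto)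
      have f: "flat (descents ?n (row_index v)) i m" "flat (descents ?n (row_index v)) i' m'"
        using descents_edge(1)[OF 1(4,2,3)] descents_edge(1)[OF 2(4,2,3)] by auto
      let ?D = "descents ?n (row_index v)"
      \<comment> \<open>Both \<open>i+m\<close> and \<open>i'+m'\<close> end the block that contains
        \<open>i\<close> and \<open>i'\<close>, so they are equal; with \<open>m = m'\<close> this
        gives \<open>i = i'\<close>.\<close>
      have bb: "blk ?D i = blk ?D i'" using 1(6) 2(6) jj vw by simp
      have "\<not> i + m < i' + m'"
      proof
        assume a: "i + m < i' + m'"
        show False
        proof (cases "i' \<le> i + m")
          case True then show False using f a unfolding flat_def by blast
        next
          case False
          then show False using blk_eqD[OF finite_descents bb, of "i + m"] f unfolding flat_def by auto
        qed
      qed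
      moreover have "\<not> i' + m' < i + m"
      proof
        assume a: "i' + m' < i + m"
        show False
        proof (cases "i \<le> i' + m'")
          case True then show False using f a unfolding flat_def by blast
        next
          case False
          then show False using blk_eqD[OF finite_descents bb[symmetric], of "i' + m'"] f unfolding flat_def by auto
        qed
      qed
      ultimately have "i = i'" using mm by simp
      then show "e1 = e2" unfolding e12 using vw mm 1(1) 2(1) by simp
    qed
    show "h ` Es = crystal_edges lam ?L"
    proof (intro set_eqI iffI)
      fix x assume "x \<in> h ` Es"
      then obtain v I w where e: "(v, I, w) \<in> Es" "x = (destd lam v, jidx (Des v) I, destd lam w)"
        unfolding h_def by auto
      have "destd lam v \<in> SSYT lam ?L" "destd lam w \<in> SSYT lam ?L"
        using e(1) bij unfolding Es_def bij_betw_def by auto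
      then show "x \<in> crystal_edges lam ?L" using data[OF e(1)] unfolding e(2) crystal_edges_def by auto
    next
      fix x assume "x \<in> crystal_edges lam ?L"
      then obtain b j c where x: "x = (b, j, c)" "b \<in> SSYT lam ?L" "1 \<le> j" "j < ?L" "f_tab j b = Some c"
        unfolding crystal_edges_def by auto
      obtain v where v: "v \<in> Vs" "b = destd lam v" using bij x(2) unfolding bij_betw_def by auto
      obtain i m w where w: "(v, (i, i + 2 * m), w) \<in> edges (CS lam)" "length (Des w) = ?L" "c = destd lam w"
        "jidx (Des v) (i, i + 2 * m) = j"
        using crystal_edge_lift[OF lam _ _ x(3,4)] v x(5) unfolding Vs_def by blast
      have "(v, (i, i + 2 * m), w) \<in> Es"
        unfolding Es_def using v(1) w(1,2) CS_edge_bounds[OF w(1)] by (simp add: Vs_def)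
      moreover have "x = h (v, (i, i + 2 * m), w)" unfolding h_def x(1) v(2) w(3) using w(4) by simp
      ultimately show "x \<in> h ` Es" by blast
    qed
  qed
  then show ?thesis
    unfolding A5_def Let_def CS_simps Min Vs_def[symmetric] Es_def[symmetric]
    by (intro exI[of _ lam] conjI lam refl exI[of _ "destd lam"] bij ballI wt) (simp_all add: h_def)
qed

theorem theorem5p7:
  assumes "is_partition lam"
  shows "is_CS_graph (sum_list lam) (CS lam)"
proof -
  have "\<forall>(v, I, w)\<in>edges (CS lam). A0_ok (vlab (CS lam) v) I"
    using CS_edge_types(1) by auto
  moreover have "\<forall>(v, I, w)\<in>edges (CS lam). edge_type 1 (vlab (CS lam) v) I (vlab (CS lam) w) \<or>
      edge_type 2 (vlab (CS lam) v) I (vlab (CS lam) w) \<or> edge_type 3 (vlab (CS lam) v) I (vlab (CS lam) w)"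
    using CS_edge_types(2) unfolding CS_simps by blast
  ultimately show ?thesis
    unfolding is_CS_graph_def
    using CS_well_formed CS_connected[OF assms] CS_A1 CS_A3 CS_A4 CS_A5[OF assms] by blast
qed

end
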